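(* Let $V=V_1+iV_2\in C^\infty(\mathbb{R}^n)$ with $V_1,V_2$ real valued, and let $p(x,\xi)=|\xi|^2+V(x)$ for $(x,\xi)\in\mathbb{R}^{2n}$. Assume $V_1\ge 0$, $V''\in S(1)$, and that for some $L>0$ and $T\ge 0$, $$|V_2(x)|-T\lesssim |V_2'(x)|^2\qquad\text{for all } x\in\{x\in\mathbb{R}^n: |V_2'(x)|\le L\}.$$ Then for any $R>0$ and $K>1$ there exist positive constants $A$, $M$, $h_0$, $c$ and $C$ such that for all $0<h\le h_0$ and all $z\in\mathbb{C}$ with $Mh\le |z|-KT\le R$ and $\operatorname{Re} z\le Ah^{2/3}(|z|-T)^{1/3}$ we have $$\left\|\left[p^w(x,hD_x)-z\right]u\right\|_{L^2}\ \ge\ c\,h^{2/3}(|z|-T)^{1/3}\|u\|_{L^2}\qquad\text{for all } u\in\mathcal{S}(\mathbb{R}^n),$$ and, with $P$ the $L^2$-graph closure of $p^w(x,hD_x)$ on $\mathcal{S}(\mathbb{R}^n)$, $P-z$ is invertible and $$\left\|(P-z)^{-1}u\right\|_{L^2}\ \le\ C\,h^{-2/3}(|z|-T)^{-1/3}\|u\|_{L^2}\qquad\text{for all } u\in L^2(\mathbb{R}^n).$$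
   Context: Notation: $f\lesssim g$ means there is a constant $c>0$, independent of the variables, with $f\le cg$. $V_2'$ denotes the gradient of $V_2$, and $\mathcal{S}(\mathbb{R}^n)$ is the Schwartz space. $V''\in S(1)$ means that $\partial^\alpha V\in L^\infty(\mathbb{R}^n)$ for all multi-indices $\alpha$ with $|\alpha|\ge 2$. For $0<h\le 1$ the semiclassical Weyl quantization is $$a^w(x,hD_x)u(x)=\int_{\mathbb{R}^{2n}}e^{2\pi i(x-y)\cdot\xi}\,a\!\left(\tfrac{x+y}{2},h\xi\right)u(y)\,dy\,d\xi,$$ so that $p^w(x,hD_x)=-\frac{h^2}{4\pi^2}\Delta+V(x)$. The $L^2$-graph closure of $p^w(x,hD_x)$ on $\mathcal{S}(\mathbb{R}^n)$ is the operator on $L^2(\mathbb{R}^n)$ whose graph is the closure in $L^2\times L^2$ of $\{(u,p^w(x,hD_x)u):u\in\mathcal{S}(\mathbb{R}^n)\}$. *)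

theory Defs
  imports "HOL-Analysis.Analysis"
begin

definition partial_deriv :: "'n \<Rightarrow> (real^'n \<Rightarrow> 'b::real_normed_vector) \<Rightarrow> real^'n \<Rightarrow> 'b" where
  "partial_deriv j f x = frechet_derivative f (at x) (axis j 1)"

text \<open>A multi-index is given by the list of the coordinates in which one differentiates, so its
  order is the length of the list. For smooth functions the order of the entries is irrelevant.\<close>

definition partial_derivs :: "'n list \<Rightarrow> (real^'n \<Rightarrow> 'b::real_normed_vector) \<Rightarrow> real^'n \<Rightarrow> 'b" where
  "partial_derivs js f = foldr partial_deriv js f"

definition gradient :: "(real^'n \<Rightarrow> real) \<Rightarrow> real^'n \<Rightarrow> real^'n" where
  "gradient f x = (\<chi> j. partial_deriv j f x)"

definition smooth :: "(real^'n \<Rightarrow> 'b::real_normed_vector) \<Rightarrow> bool" where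
  "smooth f \<longleftrightarrow> (\<forall>js. partial_derivs js f differentiable_on UNIV)"

text \<open>The condition that the second derivatives of \<open>V\<close> lie in the symbol class \<open>S(1)\<close>. The
  derivatives of a smooth function are continuous, so lying in \<open>L\<^sup>\<infinity>\<close> means being bounded.\<close>

definition second_derivs_in_S1 :: "(real^'n \<Rightarrow> complex) \<Rightarrow> bool" where
  "second_derivs_in_S1 V \<longleftrightarrow> (\<forall>js. length js \<ge> 2 \<longrightarrow> bounded (range (partial_derivs js V)))"

definition schwartz :: "(real^'n \<Rightarrow> complex) set" where
  "schwartz = {u. smooth u \<and>
     (\<forall>k js. bounded (range (\<lambda>x. norm x ^ k *\<^sub>R partial_derivs js u x)))}"

text \<open>The Weyl quantization is read as an iterated integral, first in \<open>y\<close> and then in \<open>\<xi>\<close>: for the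
  symbols used here the integrand is not absolutely integrable in \<open>(y, \<xi>)\<close> jointly, whereas for
  \<open>u\<close> in the Schwartz space the inner integral converges absolutely and defines a rapidly
  decreasing function of \<open>\<xi>\<close>.\<close>

definition weyl ::
  "(real^'n \<Rightarrow> real^'n \<Rightarrow> complex) \<Rightarrow> real \<Rightarrow> (real^'n \<Rightarrow> complex) \<Rightarrow> real^'n \<Rightarrow> complex" where
  "weyl a h u x =
     (\<integral>\<xi>. (\<integral>y. exp (2 * complex_of_real pi * \<i> * complex_of_real ((x - y) \<bullet> \<xi>))
                 * a ((1/2) *\<^sub>R (x + y)) (h *\<^sub>R \<xi>) * u y \<partial>lborel) \<partial>lborel)"

definition schroedinger_symbol ::
  "(real^'n \<Rightarrow> complex) \<Rightarrow> real^'n \<Rightarrow> real^'n \<Rightarrow> complex" where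
  "schroedinger_symbol V x \<xi> = complex_of_real ((norm \<xi>)\<^sup>2) + V x"

text \<open>Elements of \<open>L\<^sup>2\<close> are represented by functions, and two representatives are identified
  when they agree almost everywhere. An operator on \<open>L\<^sup>2\<close> is represented by its graph, the set of
  all pairs of representatives.\<close>

definition L2 :: "(real^'n \<Rightarrow> complex) set" where
  "L2 = {u \<in> borel_measurable lborel. integrable lborel (\<lambda>x. (norm (u x))\<^sup>2)}"

definition L2norm :: "(real^'n \<Rightarrow> complex) \<Rightarrow> real" where
  "L2norm u = sqrt (\<integral>x. (norm (u x))\<^sup>2 \<partial>lborel)"

definition ae_eq :: "(real^'n \<Rightarrow> complex) \<Rightarrow> (real^'n \<Rightarrow> complex) \<Rightarrow> bool" where
  "ae_eq u v \<longleftrightarrow> (AE x in lborel. u x = v x)"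

type_synonym 'n L2_graph = "((real^'n \<Rightarrow> complex) \<times> (real^'n \<Rightarrow> complex)) set"

text \<open>The intersection with \<open>L2 \<times> L2\<close> is needed because \<open>L2norm\<close> is \<open>0\<close> on functions that are
  not square integrable.\<close>

definition L2_graph_closure :: "'n::finite L2_graph \<Rightarrow> 'n L2_graph" where
  "L2_graph_closure G = {(u, f). u \<in> L2 \<and> f \<in> L2 \<and>
     (\<forall>\<epsilon>>0. \<exists>(v, g) \<in> G \<inter> (L2 \<times> L2).
        L2norm (\<lambda>x. u x - v x) < \<epsilon> \<and> L2norm (\<lambda>x. f x - g x) < \<epsilon>)}"

definition weyl_closure :: "(real^'n \<Rightarrow> real^'n \<Rightarrow> complex) \<Rightarrow> real \<Rightarrow> 'n L2_graph" where
  "weyl_closure a h = L2_graph_closure {(u, weyl a h u) | u. u \<in> schwartz}"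

definition graph_minus_scalar :: "'n::finite L2_graph \<Rightarrow> complex \<Rightarrow> 'n L2_graph" where
  "graph_minus_scalar G z = {(u, \<lambda>x. f x - z * u x) | u f. (u, f) \<in> G}"

text \<open>The conjuncts say, modulo almost everywhere equality, that \<open>G\<close> is the graph of an operator
  (single-valuedness), and that this operator is injective on its domain and onto \<open>L2\<close>.\<close>

definition L2_invertible :: "'n::finite L2_graph \<Rightarrow> bool" where
  "L2_invertible G \<longleftrightarrow>
     (\<forall>(u, f) \<in> G. \<forall>(v, g) \<in> G. ae_eq u v \<longrightarrow> ae_eq f g) \<and>
     (\<forall>(u, f) \<in> G. \<forall>(v, g) \<in> G. ae_eq f g \<longrightarrow> ae_eq u v) \<and>
     (\<forall>f \<in> L2. \<exists>u. (u, f) \<in> G)"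

text \<open>A representative of the value at \<open>f\<close> of the inverse operator.\<close>

definition L2_inverse :: "'n::finite L2_graph \<Rightarrow> (real^'n \<Rightarrow> complex) \<Rightarrow> real^'n \<Rightarrow> complex" where
  "L2_inverse G f = (SOME u. (u, f) \<in> G)"

end

theory Submission
  imports Defs "HOL-Probability.Distributions"
begin

text \<open>By Fourier inversion the Weyl quantization of \<open>|\<xi>|\<^sup>2 + V - z\<close> is \<open>H = A + i B\<close> with
  \<open>A = - \<tau> \<Delta> + V\<^sub>1 - Re z\<close>, \<open>B = V\<^sub>2 - Im z\<close> and \<open>\<tau> = (h / 2 \<pi>)\<^sup>2\<close>. Let \<open>r = |z| - T\<close> and let \<open>\<rho>\<close> be the
  power \<open>-1/6\<close> of \<open>r + |\<nabla>V\<^sub>2|\<^sup>2\<close>. Expanding \<open>|\<rho> H u|\<^sup>2\<close> bounds \<open>|\<rho> B u|\<close> up to commutators, which are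
  controlled by \<open>|\<nabla>u|\<close> and \<open>|u / \<rho>|\<close>. Integrating by parts against \<open>B \<rho>\<^sup>4 \<nabla>V\<^sub>2\<close> bounds the integral
  of \<open>|\<nabla>V\<^sub>2|\<^sup>2 \<rho>\<^sup>4 |u|\<^sup>2\<close> by \<open>|\<rho> B u|\<close> and \<open>|\<nabla>u|\<close>. Unless \<open>Re z\<close> is so negative that
  accretivity suffices, the assumption on \<open>V\<^sub>2\<close> bounds \<open>r\<close> by a multiple of \<open>|\<nabla>V\<^sub>2|\<^sup>2 + B\<^sup>2 / r\<close>, so that
  \<open>|u / \<rho>|\<close> is controlled as well. Together with the
  energy identity for \<open>Re \<langle>H u, u\<rangle>\<close>, which controls \<open>\<tau> |\<nabla>u|\<^sup>2\<close>, a scaling argument absorbs all errors.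

  By the lower bound the closure is injective with closed range. An element orthogonal to the range
  yields a weak solution in \<open>L\<^sup>2\<close> of the equation \<open>H v = 0\<close>, because \<open>H\<close> is symmetric for the bilinear
  pairing; mollified and cut off by an exponential weight it becomes a Schwartz function with small
  \<open>H v\<close>, so the lower bound forces it to vanish.\<close>

section \<open>Partial derivatives\<close>

text \<open>The weight comes from scaling. With \<open>x ^ 6 = \<tau>\<close> and
  \<open>S = |u / \<rho>|\<close>, the estimates balance if \<open>x^3 |grad u|\<close>,
  \<open>|\<rho> B u|\<close> and the integral with \<open>\<rho>^4\<close> have sizes
  \<open>x S\<close>, \<open>x^2 S\<close> and \<open>S^2\<close>. The exponent -1/6 is the one for
  which \<open>|grad V2| \<rho>^3 \<le> 1\<close>. Terms in which a derivative falls on the weight,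
  or twice on V2, then carry after scaling a factor \<open>x^2 r^(-2/3)\<close>, which is at most 1
  because \<open>h \<le> r\<close>; here the lower bound on \<open>|z|\<close> enters. If the
  estimate failed with a small constant, all these sizes would be small, contradicting the bound of
  S by the other quantities. The upper bound on \<open>|z|\<close> is used where
  \<open>|grad V2| > L\<close>, since \<open>r\<close> is there at most a multiple of
  \<open>|grad V2|^2\<close>.

  For surjectivity the obstacle is the growth of V: commuting it with a mollifier leaves an error
  that grows polynomially, so the cutoff must decay faster than any power, yet its derivatives must
  be a small multiple \<open>\<sigma>\<close> of itself. The exponential of
  \<open>- \<sigma> sqrt (1 + |x|^2)\<close> does both, and \<open>\<sigma>\<close> is fixed before
  the mollifier is shrunk.\<close>

lemma partial_deriv_eqI:
  "(f has_derivative f') (at x) \<Longrightarrow> partial_deriv j f x = f' (axis j 1)"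
  unfolding partial_deriv_def by (metis frechet_derivative_at)

lemma has_derivative_frechet:
  "f differentiable (at x) \<Longrightarrow> (f has_derivative frechet_derivative f (at x)) (at x)"
  by (simp add: frechet_derivative_works)

lemma has_derivative_partial_derivs:
  fixes f :: "real^'n \<Rightarrow> 'b::real_normed_vector"
  assumes "f differentiable (at x)"
  shows "(f has_derivative (\<lambda>h. \<Sum>j\<in>UNIV. (h $ j) *\<^sub>R partial_deriv j f x)) (at x)"
proof -
  let ?f' = "frechet_derivative f (at x)"
  have d: "(f has_derivative ?f') (at x)" by (rule has_derivative_frechet[OF assms])
  interpret bounded_linear ?f' using d by (rule has_derivative_bounded_linear)
  have "?f' h = (\<Sum>j\<in>UNIV. (h $ j) *\<^sub>R partial_deriv j f x)" for h
  proof -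
    have "?f' h = ?f' (\<Sum>j\<in>UNIV. (h $ j) *\<^sub>R axis j 1)"
      using basis_expansion[of h] by (simp add: scalar_mult_eq_scaleR)
    also have "\<dots> = (\<Sum>j\<in>UNIV. (h $ j) *\<^sub>R ?f' (axis j 1))"
      by (simp add: sum scaleR)
    finally show ?thesis by (simp add: partial_deriv_def)
  qed
  then have "?f' = (\<lambda>h. \<Sum>j\<in>UNIV. (h $ j) *\<^sub>R partial_deriv j f x)" by auto
  then show ?thesis using d by simp
qed

lemma partial_deriv_bounded_linear:
  assumes "bounded_linear T" "f differentiable (at x)"
  shows "partial_deriv j (\<lambda>x. T (f x)) x = T (partial_deriv j f x)"
    and "(\<lambda>x. T (f x)) differentiable (at x)"
proof -
  have d: "((\<lambda>x. T (f x)) has_derivative (\<lambda>h. T (frechet_derivative f (at x) h))) (at x)"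
    by (rule bounded_linear.has_derivative[OF assms(1) has_derivative_frechet[OF assms(2)]])
  show "partial_deriv j (\<lambda>x. T (f x)) x = T (partial_deriv j f x)"
    using partial_deriv_eqI[OF d] by (simp add: partial_deriv_def)
  show "(\<lambda>x. T (f x)) differentiable (at x)"
    using d differentiable_def by blast
qed

lemmas partial_deriv_Re = partial_deriv_bounded_linear[OF bounded_linear_Re]
lemmas partial_deriv_Im = partial_deriv_bounded_linear[OF bounded_linear_Im]
lemmas partial_deriv_cnj = partial_deriv_bounded_linear[OF bounded_linear_cnj]
lemmas partial_deriv_of_real = partial_deriv_bounded_linear[OF bounded_linear_of_real]
lemmas partial_deriv_cmult =
  partial_deriv_bounded_linear[OF bounded_linear_mult_right]

lemma partial_deriv_const [simp]: "partial_deriv j (\<lambda>x. c) x = 0"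
  using partial_deriv_eqI[OF has_derivative_const[of c "at x"], of j] by simp

lemma partial_deriv_component:
  "partial_deriv j (\<lambda>x::real^'n. x $ i) x = (if i = j then 1 else 0)"
proof -
  have "((\<lambda>x::real^'n. x $ i) has_derivative (\<lambda>h. h $ i)) (at x)"
    by (intro bounded_linear_imp_has_derivative bounded_linear_vec_nth)
  from partial_deriv_eqI[OF this, of j] show ?thesis
    by (simp add: axis_def)
qed

lemma partial_deriv_add:
  assumes "f differentiable (at x)" "g differentiable (at x)"
  shows "partial_deriv j (\<lambda>x. f x + g x) x = partial_deriv j f x + partial_deriv j g x"
  using partial_deriv_eqI[OF has_derivative_add[OF has_derivative_frechet[OF assms(1)]
        has_derivative_frechet[OF assms(2)]]]
  by (simp add: partial_deriv_def)

lemma partial_deriv_mult: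
  fixes f g :: "real^'n \<Rightarrow> 'b::real_normed_algebra"
  assumes "f differentiable (at x)" "g differentiable (at x)"
  shows "partial_deriv j (\<lambda>x. f x * g x) x = f x * partial_deriv j g x + partial_deriv j f x * g x"
  using partial_deriv_eqI[OF has_derivative_mult[OF has_derivative_frechet[OF assms(1)]
        has_derivative_frechet[OF assms(2)]]]
  by (simp add: partial_deriv_def)

lemma partial_deriv_comp_real:
  assumes "f differentiable (at x)" "(\<phi> has_field_derivative D) (at (f x))"
  shows "partial_deriv j (\<lambda>x. \<phi> (f x)) x = D * partial_deriv j f x"
    and "(\<lambda>x. \<phi> (f x)) differentiable (at x)"
proof -
  have d: "((\<lambda>x. \<phi> (f x)) has_derivative (\<lambda>h. D * frechet_derivative f (at x) h)) (at x)"
    using has_derivative_compose[OF has_derivative_frechet[OF assms(1)]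
      assms(2)[unfolded has_field_derivative_def]] by simp
  show "partial_deriv j (\<lambda>x. \<phi> (f x)) x = D * partial_deriv j f x"
    using partial_deriv_eqI[OF d] by (simp add: partial_deriv_def)
  show "(\<lambda>x. \<phi> (f x)) differentiable (at x)"
    using d differentiable_def by blast
qed

lemma partial_deriv_affine:
  assumes "f differentiable (at (a + c *\<^sub>R x))"
  shows "partial_deriv j (\<lambda>x. f (a + c *\<^sub>R x)) x = c *\<^sub>R partial_deriv j f (a + c *\<^sub>R x)"
    and "(\<lambda>x. f (a + c *\<^sub>R x)) differentiable (at x)"
proof -
  let ?f' = "frechet_derivative f (at (a + c *\<^sub>R x))"
  have "((\<lambda>x. a + c *\<^sub>R x) has_derivative (\<lambda>h. c *\<^sub>R h)) (at x)"
    by (auto intro!: derivative_eq_intros)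
  from has_derivative_compose[OF this has_derivative_frechet[OF assms]]
  have d: "((\<lambda>x. f (a + c *\<^sub>R x)) has_derivative (\<lambda>h. ?f' (c *\<^sub>R h))) (at x)" .
  interpret bounded_linear ?f'
    by (rule has_derivative_bounded_linear[OF has_derivative_frechet[OF assms]])
  show "partial_deriv j (\<lambda>x. f (a + c *\<^sub>R x)) x = c *\<^sub>R partial_deriv j f (a + c *\<^sub>R x)"
    using partial_deriv_eqI[OF d] by (simp add: partial_deriv_def scaleR)
  show "(\<lambda>x. f (a + c *\<^sub>R x)) differentiable (at x)"
    using d differentiable_def by blast
qed

section \<open>Difference quotients, measurability of derivatives, and mean value
  inequalities\<close>

lemma has_derivative_along_axis:
  fixes f :: "real^'n \<Rightarrow> 'b::real_normed_vector"
  assumes "f differentiable (at (x + s *\<^sub>R axis j 1))"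
  shows "((\<lambda>s. f (x + s *\<^sub>R axis j 1)) has_derivative
           (\<lambda>t. t *\<^sub>R partial_deriv j f (x + s *\<^sub>R axis j 1))) (at s)"
proof -
  let ?f' = "frechet_derivative f (at (x + s *\<^sub>R axis j 1))"
  have "((\<lambda>s. x + s *\<^sub>R axis j 1) has_derivative (\<lambda>t. t *\<^sub>R axis j 1)) (at s)"
    by (auto intro!: derivative_eq_intros)
  from has_derivative_compose[OF this has_derivative_frechet[OF assms]]
  have d: "((\<lambda>s. f (x + s *\<^sub>R axis j 1)) has_derivative (\<lambda>t. ?f' (t *\<^sub>R axis j 1))) (at s)" .
  interpret bounded_linear ?f'
    by (rule has_derivative_bounded_linear[OF has_derivative_frechet[OF assms]])
  show ?thesis using d by (simp add: partial_deriv_def scaleR)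
qed

lemma continuous_on_differentiable:
  "(\<And>x. f differentiable (at x)) \<Longrightarrow> continuous_on A f"
  by (intro differentiable_imp_continuous_on differentiable_at_imp_differentiable_on) auto

lemma borel_measurable_differentiable:
  fixes f :: "real^'n \<Rightarrow> 'b::real_normed_vector"
  shows "(\<And>x. f differentiable (at x)) \<Longrightarrow> f \<in> borel_measurable borel"
  by (intro borel_measurable_continuous_onI continuous_on_differentiable)

lemma tendsto_difference_quotient:
  fixes f :: "real^'n \<Rightarrow> 'b::real_normed_vector"
  assumes "f differentiable (at x)"
  shows "(\<lambda>k. real (Suc k) *\<^sub>R (f (x + (1 / real (Suc k)) *\<^sub>R axis j 1) - f x))
           \<longlonglongrightarrow> partial_deriv j f x"
proof -
  have "((\<lambda>s. f (x + s *\<^sub>R axis j 1)) has_vector_derivative partial_deriv j f x) (at 0)"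
    using has_derivative_along_axis[of f x 0 j] assms by (simp add: has_vector_derivative_def)
  then have "((\<lambda>s. norm (f (x + s *\<^sub>R axis j 1) - f x - s *\<^sub>R partial_deriv j f x) / norm s) \<longlongrightarrow> 0) (at 0)"
    by (simp add: has_vector_derivative_def has_derivative_at)
  moreover have "norm (f (x + s *\<^sub>R axis j 1) - f x - s *\<^sub>R partial_deriv j f x) / norm s
      = norm ((f (x + s *\<^sub>R axis j 1) - f x) /\<^sub>R s - partial_deriv j f x)" if "s \<noteq> 0" for s
  proof -
    have "(f (x + s *\<^sub>R axis j 1) - f x) /\<^sub>R s - partial_deriv j f x
        = (f (x + s *\<^sub>R axis j 1) - f x - s *\<^sub>R partial_deriv j f x) /\<^sub>R s"
      using that by (simp add: algebra_simps)
    then show ?thesis by (simp add: divide_inverse mult.commute)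
  qed
  ultimately have "((\<lambda>s. norm ((f (x + s *\<^sub>R axis j 1) - f x) /\<^sub>R s - partial_deriv j f x)) \<longlongrightarrow> 0) (at 0)"
    by (elim Lim_transform_eventually) (auto simp: eventually_at_filter)
  then have "((\<lambda>s. (f (x + s *\<^sub>R axis j 1) - f x) /\<^sub>R s) \<longlongrightarrow> partial_deriv j f x) (at 0)"
    by (rule LIM_zero_cancel[OF tendsto_norm_zero_cancel])
  moreover have "filterlim (\<lambda>k. 1 / real (Suc k)) (at 0) sequentially"
  proof (rule filterlim_atI)
    show "(\<lambda>k. 1 / real (Suc k)) \<longlonglongrightarrow> 0"
      using LIMSEQ_inverse_real_of_nat unfolding inverse_eq_divide .
    show "\<forall>\<^sub>F k in sequentially. 1 / real (Suc k) \<noteq> 0"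
      by (rule always_eventually) simp
  qed
  ultimately have "(\<lambda>k. (f (x + (1 / real (Suc k)) *\<^sub>R axis j 1) - f x) /\<^sub>R (1 / real (Suc k)))
           \<longlonglongrightarrow> partial_deriv j f x"
    by (rule filterlim_compose)
  then show ?thesis by simp
qed

text \<open>Differentiability alone does not make the derivative continuous, so measurability is
  obtained from the difference quotients with steps \<open>1 / (k + 1)\<close>: they are continuous
  and converge pointwise.\<close>

lemma borel_measurable_partial_deriv:
  fixes f :: "real^'n \<Rightarrow> 'b::real_normed_vector"
  assumes "\<And>x. f differentiable (at x)"
  shows "partial_deriv j f \<in> borel_measurable borel"
proof (rule borel_measurable_LIMSEQ_metric)
  fix x show "(\<lambda>k. real (Suc k) *\<^sub>R (f (x + (1 / real (Suc k)) *\<^sub>R axis j 1) - f x))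
           \<longlonglongrightarrow> partial_deriv j f x"
    by (rule tendsto_difference_quotient[OF assms])
next
  fix k
  have "continuous_on UNIV (\<lambda>x. real (Suc k) *\<^sub>R (f (x + (1 / real (Suc k)) *\<^sub>R axis j 1) - f x))"
    by (intro continuous_intros continuous_on_compose2[OF continuous_on_differentiable[OF assms, of UNIV]]
         continuous_on_differentiable[OF assms]) auto
  then show "(\<lambda>x. real (Suc k) *\<^sub>R (f (x + (1 / real (Suc k)) *\<^sub>R axis j 1) - f x)) \<in> borel_measurable borel"
    by (rule borel_measurable_continuous_onI)
qed

lemma norm_increment_along_axis_le:
  fixes f :: "real^'n \<Rightarrow> 'b::euclidean_space"
  assumes diff: "\<And>x. f differentiable (at x)"
    and bd: "\<And>s. 0 \<le> s \<Longrightarrow> s \<le> t \<Longrightarrow> norm (partial_deriv j f (x + s *\<^sub>R axis j 1)) \<le> B"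
    and "t > 0"
  shows "norm (f (x + t *\<^sub>R axis j 1) - f x) \<le> t * B"
proof -
  let ?g = "\<lambda>s. f (x + s *\<^sub>R axis j 1)"
  have "\<exists>s\<in>{0<..<t}. norm (?g t - ?g 0) \<le> norm ((t - 0) *\<^sub>R partial_deriv j f (x + s *\<^sub>R axis j 1))"
    using \<open>t > 0\<close> diff
    by (intro mvt_general has_derivative_along_axis)
       (auto intro!: continuous_on_compose2[OF continuous_on_differentiable[OF diff, of UNIV]] continuous_intros)
  then obtain s where s: "s \<in> {0<..<t}"
    and "norm (?g t - ?g 0) \<le> t * norm (partial_deriv j f (x + s *\<^sub>R axis j 1))"
    using \<open>t > 0\<close> by auto
  moreover have "t * norm (partial_deriv j f (x + s *\<^sub>R axis j 1)) \<le> t * B"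
    using bd[of s] s \<open>t > 0\<close> by (intro mult_left_mono) auto
  ultimately show ?thesis unfolding scaleR_zero_left add_0_right by linarith
qed

text \<open>The factor \<open>CARD('n)\<close> comes from bounding every coordinate of
  \<open>v\<close> by its norm in the sum over directions. The case \<open>B = 0\<close> is the
  statement that a vanishing gradient forces a constant function, which identifies the Fourier
  transform of a Gaussian.\<close>

lemma norm_increment_le:
  fixes f :: "real^'n \<Rightarrow> 'b::euclidean_space"
  assumes diff: "\<And>x. f differentiable (at x)"
    and bd: "\<And>s j. 0 \<le> s \<Longrightarrow> s \<le> 1 \<Longrightarrow> norm (partial_deriv j f (x + s *\<^sub>R v)) \<le> B"
  shows "norm (f (x + v) - f x) \<le> real CARD('n) * B * norm v"
proof -
  let ?g = "\<lambda>s. f (x + s *\<^sub>R v)"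
  let ?D = "\<lambda>s t. (\<Sum>j\<in>UNIV. ((t *\<^sub>R v) $ j) *\<^sub>R partial_deriv j f (x + s *\<^sub>R v))"
  have der: "(?g has_derivative ?D s) (at s)" for s
  proof -
    have "((\<lambda>s. x + s *\<^sub>R v) has_derivative (\<lambda>t. t *\<^sub>R v)) (at s)"
      by (auto intro!: derivative_eq_intros)
    from has_derivative_compose[OF this has_derivative_partial_derivs[OF diff]]
    show ?thesis by simp
  qed
  have "\<exists>s\<in>{0<..<1}. norm (?g 1 - ?g 0) \<le> norm (?D s (1 - 0))"
    by (intro mvt_general der)
       (auto intro!: continuous_on_compose2[OF continuous_on_differentiable[OF diff, of UNIV]] continuous_intros)
  then obtain s where s: "0 < s" "s < 1" and le: "norm (f (x + v) - f x) \<le> norm (?D s 1)"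
    by auto
  have "norm (?D s 1) \<le> (\<Sum>j\<in>(UNIV::'n set). norm v * B)"
    using bd[of s] s
    by (intro order_trans[OF norm_sum] sum_mono)
       (auto intro!: mult_mono component_le_norm_cart)
  then show ?thesis using le by (simp add: mult_ac)
qed

section \<open>Rapid decay and polynomial growth\<close>

text \<open>With the weight \<open>1 + norm x\<close> instead of \<open>norm x\<close>, each single
  \<open>k\<close> controls the function near 0 and at infinity at once, and the weights are
  submultiplicative under translation.\<close>

definition rapidly_decreasing :: "('a::real_normed_vector \<Rightarrow> 'b::real_normed_vector) \<Rightarrow> bool" where
  "rapidly_decreasing f \<longleftrightarrow> (\<forall>k. \<exists>C. \<forall>x. (1 + norm x) ^ k * norm (f x) \<le> C)"

definition poly_bounded :: "('a::real_normed_vector \<Rightarrow> 'b::real_normed_vector) \<Rightarrow> bool" where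
  "poly_bounded f \<longleftrightarrow> (\<exists>k C. \<forall>x. norm (f x) \<le> C * (1 + norm x) ^ k)"

lemma rapidly_decreasingE:
  assumes "rapidly_decreasing f"
  obtains C where "C > 0" "\<And>x. (1 + norm x) ^ k * norm (f x) \<le> C"
proof -
  obtain C where "\<forall>x. (1 + norm x) ^ k * norm (f x) \<le> C"
    using assms unfolding rapidly_decreasing_def by blast
  then show ?thesis by (intro that[of "max C 1"]) (auto simp: le_max_iff_disj)
qed

lemma poly_boundedE:
  assumes "poly_bounded f"
  obtains C k where "C > 0" "\<And>x. norm (f x) \<le> C * (1 + norm x) ^ k"
proof -
  obtain C k where C: "\<forall>x. norm (f x) \<le> C * (1 + norm x) ^ k"
    using assms unfolding poly_bounded_def by blast
  have "norm (f x) \<le> max C 1 * (1 + norm x) ^ k" for x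
    using C[rule_format, of x] mult_right_mono[of C "max C 1" "(1 + norm x) ^ k"] by force
  then show ?thesis by (intro that[of "max C 1"]) auto
qed

lemma rapidly_decreasing_dominated:
  assumes "rapidly_decreasing f" "poly_bounded g" "\<And>x. norm (h x) \<le> norm (f x) * norm (g x)"
  shows "rapidly_decreasing h"
  unfolding rapidly_decreasing_def
proof
  fix k
  obtain D m where D: "D > 0" "\<And>x. norm (g x) \<le> D * (1 + norm x) ^ m"
    using poly_boundedE[OF assms(2)] by blast
  obtain C where C: "C > 0" "\<And>x. (1 + norm x) ^ (k + m) * norm (f x) \<le> C"
    using rapidly_decreasingE[OF assms(1)] by blast
  have "(1 + norm x) ^ k * norm (h x) \<le> D * C" for x
  proof -
    have "(1 + norm x) ^ k * norm (h x) \<le> (1 + norm x) ^ k * (norm (f x) * (D * (1 + norm x) ^ m))"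
      by (intro mult_left_mono order_trans[OF assms(3)] D) auto
    also have "\<dots> = D * ((1 + norm x) ^ (k + m) * norm (f x))"
      by (simp add: power_add mult_ac)
    also have "\<dots> \<le> D * C" using D C by (intro mult_left_mono) auto
    finally show ?thesis .
  qed
  then show "\<exists>C. \<forall>x. (1 + norm x) ^ k * norm (h x) \<le> C" by blast
qed

lemma poly_boundedI: "(\<And>x. norm (f x) \<le> C * (1 + norm x) ^ k) \<Longrightarrow> poly_bounded f"
  unfolding poly_bounded_def by blast

lemma poly_bounded_bounded: "(\<And>x. norm (f x) \<le> C) \<Longrightarrow> poly_bounded f"
  by (rule poly_boundedI[of _ C 0]) simp

lemma poly_bounded_const [simp]: "poly_bounded (\<lambda>x. c)"
  by (rule poly_bounded_bounded[of _ "norm c"]) simp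

lemma poly_bounded_mono:
  assumes "poly_bounded g" "\<And>x. norm (f x) \<le> norm (g x)"
  shows "poly_bounded f"
  using assms unfolding poly_bounded_def by (meson order_trans)

lemma poly_bounded_dominated:
  assumes "poly_bounded f" "poly_bounded g" "\<And>x. norm (h x) \<le> norm (f x) * norm (g x)"
  shows "poly_bounded h"
proof -
  obtain C k where C: "C > 0" "\<And>x. norm (f x) \<le> C * (1 + norm x) ^ k"
    using poly_boundedE[OF assms(1)] by blast
  obtain D m where D: "D > 0" "\<And>x. norm (g x) \<le> D * (1 + norm x) ^ m"
    using poly_boundedE[OF assms(2)] by blast
  show ?thesis
  proof (rule poly_boundedI[of _ "C * D" "k + m"])
    fix x
    have "norm (h x) \<le> (C * (1 + norm x) ^ k) * (D * (1 + norm x) ^ m)"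
      using C D by (intro order_trans[OF assms(3)] mult_mono) auto
    then show "norm (h x) \<le> C * D * (1 + norm x) ^ (k + m)"
      by (simp add: power_add mult_ac)
  qed
qed

lemma poly_bounded_add:
  assumes "poly_bounded f" "poly_bounded g"
  shows "poly_bounded (\<lambda>x. f x + g x)"
proof -
  obtain C k where C: "C > 0" "\<And>x. norm (f x) \<le> C * (1 + norm x) ^ k"
    using poly_boundedE[OF assms(1)] by blast
  obtain D m where D: "D > 0" "\<And>x. norm (g x) \<le> D * (1 + norm x) ^ m"
    using poly_boundedE[OF assms(2)] by blast
  show ?thesis
  proof (rule poly_boundedI[of _ "C + D" "k + m"])
    fix x :: 'a
    have "(1 + norm x) ^ k \<le> (1 + norm x) ^ (k + m)" "(1 + norm x) ^ m \<le> (1 + norm x) ^ (k + m)"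
      by (auto intro!: power_increasing)
    then have "C * (1 + norm x) ^ k + D * (1 + norm x) ^ m \<le> C * (1 + norm x) ^ (k + m) + D * (1 + norm x) ^ (k + m)"
      using C D by (intro add_mono mult_left_mono) auto
    then show "norm (f x + g x) \<le> (C + D) * (1 + norm x) ^ (k + m)"
      using norm_triangle_ineq[of "f x" "g x"] C(2)[of x] D(2)[of x]
      unfolding distrib_right by linarith
  qed
qed

lemma poly_bounded_mult:
  fixes f g :: "'a::real_normed_vector \<Rightarrow> 'b::real_normed_algebra"
  shows "poly_bounded f \<Longrightarrow> poly_bounded g \<Longrightarrow> poly_bounded (\<lambda>x. f x * g x)"
  by (rule poly_bounded_dominated[of f g]) (auto intro: norm_mult_ineq)

lemma poly_bounded_norm: "poly_bounded (\<lambda>x. norm x)"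
  by (rule poly_boundedI[of _ 1 1]) simp

lemma poly_bounded_sum:
  "finite I \<Longrightarrow> (\<And>i. i \<in> I \<Longrightarrow> poly_bounded (f i)) \<Longrightarrow> poly_bounded (\<lambda>x. \<Sum>i\<in>I. f i x)"
  by (induction I rule: finite_induct) (auto intro: poly_bounded_add)

lemma rapidly_decreasing_imp_poly_bounded: "rapidly_decreasing f \<Longrightarrow> poly_bounded f"
  by (rule rapidly_decreasingE[of f 0]) (auto intro: poly_bounded_bounded)

lemma rapidly_decreasing_mono:
  assumes "rapidly_decreasing g" "\<And>x. norm (f x) \<le> norm (g x)"
  shows "rapidly_decreasing f"
  by (rule rapidly_decreasing_dominated[OF assms(1) poly_bounded_const[of "1::real"]]) (simp add: assms(2))

lemma rapidly_decreasing_add: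
  assumes "rapidly_decreasing f" "rapidly_decreasing g"
  shows "rapidly_decreasing (\<lambda>x. f x + g x)"
  unfolding rapidly_decreasing_def
proof
  fix k
  obtain C where C: "C > 0" "\<And>x. (1 + norm x) ^ k * norm (f x) \<le> C"
    using rapidly_decreasingE[OF assms(1)] by blast
  obtain D where D: "D > 0" "\<And>x. (1 + norm x) ^ k * norm (g x) \<le> D"
    using rapidly_decreasingE[OF assms(2)] by blast
  have "(1 + norm x) ^ k * norm (f x + g x) \<le> C + D" for x
  proof -
    have "(1 + norm x) ^ k * norm (f x + g x) \<le> (1 + norm x) ^ k * (norm (f x) + norm (g x))"
      by (intro mult_left_mono norm_triangle_ineq) auto
    then show ?thesis using C(2)[of x] D(2)[of x] unfolding distrib_left by linarith
  qed
  then show "\<exists>C. \<forall>x. (1 + norm x) ^ k * norm (f x + g x) \<le> C" by blast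
qed

lemma rapidly_decreasing_zero [simp]: "rapidly_decreasing (\<lambda>x. 0)"
  unfolding rapidly_decreasing_def by auto

lemma rapidly_decreasing_sum:
  "finite I \<Longrightarrow> (\<And>i. i \<in> I \<Longrightarrow> rapidly_decreasing (f i)) \<Longrightarrow> rapidly_decreasing (\<lambda>x. \<Sum>i\<in>I. f i x)"
  by (induction I rule: finite_induct) (auto intro: rapidly_decreasing_add)

lemma rapidly_decreasing_mult:
  fixes f g :: "'a::real_normed_vector \<Rightarrow> 'b::real_normed_algebra"
  assumes "rapidly_decreasing f" "poly_bounded g"
  shows "rapidly_decreasing (\<lambda>x. f x * g x)" "rapidly_decreasing (\<lambda>x. g x * f x)"
proof -
  show "rapidly_decreasing (\<lambda>x. f x * g x)"
    by (rule rapidly_decreasing_dominated[OF assms]) (auto intro: norm_mult_ineq)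
  show "rapidly_decreasing (\<lambda>x. g x * f x)"
    by (rule rapidly_decreasing_dominated[OF assms]) (metis mult.commute norm_mult_ineq)
qed

text \<open>The triangle inequality in Peetre form: moving a point by \<open>y\<close> changes the
  polynomial weight at most by the factor \<open>1 + norm y\<close>. All comparisons of decay at
  nearby points rest on it.\<close>

lemma one_plus_norm_add_le: "1 + norm (x + y) \<le> (1 + norm x) * (1 + norm y)"
proof -
  have "0 \<le> norm x * norm y" by simp
  then show ?thesis
    using norm_triangle_ineq[of x y] unfolding distrib_left distrib_right by linarith
qed

lemma rapidly_decreasing_shift:
  fixes f :: "'a::real_normed_vector \<Rightarrow> 'b::real_normed_vector"
  assumes "rapidly_decreasing f"
  shows "rapidly_decreasing (\<lambda>x. f (x + a))"
  unfolding rapidly_decreasing_def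
proof
  fix k
  obtain C where C: "C > 0" "\<And>x. (1 + norm x) ^ k * norm (f x) \<le> C"
    using rapidly_decreasingE[OF assms] by blast
  have "(1 + norm x) ^ k * norm (f (x + a)) \<le> (1 + norm a) ^ k * C" for x
  proof -
    have "1 + norm x \<le> (1 + norm (x + a)) * (1 + norm a)"
      using one_plus_norm_add_le[of "x + a" "- a"] by simp
    then have "(1 + norm x) ^ k \<le> (1 + norm (x + a)) ^ k * (1 + norm a) ^ k"
      using power_mono[of "1 + norm x" "(1 + norm (x + a)) * (1 + norm a)" k]
      by (simp add: power_mult_distrib)
    then have "(1 + norm x) ^ k * norm (f (x + a))
        \<le> ((1 + norm (x + a)) ^ k * (1 + norm a) ^ k) * norm (f (x + a))"
      by (intro mult_right_mono) auto
    also have "\<dots> = (1 + norm a) ^ k * ((1 + norm (x + a)) ^ k * norm (f (x + a)))"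
      by (simp add: mult_ac)
    also have "\<dots> \<le> (1 + norm a) ^ k * C" by (intro mult_left_mono C) auto
    finally show ?thesis .
  qed
  then show "\<exists>C. \<forall>x. (1 + norm x) ^ k * norm (f (x + a)) \<le> C" by blast
qed

text \<open>Integrating the gradient along the segment from 0 to \<open>x\<close> costs one power of
  the weight. This recovers the growth of a potential and of its gradient when only second
  derivatives are known to be bounded.\<close>

lemma poly_bounded_of_partial_derivs:
  fixes f :: "real^'n \<Rightarrow> 'b::euclidean_space"
  assumes diff: "\<And>x. f differentiable (at x)" and "\<And>j. poly_bounded (partial_deriv j f)"
  shows "poly_bounded f"
proof -
  have "poly_bounded (\<lambda>x. \<Sum>j\<in>UNIV. norm (partial_deriv j f x))"
    by (intro poly_bounded_sum poly_bounded_mono[OF assms(2)]) auto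
  from poly_boundedE[OF this] obtain C k where C: "C > 0"
    and bd: "\<And>x. norm (\<Sum>j\<in>UNIV. norm (partial_deriv j f x)) \<le> C * (1 + norm x) ^ k"
    by blast
  have pb: "norm (partial_deriv j f x) \<le> C * (1 + norm x) ^ k" for j x
    using bd[of x] member_le_sum[of j UNIV "\<lambda>j. norm (partial_deriv j f x)"] by simp
  have "norm (f x) \<le> (norm (f 0) + real CARD('n) * C) * (1 + norm x) ^ (k + 1)" for x
  proof -
    have "norm (partial_deriv j f (0 + s *\<^sub>R x)) \<le> C * (1 + norm x) ^ k" if "0 \<le> s" "s \<le> 1" for s j
    proof -
      have "(1 + norm (s *\<^sub>R x)) ^ k \<le> (1 + norm x) ^ k"
        using that by (intro power_mono) (auto simp: mult_left_le_one_le)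
      then show ?thesis using pb[of j "s *\<^sub>R x"] C by (auto elim!: order_trans)
    qed
    from norm_increment_le[OF diff this]
    have "norm (f x - f 0) \<le> real CARD('n) * (C * (1 + norm x) ^ k) * norm x" by simp
    also have "\<dots> \<le> real CARD('n) * C * (1 + norm x) ^ (k + 1)"
      using C by (simp add: mult_ac mult_left_mono mult_right_mono)
    finally have 1: "norm (f x - f 0) \<le> real CARD('n) * C * (1 + norm x) ^ (k + 1)" .
    have "1 \<le> (1 + norm x) ^ (k + 1)" by (rule one_le_power) simp
    then have "norm (f 0) \<le> norm (f 0) * (1 + norm x) ^ (k + 1)"
      using mult_left_mono[of 1 "(1 + norm x) ^ (k + 1)" "norm (f 0)"] by simp
    then show ?thesis using 1 norm_triangle_ineq[of "f x - f 0" "f 0"]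
      unfolding distrib_right by simp
  qed
  then show ?thesis by (rule poly_boundedI)
qed

section \<open>Integration over Euclidean space\<close>

text \<open>On the shell where \<open>norm x\<close> lies between \<open>k\<close> and
  \<open>k + 1\<close>, the integrand is at most \<open>(1 + k)^(-n-2)\<close>. The shell is
  enlarged to a ball of volume proportional to \<open>(k + 1)^n\<close>, so the series is a multiple
  of the sum of \<open>1 / (k + 1)^2\<close>. With full balls in place of shells, the exponent
  \<open>n + 1\<close> would only give the harmonic series.\<close>

lemma nn_integral_inverse_power_norm:
  "(\<integral>\<^sup>+x. ennreal (1 / (1 + norm (x::'a::euclidean_space)) ^ (DIM('a) + 2)) \<partial>lborel) < \<infinity>"
proof -
  let ?n = "DIM('a)"
  define v where "v = unit_ball_vol (real ?n)"
  have v: "v \<ge> 0" by (simp add: v_def)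
  let ?t = "\<lambda>k x::'a. ennreal (1 / (1 + real k) ^ (?n + 2)) * indicator (cball 0 (real k + 1)) x"
  have "(\<integral>\<^sup>+x. ennreal (1 / (1 + norm (x::'a)) ^ (?n + 2)) \<partial>lborel) \<le> (\<integral>\<^sup>+x. (\<Sum>k. ?t k x) \<partial>lborel)"
  proof (rule nn_integral_mono)
    fix x :: 'a
    define k where "k = nat \<lfloor>norm x\<rfloor>"
    have k: "real k \<le> norm x" "norm x < real k + 1"
      unfolding k_def by (auto simp: of_nat_nat)
    have "1 / (1 + norm x) ^ (?n + 2) \<le> 1 / (1 + real k) ^ (?n + 2)"
      using k by (intro divide_left_mono power_mono mult_pos_pos zero_less_power) auto
    then have "ennreal (1 / (1 + norm x) ^ (?n + 2)) \<le> ?t k x"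
      using k by (auto simp: indicator_def intro!: ennreal_leI)
    also have "\<dots> = (\<Sum>i\<in>{k}. ?t i x)"
      by (simp only: sum.insert[OF finite.emptyI] empty_iff not_False_eq_True sum.empty add_0_right)
    also have "\<dots> \<le> (\<Sum>k. ?t k x)"
      by (intro sum_le_suminf) auto
    finally show "ennreal (1 / (1 + norm x) ^ (?n + 2)) \<le> (\<Sum>k. ?t k x)" .
  qed
  also have "\<dots> = (\<Sum>k. \<integral>\<^sup>+x. ?t k x \<partial>lborel)"
    by (rule nn_integral_suminf) (intro borel_measurable_times_ennreal borel_measurable_indicator, auto)
  also have "\<dots> = (\<Sum>k. ennreal (v * inverse (real (Suc k) ^ 2)))"
  proof (rule suminf_cong)
    fix k
    have "(\<integral>\<^sup>+x. ?t k x \<partial>lborel) = ennreal (1 / (1 + real k) ^ (?n + 2)) * ennreal (v * (real k + 1) ^ ?n)"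
      by (subst nn_integral_cmult_indicator) (auto simp: emeasure_cball v_def)
    also have "\<dots> = ennreal (1 / (1 + real k) ^ (?n + 2) * (v * (real k + 1) ^ ?n))"
      by (rule ennreal_mult'[symmetric]) simp
    also have "1 / (1 + real k) ^ (?n + 2) * (v * (real k + 1) ^ ?n) = v * inverse (real (Suc k) ^ 2)"
    proof -
      have "1 / s ^ (m + 2) * (v * s ^ m) = v * inverse (s ^ 2)" if "s > 0" for s :: real and m
        using that by (simp add: power_add field_simps power2_eq_square)
      from this[of "1 + real k" ?n] show ?thesis by (simp only: add.commute of_nat_Suc)
    qed
    finally show "(\<integral>\<^sup>+x. ?t k x \<partial>lborel) = ennreal (v * inverse (real (Suc k) ^ 2))" .
  qed
  also have "\<dots> < \<infinity>"
  proof -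
    have "summable (\<lambda>k. inverse (real k ^ 2))" by (rule inverse_power_summable) simp
    then have "summable (\<lambda>k. v * inverse (real (Suc k) ^ 2))"
      by (intro summable_mult) (subst summable_Suc_iff)
    then show ?thesis using v
      by (simp add: suminf_ennreal2)
  qed
  finally show ?thesis .
qed

lemma integrable_inverse_power_norm:
  "integrable lborel (\<lambda>x::'a::euclidean_space. 1 / (1 + norm x) ^ (DIM('a) + 2))"
  using nn_integral_inverse_power_norm[where 'a='a] by (intro integrableI_nonneg) auto

lemma integrable_decay:
  fixes f :: "'a::euclidean_space \<Rightarrow> 'b::{second_countable_topology,banach}"
  assumes "f \<in> borel_measurable borel" "\<And>x. (1 + norm x) ^ (DIM('a) + 2) * norm (f x) \<le> C"
  shows "integrable lborel f"
proof (rule Bochner_Integration.integrable_bound)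
  show "integrable lborel (\<lambda>x::'a. C * (1 / (1 + norm x) ^ (DIM('a) + 2)))"
    by (intro integrable_mult_right integrable_inverse_power_norm)
  have "norm (f x) \<le> norm (C * (1 / (1 + norm x) ^ (DIM('a) + 2)))" for x
  proof -
    have pos: "0 < (1 + norm x) ^ (DIM('a) + 2)" by (intro zero_less_power) (simp add: add_pos_nonneg)
    then have "norm (f x) \<le> C / (1 + norm x) ^ (DIM('a) + 2)"
      using assms(2)[of x] by (subst pos_le_divide_eq) (simp_all only: mult.commute)
    also have "\<dots> \<le> norm (C * (1 / (1 + norm x) ^ (DIM('a) + 2)))"
      using abs_ge_self[of "C / (1 + norm x) ^ (DIM('a) + 2)"] by simp
    finally show ?thesis .
  qed
  then show "AE x in lborel. norm (f x) \<le> norm (C * (1 / (1 + norm x) ^ (DIM('a) + 2)))" by simp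
qed (use assms in auto)

lemma rapidly_decreasing_integrable:
  fixes f :: "'a::euclidean_space \<Rightarrow> 'b::{second_countable_topology,banach}"
  assumes "rapidly_decreasing f" "f \<in> borel_measurable borel"
  shows "integrable lborel f"
proof -
  obtain C where "\<And>x. (1 + norm x) ^ (DIM('a) + 2) * norm (f x) \<le> C"
    using rapidly_decreasingE[OF assms(1)] by blast
  then show ?thesis by (rule integrable_decay[OF assms(2)])
qed

section \<open>Affine changes of variables and integration by parts\<close>

lemma nn_integral_affine:
  fixes f :: "'a::euclidean_space \<Rightarrow> ennreal"
  assumes "f \<in> borel_measurable borel" "c \<noteq> 0"
  shows "(\<integral>\<^sup>+x. f x \<partial>lborel) = ennreal (\<bar>c\<bar> ^ DIM('a)) * (\<integral>\<^sup>+x. f (t + c *\<^sub>R x) \<partial>lborel)"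
  by (subst lborel_affine[OF assms(2), of t])
     (use assms(1) in \<open>simp add: nn_integral_density nn_integral_distr nn_integral_cmult ennreal_power\<close>)

lemma integral_affine:
  fixes f :: "'a::euclidean_space \<Rightarrow> 'b::{second_countable_topology,banach}"
  assumes "f \<in> borel_measurable borel" "c \<noteq> 0"
  shows "(\<integral>x. f x \<partial>lborel) = (\<bar>c\<bar> ^ DIM('a)) *\<^sub>R (\<integral>x. f (t + c *\<^sub>R x) \<partial>lborel)"
  by (subst lborel_affine[OF assms(2), of t])
     (use assms(1) in \<open>simp add: integral_density integral_distr\<close>)

lemma integrable_affine:
  fixes f :: "'a::euclidean_space \<Rightarrow> 'b::{second_countable_topology,banach}"
  assumes "integrable lborel f" "c \<noteq> 0"
  shows "integrable lborel (\<lambda>x. f (t + c *\<^sub>R x))"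
proof -
  have "integrable (density (distr lborel borel (\<lambda>x. t + c *\<^sub>R x)) (\<lambda>_. \<bar>c\<bar>^DIM('a))) f"
    using assms(1) lborel_affine[OF assms(2), of t] by simp
  then have "integrable lborel (\<lambda>x. (\<bar>c\<bar>^DIM('a)) *\<^sub>R f (t + c *\<^sub>R x))"
    using assms(1) by (simp add: integrable_density integrable_distr_eq ennreal_power)
  then have "integrable lborel (\<lambda>x. inverse (\<bar>c\<bar>^DIM('a)) *\<^sub>R ((\<bar>c\<bar>^DIM('a)) *\<^sub>R f (t + c *\<^sub>R x)))"
    by (rule integrable_scaleR_right)
  then show ?thesis using assms(2) by simp
qed

lemma integral_reflect:
  fixes f :: "'a::euclidean_space \<Rightarrow> 'b::{second_countable_topology,banach}"
  assumes "f \<in> borel_measurable borel"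
  shows "(\<integral>y. f (x - y) \<partial>lborel) = (\<integral>y. f y \<partial>lborel)"
  using integral_affine[OF assms, of "-1" x] by simp

lemma integral_translate:
  fixes f :: "'a::euclidean_space \<Rightarrow> 'b::{second_countable_topology,banach}"
  assumes "f \<in> borel_measurable borel"
  shows "(\<integral>y. f (x + y) \<partial>lborel) = (\<integral>y. f y \<partial>lborel)"
  using integral_affine[OF assms, of 1 x] by simp

text \<open>Only first derivatives are constrained, since each integration by parts moves one
  derivative. The weights of the subelliptic estimate are handled at this level, through
  \<open>poly_C1\<close>.\<close>

definition rapid_C1 :: "(real^'n \<Rightarrow> 'b::real_normed_vector) \<Rightarrow> bool" where
  "rapid_C1 f \<longleftrightarrow> (\<forall>x. f differentiable (at x)) \<and> rapidly_decreasing f \<and>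
     (\<forall>j. rapidly_decreasing (partial_deriv j f))"

definition poly_C1 :: "(real^'n \<Rightarrow> 'b::real_normed_vector) \<Rightarrow> bool" where
  "poly_C1 f \<longleftrightarrow> (\<forall>x. f differentiable (at x)) \<and> poly_bounded f \<and>
     (\<forall>j. poly_bounded (partial_deriv j f))"

lemma rapid_C1D:
  assumes "rapid_C1 f"
  shows "f differentiable (at x)" "rapidly_decreasing f" "rapidly_decreasing (partial_deriv j f)"
  using assms by (auto simp: rapid_C1_def)

lemma poly_C1D:
  assumes "poly_C1 f"
  shows "f differentiable (at x)" "poly_bounded f" "poly_bounded (partial_deriv j f)"
  using assms by (auto simp: poly_C1_def)

lemma rapid_C1_imp_poly_C1: "rapid_C1 f \<Longrightarrow> poly_C1 f"
  by (auto simp: rapid_C1_def poly_C1_def rapidly_decreasing_imp_poly_bounded)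

lemma rapid_C1_mult:
  fixes f g :: "real^'n \<Rightarrow> 'b::real_normed_algebra"
  assumes "rapid_C1 f" "poly_C1 g"
  shows "rapid_C1 (\<lambda>x. f x * g x)"
proof -
  have eq: "partial_deriv j (\<lambda>x. f x * g x) = (\<lambda>x. f x * partial_deriv j g x + partial_deriv j f x * g x)" for j
    by (rule ext) (intro partial_deriv_mult rapid_C1D[OF assms(1)] poly_C1D[OF assms(2)])
  show ?thesis
    unfolding rapid_C1_def eq
    by (auto intro!: differentiable_mult rapidly_decreasing_add
        rapidly_decreasing_mult(1)[OF rapid_C1D(2)[OF assms(1)]]
        rapidly_decreasing_mult(1)[OF rapid_C1D(3)[OF assms(1)]]
        rapid_C1D(1)[OF assms(1)] poly_C1D[OF assms(2)])
qed

lemma poly_C1_mult: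
  fixes f g :: "real^'n \<Rightarrow> 'b::real_normed_algebra"
  assumes "poly_C1 f" "poly_C1 g"
  shows "poly_C1 (\<lambda>x. f x * g x)"
proof -
  have eq: "partial_deriv j (\<lambda>x. f x * g x) = (\<lambda>x. f x * partial_deriv j g x + partial_deriv j f x * g x)" for j
    by (rule ext) (intro partial_deriv_mult poly_C1D[OF assms(1)] poly_C1D[OF assms(2)])
  show ?thesis
    unfolding poly_C1_def eq
    by (auto intro!: differentiable_mult poly_bounded_add poly_bounded_mult
        poly_C1D[OF assms(1)] poly_C1D[OF assms(2)])
qed

lemma rapid_C1_cnj:
  assumes "rapid_C1 f" shows "rapid_C1 (\<lambda>x. cnj (f x))"
proof -
  have eq: "partial_deriv j (\<lambda>x. cnj (f x)) = (\<lambda>x. cnj (partial_deriv j f x))" for j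
    by (rule ext) (rule partial_deriv_cnj[OF rapid_C1D(1)[OF assms]])
  show ?thesis
    unfolding rapid_C1_def eq
    by (auto intro!: partial_deriv_cnj rapid_C1D(1)[OF assms]
        intro: rapidly_decreasing_mono[OF rapid_C1D(2)[OF assms]]
          rapidly_decreasing_mono[OF rapid_C1D(3)[OF assms]])
qed

lemma poly_C1_of_real:
  assumes "poly_C1 f" shows "poly_C1 (\<lambda>x. complex_of_real (f x))"
proof -
  have eq: "partial_deriv j (\<lambda>x. complex_of_real (f x)) = (\<lambda>x. of_real (partial_deriv j f x))" for j
    by (rule ext) (rule partial_deriv_of_real[OF poly_C1D(1)[OF assms]])
  show ?thesis
    unfolding poly_C1_def eq
    by (auto intro!: partial_deriv_of_real poly_C1D(1)[OF assms]
        intro: poly_bounded_mono[OF poly_C1D(2)[OF assms]]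
          poly_bounded_mono[OF poly_C1D(3)[OF assms]])
qed

text \<open>By translation invariance every difference quotient integrates to 0. The decay of the
  derivative dominates the quotients, so the limit may be taken under the integral; no boundary
  terms have to be discussed.\<close>

lemma rapid_C1_integral_partial_deriv:
  fixes w :: "real^'n \<Rightarrow> 'b::euclidean_space"
  assumes "rapid_C1 w"
  shows "integrable lborel w" "integrable lborel (partial_deriv j w)"
    and "(\<integral>x. partial_deriv j w x \<partial>lborel) = 0"
proof -
  note diff = rapid_C1D(1)[OF assms]
  have [measurable]: "w \<in> borel_measurable borel" "partial_deriv j w \<in> borel_measurable borel"
    by (rule borel_measurable_differentiable[OF diff]) (rule borel_measurable_partial_deriv[OF diff])
  show intw: "integrable lborel w"
    by (rule rapidly_decreasing_integrable[OF rapid_C1D(2)[OF assms]]) simp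
  show intdw: "integrable lborel (partial_deriv j w)"
    by (rule rapidly_decreasing_integrable[OF rapid_C1D(3)[OF assms]]) simp
  let ?N = "DIM(real^'n) + 2"
  obtain C where C: "C > 0" "\<And>x. (1 + norm x) ^ ?N * norm (partial_deriv j w x) \<le> C"
    using rapidly_decreasingE[OF rapid_C1D(3)[OF assms]] by blast
  let ?s = "\<lambda>k x. real (Suc k) *\<^sub>R (w (x + (1 / real (Suc k)) *\<^sub>R axis j 1) - w x)"
  have "(\<lambda>k. integral\<^sup>L lborel (?s k)) \<longlonglongrightarrow> integral\<^sup>L lborel (partial_deriv j w)"
  proof (rule integral_dominated_convergence)
    show "integrable lborel (\<lambda>x::real^'n. 2 ^ ?N * C * (1 / (1 + norm x) ^ ?N))"
      by (intro integrable_mult_right integrable_inverse_power_norm)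
    show "AE x in lborel. (\<lambda>k. ?s k x) \<longlonglongrightarrow> partial_deriv j w x"
      using tendsto_difference_quotient[OF diff] by auto
    fix k
    show "?s k \<in> borel_measurable lborel" by measurable
    have "norm (?s k x) \<le> 2 ^ ?N * C * (1 / (1 + norm x) ^ ?N)" for x
    proof -
      let ?t = "1 / real (Suc k)"
      have "norm (w (x + ?t *\<^sub>R axis j 1) - w x) \<le> ?t * (2 ^ ?N * C * (1 / (1 + norm x) ^ ?N))"
      proof (rule norm_increment_along_axis_le[OF diff])
        \<comment> \<open>The intermediate points of the mean value inequality are within distance 1
          of \<open>x\<close>, so the weight changes at most by the factor 2, hence
          \<open>2 ^ ?N\<close> in the dominating function.\<close>
        fix s :: real assume s: "0 \<le> s" "s \<le> ?t"
        have "s \<le> 1" using s(2) by (rule order_trans) simp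
        let ?y = "x + s *\<^sub>R axis j 1"
        have "norm (s *\<^sub>R axis j (1::real)) \<le> 1" using s \<open>s \<le> 1\<close> by simp
        then have "1 + norm x \<le> 2 * (1 + norm ?y)"
          using one_plus_norm_add_le[of ?y "- (s *\<^sub>R axis j 1)"]
            mult_left_mono[of "1 + norm (s *\<^sub>R axis j (1::real))" 2 "1 + norm ?y"] by simp
        then have "(1 + norm x) ^ ?N \<le> 2 ^ ?N * (1 + norm ?y) ^ ?N"
          unfolding power_mult_distrib[symmetric] by (intro power_mono) auto
        then have "(1 + norm x) ^ ?N * norm (partial_deriv j w ?y)
            \<le> 2 ^ ?N * ((1 + norm ?y) ^ ?N * norm (partial_deriv j w ?y))"
          unfolding mult.assoc[symmetric] by (intro mult_right_mono) auto
        also have "\<dots> \<le> 2 ^ ?N * C" by (intro mult_left_mono C) auto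
        finally have "(1 + norm x) ^ ?N * norm (partial_deriv j w ?y) \<le> 2 ^ ?N * C" .
        moreover have "0 < (1 + norm x) ^ ?N" by (intro zero_less_power) (simp add: add_pos_nonneg)
        ultimately show "norm (partial_deriv j w ?y) \<le> 2 ^ ?N * C * (1 / (1 + norm x) ^ ?N)"
          by (simp add: field_simps)
      qed simp
      then have "real (Suc k) * norm (w (x + ?t *\<^sub>R axis j 1) - w x)
          \<le> real (Suc k) * (?t * (2 ^ ?N * C * (1 / (1 + norm x) ^ ?N)))"
        by (intro mult_left_mono) auto
      then show ?thesis by simp
    qed
    then show "AE x in lborel. norm (?s k x) \<le> 2 ^ ?N * C * (1 / (1 + norm x) ^ ?N)" by simp
  qed simp
  moreover have "integral\<^sup>L lborel (?s k) = 0" for k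
  proof -
    have "integrable lborel (\<lambda>x. w (x + (1 / real (Suc k)) *\<^sub>R axis j 1))"
      using integrable_affine[OF intw, of 1 "(1 / real (Suc k)) *\<^sub>R axis j 1"] by (simp add: add.commute)
    then show ?thesis
      using intw integral_translate[of w "(1 / real (Suc k)) *\<^sub>R axis j 1"]
      by (simp add: add.commute)
  qed
  ultimately show "(\<integral>x. partial_deriv j w x \<partial>lborel) = 0"
    by (simp add: LIMSEQ_const_iff)
qed

lemma integral_by_parts:
  fixes f g :: "real^'n \<Rightarrow> 'b::{real_normed_algebra,euclidean_space}"
  assumes "rapid_C1 f" "poly_C1 g"
  shows "(\<integral>x. partial_deriv j f x * g x \<partial>lborel) = - (\<integral>x. f x * partial_deriv j g x \<partial>lborel)"
    and "integrable lborel (\<lambda>x. partial_deriv j f x * g x)"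
    and "integrable lborel (\<lambda>x. f x * partial_deriv j g x)"
proof -
  note d = rapid_C1D(1)[OF assms(1)] poly_C1D(1)[OF assms(2)]
  have [measurable]: "f \<in> borel_measurable borel" "partial_deriv j f \<in> borel_measurable borel"
     "g \<in> borel_measurable borel" "partial_deriv j g \<in> borel_measurable borel"
    by (auto intro!: borel_measurable_differentiable borel_measurable_partial_deriv d)
  show i1: "integrable lborel (\<lambda>x. partial_deriv j f x * g x)"
    by (intro rapidly_decreasing_integrable rapidly_decreasing_mult rapid_C1D[OF assms(1)] poly_C1D[OF assms(2)])
       simp
  show i2: "integrable lborel (\<lambda>x. f x * partial_deriv j g x)"
    by (intro rapidly_decreasing_integrable rapidly_decreasing_mult rapid_C1D[OF assms(1)] poly_C1D[OF assms(2)])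
       simp
  have eq: "partial_deriv j (\<lambda>x. f x * g x) = (\<lambda>x. f x * partial_deriv j g x + partial_deriv j f x * g x)"
    by (rule ext) (intro partial_deriv_mult d)
  show "(\<integral>x. partial_deriv j f x * g x \<partial>lborel) = - (\<integral>x. f x * partial_deriv j g x \<partial>lborel)"
    using rapid_C1_integral_partial_deriv(3)[OF rapid_C1_mult[OF assms], of j] i1 i2
    unfolding eq by (simp add: eq_neg_iff_add_eq_0 add.commute)
qed

section \<open>Square integrable functions\<close>

text \<open>More general than \<open>L2\<close> in the codomain, because the estimates also involve
  real functions such as a weight times \<open>norm (u x)\<close>.\<close>

definition square_integrable :: "('a::euclidean_space \<Rightarrow> 'b::euclidean_space) \<Rightarrow> bool" where
  "square_integrable f \<longleftrightarrow> f \<in> borel_measurable borel \<and> integrable lborel (\<lambda>x. (norm (f x))\<^sup>2)"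

definition l2norm :: "('a::euclidean_space \<Rightarrow> 'b::euclidean_space) \<Rightarrow> real" where
  "l2norm f = sqrt (\<integral>x. (norm (f x))\<^sup>2 \<partial>lborel)"

lemma L2_iff: "u \<in> L2 \<longleftrightarrow> square_integrable u"
  by (simp add: L2_def square_integrable_def)

lemma L2norm_eq: "L2norm u = l2norm u"
  by (simp add: L2norm_def l2norm_def)

lemma square_integrableD:
  assumes "square_integrable f"
  shows "f \<in> borel_measurable borel" "integrable lborel (\<lambda>x. (norm (f x))\<^sup>2)"
  using assms by (auto simp: square_integrable_def)

lemma l2norm_nonneg [simp]: "0 \<le> l2norm f"
  by (simp add: l2norm_def)

lemma l2norm_power2: "(l2norm f)\<^sup>2 = (\<integral>x. (norm (f x))\<^sup>2 \<partial>lborel)"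
  by (simp add: l2norm_def)

lemma l2norm_leI:
  assumes "(\<integral>x. (norm (f x))\<^sup>2 \<partial>lborel) \<le> C\<^sup>2" "0 \<le> C"
  shows "l2norm f \<le> C"
  using assms unfolding l2norm_def by (intro real_le_lsqrt) auto

lemma square_integrable_dominated:
  fixes f :: "'a::euclidean_space \<Rightarrow> 'b::euclidean_space" and g :: "'a \<Rightarrow> 'c::euclidean_space"
  assumes "square_integrable g" "f \<in> borel_measurable borel" "\<And>x. norm (f x) \<le> C * norm (g x)"
  shows "square_integrable f"
  unfolding square_integrable_def
proof
  show "integrable lborel (\<lambda>x. (norm (f x))\<^sup>2)"
  proof (rule Bochner_Integration.integrable_bound)
    show "integrable lborel (\<lambda>x. C\<^sup>2 * (norm (g x))\<^sup>2)"
      using square_integrableD[OF assms(1)] by simp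
    show "AE x in lborel. norm ((norm (f x))\<^sup>2) \<le> norm (C\<^sup>2 * (norm (g x))\<^sup>2)"
      using assms(3) power_mono[OF assms(3), of _ 2] by (auto simp: power_mult_distrib)
  qed (use assms(2) in auto)
qed (use assms in auto)

lemma l2norm_mono:
  fixes f :: "'a::euclidean_space \<Rightarrow> 'b::euclidean_space" and g :: "'a \<Rightarrow> 'c::euclidean_space"
  assumes "square_integrable g" "f \<in> borel_measurable borel" "\<And>x. norm (f x) \<le> norm (g x)"
  shows "l2norm f \<le> l2norm g"
proof -
  have "square_integrable f"
    using square_integrable_dominated[OF assms(1,2), of 1] assms(3) by simp
  then show ?thesis unfolding l2norm_def
    by (intro real_sqrt_le_mono integral_mono square_integrableD assms power_mono) auto
qed

lemma square_integrable_cmult: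
  "square_integrable f \<Longrightarrow> square_integrable (\<lambda>x. c * f x :: complex)"
  by (rule square_integrable_dominated[of f _ "norm c"])
     (auto simp: norm_mult dest: square_integrableD(1))

lemma l2norm_cmult: "l2norm (\<lambda>x. c * f x :: complex) = norm c * l2norm f"
  by (simp add: l2norm_def norm_mult power_mult_distrib real_sqrt_mult)

lemma l2norm_minus_commute: "l2norm (\<lambda>x. f x - g x) = l2norm (\<lambda>x. g x - f x)"
  by (simp add: l2norm_def norm_minus_commute)

lemma square_integrable_add:
  assumes "square_integrable f" "square_integrable g"
  shows "square_integrable (\<lambda>x. f x + g x)"
  unfolding square_integrable_def
proof
  show m: "(\<lambda>x. f x + g x) \<in> borel_measurable borel"
    using assms[THEN square_integrableD(1)] by simp
  show "integrable lborel (\<lambda>x. (norm (f x + g x))\<^sup>2)"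
  proof (rule Bochner_Integration.integrable_bound)
    show "integrable lborel (\<lambda>x. 2 * (norm (f x))\<^sup>2 + 2 * (norm (g x))\<^sup>2)"
      using assms[THEN square_integrableD(2)] by simp
    have "(norm (f x + g x))\<^sup>2 \<le> 2 * (norm (f x))\<^sup>2 + 2 * (norm (g x))\<^sup>2" for x
    proof -
      have "(norm (f x + g x))\<^sup>2 \<le> (norm (f x) + norm (g x))\<^sup>2"
        by (intro power_mono norm_triangle_ineq) auto
      also have "\<dots> \<le> 2 * (norm (f x))\<^sup>2 + 2 * (norm (g x))\<^sup>2"
        using zero_le_power2[of "norm (f x) - norm (g x)"] by (simp add: power2_eq_square algebra_simps)
      finally show ?thesis .
    qed
    then show "AE x in lborel. norm ((norm (f x + g x))\<^sup>2) \<le> norm (2 * (norm (f x))\<^sup>2 + 2 * (norm (g x))\<^sup>2)"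
      by simp
  qed (use m in auto)
qed

lemma square_integrable_minus: "square_integrable f \<Longrightarrow> square_integrable (\<lambda>x. - f x)"
  by (simp add: square_integrable_def)

lemma square_integrable_diff:
  assumes "square_integrable f" "square_integrable g"
  shows "square_integrable (\<lambda>x. f x - g x)"
  using square_integrable_add[OF assms(1) square_integrable_minus[OF assms(2)]] by simp

lemma integrable_norm_mult:
  fixes f :: "'a::euclidean_space \<Rightarrow> 'b::euclidean_space" and g :: "'a \<Rightarrow> 'c::euclidean_space"
  assumes "square_integrable f" "square_integrable g"
  shows "integrable lborel (\<lambda>x. norm (f x) * norm (g x))"
proof (rule Bochner_Integration.integrable_bound)
  show "integrable lborel (\<lambda>x. (norm (f x))\<^sup>2 + (norm (g x))\<^sup>2)"
    using assms[THEN square_integrableD(2)] by simp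
  have "norm (f x) * norm (g x) \<le> (norm (f x))\<^sup>2 + (norm (g x))\<^sup>2" for x
    using sum_squares_bound[of "norm (f x)" "norm (g x)"]
      mult_nonneg_nonneg[of "norm (f x)" "norm (g x)"] by (simp del: mult_nonneg_nonneg)
  then show "AE x in lborel. norm (norm (f x) * norm (g x)) \<le> norm ((norm (f x))\<^sup>2 + (norm (g x))\<^sup>2)"
    by simp
qed (use assms[THEN square_integrableD(1)] in auto)

text \<open>A quadratic polynomial in \<open>t\<close> that is never negative has nonpositive
  discriminant; in the degenerate case it is linear, and the chosen \<open>t\<close> would violate
  the bound. Used for the Cauchy-Schwarz inequality and, with \<open>G = 0\<close>, to show that a
  minimizer is orthogonal to the subspace.\<close>

lemma discriminant_bound:
  fixes F G H :: real
  assumes "\<And>t. 2 * t * H \<le> t\<^sup>2 * F + G" "F \<ge> 0"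
  shows "H\<^sup>2 \<le> F * G"
proof (cases "F = 0")
  case True
  have "H = 0"
  proof (rule ccontr)
    assume "H \<noteq> 0"
    then show False using assms(1)[of "(G + 1) / (2 * H)"] True by simp
  qed
  then show ?thesis using True by simp
next
  case False
  then have "F > 0" using assms by simp
  have "2 * (H / F) * H \<le> (H / F)\<^sup>2 * F + G" by (rule assms)
  then show ?thesis using \<open>F > 0\<close> by (simp add: field_simps power2_eq_square)
qed

lemma integral_norm_mult_le:
  fixes f :: "'a::euclidean_space \<Rightarrow> 'b::euclidean_space" and g :: "'a \<Rightarrow> 'c::euclidean_space"
  assumes "square_integrable f" "square_integrable g"
  shows "(\<integral>x. norm (f x) * norm (g x) \<partial>lborel) \<le> l2norm f * l2norm g"
proof (rule power2_le_imp_le)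
  let ?H = "\<integral>x. norm (f x) * norm (g x) \<partial>lborel"
  have "2 * t * ?H \<le> t\<^sup>2 * (l2norm f)\<^sup>2 + (l2norm g)\<^sup>2" for t
  proof -
    have "2 * t * ?H = (\<integral>x. 2 * t * (norm (f x) * norm (g x)) \<partial>lborel)" by simp
    also have "\<dots> \<le> (\<integral>x. t\<^sup>2 * (norm (f x))\<^sup>2 + (norm (g x))\<^sup>2 \<partial>lborel)"
    proof (rule integral_mono)
      show "2 * t * (norm (f x) * norm (g x)) \<le> t\<^sup>2 * (norm (f x))\<^sup>2 + (norm (g x))\<^sup>2" for x
        using sum_squares_bound[of "t * norm (f x)" "norm (g x)"]
        by (simp add: power_mult_distrib mult_ac)
    qed (use assms[THEN square_integrableD(2)] integrable_norm_mult[OF assms] in auto)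
    also have "\<dots> = t\<^sup>2 * (l2norm f)\<^sup>2 + (l2norm g)\<^sup>2"
      using assms[THEN square_integrableD(2)] by (simp add: l2norm_power2)
    finally show ?thesis .
  qed
  from discriminant_bound[OF this]
  show "?H\<^sup>2 \<le> (l2norm f * l2norm g)\<^sup>2" by (simp add: power_mult_distrib)
qed simp

text \<open>Phrased for any \<open>h\<close> dominated by the product of norms, so that one
  statement covers products with conjugates, with scalars and with weights, and yields integrability
  together with the bound.\<close>

lemma Cauchy_Schwarz_integral:
  fixes f :: "'a::euclidean_space \<Rightarrow> 'b::euclidean_space" and g :: "'a \<Rightarrow> 'c::euclidean_space"
    and h :: "'a \<Rightarrow> 'd::euclidean_space"
  assumes "square_integrable f" "square_integrable g" "h \<in> borel_measurable borel"
    and "\<And>x. norm (h x) \<le> norm (f x) * norm (g x)"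
  shows "integrable lborel h" "norm (\<integral>x. h x \<partial>lborel) \<le> l2norm f * l2norm g"
proof -
  show i: "integrable lborel h"
    by (rule Bochner_Integration.integrable_bound[OF integrable_norm_mult[OF assms(1,2)]])
       (use assms in auto)
  have "norm (\<integral>x. h x \<partial>lborel) \<le> (\<integral>x. norm (f x) * norm (g x) \<partial>lborel)"
    by (rule Bochner_Integration.integral_norm_bound_integral[OF i integrable_norm_mult[OF assms(1,2)]]) (use assms in auto)
  then show "norm (\<integral>x. h x \<partial>lborel) \<le> l2norm f * l2norm g"
    using integral_norm_mult_le[OF assms(1,2)] by simp
qed

lemma l2norm_triangle:
  assumes "square_integrable f" "square_integrable g"
  shows "l2norm (\<lambda>x. f x + g x) \<le> l2norm f + l2norm g"
proof (rule l2norm_leI)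
  note i = assms[THEN square_integrableD(2)] square_integrableD(2)[OF square_integrable_add[OF assms]]
    integrable_norm_mult[OF assms]
  have "(\<integral>x. (norm (f x + g x))\<^sup>2 \<partial>lborel)
      \<le> (\<integral>x. (norm (f x))\<^sup>2 + 2 * (norm (f x) * norm (g x)) + (norm (g x))\<^sup>2 \<partial>lborel)"
  proof (rule integral_mono)
    fix x
    have "(norm (f x + g x))\<^sup>2 \<le> (norm (f x) + norm (g x))\<^sup>2"
      by (intro power_mono norm_triangle_ineq) auto
    then show "(norm (f x + g x))\<^sup>2 \<le> (norm (f x))\<^sup>2 + 2 * (norm (f x) * norm (g x)) + (norm (g x))\<^sup>2"
      by (simp add: power2_sum)
  qed (use i in auto)
  also have "\<dots> = (l2norm f)\<^sup>2 + 2 * (\<integral>x. norm (f x) * norm (g x) \<partial>lborel) + (l2norm g)\<^sup>2"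
    using i by (simp add: l2norm_power2)
  also have "\<dots> \<le> (l2norm f + l2norm g)\<^sup>2"
    using integral_norm_mult_le[OF assms] by (simp add: power2_sum)
  finally show "(\<integral>x. (norm (f x + g x))\<^sup>2 \<partial>lborel) \<le> (l2norm f + l2norm g)\<^sup>2" .
qed simp

lemma l2norm_triangle_diff:
  assumes "square_integrable f" "square_integrable g" "square_integrable h"
  shows "l2norm (\<lambda>x. f x - h x) \<le> l2norm (\<lambda>x. f x - g x) + l2norm (\<lambda>x. g x - h x)"
  using l2norm_triangle[OF square_integrable_diff[OF assms(1,2)] square_integrable_diff[OF assms(2,3)]]
  by simp

lemma l2norm_eq_0D:
  assumes "square_integrable f" "l2norm f = 0"
  shows "AE x in lborel. f x = 0"
proof -
  have "(\<integral>x. (norm (f x))\<^sup>2 \<partial>lborel) = 0" using assms(2) l2norm_power2[of f] by simp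
  then have "AE x in lborel. (norm (f x))\<^sup>2 = 0"
    using integral_nonneg_eq_0_iff_AE[OF square_integrableD(2)[OF assms(1)]] by simp
  then show ?thesis by simp
qed

lemma l2norm_cong_AE:
  assumes "AE x in lborel. f x = g x" "f \<in> borel_measurable borel" "g \<in> borel_measurable borel"
  shows "l2norm f = l2norm g"
  unfolding l2norm_def using assms by (intro arg_cong[of _ _ sqrt] integral_cong_AE) auto

lemma nn_integral_square:
  assumes "square_integrable f"
  shows "(\<integral>\<^sup>+x. ennreal ((norm (f x))\<^sup>2) \<partial>lborel) = ennreal ((l2norm f)\<^sup>2)"
  unfolding l2norm_power2 using square_integrableD[OF assms] by (intro nn_integral_eq_integral) auto

text \<open>Fatou's lemma and Young's inequality produce bounds for nonnegative integrals whose
  finiteness is not known beforehand; this turns them into integrability and a norm bound in one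
  move.\<close>

lemma square_integrable_nnI:
  assumes "f \<in> borel_measurable borel" "(\<integral>\<^sup>+x. ennreal ((norm (f x))\<^sup>2) \<partial>lborel) \<le> ennreal (C\<^sup>2)" "C \<ge> 0"
  shows "square_integrable f" "l2norm f \<le> C"
proof -
  have "(\<integral>\<^sup>+x. ennreal ((norm (f x))\<^sup>2) \<partial>lborel) < \<infinity>"
    using assms(2) by (rule le_less_trans) simp
  then have "integrable lborel (\<lambda>x. (norm (f x))\<^sup>2)"
    using assms(1) by (intro integrableI_nonneg) auto
  then show s: "square_integrable f" using assms(1) by (simp add: square_integrable_def)
  show "l2norm f \<le> C"
    using assms(2,3) unfolding nn_integral_square[OF s] by simp
qed

text \<open>Riesz--Fischer: along a subsequence with increments at most \<open>8\<^sup>-\<^sup>k\<close>, the weighted sum of the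
  squared increments is integrable, so almost every increment is bounded by a multiple of \<open>2\<^sup>-\<^sup>k\<close>.\<close>

lemma square_integrable_complete:
  fixes u :: "nat \<Rightarrow> 'a::euclidean_space \<Rightarrow> 'b::euclidean_space"
  assumes sq: "\<And>n. square_integrable (u n)"
    and cauchy: "\<And>e. e > 0 \<Longrightarrow> \<exists>N. \<forall>m\<ge>N. \<forall>n\<ge>N. l2norm (\<lambda>x. u m x - u n x) < e"
  shows "\<exists>v. square_integrable v \<and> (\<lambda>n. l2norm (\<lambda>x. u n x - v x)) \<longlonglongrightarrow> 0"
proof -
  note [measurable] = sq[THEN square_integrableD(1)]
  have "\<exists>r. strict_mono r \<and> (\<forall>k. \<forall>m\<ge>r k. \<forall>n\<ge>r k. l2norm (\<lambda>x. u m x - u n x) < (1/8)^k)"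
  proof -
    have "\<exists>f. \<forall>k. (\<forall>m\<ge>f k. \<forall>n\<ge>f k. l2norm (\<lambda>x. u m x - u n x) < (1/8)^k) \<and> f k < f (Suc k)"
    proof (rule dependent_nat_choice)
      show "\<exists>N. \<forall>m\<ge>N. \<forall>n\<ge>N. l2norm (\<lambda>x. u m x - u n x) < (1/8)^0"
        by (rule cauchy) simp
      fix N k
      obtain M where M: "\<forall>m\<ge>M. \<forall>n\<ge>M. l2norm (\<lambda>x. u m x - u n x) < (1/8)^Suc k"
        using cauchy[of "(1/8)^Suc k"] by auto
      show "\<exists>M. (\<forall>m\<ge>M. \<forall>n\<ge>M. l2norm (\<lambda>x. u m x - u n x) < (1/8)^Suc k) \<and> N < M"
        using M by (intro exI[of _ "max M (Suc N)"]) auto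
    qed
    then show ?thesis by (auto simp: strict_mono_Suc_iff)
  qed
  then obtain r where r: "strict_mono r"
    and rb: "\<And>k m n. m \<ge> r k \<Longrightarrow> n \<ge> r k \<Longrightarrow> l2norm (\<lambda>x. u m x - u n x) < (1/8)^k" by blast
  let ?d = "\<lambda>k x. u (r (Suc k)) x - u (r k) x"
  have "(\<integral>\<^sup>+x. (\<Sum>k. ennreal (4^k * (norm (?d k x))\<^sup>2)) \<partial>lborel)
      = (\<Sum>k. \<integral>\<^sup>+x. ennreal (4^k * (norm (?d k x))\<^sup>2) \<partial>lborel)"
    by (rule nn_integral_suminf) simp
  also have "\<dots> \<le> (\<Sum>k. ennreal ((1/2)^k))"
  proof (rule suminf_le)
    fix k
    have "(\<integral>\<^sup>+x. ennreal (4^k * (norm (?d k x))\<^sup>2) \<partial>lborel) = ennreal (4^k) * ennreal ((l2norm (?d k))\<^sup>2)"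
      by (simp add: ennreal_mult' nn_integral_cmult nn_integral_square square_integrable_diff sq)
    also have "\<dots> = ennreal (4^k * (l2norm (?d k))\<^sup>2)" by (simp add: ennreal_mult')
    also have "\<dots> \<le> ennreal ((1/2)^k)"
    proof (rule ennreal_leI)
      have "l2norm (?d k) \<le> (1/8)^k"
        using rb[of k "r (Suc k)" "r k"] strict_mono_leD[OF r, of k "Suc k"] by simp
      then have "(l2norm (?d k))\<^sup>2 \<le> ((1/8)^k)\<^sup>2" by (intro power_mono) auto
      also have "\<dots> \<le> (1/8)^k"
        using power_le_one[of "1/8::real" k] by (simp add: power2_eq_square mult_left_le)
      finally have "4^k * (l2norm (?d k))\<^sup>2 \<le> 4^k * (1/8)^k" by simp
      also have "\<dots> = (1/2)^k" by (simp add: power_mult_distrib[symmetric])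
      finally show "4^k * (l2norm (?d k))\<^sup>2 \<le> (1/2)^k" .
    qed
    finally show "(\<integral>\<^sup>+x. ennreal (4^k * (norm (?d k x))\<^sup>2) \<partial>lborel) \<le> ennreal ((1/2)^k)" .
  qed auto
  also have "\<dots> = ennreal (\<Sum>k. (1/2)^k)"
    by (intro suminf_ennreal2) (auto intro: summable_geometric)
  also have "\<dots> < \<infinity>" by simp
  finally have "AE x in lborel. (\<Sum>k. ennreal (4^k * (norm (?d k x))\<^sup>2)) \<noteq> \<infinity>"
    by (intro nn_integral_PInf_AE) auto
  then have conv: "AE x in lborel. convergent (\<lambda>k. u (r k) x)"
  proof eventually_elim
    case (elim x)
    have "\<exists>C\<ge>0. S = ennreal C" if "S \<noteq> \<infinity>" for S
      using that by (cases S) auto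
    from this[OF elim] obtain C where C: "C \<ge> 0" "(\<Sum>k. ennreal (4^k * (norm (?d k x))\<^sup>2)) = ennreal C"
      by (elim exE conjE)
    have "norm (?d k x) \<le> sqrt C * (1/2)^k" for k
    proof -
      have "(\<Sum>i\<in>{k}. ennreal (4^i * (norm (?d i x))\<^sup>2)) \<le> ennreal C"
        unfolding C(2)[symmetric] by (rule sum_le_suminf) auto
      then have "4^k * (norm (?d k x))\<^sup>2 \<le> C" using C(1) by simp
      then have "sqrt (4^k * (norm (?d k x))\<^sup>2) \<le> sqrt C" by (rule real_sqrt_le_mono)
      then have "2^k * norm (?d k x) \<le> sqrt C"
        using real_sqrt_power[of 4 k] by (simp add: real_sqrt_mult)
      then show ?thesis by (simp add: field_simps)
    qed
    moreover have "summable (\<lambda>k. sqrt C * (1/2)^k)"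
      by (intro summable_mult summable_geometric) simp
    ultimately have "summable (\<lambda>k. ?d k x)"
      by (rule summable_comparison_test'[rotated])
    then have "convergent (\<lambda>n. \<Sum>k<n. ?d k x)" unfolding summable_iff_convergent .
    then have "convergent (\<lambda>n. (\<Sum>k<n. ?d k x) + u (r 0) x)"
      by (intro convergent_add convergent_const)
    moreover have "(\<Sum>k<n. ?d k x) + u (r 0) x = u (r n) x" for n
      using sum_lessThan_telescope[of "\<lambda>k. u (r k) x" n] by (simp only: diff_add_cancel)
    ultimately show ?case by (simp only:)
  qed
  define v where "v x = lim (\<lambda>k. u (r k) x)" for x
  have [measurable]: "v \<in> borel_measurable borel"
    unfolding v_def[abs_def] by (rule borel_measurable_lim_metric) simp
  have lim: "AE x in lborel. (\<lambda>k. u (r k) x) \<longlonglongrightarrow> v x"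
    using conv by eventually_elim (simp add: v_def convergent_LIMSEQ_iff)
  \<comment> \<open>Fatou's lemma: \<open>u n - v\<close> is the almost everywhere limit of
    \<open>u n - u (r m)\<close> as \<open>m\<close> grows, and for \<open>m \<ge> k\<close> these
    differences have norm at most \<open>8^(-k)\<close>.\<close>
  have bound: "square_integrable (\<lambda>x. u n x - v x)" "l2norm (\<lambda>x. u n x - v x) \<le> (1/8)^k"
    if "n \<ge> r k" for n k
  proof -
    have "(\<integral>\<^sup>+x. ennreal ((norm (u n x - v x))\<^sup>2) \<partial>lborel)
        = (\<integral>\<^sup>+x. liminf (\<lambda>m. ennreal ((norm (u n x - u (r m) x))\<^sup>2)) \<partial>lborel)"
    proof (rule nn_integral_cong_AE)
      show "AE x in lborel. ennreal ((norm (u n x - v x))\<^sup>2) = liminf (\<lambda>m. ennreal ((norm (u n x - u (r m) x))\<^sup>2))"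
        using lim
      proof eventually_elim
        case (elim x)
        then have "(\<lambda>m. ennreal ((norm (u n x - u (r m) x))\<^sup>2)) \<longlonglongrightarrow> ennreal ((norm (u n x - v x))\<^sup>2)"
          by (intro tendsto_ennrealI tendsto_power tendsto_norm tendsto_diff tendsto_const)
        from lim_imp_Liminf[OF _ this] show ?case by simp
      qed
    qed
    also have "\<dots> \<le> liminf (\<lambda>m. \<integral>\<^sup>+x. ennreal ((norm (u n x - u (r m) x))\<^sup>2) \<partial>lborel)"
      by (rule nn_integral_liminf) simp
    also have "\<dots> \<le> ennreal (((1/8)^k)\<^sup>2)"
    proof (rule Liminf_le)
      show "\<forall>\<^sub>F m in sequentially. (\<integral>\<^sup>+x. ennreal ((norm (u n x - u (r m) x))\<^sup>2) \<partial>lborel) \<le> ennreal (((1/8)^k)\<^sup>2)"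
        using eventually_ge_at_top[of k]
      proof eventually_elim
        case (elim m)
        have "l2norm (\<lambda>x. u n x - u (r m) x) \<le> (1/8)^k"
          using rb[of k n "r m"] that strict_mono_leD[OF r elim] by simp
        then show ?case
          by (subst nn_integral_square[OF square_integrable_diff[OF sq sq]])
             (intro ennreal_leI power_mono, auto)
      qed
    qed simp
    finally have "(\<integral>\<^sup>+x. ennreal ((norm (u n x - v x))\<^sup>2) \<partial>lborel) \<le> ennreal (((1/8)^k)\<^sup>2)" .
    then show "square_integrable (\<lambda>x. u n x - v x)" "l2norm (\<lambda>x. u n x - v x) \<le> (1/8)^k"
      by (auto intro!: square_integrable_nnI)
  qed
  have "square_integrable v"
    using square_integrable_diff[OF sq[of "r 0"] bound(1)[of 0 "r 0"]] by simp
  moreover have "(\<lambda>n. l2norm (\<lambda>x. u n x - v x)) \<longlonglongrightarrow> 0"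
  proof (rule LIMSEQ_I)
    fix e :: real assume "e > 0"
    then obtain k where "(1/8)^k < e" using real_arch_pow_inv[of e "1/8"] by auto
    then show "\<exists>no. \<forall>n\<ge>no. norm (l2norm (\<lambda>x. u n x - v x) - 0) < e"
      using bound(2)[of k] by (intro exI[of _ "r k"]) (auto intro: le_less_trans)
  qed
  ultimately show ?thesis by blast
qed

section \<open>Schwartz functions and their multipliers\<close>

lemma partial_derivs_simps [simp]:
  "partial_derivs [] f = f" "partial_derivs (j # js) f = partial_deriv j (partial_derivs js f)"
  by (simp_all add: partial_derivs_def)

lemma partial_derivs_snoc: "partial_derivs (js @ [j]) f = partial_derivs js (partial_deriv j f)"
  by (simp add: partial_derivs_def)

lemma smooth_iff: "smooth f \<longleftrightarrow> (\<forall>js x. partial_derivs js f differentiable (at x))"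
  by (auto simp: smooth_def differentiable_on_def)

lemma smooth_differentiable: "smooth f \<Longrightarrow> f differentiable (at x)"
  unfolding smooth_iff by (metis partial_derivs_simps(1))

lemma smooth_partial_deriv: "smooth f \<Longrightarrow> smooth (partial_deriv j f)"
  unfolding smooth_iff by (metis partial_derivs_snoc)

text \<open>The slowly increasing smooth functions, often written O_M, which multiply the Schwartz
  space into itself. The exponent of growth may depend on the derivative.\<close>

definition moderate :: "(real^'n \<Rightarrow> complex) \<Rightarrow> bool" where
  "moderate f \<longleftrightarrow> smooth f \<and> (\<forall>js. poly_bounded (partial_derivs js f))"

text \<open>The definition bounds \<open>norm x ^ k\<close> times a derivative for every
  \<open>k\<close>. Adding the bound for \<open>k = 0\<close> gives one for
  \<open>1 + norm x ^ k\<close>, and this dominates \<open>(1 + norm x) ^ k\<close> up to the factor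
  \<open>2 ^ k\<close>.\<close>

lemma schwartz_iff: "u \<in> schwartz \<longleftrightarrow> smooth u \<and> (\<forall>js. rapidly_decreasing (partial_derivs js u))"
proof -
  have "(\<forall>k. bounded (range (\<lambda>x. norm x ^ k *\<^sub>R f x))) \<longleftrightarrow> rapidly_decreasing f" for f :: "real^'n \<Rightarrow> complex"
  proof
    assume *: "\<forall>k. bounded (range (\<lambda>x. norm x ^ k *\<^sub>R f x))"
    show "rapidly_decreasing f"
      unfolding rapidly_decreasing_def
    proof
      fix k
      obtain C where C: "\<And>x. norm x ^ k * norm (f x) \<le> C"
        using *[rule_format, of k] by (auto simp: bounded_iff)
      obtain D where D: "\<And>x. norm (f x) \<le> D"
        using *[rule_format, of 0] by (auto simp: bounded_iff)
      have "(1 + norm x) ^ k * norm (f x) \<le> 2 ^ k * (C + D)" for x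
      proof -
        have "(1 + norm x) ^ k \<le> (2 * max (norm x) 1) ^ k" by (intro power_mono) auto
        also have "\<dots> = 2 ^ k * max (norm x) 1 ^ k" by (rule power_mult_distrib)
        also have "\<dots> \<le> 2 ^ k * (norm x ^ k + 1)"
          by (intro mult_left_mono) (auto simp: max_def)
        finally have "(1 + norm x) ^ k * norm (f x) \<le> 2 ^ k * (norm x ^ k + 1) * norm (f x)"
          by (rule mult_right_mono) auto
        also have "\<dots> = 2 ^ k * (norm x ^ k * norm (f x) + norm (f x))" by (simp add: algebra_simps)
        also have "\<dots> \<le> 2 ^ k * (C + D)" using C D by (intro mult_left_mono add_mono) auto
        finally show ?thesis .
      qed
      then show "\<exists>C. \<forall>x. (1 + norm x) ^ k * norm (f x) \<le> C" by blast
    qed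
  next
    assume *: "rapidly_decreasing f"
    show "\<forall>k. bounded (range (\<lambda>x. norm x ^ k *\<^sub>R f x))"
    proof
      fix k
      obtain C where C: "\<And>x. (1 + norm x) ^ k * norm (f x) \<le> C"
        using rapidly_decreasingE[OF *] by blast
      have "norm x ^ k * norm (f x) \<le> C" for x
        using C[of x] mult_right_mono[OF power_mono[of "norm x" "1 + norm x" k], of "norm (f x)"] by simp
      then show "bounded (range (\<lambda>x. norm x ^ k *\<^sub>R f x))" by (auto simp: bounded_iff)
    qed
  qed
  then show ?thesis by (auto simp: schwartz_def)
qed

lemma partial_derivs_mem:
  assumes "f \<in> F" "\<And>f j. f \<in> F \<Longrightarrow> partial_deriv j f \<in> F"
  shows "partial_derivs js f \<in> F"
  by (induction js) (use assms in auto)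

text \<open>Derivatives of all orders are handled by naming a family \<open>F\<close> that is closed
  under partial differentiation; then only first derivatives of its members have to be
  computed.\<close>

lemma schwartz_coinduct:
  assumes "f \<in> F" "\<And>f x. f \<in> F \<Longrightarrow> f differentiable (at x)"
    and "\<And>f. f \<in> F \<Longrightarrow> rapidly_decreasing f" "\<And>f j. f \<in> F \<Longrightarrow> partial_deriv j f \<in> F"
  shows "f \<in> schwartz"
  using partial_derivs_mem[OF assms(1,4)] assms(2,3) by (auto simp: schwartz_iff smooth_iff)

lemma moderate_coinduct:
  assumes "f \<in> F" "\<And>f x. f \<in> F \<Longrightarrow> f differentiable (at x)"
    and "\<And>f. f \<in> F \<Longrightarrow> poly_bounded f" "\<And>f j. f \<in> F \<Longrightarrow> partial_deriv j f \<in> F"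
  shows "moderate f"
  using partial_derivs_mem[OF assms(1,4)] assms(2,3) by (auto simp: moderate_def smooth_iff)

lemma schwartz_partial_deriv:
  assumes "u \<in> schwartz" shows "partial_deriv j u \<in> schwartz"
  using assms unfolding schwartz_iff by (metis smooth_partial_deriv partial_derivs_snoc)

lemma schwartz_rapidly_decreasing: "u \<in> schwartz \<Longrightarrow> rapidly_decreasing u"
  unfolding schwartz_iff by (metis partial_derivs_simps(1))

lemma schwartz_differentiable: "u \<in> schwartz \<Longrightarrow> u differentiable (at x)"
  by (simp add: schwartz_iff smooth_differentiable)

lemma schwartz_rapid_C1: "u \<in> schwartz \<Longrightarrow> rapid_C1 u"
  by (simp add: rapid_C1_def schwartz_differentiable schwartz_rapidly_decreasing schwartz_partial_deriv)

lemma moderate_partial_deriv: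
  assumes "moderate f" shows "moderate (partial_deriv j f)"
  using assms unfolding moderate_def by (metis smooth_partial_deriv partial_derivs_snoc)

lemma moderate_poly_bounded: "moderate f \<Longrightarrow> poly_bounded f"
  unfolding moderate_def by (metis partial_derivs_simps(1))

lemma moderate_differentiable: "moderate f \<Longrightarrow> f differentiable (at x)"
  by (simp add: moderate_def smooth_differentiable)

lemma schwartz_borel: "u \<in> schwartz \<Longrightarrow> u \<in> borel_measurable borel"
  by (intro borel_measurable_differentiable schwartz_differentiable)

lemma moderate_borel: "moderate u \<Longrightarrow> u \<in> borel_measurable borel"
  by (intro borel_measurable_differentiable moderate_differentiable)

lemma schwartz_integrable: "u \<in> schwartz \<Longrightarrow> integrable lborel u"
  by (intro rapidly_decreasing_integrable schwartz_rapidly_decreasing schwartz_borel)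

section \<open>Moderate functions as multipliers of Schwartz functions\<close>

lemma moderate_const: "moderate (\<lambda>x. c)"
proof (rule moderate_coinduct[of _ "range (\<lambda>c x. c)"])
  fix f :: "real^'n \<Rightarrow> complex" and j assume "f \<in> range (\<lambda>c x. c)"
  then obtain c where f: "f = (\<lambda>x. c)" by auto
  have "partial_deriv j f = (\<lambda>x. 0)" unfolding f by (rule ext) simp
  then show "partial_deriv j f \<in> range (\<lambda>c x. c)" by auto
qed auto

text \<open>Needed for the potential at the midpoint \<open>(x + y) / 2\<close> in the Weyl
  quantization. The scalar \<open>k\<close> in the family absorbs the powers of \<open>c\<close>
  produced by the chain rule.\<close>

lemma moderate_affine:
  fixes f :: "real^'n \<Rightarrow> complex"
  assumes "moderate f"
  shows "moderate (\<lambda>x. f (a + c *\<^sub>R x))"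
proof (rule moderate_coinduct[of _ "{\<lambda>x. k * f (a + c *\<^sub>R x) | k f. moderate f}"])
  show "(\<lambda>x. f (a + c *\<^sub>R x)) \<in> {\<lambda>x. k * f (a + c *\<^sub>R x) | k f. moderate f}"
    using assms by (intro CollectI exI[of _ 1] exI[of _ f]) simp
next
  fix g :: "real^'n \<Rightarrow> complex" assume "g \<in> {\<lambda>x. k * f (a + c *\<^sub>R x) | k f. moderate f}"
  then obtain k f where g: "g = (\<lambda>x. k * f (a + c *\<^sub>R x))" and f: "moderate f" by blast
  note d = partial_deriv_affine[OF moderate_differentiable[OF f]]
  show "g differentiable (at x)" for x
    unfolding g by (intro differentiable_mult d(2)) simp
  have "partial_deriv j g = (\<lambda>x. (k * of_real c) * partial_deriv j f (a + c *\<^sub>R x))" for j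
    unfolding g by (rule ext) (simp add: partial_deriv_cmult(1)[OF d(2)] d(1) scaleR_conv_of_real[where 'a=complex])
  then show "partial_deriv j g \<in> {\<lambda>x. k * f (a + c *\<^sub>R x) | k f. moderate f}" for j
    using moderate_partial_deriv[OF f] by blast
  obtain C m where C: "C > 0" "\<And>x. norm (f x) \<le> C * (1 + norm x) ^ m"
    using poly_boundedE[OF moderate_poly_bounded[OF f]] by blast
  show "poly_bounded g"
  proof (rule poly_boundedI[of _ "norm k * C * (1 + norm a + \<bar>c\<bar>) ^ m" m])
    fix x :: "real^'n"
    have "1 + norm (a + c *\<^sub>R x) \<le> (1 + norm a + \<bar>c\<bar>) * (1 + norm x)"
    proof -
      have "0 \<le> norm x + norm a * norm x + \<bar>c\<bar>" by simp
      then show ?thesis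
        using norm_triangle_ineq[of a "c *\<^sub>R x"] unfolding distrib_left distrib_right norm_scaleR by linarith
    qed
    then have "(1 + norm (a + c *\<^sub>R x)) ^ m \<le> (1 + norm a + \<bar>c\<bar>) ^ m * (1 + norm x) ^ m"
      unfolding power_mult_distrib[symmetric] by (intro power_mono) auto
    then have "norm (f (a + c *\<^sub>R x)) \<le> C * ((1 + norm a + \<bar>c\<bar>) ^ m * (1 + norm x) ^ m)"
      using C(1) by (intro order_trans[OF C(2)] mult_left_mono) auto
    then show "norm (g x) \<le> norm k * C * (1 + norm a + \<bar>c\<bar>) ^ m * (1 + norm x) ^ m"
      unfolding g norm_mult mult.assoc by (intro mult_left_mono) auto
  qed
qed

text \<open>The Leibniz rule turns one product into two, so products by themselves are not closed
  under differentiation, but their finite sums are.\<close>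

inductive_set product_span :: "(real^'n \<Rightarrow> complex) set"
  where
    product: "moderate f \<Longrightarrow> u \<in> schwartz \<Longrightarrow> (\<lambda>x. f x * u x) \<in> product_span"
  | add: "v \<in> product_span \<Longrightarrow> w \<in> product_span \<Longrightarrow> (\<lambda>x. v x + w x) \<in> product_span"

lemma product_span_subset_schwartz:
  assumes "v \<in> product_span" shows "v \<in> schwartz"
proof (rule schwartz_coinduct[OF assms])
  fix v :: "real^'n \<Rightarrow> complex" assume v: "v \<in> product_span"
  show d: "v differentiable (at x)" for x
    using v
  proof induction
    case (product f u)
    show ?case
      by (intro differentiable_mult schwartz_differentiable[OF product(2)] moderate_differentiable[OF product(1)])
  qed (rule differentiable_add)
  show "rapidly_decreasing v"
    using v
  proof induction
    case (product f u)
    show ?case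
      by (rule rapidly_decreasing_mult(2)[OF schwartz_rapidly_decreasing[OF product(2)]
          moderate_poly_bounded[OF product(1)]])
  qed (rule rapidly_decreasing_add)
  have "(\<forall>x. v differentiable (at x)) \<and> partial_deriv j v \<in> product_span" for j
    using v
  proof induction
    case (product f u)
    have "partial_deriv j (\<lambda>x. f x * u x) = (\<lambda>x. f x * partial_deriv j u x + partial_deriv j f x * u x)"
      by (rule ext) (intro partial_deriv_mult schwartz_differentiable moderate_differentiable product)
    then have "partial_deriv j (\<lambda>x. f x * u x) \<in> product_span"
      using product by (auto intro!: product_span.intros moderate_partial_deriv schwartz_partial_deriv)
    moreover have "(\<lambda>x. f x * u x) differentiable (at x)" for x
      by (intro differentiable_mult schwartz_differentiable[OF product(2)] moderate_differentiable[OF product(1)])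
    ultimately show ?case by blast
  next
    case (add v w)
    have "partial_deriv j (\<lambda>x. v x + w x) = (\<lambda>x. partial_deriv j v x + partial_deriv j w x)"
      using add.IH by (intro ext partial_deriv_add) auto
    then show ?case
      using add by (auto intro!: product_span.add differentiable_add)
  qed
  then show "partial_deriv j v \<in> product_span" for j by blast
qed

lemma schwartz_mult:
  assumes "moderate f" "u \<in> schwartz"
  shows "(\<lambda>x. f x * u x) \<in> schwartz"
  by (intro product_span_subset_schwartz product_span.product assms)

lemma schwartz_cmult: "u \<in> schwartz \<Longrightarrow> (\<lambda>x. c * u x) \<in> schwartz"
  by (rule schwartz_mult[OF moderate_const])

lemma schwartz_add:
  assumes "u \<in> schwartz" "v \<in> schwartz"
  shows "(\<lambda>x. u x + v x) \<in> schwartz"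
proof -
  have "(\<lambda>x. 1 * u x + 1 * v x) \<in> schwartz"
    by (intro product_span_subset_schwartz product_span.intros moderate_const assms)
  then show ?thesis by simp
qed

lemma schwartz_diff:
  assumes "u \<in> schwartz" "v \<in> schwartz"
  shows "(\<lambda>x. u x - v x) \<in> schwartz"
  using schwartz_add[OF assms(1) schwartz_cmult[OF assms(2), of "-1"]] by simp

lemma schwartz_zero: "(\<lambda>x. 0) \<in> schwartz"
proof (rule schwartz_coinduct[of _ "{\<lambda>x. 0}"])
  fix f :: "real^'n \<Rightarrow> complex" and j assume "f \<in> {\<lambda>x. 0}"
  then have "partial_deriv j f = (\<lambda>x. 0)" by (intro ext) simp
  then show "partial_deriv j f \<in> {\<lambda>x. 0}" by simp
qed auto

lemma schwartz_sum:
  "finite I \<Longrightarrow> (\<And>i. i \<in> I \<Longrightarrow> u i \<in> schwartz) \<Longrightarrow> (\<lambda>x. \<Sum>i\<in>I. u i x) \<in> schwartz"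
  by (induction I rule: finite_induct) (auto intro: schwartz_zero schwartz_add)

lemma schwartz_imp_moderate: "u \<in> schwartz \<Longrightarrow> moderate u"
  by (auto simp: schwartz_iff moderate_def rapidly_decreasing_imp_poly_bounded)

text \<open>Derivatives of order at least 2 are bounded by assumption; those of order 1 and then 0
  are recovered by integrating from the origin.\<close>

lemma moderate_of_second_derivs:
  assumes "smooth V" "second_derivs_in_S1 V"
  shows "moderate V"
proof -
  have 2: "poly_bounded (partial_derivs js V)" if "length js \<ge> 2" for js
    using assms(2) that unfolding second_derivs_in_S1_def bounded_iff
    by (metis poly_bounded_bounded rangeI)
  have d: "partial_derivs js V differentiable (at x)" for js x
    using assms(1) by (auto simp: smooth_iff)
  have 1: "poly_bounded (partial_derivs [j] V)" for j
    by (rule poly_bounded_of_partial_derivs[OF d]) (use 2[of "[_, j]"] in simp)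
  have 0: "poly_bounded (partial_derivs [] V)"
    by (rule poly_bounded_of_partial_derivs[OF d]) (use 1 in simp)
  have "poly_bounded (partial_derivs js V)" for js
    using 0 1 2[of js] by (cases js; cases "tl js") auto
  then show ?thesis using assms(1) by (simp add: moderate_def)
qed

section \<open>Gaussians\<close>

definition gaussian :: "real \<Rightarrow> real^'n \<Rightarrow> real^'n \<Rightarrow> real" where
  "gaussian a c x = exp (- a * (norm (x - c))\<^sup>2)"

lemma gaussian_pos [simp]: "0 < gaussian a c x"
  by (simp add: gaussian_def)

lemma gaussian_le_1: "0 \<le> a \<Longrightarrow> gaussian a c x \<le> 1"
  by (simp add: gaussian_def)

lemma gaussian_deriv:
  "partial_deriv j (gaussian a c) x = - 2 * a * (x $ j - c $ j) * gaussian a c x"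
  "gaussian a c differentiable (at x)"
proof -
  have "((\<lambda>x. exp (- a * ((x - c) \<bullet> (x - c)))) has_derivative
      (\<lambda>h. exp (- a * ((x - c) \<bullet> (x - c))) * (- a * (2 * ((x - c) \<bullet> h))))) (at x)"
    by (auto intro!: derivative_eq_intros simp: inner_commute algebra_simps)
  then have d: "(gaussian a c has_derivative
      (\<lambda>h. gaussian a c x * (- a * (2 * ((x - c) \<bullet> h))))) (at x)"
    by (simp add: gaussian_def[abs_def] power2_norm_eq_inner)
  show "partial_deriv j (gaussian a c) x = - 2 * a * (x $ j - c $ j) * gaussian a c x"
    using partial_deriv_eqI[OF d, of j] by (simp add: inner_axis mult_ac)
  show "gaussian a c differentiable (at x)" using d differentiable_def by blast
qed

lemma gaussian_borel [measurable]: "gaussian a c \<in> borel_measurable borel"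
  by (rule borel_measurable_differentiable) (rule gaussian_deriv(2))

lemma gaussian_rapidly_decreasing:
  fixes c :: "real^'n"
  assumes "a > 0" shows "rapidly_decreasing (gaussian a c)"
proof -
  have "rapidly_decreasing (gaussian a (0::real^'n))"
    unfolding rapidly_decreasing_def
  proof
    fix k
    \<comment> \<open>\<open>K = k + 1\<close> stays positive for \<open>k = 0\<close>. With
      \<open>s = a |x|^2 / K\<close> one has \<open>1 + |x| \<le> b (1 + s) \<le> b exp s\<close>,
      and the k-th power of \<open>exp s\<close> is at most \<open>exp (a |x|^2)\<close>.\<close>
    define K where "K = real k + 1"
    have K: "K > 0" "real k \<le> K" by (simp_all add: K_def)
    define b where "b = 2 + K / a"
    have "b \<ge> 2" using assms K by (simp add: b_def)
    have "(1 + norm x) ^ k * norm (gaussian a 0 x) \<le> b ^ k" for x :: "real^'n"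
    proof -
      define s where "s = a * (norm x)\<^sup>2 / K"
      have s: "s \<ge> 0" "(norm x)\<^sup>2 = (K / a) * s"
        using assms K by (simp_all add: s_def)
      have "real k * s \<le> K * s" using s(1) K by (intro mult_right_mono) auto
      also have "\<dots> = a * (norm x)\<^sup>2" using K by (simp add: s_def)
      finally have s3: "real k * s \<le> a * (norm x)\<^sup>2" .
      have "norm x \<le> 1 + (norm x)\<^sup>2"
        using sum_squares_bound[of 1 "norm x"] norm_ge_zero[of x] unfolding mult_1_right power_one by linarith
      then have "1 + norm x \<le> 2 + (K / a) * s" using s(2) by linarith
      also have "\<dots> \<le> b * (1 + s)"
        using s(1) assms K unfolding b_def distrib_left distrib_right by simp
      also have "\<dots> \<le> b * exp s"
        using \<open>b \<ge> 2\<close> exp_ge_add_one_self[of s] by (intro mult_left_mono) auto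
      finally have "(1 + norm x) ^ k \<le> (b * exp s) ^ k" by (intro power_mono) auto
      also have "\<dots> = b ^ k * exp (real k * s)" by (simp add: power_mult_distrib exp_of_nat_mult)
      also have "\<dots> \<le> b ^ k * exp (a * (norm x)\<^sup>2)"
        using s3 \<open>b \<ge> 2\<close> by (intro mult_left_mono) auto
      finally have "(1 + norm x) ^ k * exp (- (a * (norm x)\<^sup>2)) \<le> b ^ k * exp (a * (norm x)\<^sup>2) * exp (- (a * (norm x)\<^sup>2))"
        by (rule mult_right_mono) simp
      then show ?thesis by (simp add: gaussian_def mult.assoc exp_add[symmetric])
    qed
    then show "\<exists>C. \<forall>x::real^'n. (1 + norm x) ^ k * norm (gaussian a 0 x) \<le> C" by blast
  qed
  from rapidly_decreasing_shift[OF this, of "- c"] show ?thesis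
    by (simp add: gaussian_def[abs_def])
qed

text \<open>Polynomials times a fixed Gaussian, generated inductively so that closure under
  differentiation and rapid decay are both inductions.\<close>

inductive_set gaussian_span :: "real \<Rightarrow> real^'n \<Rightarrow> (real^'n \<Rightarrow> complex) set" for a c
  where
    gaussian: "(\<lambda>x. complex_of_real (gaussian a c x)) \<in> gaussian_span a c"
  | component: "f \<in> gaussian_span a c \<Longrightarrow> (\<lambda>x. complex_of_real (x $ i) * f x) \<in> gaussian_span a c"
  | cmult: "f \<in> gaussian_span a c \<Longrightarrow> (\<lambda>x. k * f x) \<in> gaussian_span a c"
  | add: "f \<in> gaussian_span a c \<Longrightarrow> g \<in> gaussian_span a c \<Longrightarrow> (\<lambda>x. f x + g x) \<in> gaussian_span a c"

lemma component_differentiable: "(\<lambda>x::real^'n. x $ i) differentiable (at x)"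
  by (intro bounded_linear_imp_differentiable bounded_linear_vec_nth)

lemma poly_bounded_component: "poly_bounded (\<lambda>x::real^'n. complex_of_real (x $ i))"
  by (rule poly_bounded_mono[OF poly_bounded_norm]) (simp add: component_le_norm_cart)

lemma gaussian_span_partial_deriv:
  fixes f :: "real^'n \<Rightarrow> complex"
  assumes "f \<in> gaussian_span a c"
  shows "(\<forall>x. f differentiable (at x)) \<and> partial_deriv j f \<in> gaussian_span a c"
  using assms
proof induction
  case gaussian
  have "partial_deriv j (\<lambda>x. complex_of_real (gaussian a c x)) =
     (\<lambda>x. (-2 * of_real a) * (of_real (x $ j) * of_real (gaussian a c x)) + (2 * of_real a * of_real (c $ j)) * of_real (gaussian a c x))"
    by (rule ext) (simp add: partial_deriv_of_real(1)[OF gaussian_deriv(2)] gaussian_deriv(1) algebra_simps)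
  also have "\<dots> \<in> gaussian_span a c" by (intro gaussian_span.intros)
  finally show ?case
    using partial_deriv_of_real(2)[OF gaussian_deriv(2)[of a c]] by blast
next
  case (component f i)
  have "partial_deriv j (\<lambda>x. complex_of_real (x $ i) * f x) =
     (\<lambda>x. complex_of_real (x $ i) * partial_deriv j f x + (if i = j then 1 else 0) * f x)"
    by (rule ext, subst partial_deriv_mult)
       (use component.IH in \<open>auto intro!: partial_deriv_of_real(2) component_differentiable
          simp: partial_deriv_of_real(1)[OF component_differentiable] partial_deriv_component\<close>)
  then show ?case using component
    by (auto intro!: gaussian_span.add gaussian_span.component gaussian_span.cmult differentiable_mult
         partial_deriv_of_real(2) component_differentiable)
next
  case (cmult f k)
  have "partial_deriv j (\<lambda>x. k * f x) = (\<lambda>x. k * partial_deriv j f x)"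
    using cmult.IH by (intro ext partial_deriv_cmult) auto
  then show ?case using cmult by (auto intro!: gaussian_span.cmult differentiable_mult)
next
  case (add f g)
  have "partial_deriv j (\<lambda>x. f x + g x) = (\<lambda>x. partial_deriv j f x + partial_deriv j g x)"
    using add.IH by (intro ext partial_deriv_add) auto
  then show ?case using add by (auto intro!: gaussian_span.add)
qed

lemma gaussian_schwartz:
  fixes c :: "real^'n"
  assumes "a > 0" shows "(\<lambda>x. complex_of_real (gaussian a c x)) \<in> schwartz"
proof (rule schwartz_coinduct[OF gaussian_span.gaussian])
  fix f :: "real^'n \<Rightarrow> complex" assume f: "f \<in> gaussian_span a c"
  show "f differentiable (at x)" for x using gaussian_span_partial_deriv[OF f] by blast
  show "partial_deriv j f \<in> gaussian_span a c" for j
    using gaussian_span_partial_deriv[OF f] by blast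
  show "rapidly_decreasing f"
    using f
  proof induction
    case gaussian
    show ?case by (rule rapidly_decreasing_mono[OF gaussian_rapidly_decreasing[OF assms, of c]]) simp
  next
    case (component f i)
    show ?case by (rule rapidly_decreasing_mult(2)[OF component.IH poly_bounded_component])
  next
    case (cmult f k)
    show ?case by (rule rapidly_decreasing_mult(2)[OF cmult.IH poly_bounded_const])
  qed (rule rapidly_decreasing_add)
qed

lemma borel_measurable_cnj [measurable (raw)]:
  "f \<in> borel_measurable M \<Longrightarrow> (\<lambda>x. cnj (f x)) \<in> borel_measurable M"
  by (simp add: borel_measurable_complex_iff)

section \<open>Schroedinger operators on Schwartz functions\<close>

lemma square_integrable_rapid:
  fixes f :: "'a::euclidean_space \<Rightarrow> 'b::euclidean_space"
  assumes "rapidly_decreasing f" "f \<in> borel_measurable borel"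
  shows "square_integrable f"
  unfolding square_integrable_def
proof
  have "rapidly_decreasing (\<lambda>x. (norm (f x))\<^sup>2)"
    by (rule rapidly_decreasing_dominated[OF assms(1) rapidly_decreasing_imp_poly_bounded[OF assms(1)]])
       (simp add: power2_eq_square)
  then show "integrable lborel (\<lambda>x. (norm (f x))\<^sup>2)"
    by (rule rapidly_decreasing_integrable) (use assms in auto)
qed (use assms in auto)

lemma schwartz_square_integrable: "u \<in> schwartz \<Longrightarrow> square_integrable u"
  by (intro square_integrable_rapid schwartz_rapidly_decreasing schwartz_borel)

definition laplacian :: "(real^'n \<Rightarrow> complex) \<Rightarrow> real^'n \<Rightarrow> complex" where
  "laplacian u x = (\<Sum>j\<in>UNIV. partial_deriv j (partial_deriv j u) x)"

definition schroedinger :: "real \<Rightarrow> (real^'n \<Rightarrow> complex) \<Rightarrow> (real^'n \<Rightarrow> complex) \<Rightarrow> real^'n \<Rightarrow> complex" where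
  "schroedinger \<tau> W u x = - of_real \<tau> * laplacian u x + W x * u x"

lemma laplacian_schwartz: "u \<in> schwartz \<Longrightarrow> laplacian u \<in> schwartz"
  unfolding laplacian_def[abs_def] by (intro schwartz_sum schwartz_partial_deriv) auto

lemma schroedinger_schwartz:
  assumes "u \<in> schwartz" "moderate W" shows "schroedinger \<tau> W u \<in> schwartz"
  unfolding schroedinger_def[abs_def]
  by (intro schwartz_add schwartz_cmult schwartz_mult laplacian_schwartz assms)

text \<open>Because the weight \<open>f\<close> is real it passes through the conjugation. The term
  with the derivative of \<open>f\<close> is the source of all commutators below.\<close>

lemma integral_by_parts_weighted:
  fixes u v :: "real^'n \<Rightarrow> complex" and f :: "real^'n \<Rightarrow> real"
  assumes "rapid_C1 v" "rapid_C1 u" "poly_C1 f"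
  shows "(\<integral>x. of_real (f x) * (partial_deriv j v x * cnj (u x)) \<partial>lborel)
     = - (\<integral>x. of_real (partial_deriv j f x) * (v x * cnj (u x)) \<partial>lborel)
       - (\<integral>x. of_real (f x) * (v x * cnj (partial_deriv j u x)) \<partial>lborel)"
    and "integrable lborel (\<lambda>x. of_real (f x) * (partial_deriv j v x * cnj (u x)))"
    and "integrable lborel (\<lambda>x. of_real (partial_deriv j f x) * (v x * cnj (u x)))"
    and "integrable lborel (\<lambda>x. of_real (f x) * (v x * cnj (partial_deriv j u x)))"
proof -
  let ?g = "\<lambda>x. complex_of_real (f x) * cnj (u x)"
  note cf = poly_C1_of_real[OF assms(3)] and cu = rapid_C1_cnj[OF assms(2)]
  note pg = poly_C1_mult[OF cf rapid_C1_imp_poly_C1[OF cu]]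
  have dg: "partial_deriv j ?g x
      = of_real (f x) * cnj (partial_deriv j u x) + of_real (partial_deriv j f x) * cnj (u x)" for x
    by (subst partial_deriv_mult)
       (simp_all add: poly_C1D(1)[OF cf] rapid_C1D(1)[OF cu] partial_deriv_cnj(1)[OF rapid_C1D(1)[OF assms(2)]]
          partial_deriv_of_real(1)[OF poly_C1D(1)[OF assms(3)]])
  have [measurable]: "u \<in> borel_measurable borel" "v \<in> borel_measurable borel"
    "f \<in> borel_measurable borel" "partial_deriv j f \<in> borel_measurable borel"
    "partial_deriv j u \<in> borel_measurable borel" "partial_deriv j v \<in> borel_measurable borel"
    by (auto intro!: borel_measurable_differentiable borel_measurable_partial_deriv
        rapid_C1D(1)[OF assms(1)] rapid_C1D(1)[OF assms(2)] poly_C1D(1)[OF assms(3)])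
  show i0: "integrable lborel (\<lambda>x. of_real (f x) * (partial_deriv j v x * cnj (u x)))"
    using integral_by_parts(2)[OF assms(1) pg, of j] by (simp add: mult_ac)
  have "rapidly_decreasing (\<lambda>x. of_real (partial_deriv j f x) * (v x * cnj (u x)))"
    by (rule rapidly_decreasing_dominated[OF rapid_C1D(2)[OF assms(1)]
        poly_bounded_dominated[OF poly_C1D(3)[OF assms(3), of j] poly_C1D(2)[OF rapid_C1_imp_poly_C1[OF assms(2)]],
          of "\<lambda>x. partial_deriv j f x * norm (u x)"]]) (simp_all add: norm_mult abs_mult mult_ac)
  then show i1: "integrable lborel (\<lambda>x. of_real (partial_deriv j f x) * (v x * cnj (u x)))"
    by (rule rapidly_decreasing_integrable) measurable
  have "rapidly_decreasing (\<lambda>x. of_real (f x) * (v x * cnj (partial_deriv j u x)))"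
    by (rule rapidly_decreasing_dominated[OF rapid_C1D(2)[OF assms(1)]
        poly_bounded_dominated[OF poly_C1D(2)[OF assms(3)] poly_C1D(3)[OF rapid_C1_imp_poly_C1[OF assms(2)], of j],
          of "\<lambda>x. f x * norm (partial_deriv j u x)"]]) (simp_all add: norm_mult abs_mult mult_ac)
  then show i2: "integrable lborel (\<lambda>x. of_real (f x) * (v x * cnj (partial_deriv j u x)))"
    by (rule rapidly_decreasing_integrable) measurable
  have "(\<integral>x. partial_deriv j v x * ?g x \<partial>lborel) = - (\<integral>x. v x * partial_deriv j ?g x \<partial>lborel)"
    by (rule integral_by_parts(1)[OF assms(1) pg])
  also have "(\<integral>x. v x * partial_deriv j ?g x \<partial>lborel)
     = (\<integral>x. of_real (partial_deriv j f x) * (v x * cnj (u x)) + of_real (f x) * (v x * cnj (partial_deriv j u x)) \<partial>lborel)"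
    unfolding dg by (intro Bochner_Integration.integral_cong) (simp_all add: algebra_simps)
  also have "\<dots> = (\<integral>x. of_real (partial_deriv j f x) * (v x * cnj (u x)) \<partial>lborel)
       + (\<integral>x. of_real (f x) * (v x * cnj (partial_deriv j u x)) \<partial>lborel)"
    by (rule Bochner_Integration.integral_add[OF i1 i2])
  finally show "(\<integral>x. of_real (f x) * (partial_deriv j v x * cnj (u x)) \<partial>lborel)
     = - (\<integral>x. of_real (partial_deriv j f x) * (v x * cnj (u x)) \<partial>lborel)
       - (\<integral>x. of_real (f x) * (v x * cnj (partial_deriv j u x)) \<partial>lborel)"
    by (simp add: mult_ac)
qed

lemma poly_C1_const: "poly_C1 (\<lambda>x::real^'n. c)"
proof -
  have "partial_deriv j (\<lambda>x::real^'n. c) = (\<lambda>x. 0)" for j by (rule ext) simp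
  then show ?thesis by (simp add: poly_C1_def)
qed

lemma mult_cnj_norm: "z * cnj z = of_real ((norm z)\<^sup>2)"
  by (metis complex_norm_square of_real_power)

text \<open>The second sum is real. Hence only the terms with a derivative on \<open>f\<close>
  survive in the imaginary part, which is what \<open>wB_bound\<close> needs, while for constant
  \<open>f\<close> they vanish and the real part is the energy identity.\<close>

lemma integral_laplacian_weighted:
  fixes u :: "real^'n \<Rightarrow> complex" and f :: "real^'n \<Rightarrow> real"
  assumes u: "u \<in> schwartz" and f: "poly_C1 f"
  shows "(\<integral>x. of_real (f x) * (laplacian u x * cnj (u x)) \<partial>lborel)
     = - (\<Sum>j\<in>UNIV. \<integral>x. of_real (partial_deriv j f x) * (partial_deriv j u x * cnj (u x)) \<partial>lborel)
       - (\<Sum>j\<in>UNIV. of_real (\<integral>x. f x * (norm (partial_deriv j u x))\<^sup>2 \<partial>lborel))"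
    and "integrable lborel (\<lambda>x. of_real (f x) * (laplacian u x * cnj (u x)))"
proof -
  note d = integral_by_parts_weighted[OF schwartz_rapid_C1[OF schwartz_partial_deriv[OF u]]
      schwartz_rapid_C1[OF u] f]
  have eq: "of_real (f x) * (laplacian u x * cnj (u x))
     = (\<Sum>j\<in>UNIV. of_real (f x) * (partial_deriv j (partial_deriv j u) x * cnj (u x)))" for x
    by (simp add: laplacian_def sum_distrib_left sum_distrib_right)
  show "integrable lborel (\<lambda>x. of_real (f x) * (laplacian u x * cnj (u x)))"
    unfolding eq by (intro Bochner_Integration.integrable_sum d(2))
  have "(\<integral>x. of_real (f x) * (laplacian u x * cnj (u x)) \<partial>lborel)
     = (\<Sum>j\<in>UNIV. \<integral>x. of_real (f x) * (partial_deriv j (partial_deriv j u) x * cnj (u x)) \<partial>lborel)"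
    unfolding eq by (intro Bochner_Integration.integral_sum d(2))
  also have "\<dots> = (\<Sum>j\<in>UNIV. - (\<integral>x. of_real (partial_deriv j f x) * (partial_deriv j u x * cnj (u x)) \<partial>lborel)
       - of_real (\<integral>x. f x * (norm (partial_deriv j u x))\<^sup>2 \<partial>lborel))"
  proof (rule sum.cong)
    fix j
    have "(\<integral>x. of_real (f x) * (partial_deriv j u x * cnj (partial_deriv j u x)) \<partial>lborel)
       = of_real (\<integral>x. f x * (norm (partial_deriv j u x))\<^sup>2 \<partial>lborel)"
      unfolding mult_cnj_norm of_real_mult[symmetric] by (rule integral_complex_of_real)
    then show "(\<integral>x. of_real (f x) * (partial_deriv j (partial_deriv j u) x * cnj (u x)) \<partial>lborel)
      = - (\<integral>x. of_real (partial_deriv j f x) * (partial_deriv j u x * cnj (u x)) \<partial>lborel)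
       - of_real (\<integral>x. f x * (norm (partial_deriv j u x))\<^sup>2 \<partial>lborel)"
      unfolding d(1) by simp
  qed simp
  finally show "(\<integral>x. of_real (f x) * (laplacian u x * cnj (u x)) \<partial>lborel)
     = - (\<Sum>j\<in>UNIV. \<integral>x. of_real (partial_deriv j f x) * (partial_deriv j u x * cnj (u x)) \<partial>lborel)
       - (\<Sum>j\<in>UNIV. of_real (\<integral>x. f x * (norm (partial_deriv j u x))\<^sup>2 \<partial>lborel))"
    by (simp add: sum_subtractf sum_negf)
qed

lemma energy_identity:
  fixes u W :: "real^'n \<Rightarrow> complex"
  assumes u: "u \<in> schwartz" and W: "moderate W"
  shows "Re (\<integral>x. schroedinger \<tau> W u x * cnj (u x) \<partial>lborel)
     = \<tau> * (\<Sum>j\<in>UNIV. (l2norm (partial_deriv j u))\<^sup>2) + (\<integral>x. Re (W x) * (norm (u x))\<^sup>2 \<partial>lborel)"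
    and "integrable lborel (\<lambda>x. Re (W x) * (norm (u x))\<^sup>2)"
    and "integrable lborel (\<lambda>x. schroedinger \<tau> W u x * cnj (u x))"
proof -
  note [measurable] = schwartz_borel[OF u] moderate_borel[OF W]
  note lap = integral_laplacian_weighted[OF u poly_C1_const[of 1], simplified]
  have "rapidly_decreasing (\<lambda>x. W x * (u x * cnj (u x)))"
    by (rule rapidly_decreasing_dominated[OF schwartz_rapidly_decreasing[OF schwartz_mult[OF W u]]
        moderate_poly_bounded[OF schwartz_imp_moderate[OF u]]]) (simp add: norm_mult)
  then have iW: "integrable lborel (\<lambda>x. W x * (u x * cnj (u x)))"
    by (rule rapidly_decreasing_integrable) measurable
  have eq: "schroedinger \<tau> W u x * cnj (u x)
      = - of_real \<tau> * (laplacian u x * cnj (u x)) + W x * (u x * cnj (u x))" for x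
    by (simp add: schroedinger_def algebra_simps)
  show "integrable lborel (\<lambda>x. schroedinger \<tau> W u x * cnj (u x))"
    unfolding eq using iW lap(2) by simp
  have ReW: "Re (W x * (u x * cnj (u x))) = Re (W x) * (norm (u x))\<^sup>2" for x
    unfolding mult_cnj_norm by simp
  show "integrable lborel (\<lambda>x. Re (W x) * (norm (u x))\<^sup>2)"
    using integrable_Re[OF iW] unfolding ReW .
  have "Re (\<integral>x. W x * (u x * cnj (u x)) \<partial>lborel) = (\<integral>x. Re (W x) * (norm (u x))\<^sup>2 \<partial>lborel)"
    unfolding ReW[symmetric] by (rule integral_Re[OF iW, symmetric])
  then show "Re (\<integral>x. schroedinger \<tau> W u x * cnj (u x) \<partial>lborel)
     = \<tau> * (\<Sum>j\<in>UNIV. (l2norm (partial_deriv j u))\<^sup>2) + (\<integral>x. Re (W x) * (norm (u x))\<^sup>2 \<partial>lborel)"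
    unfolding eq using iW lap by (simp add: l2norm_power2)
qed

section \<open>The subelliptic estimate\<close>

lemma l2norm_scaleR: "l2norm (\<lambda>x. c *\<^sub>R f x) = \<bar>c\<bar> * l2norm f"
  by (simp add: l2norm_def power_mult_distrib real_sqrt_mult)

text \<open>A sum of norms, so that bounds obtained direction by direction simply add up. It is
  equivalent to the norm of the gradient, and the comparison costs a factor n in
  \<open>grad_bound\<close>.\<close>

definition grad_norm :: "(real^'n \<Rightarrow> complex) \<Rightarrow> real" where
  "grad_norm u = (\<Sum>j\<in>UNIV. l2norm (partial_deriv j u))"

text \<open>The energy identity, with the real part of the pairing estimated by Cauchy-Schwarz. The
  number \<open>\<mu>\<close> may be negative; in that case the inequality expresses coercivity,
  which settles the case of very negative \<open>Re z\<close>.\<close>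

lemma grad_bound:
  fixes u W :: "real^'n \<Rightarrow> complex"
  assumes u: "u \<in> schwartz" and W: "moderate W" and \<tau>: "\<tau> \<ge> 0" and \<mu>: "\<And>x. - \<mu> \<le> Re (W x)"
  shows "\<tau> * (grad_norm u)\<^sup>2
     \<le> real CARD('n) * (l2norm (schroedinger \<tau> W u) * l2norm u + \<mu> * (l2norm u)\<^sup>2)"
proof -
  let ?H = "schroedinger \<tau> W u"
  have H: "?H \<in> schwartz" by (rule schroedinger_schwartz[OF u W])
  note su = schwartz_square_integrable[OF u]
  note [measurable] = schwartz_borel[OF u] schwartz_borel[OF H]
  have "Re (\<integral>x. ?H x * cnj (u x) \<partial>lborel) \<le> norm (\<integral>x. ?H x * cnj (u x) \<partial>lborel)"
    by (rule complex_Re_le_cmod)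
  also have "\<dots> \<le> l2norm ?H * l2norm u"
    by (rule Cauchy_Schwarz_integral(2)[OF schwartz_square_integrable[OF H] su]) (auto simp: norm_mult)
  finally have "\<tau> * (\<Sum>j\<in>UNIV. (l2norm (partial_deriv j u))\<^sup>2) + (\<integral>x. Re (W x) * (norm (u x))\<^sup>2 \<partial>lborel)
       \<le> l2norm ?H * l2norm u"
    unfolding energy_identity(1)[OF u W] .
  moreover have "- \<mu> * (l2norm u)\<^sup>2 \<le> (\<integral>x. Re (W x) * (norm (u x))\<^sup>2 \<partial>lborel)"
  proof -
    have "- \<mu> * (l2norm u)\<^sup>2 = (\<integral>x. - \<mu> * (norm (u x))\<^sup>2 \<partial>lborel)"
      unfolding l2norm_power2 by simp
    also have "\<dots> \<le> (\<integral>x. Re (W x) * (norm (u x))\<^sup>2 \<partial>lborel)"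
      by (rule integral_mono[OF _ energy_identity(2)[OF u W]])
         (use square_integrableD(2)[OF su] mult_right_mono[OF \<mu>] in \<open>auto simp del: mult_minus_left\<close>)
    finally show ?thesis .
  qed
  ultimately have 1: "\<tau> * (\<Sum>j\<in>UNIV. (l2norm (partial_deriv j u))\<^sup>2) \<le> l2norm ?H * l2norm u + \<mu> * (l2norm u)\<^sup>2"
    by simp
  have "(grad_norm u)\<^sup>2 \<le> (\<Sum>j\<in>UNIV. (l2norm (partial_deriv j u))\<^sup>2) * real CARD('n)"
    unfolding grad_norm_def using sum_squared_le_sum_of_squares[of "\<lambda>j. l2norm (partial_deriv j u)" "UNIV::'n set"]
    by simp
  then have "\<tau> * (grad_norm u)\<^sup>2 \<le> real CARD('n) * (\<tau> * (\<Sum>j\<in>UNIV. (l2norm (partial_deriv j u))\<^sup>2))"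
    using \<tau> by (simp add: mult_left_mono mult_ac)
  also have "\<dots> \<le> real CARD('n) * (l2norm ?H * l2norm u + \<mu> * (l2norm u)\<^sup>2)"
    using 1 by (intro mult_left_mono) auto
  finally show ?thesis .
qed

text \<open>To be used with \<open>W = V - z\<close>, \<open>\<tau> = (h / 2 \<pi>)^2\<close> and
  \<open>r = |z| - T\<close>. The constants of the estimates see \<open>W\<close> only through the
  bound \<open>C\<close> for the second derivatives of its imaginary part.\<close>

locale subelliptic =
  fixes W :: "real^'n \<Rightarrow> complex" and \<tau> r C :: real
  assumes W: "moderate W" and C: "C \<ge> 0" and r: "r > 0" and \<tau>: "\<tau> > 0"
    and second_deriv_bound:
      "\<And>i j x. \<bar>partial_deriv i (partial_deriv j (\<lambda>x. Im (W x))) x\<bar> \<le> C"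
begin

definition B :: "real^'n \<Rightarrow> real" where "B x = Im (W x)"

definition G :: "'n \<Rightarrow> real^'n \<Rightarrow> real" where "G j = partial_deriv j B"

definition \<omega> :: "real^'n \<Rightarrow> real" where "\<omega> x = r + (\<Sum>j\<in>UNIV. (G j x)\<^sup>2)"

text \<open>The weight \<open>\<rho>\<close> is the power \<open>-1/3\<close> of \<open>(r + |\<nabla> Im W|\<^sup>2)\<^sup>1\<^sup>/\<^sup>2\<close>; with this exponent the
  estimates below close up without any localization.\<close>

definition \<rho> :: "real^'n \<Rightarrow> real" where "\<rho> x = \<omega> x powr (-1/6)"

text \<open>The value of \<open>\<rho>\<close> at points where the gradient vanishes, hence an upper
  bound for it. The final estimate is expressed through \<open>1 / \<kappa>^2\<close>, which is the
  cube root of \<open>r\<close>.\<close>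

definition \<kappa> :: real where "\<kappa> = r powr (-1/6)"

text \<open>The constant in \<open>\<rho>_deriv_le\<close>; the fraction 1/3 is 2/6, from
  differentiating a sum of squares raised to the power -1/6.\<close>

definition c1 :: real where "c1 = real CARD('n) * C / 3"

lemma B_poly_C1: "poly_C1 B" and G_poly_C1: "poly_C1 (G j)"
  and G_deriv_le: "\<bar>partial_deriv i (G j) x\<bar> \<le> C"
proof -
  have Im_poly: "poly_C1 (\<lambda>x. Im (f x)) \<and> partial_deriv j (\<lambda>x. Im (f x)) = (\<lambda>x. Im (partial_deriv j f x))"
    if "moderate f" for f :: "real^'n \<Rightarrow> complex" and j
  proof -
    have eq: "partial_deriv j (\<lambda>x. Im (f x)) = (\<lambda>x. Im (partial_deriv j f x))" for j
      by (rule ext) (rule partial_deriv_Im(1)[OF moderate_differentiable[OF that]])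
    have "poly_bounded (\<lambda>x. Im (g x))" if "moderate g" for g :: "real^'n \<Rightarrow> complex"
      by (rule poly_bounded_mono[OF moderate_poly_bounded[OF that]]) (simp add: abs_Im_le_cmod)
    then show ?thesis
      using that by (auto simp: poly_C1_def eq moderate_partial_deriv
          intro!: partial_deriv_Im(2) moderate_differentiable)
  qed
  have B_eq: "B = (\<lambda>x. Im (W x))" by (rule ext) (simp add: B_def)
  then show "poly_C1 B" using Im_poly[OF W] by simp
  have G_eq: "G j = (\<lambda>x. Im (partial_deriv j W x))"
    unfolding G_def B_eq using Im_poly[OF W] by blast
  then show "poly_C1 (G j)" using Im_poly[OF moderate_partial_deriv[OF W]] by simp
  show "\<bar>partial_deriv i (G j) x\<bar> \<le> C"
    using second_deriv_bound[of i j x] by (simp add: G_def B_eq)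
qed

lemmas B_diff = poly_C1D(1)[OF B_poly_C1]
lemmas G_diff = poly_C1D(1)[OF G_poly_C1]

lemma \<omega>_ge: "r \<le> \<omega> x" and \<omega>_pos: "0 < \<omega> x"
proof -
  show "r \<le> \<omega> x" by (simp add: \<omega>_def sum_nonneg)
  then show "0 < \<omega> x" using r by linarith
qed

lemma \<rho>_pos [simp]: "0 < \<rho> x"
  using \<omega>_pos[of x] by (simp add: \<rho>_def)

lemma \<kappa>_pos [simp]: "0 < \<kappa>"
  using r by (simp add: \<kappa>_def)

lemma \<rho>_le: "\<rho> x \<le> \<kappa>"
  unfolding \<rho>_def \<kappa>_def using \<omega>_ge[of x] r by (intro powr_mono2') auto

lemma \<rho>_power6: "\<rho> x ^ 6 * \<omega> x = 1"
  unfolding \<rho>_def using \<omega>_pos[of x] by (subst powr_power) (auto simp: powr_minus)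

lemma \<kappa>_power6: "\<kappa> ^ 6 * r = 1"
  unfolding \<kappa>_def using r by (subst powr_power) (auto simp: powr_minus)

text \<open>Since \<open>\<omega>\<close> equals \<open>\<rho>\<close> to the power -6 and dominates
  \<open>(G j)^2\<close>, three factors of \<open>\<rho>\<close> absorb exactly one first derivative
  of the imaginary part.\<close>

lemma G_\<rho>: "\<bar>G j x\<bar> * \<rho> x ^ 3 \<le> 1"
proof (rule power2_le_imp_le)
  have "(G j x)\<^sup>2 \<le> (\<Sum>j\<in>UNIV. (G j x)\<^sup>2)"
    using member_le_sum[of j UNIV "\<lambda>j. (G j x)\<^sup>2"] by simp
  then have "(G j x)\<^sup>2 \<le> \<omega> x" using r by (simp add: \<omega>_def)
  then have "(G j x)\<^sup>2 * \<rho> x ^ 6 \<le> \<omega> x * \<rho> x ^ 6" by (intro mult_right_mono) auto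
  then show "(\<bar>G j x\<bar> * \<rho> x ^ 3)\<^sup>2 \<le> 1\<^sup>2"
    using \<rho>_power6[of x] by (simp add: power_mult_distrib power_mult[symmetric] mult.commute)
qed simp

text \<open>Differentiating the power of \<open>\<omega>\<close> yields \<open>\<rho>^7\<close>
  times products of \<open>G\<close> with second derivatives. The latter are bounded by
  \<open>C\<close> and \<open>G\<close> by the power -3 of \<open>\<rho>\<close>, so four factors of
  \<open>\<rho>\<close> remain.\<close>

lemma \<rho>_diff: "\<rho> differentiable (at x)"
  and \<rho>_deriv_le: "\<bar>partial_deriv i \<rho> x\<bar> \<le> c1 * \<rho> x ^ 4"
proof -
  have dG: "((\<lambda>x. \<omega> x) has_derivative (\<lambda>h. 0 + (\<Sum>j\<in>UNIV. 2 * G j x * frechet_derivative (G j) (at x) h))) (at x)"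
    unfolding \<omega>_def[abs_def]
    by (intro has_derivative_add has_derivative_const has_derivative_sum)
       (auto intro!: derivative_eq_intros has_derivative_frechet[OF G_diff] simp: power2_eq_square)
  have \<omega>_diff: "\<omega> differentiable (at x)" using dG differentiable_def by blast
  have \<omega>': "partial_deriv i \<omega> x = (\<Sum>j\<in>UNIV. 2 * G j x * partial_deriv i (G j) x)"
    using partial_deriv_eqI[OF dG, of i] by (simp add: partial_deriv_def)
  have p: "((\<lambda>t. t powr (-1/6)) has_field_derivative ((-1/6) * \<omega> x powr (-1/6 - 1))) (at (\<omega> x))"
    using \<omega>_pos[of x] by (intro has_real_derivative_powr)
  have \<rho>_eq: "\<rho> = (\<lambda>x. \<omega> x powr (-1/6))" by (rule ext) (simp add: \<rho>_def)
  show "\<rho> differentiable (at x)"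
    unfolding \<rho>_eq by (rule partial_deriv_comp_real(2)[OF \<omega>_diff p])
  have "\<omega> x powr (-1/6 - 1) = \<rho> x ^ 7"
    using \<omega>_pos[of x] by (simp add: \<rho>_def powr_power)
  then have "partial_deriv i \<rho> x = (-1/6) * \<rho> x ^ 7 * (\<Sum>j\<in>UNIV. 2 * G j x * partial_deriv i (G j) x)"
    unfolding \<rho>_eq using partial_deriv_comp_real(1)[OF \<omega>_diff p, of i] \<omega>' by (simp add: \<rho>_eq)
  then have "\<bar>partial_deriv i \<rho> x\<bar> = (1/6) * \<rho> x ^ 7 * \<bar>\<Sum>j\<in>UNIV. 2 * G j x * partial_deriv i (G j) x\<bar>"
    by (simp add: abs_mult less_imp_le)
  also have "\<dots> \<le> (1/6) * \<rho> x ^ 7 * (\<Sum>j\<in>(UNIV::'n set). 2 * C * (1 / \<rho> x ^ 3))"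
  proof (intro mult_left_mono order_trans[OF sum_abs] sum_mono)
    fix j
    have "\<bar>G j x\<bar> \<le> 1 / \<rho> x ^ 3" using G_\<rho>[of j x] by (simp add: field_simps)
    then have "\<bar>G j x\<bar> * \<bar>partial_deriv i (G j) x\<bar> \<le> (1 / \<rho> x ^ 3) * C"
      using G_deriv_le[of i j x] by (intro mult_mono) (auto simp: less_imp_le)
    then have "2 * (\<bar>G j x\<bar> * \<bar>partial_deriv i (G j) x\<bar>) \<le> 2 * ((1 / \<rho> x ^ 3) * C)"
      by (rule mult_left_mono) simp
    then show "\<bar>2 * G j x * partial_deriv i (G j) x\<bar> \<le> 2 * C * (1 / \<rho> x ^ 3)"
      by (simp add: abs_mult mult_ac)
  qed (simp add: less_imp_le)
  also have "\<dots> = c1 * (\<rho> x ^ 7 / \<rho> x ^ 3)" by (simp add: c1_def)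
  also have "\<rho> x ^ 7 / \<rho> x ^ 3 = \<rho> x ^ 4"
    using \<rho>_pos[of x] power_add[of "\<rho> x" 4 3] by (simp add: divide_eq_eq)
  finally show "\<bar>partial_deriv i \<rho> x\<bar> \<le> c1 * \<rho> x ^ 4" .
qed

lemma c1_nonneg: "c1 \<ge> 0" using C by (simp add: c1_def)

lemma \<rho>_poly_C1: "poly_C1 \<rho>"
  unfolding poly_C1_def
proof (intro conjI allI)
  show "poly_bounded \<rho>"
    using \<rho>_le by (intro poly_bounded_bounded[of _ \<kappa>]) (simp add: less_imp_le)
  show "poly_bounded (partial_deriv j \<rho>)" for j
  proof (rule poly_bounded_bounded)
    fix x
    have "c1 * \<rho> x ^ 4 \<le> c1 * \<kappa> ^ 4"
      using c1_nonneg \<rho>_le[of x] by (intro mult_left_mono power_mono) (auto simp: less_imp_le)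
    then show "norm (partial_deriv j \<rho> x) \<le> c1 * \<kappa> ^ 4"
      using \<rho>_deriv_le[of j x] by simp
  qed
qed (rule \<rho>_diff)

text \<open>Guarantees that \<open>wS\<close> is a genuine norm of a Schwartz function even where
  the gradient of the imaginary part grows and \<open>1 / \<rho>\<close> with it.\<close>

lemma inverse_\<rho>_poly_bounded: "poly_bounded (\<lambda>x. inverse (\<rho> x))"
proof -
  have "poly_bounded \<omega>"
    unfolding \<omega>_def[abs_def] power2_eq_square
    by (intro poly_bounded_add poly_bounded_const poly_bounded_sum poly_bounded_mult poly_C1D(2)[OF G_poly_C1]) simp
  from poly_bounded_mult[OF poly_bounded_const[of "\<kappa> ^ 5"] this]
  show ?thesis
  proof (rule poly_bounded_mono)
    fix x
    have "inverse (\<rho> x) = \<rho> x ^ 5 * \<omega> x"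
      by (rule inverse_unique) (use \<rho>_power6[of x] in \<open>simp add: eval_nat_numeral mult_ac\<close>)
    also have "\<dots> \<le> \<kappa> ^ 5 * \<omega> x"
      using \<rho>_le[of x] \<omega>_pos[of x] by (intro mult_right_mono power_mono) (auto simp: less_imp_le)
    finally show "norm (inverse (\<rho> x)) \<le> norm (\<kappa> ^ 5 * \<omega> x)"
      by (simp add: abs_mult less_imp_le \<omega>_pos)
  qed
qed

lemmas weight_borel [measurable] =
  borel_measurable_differentiable[OF \<rho>_diff] borel_measurable_differentiable[OF B_diff]
  borel_measurable_differentiable[OF G_diff] borel_measurable_partial_deriv[OF \<rho>_diff]
  borel_measurable_partial_deriv[OF G_diff]

lemma square_integrable_weighted:
  assumes "u \<in> schwartz" "poly_bounded f" "f \<in> borel_measurable borel"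
  shows "square_integrable (\<lambda>x. f x * norm (u x :: complex) :: real)"
proof (rule square_integrable_rapid)
  show "rapidly_decreasing (\<lambda>x. f x * norm (u x))"
    by (rule rapidly_decreasing_dominated[OF schwartz_rapidly_decreasing[OF assms(1)] assms(2)])
       (simp add: abs_mult)
  show "(\<lambda>x. f x * norm (u x)) \<in> borel_measurable borel"
    using assms(3) schwartz_borel[OF assms(1)] by measurable
qed

section \<open>Weighted quantities and the two commutator estimates\<close>

definition wB :: "(real^'n \<Rightarrow> complex) \<Rightarrow> real" where
  "wB u = l2norm (\<lambda>x. \<rho> x * \<bar>B x\<bar> * norm (u x))"

definition wS :: "(real^'n \<Rightarrow> complex) \<Rightarrow> real" where
  "wS u = l2norm (\<lambda>x. inverse (\<rho> x) * norm (u x))"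

text \<open>Kept as a sum over the directions because the integration by parts that controls it uses
  the vector field \<open>B \<rho>^4 G\<close> one component at a time.\<close>

definition wJ :: "(real^'n \<Rightarrow> complex) \<Rightarrow> real" where
  "wJ u = (\<Sum>j\<in>UNIV. \<integral>x. (G j x)\<^sup>2 * \<rho> x ^ 4 * (norm (u x))\<^sup>2 \<partial>lborel)"

lemma wB_square_integrable: "u \<in> schwartz \<Longrightarrow> square_integrable (\<lambda>x. \<rho> x * \<bar>B x\<bar> * norm (u x))"
  using poly_C1D(2)[OF poly_C1_mult[OF \<rho>_poly_C1 B_poly_C1]]
  by (intro square_integrable_weighted) (auto elim: poly_bounded_mono simp: abs_mult)

lemma wS_square_integrable: "u \<in> schwartz \<Longrightarrow> square_integrable (\<lambda>x. inverse (\<rho> x) * norm (u x))"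
  by (intro square_integrable_weighted inverse_\<rho>_poly_bounded) measurable

text \<open>Expanding \<open>|\<rho> H u|\<^sup>2\<close> for \<open>H = A + i B\<close> with \<open>A\<close> symmetric; the cross term is a commutator.\<close>

lemma wB_bound:
  assumes u: "u \<in> schwartz"
  shows "(wB u)\<^sup>2 \<le> \<kappa>\<^sup>2 * (l2norm (schroedinger \<tau> W u))\<^sup>2
           + 2 * \<tau> * grad_norm u * (wS u + 2 * c1 * \<kappa> ^ 4 * wB u)"
proof -
  let ?H = "schroedinger \<tau> W u"
  define f where "f x = \<rho> x * \<rho> x * B x" for x
  have H: "?H \<in> schwartz" by (rule schroedinger_schwartz[OF u W])
  note [measurable] = schwartz_borel[OF u] schwartz_borel[OF H] schwartz_borel[OF schwartz_partial_deriv[OF u]]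
  have f_poly: "poly_C1 f"
    unfolding f_def[abs_def] by (intro poly_C1_mult \<rho>_poly_C1 B_poly_C1)
  have f': "partial_deriv j f x = \<rho> x * \<rho> x * G j x + (2 * \<rho> x * partial_deriv j \<rho> x) * B x" for j x
    unfolding f_def[abs_def]
    by (subst partial_deriv_mult, (intro differentiable_mult \<rho>_diff B_diff)+, subst partial_deriv_mult)
       (auto intro!: \<rho>_diff simp: G_def algebra_simps)
  note lap = integral_laplacian_weighted[OF u f_poly]
  have pw: "(\<rho> x * norm (?H x))\<^sup>2 \<ge> (\<rho> x * \<bar>B x\<bar> * norm (u x))\<^sup>2
       - 2 * \<tau> * Im (of_real (f x) * (laplacian u x * cnj (u x)))" for x
  proof -
    \<comment> \<open>\<open>a\<close> is the symmetric part of the operator applied to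
      \<open>u\<close> at the point \<open>x\<close>. In the cross term
      \<open>Im (a * cnj (u x))\<close> the real part of \<open>W\<close> contributes a real number
      and drops out, leaving only the Laplacian; the square of \<open>norm a\<close> is
      discarded.\<close>
    define a where "a = ?H x - \<i> * of_real (B x) * u x"
    have "W x - \<i> * of_real (B x) = of_real (Re (W x))"
      by (simp add: B_def complex_eq_iff)
    then have a_eq: "a = - of_real \<tau> * laplacian u x + of_real (Re (W x)) * u x"
      unfolding a_def schroedinger_def by (metis (no_types, lifting) add_diff_eq left_diff_distrib)
    have "a * cnj (u x) = - of_real \<tau> * (laplacian u x * cnj (u x)) + of_real (Re (W x)) * (u x * cnj (u x))"
      unfolding a_eq by (simp only: distrib_right mult.assoc)
    then have "Im (a * cnj (u x)) = - \<tau> * Im (laplacian u x * cnj (u x))"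
      unfolding mult_cnj_norm by simp
    moreover have "(norm (?H x))\<^sup>2 = (norm a)\<^sup>2 + (B x)\<^sup>2 * (norm (u x))\<^sup>2 + 2 * B x * Im (a * cnj (u x))"
    proof -
      have "?H x = a + \<i> * of_real (B x) * u x" by (simp add: a_def)
      then show ?thesis
        unfolding cmod_power2 by (simp add: power2_eq_square algebra_simps)
    qed
    ultimately have "(norm (?H x))\<^sup>2 \<ge> (B x)\<^sup>2 * (norm (u x))\<^sup>2 - 2 * \<tau> * B x * Im (laplacian u x * cnj (u x))"
      by simp
    then have "(\<rho> x)\<^sup>2 * (norm (?H x))\<^sup>2 \<ge> (\<rho> x)\<^sup>2 * ((B x)\<^sup>2 * (norm (u x))\<^sup>2 - 2 * \<tau> * B x * Im (laplacian u x * cnj (u x)))"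
      by (intro mult_left_mono) auto
    moreover have "Im (of_real (f x) * (laplacian u x * cnj (u x))) = f x * Im (laplacian u x * cnj (u x))"
      by simp
    ultimately have "(\<rho> x)\<^sup>2 * (B x)\<^sup>2 * (norm (u x))\<^sup>2
        - 2 * \<tau> * Im (of_real (f x) * (laplacian u x * cnj (u x))) \<le> (\<rho> x * norm (?H x))\<^sup>2"
      unfolding f_def by (simp add: power_mult_distrib power2_eq_square algebra_simps)
    moreover have "(\<rho> x * \<bar>B x\<bar> * norm (u x))\<^sup>2 = (\<rho> x)\<^sup>2 * (B x)\<^sup>2 * (norm (u x))\<^sup>2"
      by (simp add: power_mult_distrib)
    ultimately show ?thesis by (simp only:)
  qed
  note sB = wB_square_integrable[OF u]
  have sH: "square_integrable (\<lambda>x. \<rho> x * norm (?H x))"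
    by (intro square_integrable_weighted H poly_C1D(2)[OF \<rho>_poly_C1]) measurable
  let ?I = "\<integral>x. of_real (f x) * (laplacian u x * cnj (u x)) \<partial>lborel"
  have "(wB u)\<^sup>2 - 2 * \<tau> * Im ?I
      = (\<integral>x. (\<rho> x * \<bar>B x\<bar> * norm (u x))\<^sup>2 - 2 * \<tau> * Im (of_real (f x) * (laplacian u x * cnj (u x))) \<partial>lborel)"
    using square_integrableD(2)[OF sB] integral_Im[OF lap(2)] integrable_Im[OF lap(2)]
    unfolding wB_def l2norm_power2 by simp
  also have "\<dots> \<le> (\<integral>x. (\<rho> x * norm (?H x))\<^sup>2 \<partial>lborel)"
    using square_integrableD(2)[OF sB] square_integrableD(2)[OF sH] integrable_Im[OF lap(2)] pw
    by (intro integral_mono) auto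
  also have "\<dots> = (l2norm (\<lambda>x. \<rho> x * norm (?H x)))\<^sup>2" by (simp add: l2norm_power2)
  also have "\<dots> \<le> (\<kappa> * l2norm ?H)\<^sup>2"
  proof (intro power_mono)
    have "l2norm (\<lambda>x. \<rho> x * norm (?H x)) \<le> l2norm (\<lambda>x. \<kappa> * ?H x)"
      using \<rho>_le by (intro l2norm_mono square_integrable_cmult schwartz_square_integrable H)
        (auto simp: norm_mult abs_mult less_imp_le intro!: mult_right_mono)
    then show "l2norm (\<lambda>x. \<rho> x * norm (?H x)) \<le> \<kappa> * l2norm ?H"
      by (simp add: l2norm_cmult less_imp_le)
  qed simp
  finally have 1: "(wB u)\<^sup>2 - 2 * \<tau> * Im ?I \<le> \<kappa>\<^sup>2 * (l2norm ?H)\<^sup>2"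
    by (simp add: power_mult_distrib)
  let ?g = "\<lambda>x. inverse (\<rho> x) * norm (u x) + (2 * c1 * \<kappa> ^ 4) *\<^sub>R (\<rho> x * \<bar>B x\<bar> * norm (u x))"
  have sB': "square_integrable (\<lambda>x. (2 * c1 * \<kappa> ^ 4) *\<^sub>R (\<rho> x * \<bar>B x\<bar> * norm (u x)))"
    by (rule square_integrable_dominated[OF sB, of _ "\<bar>2 * c1 * \<kappa> ^ 4\<bar>"]) (auto simp: abs_mult)
  have sg: "square_integrable ?g"
    by (intro square_integrable_add wS_square_integrable u sB')
  have ng: "l2norm ?g \<le> wS u + 2 * c1 * \<kappa> ^ 4 * wB u"
    using l2norm_triangle[OF wS_square_integrable[OF u] sB'] c1_nonneg
    by (simp only: wS_def wB_def l2norm_scaleR) (simp add: less_imp_le)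
  \<comment> \<open>For \<open>f = \<rho>^2 B\<close>, a derivative on \<open>B\<close> leaves
    \<open>\<rho>^2 |G| \<le> 1 / \<rho>\<close>, and a derivative on \<open>\<rho>^2\<close> leaves
    at most \<open>2 c1 \<kappa>^4 \<rho> |B|\<close>. Hence \<open>wS\<close> and \<open>wB\<close>
    on the right hand side.\<close>
  have fbound: "\<bar>partial_deriv j f x\<bar> \<le> inverse (\<rho> x) + 2 * c1 * \<kappa> ^ 4 * (\<rho> x * \<bar>B x\<bar>)" for j x
  proof -
    have "\<rho> x * \<rho> x * \<bar>G j x\<bar> \<le> inverse (\<rho> x)"
      using G_\<rho>[of j x] by (simp add: field_simps power3_eq_cube)
    moreover have "2 * \<rho> x * \<bar>partial_deriv j \<rho> x\<bar> * \<bar>B x\<bar> \<le> 2 * c1 * \<kappa> ^ 4 * (\<rho> x * \<bar>B x\<bar>)"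
    proof -
      have "\<bar>partial_deriv j \<rho> x\<bar> \<le> c1 * \<kappa> ^ 4"
        using \<rho>_deriv_le[of j x] c1_nonneg \<rho>_le[of x] power_mono[of "\<rho> x" \<kappa> 4]
        by (meson less_imp_le mult_left_mono order_trans \<rho>_pos)
      then have "(2 * \<rho> x * \<bar>B x\<bar>) * \<bar>partial_deriv j \<rho> x\<bar> \<le> (2 * \<rho> x * \<bar>B x\<bar>) * (c1 * \<kappa> ^ 4)"
        by (intro mult_left_mono) (auto simp: less_imp_le)
      then show ?thesis by (simp add: mult_ac)
    qed
    moreover have "\<bar>partial_deriv j f x\<bar> \<le> \<rho> x * \<rho> x * \<bar>G j x\<bar> + 2 * \<rho> x * \<bar>partial_deriv j \<rho> x\<bar> * \<bar>B x\<bar>"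
      unfolding f' by (rule order_trans[OF abs_triangle_ineq]) (simp add: abs_mult less_imp_le)
    ultimately show ?thesis by linarith
  qed
  have 2: "norm (\<integral>x. of_real (partial_deriv j f x) * (partial_deriv j u x * cnj (u x)) \<partial>lborel)
      \<le> l2norm (partial_deriv j u) * (wS u + 2 * c1 * \<kappa> ^ 4 * wB u)" for j
  proof -
    have [measurable]: "partial_deriv j f \<in> borel_measurable borel"
      by (intro borel_measurable_partial_deriv poly_C1D(1)[OF f_poly])
    have "norm (\<integral>x. of_real (partial_deriv j f x) * (partial_deriv j u x * cnj (u x)) \<partial>lborel)
      \<le> l2norm (partial_deriv j u) * l2norm ?g"
    proof (rule Cauchy_Schwarz_integral(2)[OF _ sg])
      show "square_integrable (partial_deriv j u)"
        by (intro schwartz_square_integrable schwartz_partial_deriv u)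
      fix x
      have "\<bar>partial_deriv j f x\<bar> * norm (u x) \<le> ?g x"
        using mult_right_mono[OF fbound[of j x], of "norm (u x)"] by (simp add: algebra_simps)
      then have "norm (partial_deriv j u x) * (\<bar>partial_deriv j f x\<bar> * norm (u x)) \<le> norm (partial_deriv j u x) * norm (?g x)"
        by (intro mult_left_mono) auto
      then show "norm (of_real (partial_deriv j f x) * (partial_deriv j u x * cnj (u x))) \<le> norm (partial_deriv j u x) * norm (?g x)"
        by (simp add: norm_mult mult_ac)
    qed measurable
    also have "\<dots> \<le> l2norm (partial_deriv j u) * (wS u + 2 * c1 * \<kappa> ^ 4 * wB u)"
      by (intro mult_left_mono ng) simp
    finally show ?thesis .
  qed
  have "Im ?I = - (\<Sum>j\<in>UNIV. Im (\<integral>x. of_real (partial_deriv j f x) * (partial_deriv j u x * cnj (u x)) \<partial>lborel))"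
    unfolding lap(1) by (simp add: Im_sum)
  also have "\<dots> \<le> \<bar>\<dots>\<bar>" by (rule abs_ge_self)
  also have "\<dots> \<le> (\<Sum>j\<in>UNIV. l2norm (partial_deriv j u) * (wS u + 2 * c1 * \<kappa> ^ 4 * wB u))"
    unfolding abs_minus_cancel
    by (intro order_trans[OF sum_abs] sum_mono order_trans[OF abs_Im_le_cmod 2])
  also have "\<dots> = grad_norm u * (wS u + 2 * c1 * \<kappa> ^ 4 * wB u)"
    by (simp add: grad_norm_def sum_distrib_right)
  finally have "2 * \<tau> * Im ?I \<le> 2 * \<tau> * (grad_norm u * (wS u + 2 * c1 * \<kappa> ^ 4 * wB u))"
    using \<tau> by (intro mult_left_mono) auto
  then show ?thesis using 1 by (simp add: mult.assoc)
qed

text \<open>The derivative of \<open>f = \<rho>^4 G_j B\<close> in direction j is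
  \<open>\<rho>^4 G_j^2\<close> plus a remainder \<open>s\<close> in which it falls on
  \<open>\<rho>^4\<close> or on \<open>G_j\<close>. Against \<open>|u|^2\<close>, integration by
  parts trades it for two terms with one derivative of \<open>u\<close>, and these are controlled
  because \<open>|G_j| \<rho>^3 \<le> 1\<close> gives \<open>|f| \<le> \<rho> |B|\<close>.\<close>

lemma wJ_bound:
  assumes u: "u \<in> schwartz"
  shows "wJ u \<le> 2 * wB u * grad_norm u + real CARD('n) * (C + 4 * c1) * \<kappa> ^ 3 * wB u * l2norm u"
proof -
  note [measurable] = schwartz_borel[OF u] schwartz_borel[OF schwartz_partial_deriv[OF u]]
  note sB = wB_square_integrable[OF u]
  have each: "(\<integral>x. (G j x)\<^sup>2 * \<rho> x ^ 4 * (norm (u x))\<^sup>2 \<partial>lborel)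
     \<le> 2 * wB u * l2norm (partial_deriv j u) + (C + 4 * c1) * \<kappa> ^ 3 * wB u * l2norm u" for j
  proof -
    \<comment> \<open>The fourth power is written as a product so that closure of
      \<open>poly_C1\<close> under products applies.\<close>
    define q where "q x = (\<rho> x * \<rho> x) * (\<rho> x * \<rho> x)" for x
    define f where "f x = (q x * G j x) * B x" for x
    have q4: "q x = \<rho> x ^ 4" for x by (simp add: q_def eval_nat_numeral)
    have q_poly: "poly_C1 q"
      unfolding q_def[abs_def] by (intro poly_C1_mult \<rho>_poly_C1)
    have q': "partial_deriv j q x = 4 * \<rho> x ^ 3 * partial_deriv j \<rho> x" for x
    proof -
      have 2: "partial_deriv j (\<lambda>x. \<rho> x * \<rho> x) x = 2 * \<rho> x * partial_deriv j \<rho> x" for x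
        by (subst partial_deriv_mult) (auto intro!: \<rho>_diff)
      show ?thesis
        unfolding q_def[abs_def]
        by (subst partial_deriv_mult) (auto intro!: \<rho>_diff differentiable_mult simp: 2 power3_eq_cube)
    qed
    have f_poly: "poly_C1 f"
      unfolding f_def[abs_def] by (intro poly_C1_mult q_poly G_poly_C1 B_poly_C1)
    define s where "s x = (q x * partial_deriv j (G j) x + partial_deriv j q x * G j x) * B x" for x
    have f': "partial_deriv j f x = q x * (G j x)\<^sup>2 + s x" for x
      unfolding f_def[abs_def] s_def
      by (subst partial_deriv_mult, (intro differentiable_mult G_diff B_diff poly_C1D(1)[OF q_poly])+,
          subst partial_deriv_mult)
         (auto intro!: G_diff poly_C1D(1)[OF q_poly] simp: G_def[symmetric] power2_eq_square algebra_simps)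
    have [measurable]: "q \<in> borel_measurable borel" "f \<in> borel_measurable borel"
      "s \<in> borel_measurable borel"
      unfolding s_def[abs_def] f_def[abs_def]
      by (auto intro!: borel_measurable_differentiable[OF poly_C1D(1)[OF q_poly]]
           borel_measurable_partial_deriv[OF poly_C1D(1)[OF q_poly]] borel_measurable_times borel_measurable_add)
    have s_le: "\<bar>s x\<bar> \<le> ((C + 4 * c1) * \<kappa> ^ 3) * (\<rho> x * \<bar>B x\<bar>)" for x
    proof -
      have "\<bar>q x * partial_deriv j (G j) x + partial_deriv j q x * G j x\<bar>
          \<le> \<rho> x ^ 4 * \<bar>partial_deriv j (G j) x\<bar> + 4 * \<bar>partial_deriv j \<rho> x\<bar> * (\<bar>G j x\<bar> * \<rho> x ^ 3)"
        unfolding q' q4 by (rule order_trans[OF abs_triangle_ineq]) (simp add: abs_mult less_imp_le)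
      also have "\<dots> \<le> \<rho> x ^ 4 * C + 4 * (c1 * \<rho> x ^ 4) * 1"
        using c1_nonneg by (intro add_mono mult_mono mult_left_mono G_\<rho> \<rho>_deriv_le G_deriv_le) (auto simp: less_imp_le)
      also have "\<dots> = (C + 4 * c1) * \<rho> x ^ 3 * \<rho> x" by (simp add: algebra_simps eval_nat_numeral)
      also have "\<dots> \<le> (C + 4 * c1) * \<kappa> ^ 3 * \<rho> x"
        using C c1_nonneg \<rho>_le[of x] by (intro mult_right_mono mult_left_mono power_mono) (auto simp: less_imp_le)
      finally have "\<bar>q x * partial_deriv j (G j) x + partial_deriv j q x * G j x\<bar> * \<bar>B x\<bar>
         \<le> (C + 4 * c1) * \<kappa> ^ 3 * \<rho> x * \<bar>B x\<bar>" by (rule mult_right_mono) simp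
      then show ?thesis by (simp add: s_def abs_mult mult_ac)
    qed
    note ibp = integral_by_parts_weighted[OF schwartz_rapid_C1[OF u] schwartz_rapid_C1[OF u] f_poly, of j]
    have bd: "norm (\<integral>x. of_real (f x) * (v x * cnj (w x)) \<partial>lborel) \<le> wB u * l2norm (partial_deriv j u)"
      if "(v = partial_deriv j u \<and> w = u) \<or> (v = u \<and> w = partial_deriv j u)" for v w
      unfolding wB_def
    proof (rule Cauchy_Schwarz_integral(2)[OF sB])
      show "square_integrable (partial_deriv j u)"
        by (intro schwartz_square_integrable schwartz_partial_deriv u)
      show "(\<lambda>x. complex_of_real (f x) * (v x * cnj (w x))) \<in> borel_measurable borel"
        using that by auto
      fix x
      have "\<bar>f x\<bar> = \<rho> x * \<bar>B x\<bar> * (\<bar>G j x\<bar> * \<rho> x ^ 3)"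
        by (simp add: f_def q4 abs_mult eval_nat_numeral mult_ac less_imp_le)
      also have "\<dots> \<le> \<rho> x * \<bar>B x\<bar> * 1"
        by (intro mult_left_mono G_\<rho>) (auto simp: less_imp_le)
      finally have "\<bar>f x\<bar> * (norm (u x) * norm (partial_deriv j u x)) \<le> \<rho> x * \<bar>B x\<bar> * (norm (u x) * norm (partial_deriv j u x))"
        by (intro mult_right_mono) auto
      then show "norm (of_real (f x) * (v x * cnj (w x))) \<le> norm (\<rho> x * \<bar>B x\<bar> * norm (u x)) * norm (partial_deriv j u x)"
        using that by (auto simp: norm_mult abs_mult less_imp_le mult_ac)
    qed
    have s_int: "integrable lborel (\<lambda>x. s x * (norm (u x))\<^sup>2)"
      and ns: "norm (\<integral>x. s x * (norm (u x))\<^sup>2 \<partial>lborel) \<le> (C + 4 * c1) * \<kappa> ^ 3 * wB u * l2norm u"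
    proof -
      have 1: "square_integrable (\<lambda>x. ((C + 4 * c1) * \<kappa> ^ 3) *\<^sub>R (\<rho> x * \<bar>B x\<bar> * norm (u x)))"
        by (rule square_integrable_dominated[OF sB, of _ "\<bar>(C + 4 * c1) * \<kappa> ^ 3\<bar>"]) (auto simp: abs_mult)
      have 2: "norm (s x * (norm (u x))\<^sup>2) \<le> norm (((C + 4 * c1) * \<kappa> ^ 3) *\<^sub>R (\<rho> x * \<bar>B x\<bar> * norm (u x))) * norm (u x)" for x
        using mult_right_mono[OF s_le[of x], of "(norm (u x))\<^sup>2"] C c1_nonneg
        by (simp add: abs_mult less_imp_le power2_eq_square mult_ac)
      show "integrable lborel (\<lambda>x. s x * (norm (u x))\<^sup>2)"
        by (rule Cauchy_Schwarz_integral(1)[OF 1 schwartz_square_integrable[OF u] _ 2]) measurable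
      have "norm (\<integral>x. s x * (norm (u x))\<^sup>2 \<partial>lborel)
         \<le> l2norm (\<lambda>x. ((C + 4 * c1) * \<kappa> ^ 3) *\<^sub>R (\<rho> x * \<bar>B x\<bar> * norm (u x))) * l2norm u"
        by (rule Cauchy_Schwarz_integral(2)[OF 1 schwartz_square_integrable[OF u] _ 2]) measurable
      then show "norm (\<integral>x. s x * (norm (u x))\<^sup>2 \<partial>lborel) \<le> (C + 4 * c1) * \<kappa> ^ 3 * wB u * l2norm u"
        unfolding l2norm_scaleR wB_def using C c1_nonneg by (simp add: abs_mult less_imp_le)
    qed
    have id': "(\<integral>x. partial_deriv j f x * (norm (u x))\<^sup>2 \<partial>lborel)
       = - Re (\<integral>x. of_real (f x) * (partial_deriv j u x * cnj (u x)) \<partial>lborel)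
         - Re (\<integral>x. of_real (f x) * (u x * cnj (partial_deriv j u x)) \<partial>lborel)"
      and f_int: "integrable lborel (\<lambda>x. partial_deriv j f x * (norm (u x))\<^sup>2)"
    proof -
      have "of_real (partial_deriv j f x) * (u x * cnj (u x)) = of_real (partial_deriv j f x * (norm (u x))\<^sup>2)" for x
        unfolding mult_cnj_norm by simp
      note e = ibp(1,3)[unfolded this]
      have "(\<integral>x. complex_of_real (partial_deriv j f x * (norm (u x))\<^sup>2) \<partial>lborel)
        = of_real (\<integral>x. partial_deriv j f x * (norm (u x))\<^sup>2 \<partial>lborel)" by (rule integral_complex_of_real)
      then show "(\<integral>x. partial_deriv j f x * (norm (u x))\<^sup>2 \<partial>lborel)
       = - Re (\<integral>x. of_real (f x) * (partial_deriv j u x * cnj (u x)) \<partial>lborel)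
         - Re (\<integral>x. of_real (f x) * (u x * cnj (partial_deriv j u x)) \<partial>lborel)"
        using arg_cong[OF e(1), of Re] by simp
      show "integrable lborel (\<lambda>x. partial_deriv j f x * (norm (u x))\<^sup>2)"
        using integrable_Re[OF e(2)] by simp
    qed
    have "(\<integral>x. (G j x)\<^sup>2 * \<rho> x ^ 4 * (norm (u x))\<^sup>2 \<partial>lborel)
       = (\<integral>x. partial_deriv j f x * (norm (u x))\<^sup>2 - s x * (norm (u x))\<^sup>2 \<partial>lborel)"
      by (intro Bochner_Integration.integral_cong) (simp_all add: f' q4 algebra_simps)
    also have "\<dots> = (\<integral>x. partial_deriv j f x * (norm (u x))\<^sup>2 \<partial>lborel) - (\<integral>x. s x * (norm (u x))\<^sup>2 \<partial>lborel)"
      by (rule Bochner_Integration.integral_diff[OF f_int s_int])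
    finally show ?thesis
      unfolding id'
      using ns bd[of "partial_deriv j u" u] bd[of u "partial_deriv j u"]
        abs_Re_le_cmod[of "\<integral>x. of_real (f x) * (partial_deriv j u x * cnj (u x)) \<partial>lborel"]
        abs_Re_le_cmod[of "\<integral>x. of_real (f x) * (u x * cnj (partial_deriv j u x)) \<partial>lborel"]
      by (simp add: abs_le_iff)
  qed
  have "wJ u \<le> (\<Sum>j\<in>(UNIV::'n set). 2 * wB u * l2norm (partial_deriv j u) + (C + 4 * c1) * \<kappa> ^ 3 * wB u * l2norm u)"
    unfolding wJ_def by (intro sum_mono each)
  also have "\<dots> = 2 * wB u * grad_norm u + real CARD('n) * (C + 4 * c1) * \<kappa> ^ 3 * wB u * l2norm u"
    by (simp add: sum.distrib grad_norm_def sum_distrib_left mult_ac)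
  finally show ?thesis .
qed
end

text \<open>The real arithmetic of the absorption. In units given by \<open>S\<close>,
  \<open>e\<close> is at most \<open>\<theta> x S\<close> and \<open>b\<close> at most
  \<open>\<phi> x^2 S\<close>; then \<open>E3\<close> and \<open>E4\<close> bound \<open>S^2\<close>
  by \<open>C3 (3 + c2) \<phi> S^2\<close>, which is smaller than \<open>S^2\<close>. The small
  constants are chosen backwards: \<open>\<phi>\<close> from this last step, \<open>\<theta>\<close>
  from \<open>\<phi>\<close> through \<open>E2\<close>, and \<open>\<eta>\<close> from
  \<open>\<theta>\<close> through \<open>E1\<close>.\<close>

lemma scaling_contradiction:
  fixes x \<kappa> e b S J N n \<mu> d c1 c2 C3 \<phi> \<theta> \<eta> :: real
  assumes pos: "x > 0" "\<kappa> > 0" "n > 0" and xk: "x * \<kappa>\<^sup>2 \<le> 1"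
    and nonneg: "e \<ge> 0" "b \<ge> 0" "S \<ge> 0" "N \<ge> 0" "c1 \<ge> 0" "c2 \<ge> 0" "C3 > 0" "d \<ge> 1"
    and E1: "e\<^sup>2 \<le> d * (N * n + \<mu> * n\<^sup>2)"
    and E2: "b\<^sup>2 \<le> \<kappa>\<^sup>2 * N\<^sup>2 + 2 * x ^ 3 * e * (S + 2 * c1 * \<kappa> ^ 4 * b)"
    and E3: "x ^ 3 * J \<le> 2 * b * e + c2 * x ^ 3 * \<kappa> ^ 3 * b * n"
    and E4: "S\<^sup>2 \<le> C3 * (J + \<kappa> ^ 8 * b\<^sup>2)"
    and E5: "n \<le> \<kappa> * S"
    and \<phi>: "0 < \<phi>" "\<phi> \<le> 1" "C3 * (3 + c2) * \<phi> < 1"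
    and \<theta>: "\<theta> = \<phi>\<^sup>2 / (6 + 16 * c1\<^sup>2)" and \<eta>: "\<eta> = \<theta>\<^sup>2 / (2 * d)"
    and \<mu>: "\<mu> \<le> \<eta> * (x\<^sup>2 / \<kappa>\<^sup>2)" and N: "N \<le> \<eta> * (x\<^sup>2 / \<kappa>\<^sup>2) * n"
  shows False
proof -
  have S: "S > 0" using E5 pos by (metis less_le_trans zero_less_mult_pos)
  \<comment> \<open>Dividing \<open>E2\<close> by \<open>x^4 S^2\<close> gives \<open>\<beta>^2
    \<le> \<eta>^2 + 2 \<theta> + 4 c1 \<theta> \<beta>\<close>. Here
    \<open>\<eta>^2 \<le> \<theta>\<close>, and the last term is at most
    \<open>\<beta>^2 / 2 + 8 c1^2 \<theta>\<close>; absorbing and doubling produces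
    \<open>\<beta>^2 \<le> K \<theta>\<close>, which is \<open>\<phi>^2\<close>.\<close>
  define K where "K = 6 + 16 * c1\<^sup>2"
  have K: "K \<ge> 6" by (simp add: K_def)
  have \<theta>K: "\<theta> * K = \<phi>\<^sup>2" using K by (simp add: \<theta> K_def[symmetric])
  have \<theta>_pos: "\<theta> > 0" using \<phi> K by (simp add: \<theta> K_def[symmetric])
  have "\<phi>\<^sup>2 \<le> 1" using \<phi> by (simp add: power_le_one)
  then have "\<theta> * 6 \<le> 1" using mult_left_mono[OF K, of \<theta>] \<theta>_pos \<theta>K by linarith
  then have \<theta>1: "\<theta> \<le> 1" by simp
  have \<eta>_pos: "\<eta> > 0" using \<theta>_pos nonneg by (simp add: \<eta>)
  have "\<theta>\<^sup>2 \<le> \<theta>" using \<theta>1 \<theta>_pos by (simp add: power2_eq_square mult_left_le)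
  then have \<eta>\<theta>: "\<eta> \<le> \<theta>" and \<eta>1: "\<eta> \<le> 1"
    using nonneg(8) \<theta>1 \<theta>_pos by (auto simp: \<eta> divide_le_eq intro: order_trans[of _ \<theta>])
  \<comment> \<open>The factor carried by all lower order terms. It is the square of
    \<open>x \<kappa>^2\<close>, hence at most 1 by \<open>xk\<close>.\<close>
  define t where "t = x\<^sup>2 * \<kappa> ^ 4"
  have t: "0 \<le> t" "t \<le> 1"
  proof -
    have "(x * \<kappa>\<^sup>2)\<^sup>2 \<le> 1" using xk pos by (intro power_le_one) auto
    then show "t \<le> 1" by (simp add: t_def power_mult_distrib power_mult[symmetric])
  qed (simp add: t_def)
  \<comment> \<open>\<open>b\<close> measured in its natural unit \<open>x^2 S\<close>, so that
    \<open>x\<close> and \<open>S\<close> cancel from the inequalities.\<close>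
  define \<beta> where "\<beta> = b / (x\<^sup>2 * S)"
  have b: "b = x\<^sup>2 * S * \<beta>" using pos S by (simp add: \<beta>_def)
  have \<beta>: "\<beta> \<ge> 0" using nonneg S by (simp add: \<beta>_def)
  have nn: "n\<^sup>2 \<le> \<kappa>\<^sup>2 * S\<^sup>2" using E5 pos power_mono[of n "\<kappa> * S" 2] by (simp add: power_mult_distrib)
  have e: "e \<le> \<theta> * x * S"
  proof (rule power2_le_imp_le)
    \<comment> \<open>The terms with \<open>N\<close> and with \<open>\<mu>\<close> contribute
      equally. The denominator \<open>2 * d\<close> in \<open>\<eta>\<close> pays for this doubling
      and for the factor \<open>d\<close> in \<open>E1\<close>.\<close>
    have "N * n \<le> \<eta> * (x\<^sup>2 / \<kappa>\<^sup>2) * n\<^sup>2"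
      using mult_right_mono[OF N, of n] pos by (simp add: power2_eq_square mult.assoc)
    moreover have "\<mu> * n\<^sup>2 \<le> \<eta> * (x\<^sup>2 / \<kappa>\<^sup>2) * n\<^sup>2" by (intro mult_right_mono \<mu>) simp
    ultimately have "N * n + \<mu> * n\<^sup>2 \<le> \<eta> * (x\<^sup>2 / \<kappa>\<^sup>2) * n\<^sup>2 + \<eta> * (x\<^sup>2 / \<kappa>\<^sup>2) * n\<^sup>2"
      by (rule add_mono)
    also have "\<dots> = 2 * (\<eta> * (x\<^sup>2 / \<kappa>\<^sup>2) * n\<^sup>2)" by simp
    also have "\<dots> \<le> 2 * (\<eta> * (x\<^sup>2 / \<kappa>\<^sup>2) * (\<kappa>\<^sup>2 * S\<^sup>2))"
      using \<eta>_pos nn by (intro mult_left_mono) auto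
    also have "\<dots> = 2 * \<eta> * x\<^sup>2 * S\<^sup>2" using pos by simp
    finally have "d * (N * n + \<mu> * n\<^sup>2) \<le> d * (2 * \<eta> * x\<^sup>2 * S\<^sup>2)"
      using nonneg by (intro mult_left_mono) auto
    also have "\<dots> = (\<theta> * x * S)\<^sup>2" using nonneg by (simp add: \<eta> power_mult_distrib)
    finally show "e\<^sup>2 \<le> (\<theta> * x * S)\<^sup>2" using E1 by simp
  qed (use \<theta>_pos pos S in simp)
  have \<beta>\<phi>: "\<beta> \<le> \<phi>"
  proof (rule power2_le_imp_le)
    have "\<kappa>\<^sup>2 * N\<^sup>2 \<le> \<kappa>\<^sup>2 * ((\<eta> * (x\<^sup>2 / \<kappa>\<^sup>2))\<^sup>2 * (\<kappa>\<^sup>2 * S\<^sup>2))"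
    proof (rule mult_left_mono)
      have "N\<^sup>2 \<le> (\<eta> * (x\<^sup>2 / \<kappa>\<^sup>2))\<^sup>2 * n\<^sup>2"
        using power_mono[OF N nonneg(4), of 2] by (simp only: power_mult_distrib)
      also have "\<dots> \<le> (\<eta> * (x\<^sup>2 / \<kappa>\<^sup>2))\<^sup>2 * (\<kappa>\<^sup>2 * S\<^sup>2)" by (intro mult_left_mono nn) simp
      finally show "N\<^sup>2 \<le> (\<eta> * (x\<^sup>2 / \<kappa>\<^sup>2))\<^sup>2 * (\<kappa>\<^sup>2 * S\<^sup>2)" .
    qed simp
    also have "\<dots> = x ^ 4 * S\<^sup>2 * \<eta>\<^sup>2"
      using pos by (simp add: power_mult_distrib power_divide power_mult[symmetric] field_simps eval_nat_numeral)
    finally have 1: "\<kappa>\<^sup>2 * N\<^sup>2 \<le> x ^ 4 * S\<^sup>2 * \<eta>\<^sup>2" .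
    have "2 * x ^ 3 * e * (S + 2 * c1 * \<kappa> ^ 4 * b) \<le> 2 * x ^ 3 * (\<theta> * x * S) * (S + 2 * c1 * \<kappa> ^ 4 * b)"
      using e pos nonneg by (intro mult_right_mono mult_left_mono) auto
    also have "\<dots> = x ^ 4 * S\<^sup>2 * (2 * \<theta> + 4 * c1 * \<theta> * \<beta> * t)"
      unfolding b t_def by (simp add: algebra_simps eval_nat_numeral)
    finally have "b\<^sup>2 \<le> x ^ 4 * S\<^sup>2 * (\<eta>\<^sup>2 + (2 * \<theta> + 4 * c1 * \<theta> * \<beta> * t))"
      using E2 1 unfolding distrib_left by linarith
    also have "b\<^sup>2 = x ^ 4 * S\<^sup>2 * \<beta>\<^sup>2" unfolding b by (simp add: power_mult_distrib eval_nat_numeral)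
    finally have "\<beta>\<^sup>2 \<le> \<eta>\<^sup>2 + (2 * \<theta> + 4 * c1 * \<theta> * \<beta> * t)"
      using pos S by (subst (asm) mult_le_cancel_left_pos) auto
    moreover have "4 * c1 * \<theta> * \<beta> * t \<le> 4 * c1 * \<theta> * \<beta>"
      using t nonneg \<theta>_pos \<beta> by (intro mult_left_le) auto
    moreover have "\<eta>\<^sup>2 \<le> \<theta>"
      using \<eta>_pos \<eta>1 \<eta>\<theta> by (simp add: power2_eq_square) (meson less_imp_le mult_left_le order_trans)
    moreover have "2 * (4 * c1 * \<theta> * \<beta>) \<le> \<beta>\<^sup>2 + 16 * c1\<^sup>2 * \<theta>\<^sup>2"
      using zero_le_power2[of "\<beta> - 4 * c1 * \<theta>"] by (simp add: power2_eq_square algebra_simps)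
    moreover have "16 * c1\<^sup>2 * \<theta>\<^sup>2 \<le> 16 * c1\<^sup>2 * \<theta>"
      using \<open>\<theta>\<^sup>2 \<le> \<theta>\<close> by (intro mult_left_mono) auto
    moreover have "\<theta> * K = 6 * \<theta> + 16 * c1\<^sup>2 * \<theta>" by (simp add: K_def algebra_simps)
    ultimately show "\<beta>\<^sup>2 \<le> \<phi>\<^sup>2" using \<theta>K by linarith
  qed (use \<phi> in simp)
  have "x ^ 3 * J \<le> 2 * b * (\<theta> * x * S) + c2 * x ^ 3 * \<kappa> ^ 3 * b * (\<kappa> * S)"
    using E3 e E5 nonneg pos
    by (elim order_trans) (intro add_mono mult_left_mono, auto)
  also have "\<dots> = x ^ 3 * (S\<^sup>2 * (2 * \<beta> * \<theta> + c2 * \<beta> * t))"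
    unfolding b t_def by (simp add: algebra_simps eval_nat_numeral)
  finally have "J \<le> S\<^sup>2 * (2 * \<beta> * \<theta> + c2 * \<beta> * t)" using pos by simp
  also have "\<dots> \<le> S\<^sup>2 * (2 * \<phi> + c2 * \<phi>)"
  proof (intro mult_left_mono add_mono)
    have "\<beta> * \<theta> \<le> \<phi> * 1" using \<beta> \<beta>\<phi> \<theta>1 \<theta>_pos \<phi> by (intro mult_mono) auto
    then show "2 * \<beta> * \<theta> \<le> 2 * \<phi>" by simp
    have "c2 * \<beta> * t \<le> c2 * \<beta>" using nonneg \<beta> t by (intro mult_left_le) auto
    also have "\<dots> \<le> c2 * \<phi>" using \<beta>\<phi> nonneg by (intro mult_left_mono) auto
    finally show "c2 * \<beta> * t \<le> c2 * \<phi>" .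
  qed simp
  finally have J: "J \<le> S\<^sup>2 * (2 * \<phi> + c2 * \<phi>)" .
  have "\<kappa> ^ 8 * b\<^sup>2 = S\<^sup>2 * (t\<^sup>2 * \<beta>\<^sup>2)"
    unfolding b t_def by (simp add: algebra_simps eval_nat_numeral)
  also have "\<dots> \<le> S\<^sup>2 * \<phi>"
  proof (intro mult_left_mono)
    have "t\<^sup>2 * \<beta>\<^sup>2 \<le> 1 * \<beta>\<^sup>2" using t by (intro mult_right_mono power_le_one) auto
    also have "\<beta>\<^sup>2 \<le> \<phi>\<^sup>2" using \<beta> \<beta>\<phi> by (intro power_mono) auto
    also have "\<phi>\<^sup>2 \<le> \<phi>" using \<phi> by (simp add: power2_eq_square mult_left_le)
    finally show "t\<^sup>2 * \<beta>\<^sup>2 \<le> \<phi>" by simp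
  qed simp
  finally have "C3 * (J + \<kappa> ^ 8 * b\<^sup>2) \<le> C3 * (S\<^sup>2 * (2 * \<phi> + c2 * \<phi>) + S\<^sup>2 * \<phi>)"
    using J nonneg by (intro mult_left_mono add_mono) auto
  also have "\<dots> = S\<^sup>2 * (C3 * (3 + c2) * \<phi>)" by (simp add: algebra_simps)
  also have "\<dots> < S\<^sup>2 * 1" using S \<phi> by (intro mult_strict_left_mono) auto
  finally show False using E4 by simp
qed

context subelliptic
begin

text \<open>Multiply \<open>star\<close> by \<open>\<rho>^4 |u|^2\<close> and integrate:
  \<open>\<omega> \<rho>^4\<close> is \<open>1 / \<rho>^2\<close>, and since
  \<open>1 / r = \<kappa>^6\<close>, the term with \<open>B^2 / r\<close> is at most
  \<open>\<kappa>^8 (\<rho> B)^2\<close>.\<close>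

lemma wS_bound:
  assumes u: "u \<in> schwartz" and C3: "C3 \<ge> 0"
    and star: "\<And>x. \<omega> x \<le> C3 * ((\<Sum>j\<in>UNIV. (G j x)\<^sup>2) + (B x)\<^sup>2 / r)"
  shows "(wS u)\<^sup>2 \<le> C3 * (wJ u + \<kappa> ^ 8 * (wB u)\<^sup>2)"
proof -
  note [measurable] = schwartz_borel[OF u]
  note iB = square_integrableD(2)[OF wB_square_integrable[OF u]]
  note iS = square_integrableD(2)[OF wS_square_integrable[OF u]]
  have iJ: "integrable lborel (\<lambda>x. (G j x)\<^sup>2 * \<rho> x ^ 4 * (norm (u x))\<^sup>2)" for j
  proof (rule Bochner_Integration.integrable_bound[OF iS])
    have "(G j x)\<^sup>2 * \<rho> x ^ 4 * (norm (u x))\<^sup>2 \<le> (inverse (\<rho> x) * norm (u x))\<^sup>2" for x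
    proof -
      have "(\<bar>G j x\<bar> * \<rho> x ^ 3)\<^sup>2 \<le> 1" using G_\<rho>[of j x] by (intro power_le_one) (auto simp: less_imp_le)
      then have P: "(inverse (\<rho> x))\<^sup>2 * (\<bar>G j x\<bar> * \<rho> x ^ 3)\<^sup>2 * (norm (u x))\<^sup>2 \<le> (inverse (\<rho> x))\<^sup>2 * 1 * (norm (u x))\<^sup>2"
        by (intro mult_left_mono mult_right_mono) auto
      have E: "(inverse (\<rho> x))\<^sup>2 * (\<bar>G j x\<bar> * \<rho> x ^ 3)\<^sup>2 = (G j x)\<^sup>2 * \<rho> x ^ 4"
      proof -
        have "inverse (\<rho> x) * \<rho> x ^ 3 = (\<rho> x)\<^sup>2"
          using less_imp_neq[OF \<rho>_pos[of x]] by (simp add: eval_nat_numeral)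
        moreover have "(inverse (\<rho> x))\<^sup>2 * (\<bar>G j x\<bar> * \<rho> x ^ 3)\<^sup>2 = (G j x)\<^sup>2 * (inverse (\<rho> x) * \<rho> x ^ 3)\<^sup>2"
          by (simp add: power_mult_distrib)
        ultimately show ?thesis by (simp only: power_mult[symmetric]) simp
      qed
      show ?thesis using P unfolding E by (simp add: power_mult_distrib)
    qed
    then show "AE x in lborel. norm ((G j x)\<^sup>2 * \<rho> x ^ 4 * (norm (u x))\<^sup>2) \<le> norm ((norm (inverse (\<rho> x) * norm (u x)))\<^sup>2)"
      by (simp add: abs_mult less_imp_le)
  qed measurable
  have "(wS u)\<^sup>2 = (\<integral>x. (norm (inverse (\<rho> x) * norm (u x)))\<^sup>2 \<partial>lborel)"
    unfolding wS_def l2norm_power2 ..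
  also have "\<dots> \<le> (\<integral>x. C3 * ((\<Sum>j\<in>UNIV. (G j x)\<^sup>2 * \<rho> x ^ 4 * (norm (u x))\<^sup>2)
                     + \<kappa> ^ 8 * (norm (\<rho> x * \<bar>B x\<bar> * norm (u x)))\<^sup>2) \<partial>lborel)"
  proof (rule integral_mono)
    fix x
    have "(inverse (\<rho> x))\<^sup>2 = \<omega> x * \<rho> x ^ 4"
    proof -
      have "inverse (\<rho> x ^ 2) = \<omega> x * \<rho> x ^ 4"
        by (rule inverse_unique) (use \<rho>_power6[of x] in \<open>simp add: eval_nat_numeral mult_ac\<close>)
      then show ?thesis by (simp add: power_inverse)
    qed
    also have "\<dots> \<le> C3 * ((\<Sum>j\<in>UNIV. (G j x)\<^sup>2) + (B x)\<^sup>2 / r) * \<rho> x ^ 4"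
      by (intro mult_right_mono star) (simp add: less_imp_le)
    also have "\<dots> = C3 * ((\<Sum>j\<in>UNIV. (G j x)\<^sup>2) * \<rho> x ^ 4 + (B x)\<^sup>2 / r * \<rho> x ^ 4)"
      by (simp add: algebra_simps)
    also have "\<dots> \<le> C3 * ((\<Sum>j\<in>UNIV. (G j x)\<^sup>2) * \<rho> x ^ 4 + \<kappa> ^ 8 * (\<rho> x * \<bar>B x\<bar>)\<^sup>2)"
    proof (intro mult_left_mono C3 add_left_mono)
      have "inverse r = \<kappa> ^ 6" by (rule inverse_unique) (use \<kappa>_power6 in \<open>simp add: mult.commute\<close>)
      then have "(B x)\<^sup>2 / r * \<rho> x ^ 4 = (B x)\<^sup>2 * \<kappa> ^ 6 * (\<rho> x)\<^sup>2 * (\<rho> x)\<^sup>2"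
        by (simp add: divide_inverse power_add[symmetric] mult.assoc)
      also have "\<dots> \<le> (B x)\<^sup>2 * \<kappa> ^ 6 * (\<rho> x)\<^sup>2 * \<kappa>\<^sup>2"
        using \<rho>_le[of x] by (intro mult_left_mono power_mono) (auto simp: less_imp_le)
      also have "\<dots> = \<kappa> ^ 8 * (\<rho> x * \<bar>B x\<bar>)\<^sup>2"
        by (simp add: power_mult_distrib)
      finally show "(B x)\<^sup>2 / r * \<rho> x ^ 4 \<le> \<kappa> ^ 8 * (\<rho> x * \<bar>B x\<bar>)\<^sup>2" .
    qed
    finally have "(inverse (\<rho> x))\<^sup>2 * (norm (u x))\<^sup>2
        \<le> C3 * ((\<Sum>j\<in>UNIV. (G j x)\<^sup>2) * \<rho> x ^ 4 + \<kappa> ^ 8 * (\<rho> x * \<bar>B x\<bar>)\<^sup>2) * (norm (u x))\<^sup>2"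
      by (rule mult_right_mono) simp
    then show "(norm (inverse (\<rho> x) * norm (u x)))\<^sup>2
        \<le> C3 * ((\<Sum>j\<in>UNIV. (G j x)\<^sup>2 * \<rho> x ^ 4 * (norm (u x))\<^sup>2)
                     + \<kappa> ^ 8 * (norm (\<rho> x * \<bar>B x\<bar> * norm (u x)))\<^sup>2)"
      by (simp add: power_mult_distrib sum_distrib_right distrib_right mult.assoc)
  qed (use iS iB iJ in auto)
  also have "\<dots> = C3 * (wJ u + \<kappa> ^ 8 * (wB u)\<^sup>2)"
    using iB iJ unfolding wJ_def wB_def l2norm_power2 by simp
  finally show ?thesis .
qed

lemma l2norm_le_wS:
  assumes u: "u \<in> schwartz" shows "l2norm u \<le> \<kappa> * wS u"
proof -
  note sS = wS_square_integrable[OF u]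
  have "l2norm u \<le> l2norm (\<lambda>x. \<kappa> *\<^sub>R (inverse (\<rho> x) * norm (u x)))"
  proof (rule l2norm_mono)
    show "square_integrable (\<lambda>x. \<kappa> *\<^sub>R (inverse (\<rho> x) * norm (u x)))"
      by (rule square_integrable_dominated[OF sS, of _ "\<kappa>"]) (use schwartz_borel[OF u] in \<open>auto simp: abs_mult less_imp_le\<close>)
    show "norm (u x) \<le> norm (\<kappa> *\<^sub>R (inverse (\<rho> x) * norm (u x)))" for x
    proof -
      have "1 \<le> \<kappa> * inverse (\<rho> x)" using \<rho>_le[of x] by (simp add: field_simps)
      from mult_right_mono[OF this, of "norm (u x)"] show ?thesis
        by (simp add: abs_mult less_imp_le)
    qed
  qed (use schwartz_borel[OF u] in simp)
  then show ?thesis unfolding l2norm_scaleR wS_def by (simp add: less_imp_le)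
qed

text \<open>Failure of the bound is exactly the smallness of \<open>N\<close> required by
  \<open>scaling_contradiction\<close>. Since \<open>\<tau> = x^6\<close>, the gradient enters
  multiplied by \<open>x^3\<close>, and \<open>\<mu>\<close> is allowed the same size as the
  spectral bound to be proved.\<close>

lemma lower_bound:
  assumes u: "u \<in> schwartz" and C3: "C3 > 0"
    and star: "\<And>x. \<omega> x \<le> C3 * ((\<Sum>j\<in>UNIV. (G j x)\<^sup>2) + (B x)\<^sup>2 / r)"
    and x: "x > 0" "\<tau> = x ^ 6" "x * \<kappa>\<^sup>2 \<le> 1"
    and \<phi>: "0 < \<phi>" "\<phi> \<le> 1" "C3 * (3 + real CARD('n) * (C + 4 * c1)) * \<phi> < 1"
    and \<theta>: "\<theta> = \<phi>\<^sup>2 / (6 + 16 * c1\<^sup>2)" and \<eta>: "\<eta> = \<theta>\<^sup>2 / (2 * real CARD('n))"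
    and \<mu>: "\<And>y. - (\<eta> * (x\<^sup>2 / \<kappa>\<^sup>2)) \<le> Re (W y)"
  shows "\<eta> * (x\<^sup>2 / \<kappa>\<^sup>2) * l2norm u \<le> l2norm (schroedinger \<tau> W u)"
proof (rule ccontr)
  let ?n = "l2norm u" and ?N = "l2norm (schroedinger \<tau> W u)"
  assume contra: "\<not> \<eta> * (x\<^sup>2 / \<kappa>\<^sup>2) * ?n \<le> ?N"
  have "?n \<noteq> 0" using contra by auto
  then have n: "?n > 0" using l2norm_nonneg[of u] by linarith
  have wB: "wB u \<ge> 0" and wS: "wS u \<ge> 0" and g: "grad_norm u \<ge> 0"
    by (simp_all add: wB_def wS_def grad_norm_def sum_nonneg)
  show False
  proof (rule scaling_contradiction[where x=x and \<kappa>=\<kappa> and n="?n" and N="?N" and e="x ^ 3 * grad_norm u"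
        and b="wB u" and S="wS u" and J="wJ u" and d="real CARD('n)" and \<mu>="\<eta> * (x\<^sup>2 / \<kappa>\<^sup>2)"
        and ?c1.0=c1 and ?c2.0="real CARD('n) * (C + 4 * c1)" and ?C3.0=C3 and \<phi>=\<phi> and \<theta>=\<theta> and \<eta>=\<eta>])
    show "1 \<le> real CARD('n)" by (simp add: Suc_leI)
    show "(x ^ 3 * grad_norm u)\<^sup>2 \<le> real CARD('n) * (?N * ?n + \<eta> * (x\<^sup>2 / \<kappa>\<^sup>2) * ?n\<^sup>2)"
      using grad_bound[OF u W less_imp_le[OF \<tau>] \<mu>] x(2) by (simp add: power_mult_distrib power_mult[symmetric])
    show "(wB u)\<^sup>2 \<le> \<kappa>\<^sup>2 * ?N\<^sup>2 + 2 * x ^ 3 * (x ^ 3 * grad_norm u) * (wS u + 2 * c1 * \<kappa> ^ 4 * wB u)"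
    proof -
      have "\<tau> = x ^ 3 * x ^ 3" using x(2) by (simp add: power_add[symmetric])
      then show ?thesis using wB_bound[OF u] by (simp add: mult_ac)
    qed
    show "x ^ 3 * wJ u \<le> 2 * wB u * (x ^ 3 * grad_norm u) + real CARD('n) * (C + 4 * c1) * x ^ 3 * \<kappa> ^ 3 * wB u * ?n"
      using mult_left_mono[OF wJ_bound[OF u], of "x ^ 3"] x(1) by (simp add: algebra_simps)
    show "(wS u)\<^sup>2 \<le> C3 * (wJ u + \<kappa> ^ 8 * (wB u)\<^sup>2)"
      using C3 star by (intro wS_bound u) auto
    show "?n \<le> \<kappa> * wS u" by (rule l2norm_le_wS[OF u])
    show "?N \<le> \<eta> * (x\<^sup>2 / \<kappa>\<^sup>2) * ?n" using contra by simp
  qed (use assms n wB wS g c1_nonneg C in auto)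
qed
end

section \<open>From the assumption on the potential to the pointwise inequality for the
  weight\<close>

lemma moderate_add:
  assumes "moderate f" "moderate g"
  shows "moderate (\<lambda>x. f x + g x)"
proof (rule moderate_coinduct[of _ "{\<lambda>x. f x + g x | f g. moderate f \<and> moderate g}"])
  fix h :: "real^'a \<Rightarrow> complex" assume "h \<in> {\<lambda>x. f x + g x | f g. moderate f \<and> moderate g}"
  then obtain f g where h: "h = (\<lambda>x. f x + g x)" and fg: "moderate f" "moderate g" by blast
  note d = moderate_differentiable[OF fg(1)] moderate_differentiable[OF fg(2)]
  show "h differentiable (at x)" for x unfolding h by (intro differentiable_add d)
  show "poly_bounded h" unfolding h by (intro poly_bounded_add moderate_poly_bounded fg)
  have "partial_deriv j h = (\<lambda>x. partial_deriv j f x + partial_deriv j g x)" for j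
    unfolding h by (rule ext) (intro partial_deriv_add d)
  then show "partial_deriv j h \<in> {\<lambda>x. f x + g x | f g. moderate f \<and> moderate g}" for j
    using moderate_partial_deriv[OF fg(1), of j] moderate_partial_deriv[OF fg(2), of j] by blast
qed (use assms in blast)

lemma moderate_diff_const: "moderate f \<Longrightarrow> moderate (\<lambda>x. f x - c)"
  using moderate_add[OF _ moderate_const[of "- c"]] by simp

text \<open>Here \<open>k^6\<close> stands for \<open>\<tau>\<close>, so \<open>k^2 r^(1/3)\<close>
  is \<open>h^(2/3) (|z| - T)^(1/3)\<close> up to a constant. A single \<open>\<eta>\<close>, fixed
  before \<open>k\<close>, \<open>r\<close>, \<open>z\<close> and \<open>u\<close>, limits
  \<open>Re z\<close> and is the constant of the estimate.\<close>

lemma schroedinger_lower_bound: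
  fixes V :: "real^'n \<Rightarrow> complex"
  defines "V2 \<equiv> \<lambda>x. Im (V x)"
  assumes V: "moderate V" and Re_nonneg: "\<And>x. 0 \<le> Re (V x)"
    and C: "C \<ge> 0" "\<And>i j x. \<bar>partial_deriv i (partial_deriv j V2) x\<bar> \<le> C"
    and L: "L > 0" and T: "T \<ge> 0" and c0: "c0 > 0"
    and hyp: "\<And>x. norm (gradient V2 x) \<le> L \<Longrightarrow> \<bar>V2 x\<bar> - T \<le> c0 * (norm (gradient V2 x))\<^sup>2"
    and R: "R > 0"
  shows "\<exists>\<eta>>0. \<forall>k r z u. 0 < k \<and> k ^ 3 \<le> r \<and> r \<le> R \<and> cmod z = r + T
      \<and> Re z \<le> \<eta> * (k\<^sup>2 * r powr (1/3)) \<and> u \<in> schwartz \<longrightarrow>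
      \<eta> * (k\<^sup>2 * r powr (1/3)) * l2norm u \<le> l2norm (schroedinger (k ^ 6) (\<lambda>x. V x - z) u)"
proof -
  \<comment> \<open>The three entries match the three ways to dominate \<open>r\<close>:
    \<open>R / L^2\<close> where the gradient exceeds \<open>L\<close>, \<open>4 c0\<close> where
    the assumption makes the gradient large, and 16 where \<open>B\<close> is large. The summand 1
    absorbs the squared gradient contained in \<open>\<omega>\<close>.\<close>
  define C3 where "C3 = max (R / L\<^sup>2) (max (4 * c0) 16) + 1"
  \<comment> \<open>This is \<open>c1\<close> of the locale written out, since the constants have to
    be chosen before \<open>z\<close>, and with it the potential of the locale, is given.\<close>
  define cw where "cw = real CARD('n) * C / 3"
  define E where "E = C3 * (3 + real CARD('n) * (C + 4 * cw))"
  define \<phi> where "\<phi> = min 1 (1 / (2 * E))"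
  define \<theta> where "\<theta> = \<phi>\<^sup>2 / (6 + 16 * cw\<^sup>2)"
  define \<eta> where "\<eta> = \<theta>\<^sup>2 / (2 * real CARD('n))"
  have C3: "C3 \<ge> R / L\<^sup>2 + 1" "C3 \<ge> 4 * c0 + 1" "C3 \<ge> 17" by (auto simp: C3_def)
  have cw: "cw \<ge> 0" using C by (simp add: cw_def)
  have "3 + real CARD('n) * (C + 4 * cw) > 0" using C cw by (intro add_pos_nonneg mult_nonneg_nonneg) auto
  then have E: "E > 0" using C3 unfolding E_def by (intro mult_pos_pos) auto
  have \<phi>: "0 < \<phi>" "\<phi> \<le> 1" using E by (auto simp: \<phi>_def)
  have "E * \<phi> \<le> E * (1 / (2 * E))" using E by (intro mult_left_mono) (auto simp: \<phi>_def)
  then have E\<phi>: "E * \<phi> < 1" using E by simp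
  have c16: "6 \<le> 6 + 16 * cw\<^sup>2" by simp
  have \<theta>: "0 < \<theta>" using \<phi> by (simp add: \<theta>_def add_pos_nonneg)
  have "\<phi>\<^sup>2 \<le> 1" using \<phi> by (intro power_le_one) auto
  then have \<theta>1: "\<theta> \<le> 1" unfolding \<theta>_def using c16 by (subst divide_le_eq_1_pos) linarith+
  have \<eta>: "0 < \<eta>" using \<theta> by (simp add: \<eta>_def)
  have "\<theta>\<^sup>2 \<le> 1" using \<theta> \<theta>1 by (intro power_le_one) auto
  moreover have "1 \<le> real CARD('n)" by (simp add: Suc_leI)
  ultimately have \<eta>_half: "\<eta> \<le> 1/2"
    unfolding \<eta>_def by (subst pos_divide_le_eq) linarith+
  show ?thesis
  proof (intro exI[of _ \<eta>] conjI allI impI \<eta>; elim conjE)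
    fix k r :: real and z :: complex and u :: "real^'n \<Rightarrow> complex"
    assume k: "0 < k" "k ^ 3 \<le> r" and rR: "r \<le> R" and z: "cmod z = r + T"
      and Rez: "Re z \<le> \<eta> * (k\<^sup>2 * r powr (1/3))" and u: "u \<in> schwartz"
    define W where "W = (\<lambda>x. V x - z)"
    have r: "r > 0" using k zero_less_power[of k 3] by linarith
    have W: "moderate W" unfolding W_def by (rule moderate_diff_const[OF V])
    have V2_diff: "V2 differentiable (at x)" for x
      unfolding V2_def by (rule partial_deriv_Im(2)[OF moderate_differentiable[OF V]])
    have W_deriv: "partial_deriv j (\<lambda>x. Im (W x)) = partial_deriv j V2" for j
    proof
      fix x
      have "partial_deriv j (\<lambda>x. V2 x + - Im z) x = partial_deriv j V2 x + partial_deriv j (\<lambda>x. - Im z) x"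
        by (rule partial_deriv_add[OF V2_diff]) simp
      then show "partial_deriv j (\<lambda>x. Im (W x)) x = partial_deriv j V2 x"
        by (simp add: W_def V2_def)
    qed
    interpret subelliptic W "k ^ 6" r C
      by unfold_locales (use W C r k W_deriv in auto)
    have c1_eq: "cw = c1" unfolding c1_def cw_def ..
    have \<kappa>2: "\<kappa>\<^sup>2 = r powr (-1/3)" unfolding \<kappa>_def using r by (subst powr_power) auto
    have x\<kappa>: "k\<^sup>2 / \<kappa>\<^sup>2 = k\<^sup>2 * r powr (1/3)"
      unfolding \<kappa>2 by (simp add: powr_minus field_simps)
    have "(k ^ 3) powr (1/3) \<le> r powr (1/3)" using k by (intro powr_mono2) auto
    moreover have "(k ^ 3) powr (1/3) = k"
    proof -
      have "(k ^ 3) powr (1/3) = (k powr 3) powr (1/3)" using k(1) by simp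
      then show ?thesis using k(1) by (simp only: powr_powr) simp
    qed
    ultimately have k_le: "k \<le> r powr (1/3)" by simp
    then have k\<kappa>: "k * \<kappa>\<^sup>2 \<le> 1"
      unfolding \<kappa>2 using r by (simp add: powr_minus field_simps)
    have "k\<^sup>2 \<le> (r powr (1/3))\<^sup>2" using k k_le by (intro power_mono) auto
    then have "k\<^sup>2 * r powr (1/3) \<le> (r powr (1/3))\<^sup>2 * r powr (1/3)" by (intro mult_right_mono) auto
    also have "\<dots> = r" using r by (simp add: power2_eq_square powr_add[symmetric])
    finally have lam_le: "k\<^sup>2 * r powr (1/3) \<le> r" .
    show "\<eta> * (k\<^sup>2 * r powr (1/3)) * l2norm u \<le> l2norm (schroedinger (k ^ 6) (\<lambda>x. V x - z) u)"
    proof (cases "Re z \<le> - (\<eta> * (k\<^sup>2 * r powr (1/3)))")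
      case True
      let ?n = "l2norm u" and ?N = "l2norm (schroedinger (k ^ 6) W u)"
      have "0 \<le> k ^ 6 * (grad_norm u)\<^sup>2" using k by simp
      also have "\<dots> \<le> real CARD('n) * (?N * ?n + Re z * ?n\<^sup>2)"
        by (rule grad_bound[OF u W]) (use Re_nonneg k in \<open>simp_all add: W_def\<close>)
      finally have "0 \<le> ?N * ?n + Re z * ?n\<^sup>2" by (simp add: zero_le_mult_iff)
      moreover have "Re z * ?n\<^sup>2 \<le> - (\<eta> * (k\<^sup>2 * r powr (1/3))) * ?n\<^sup>2"
        by (intro mult_right_mono True) simp
      ultimately have "(\<eta> * (k\<^sup>2 * r powr (1/3)) * ?n) * ?n \<le> ?N * ?n"
        by (simp add: power2_eq_square mult.assoc)
      then show ?thesis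
        using l2norm_nonneg[of u] by (cases "?n = 0") (auto simp: W_def mult_le_cancel_right)
    next
      case False
      \<comment> \<open>Now \<open>Re z\<close> is small on both sides. Because
        \<open>\<eta> \<le> 1/2\<close> and \<open>k^2 r^(1/3) \<le> r\<close>, it is at most
        \<open>r / 2\<close>, so the imaginary part has to account for the remaining
        \<open>r / 2 + T\<close> of \<open>|z|\<close>.\<close>
      have Rez_abs: "\<bar>Re z\<bar> \<le> r / 2"
      proof -
        have "\<bar>Re z\<bar> \<le> \<eta> * (k\<^sup>2 * r powr (1/3))" using False Rez by linarith
        also have "\<dots> \<le> (1/2) * r" using \<eta>_half \<eta> lam_le by (intro mult_mono) auto
        finally show ?thesis by simp
      qed
      have Imz: "\<bar>Im z\<bar> \<ge> r / 2 + T" using cmod_le[of z] z Rez_abs by linarith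
      have star: "\<omega> y \<le> C3 * ((\<Sum>j\<in>UNIV. (G j y)\<^sup>2) + (B y)\<^sup>2 / r)" for y
      proof -
        define g where "g = (\<Sum>j\<in>UNIV. (G j y)\<^sup>2)"
        have B_eq: "B = (\<lambda>x. Im (W x))" by (rule ext) (simp add: B_def)
        have G_eq: "G j y = partial_deriv j V2 y" for j
          unfolding G_def B_eq W_deriv ..
        have g_eq: "g = (norm (gradient V2 y))\<^sup>2"
          unfolding g_def G_eq norm_vec_def L2_set_def gradient_def by (simp add: sum_nonneg)
        have g: "g \<ge> 0" by (simp add: g_def sum_nonneg)
        have B2: "(B y)\<^sup>2 / r \<ge> 0" using r by simp
        have "r \<le> (C3 - 1) * (g + (B y)\<^sup>2 / r)"
        proof (cases "norm (gradient V2 y) \<le> L")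
          case True
          \<comment> \<open>The assumption bounds \<open>|V2|\<close> by \<open>T + c0 g\<close>, so
            \<open>T\<close> cancels and \<open>r / 2\<close> is shared between \<open>|B|\<close>
            and \<open>c0 g\<close>; one of them is at least \<open>r / 4\<close>.\<close>
          have "\<bar>B y\<bar> \<ge> \<bar>Im z\<bar> - \<bar>V2 y\<bar>" unfolding B_eq by (simp add: W_def V2_def)
          then have "r / 2 \<le> \<bar>B y\<bar> + c0 * g" using hyp[OF True] Imz unfolding g_eq by linarith
          then consider "r / 4 \<le> \<bar>B y\<bar>" | "r / 4 \<le> c0 * g" by linarith
          then show ?thesis
          proof cases
            case 1
            then have "(r / 4)\<^sup>2 \<le> (B y)\<^sup>2" using r power_mono[of "r / 4" "\<bar>B y\<bar>" 2] by simp
            then have "r \<le> 16 * ((B y)\<^sup>2 / r)" using r by (simp add: field_simps power2_eq_square)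
            also have "\<dots> \<le> (C3 - 1) * (g + (B y)\<^sup>2 / r)"
              using C3 g B2 by (intro mult_mono) auto
            finally show ?thesis .
          next
            case 2
            then have "r \<le> (4 * c0) * g" by simp
            also have "\<dots> \<le> (C3 - 1) * (g + (B y)\<^sup>2 / r)"
              using C3 g B2 c0 by (intro mult_mono) auto
            finally show ?thesis .
          qed
        next
          case False
          then have "L\<^sup>2 \<le> g" unfolding g_eq using L by (intro power_mono) auto
          then have "1 \<le> g / L\<^sup>2" using L by simp
          then have "R * 1 \<le> R * (g / L\<^sup>2)" using R by (intro mult_left_mono) auto
          then have "r \<le> (R / L\<^sup>2) * g" using rR by simp
          also have "\<dots> \<le> (C3 - 1) * (g + (B y)\<^sup>2 / r)"
            using C3 g B2 R L by (intro mult_mono) auto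
          finally show ?thesis .
        qed
        moreover have "g \<le> g + (B y)\<^sup>2 / r" using B2 by simp
        moreover have "r + g \<le> C3 * Q" if "r \<le> (C3 - 1) * Q" "g \<le> Q" for Q
          using that by (simp add: left_diff_distrib)
        ultimately have "r + g \<le> C3 * (g + (B y)\<^sup>2 / r)" by blast
        then show ?thesis unfolding \<omega>_def g_def .
      qed
      have "\<eta> * (k\<^sup>2 / \<kappa>\<^sup>2) * l2norm u \<le> l2norm (schroedinger (k ^ 6) W u)"
      proof (rule lower_bound[OF u _ star k(1) refl k\<kappa> \<phi>])
        show "C3 > 0" using C3 by linarith
        show "C3 * (3 + real CARD('n) * (C + 4 * c1)) * \<phi> < 1"
          using E\<phi> unfolding E_def c1_eq .
        show "\<theta> = \<phi>\<^sup>2 / (6 + 16 * c1\<^sup>2)" unfolding \<theta>_def c1_eq ..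
        show "- (\<eta> * (k\<^sup>2 / \<kappa>\<^sup>2)) \<le> Re (W y)" for y
          using Re_nonneg[of y] Rez unfolding x\<kappa> W_def by simp
      qed (rule \<eta>_def)
      then show ?thesis by (simp add: x\<kappa> W_def)
    qed
  qed
qed

section \<open>Differentiation under the integral sign\<close>

text \<open>Full differentiability is obtained, not just the existence of partial derivatives: the
  first order remainder divided by the length of the increment is at most \<open>2 n Bd\<close>, so
  dominated convergence applies to it. The derivatives are dominated on the unit ball around
  \<open>x0\<close>.\<close>

lemma partial_deriv_integral:
  fixes f :: "real^'n \<Rightarrow> 'c \<Rightarrow> complex"
  assumes diff: "\<And>x y. (\<lambda>x. f x y) differentiable (at x)"
    and int: "\<And>x. integrable M (f x)"
    and bd: "\<And>j x y. norm (x - x0) \<le> 1 \<Longrightarrow> norm (partial_deriv j (\<lambda>x. f x y) x) \<le> Bd y"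
    and intB: "integrable M Bd"
  shows "(\<lambda>x. \<integral>y. f x y \<partial>M) differentiable (at x0)"
    and "partial_deriv j (\<lambda>x. \<integral>y. f x y \<partial>M) x0 = (\<integral>y. partial_deriv j (\<lambda>x. f x y) x0 \<partial>M)"
    and "integrable M (\<lambda>y. partial_deriv j (\<lambda>x. f x y) x0)"
proof -
  let ?d = "\<lambda>j y. partial_deriv j (\<lambda>x. f x y) x0"
  let ?F = "\<lambda>x. \<integral>y. f x y \<partial>M"
  have [measurable]: "f x \<in> borel_measurable M" for x using int by auto
  have Bd: "0 \<le> Bd y" for y using order_trans[OF norm_ge_zero bd[of x0]] by simp
  have [measurable]: "?d j \<in> borel_measurable M" for j
  proof (rule borel_measurable_LIMSEQ_metric)
    fix y show "(\<lambda>k. real (Suc k) *\<^sub>R (f (x0 + (1 / real (Suc k)) *\<^sub>R axis j 1) y - f x0 y)) \<longlonglongrightarrow> ?d j y"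
      by (rule tendsto_difference_quotient[OF diff])
  qed simp
  show int_d: "integrable M (?d j)" for j
    by (rule Bochner_Integration.integrable_bound[OF intB]) (use bd[of x0] in \<open>auto intro: order_trans[OF _ abs_ge_self]\<close>)
  let ?D = "\<lambda>h. \<Sum>j\<in>UNIV. (h $ j) *\<^sub>R (\<integral>y. ?d j y \<partial>M)"
  have "(?F has_derivative ?D) (at x0)"
    unfolding has_derivative_at
  proof
    show "bounded_linear ?D"
      by (intro bounded_linear_sum bounded_linear_scaleR_const bounded_linear_vec_nth)
    \<comment> \<open>Restricting to increments of length at most 1 keeps the segments inside the
      ball where \<open>Bd\<close> dominates, and passing to sequences makes dominated convergence
      available.\<close>
    have "((\<lambda>h. norm (?F (x0 + h) - ?F x0 - ?D h) / norm h) \<longlongrightarrow> 0) (at 0 within cball 0 1)"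
      unfolding tendsto_at_iff_sequentially
    proof (intro allI impI)
      fix X :: "nat \<Rightarrow> real^'n"
      assume X: "\<forall>i. X i \<in> cball 0 1 - {0}" and lim: "X \<longlonglongrightarrow> 0"
      let ?s = "\<lambda>k y. norm (f (x0 + X k) y - f x0 y - (\<Sum>j\<in>UNIV. (X k $ j) *\<^sub>R ?d j y)) / norm (X k)"
      have lim0: "(\<lambda>k. \<integral>y. ?s k y \<partial>M) \<longlonglongrightarrow> (\<integral>y. 0 \<partial>M)"
      proof (rule integral_dominated_convergence)
        show "integrable M (\<lambda>y. 2 * real CARD('n) * Bd y)" using intB by simp
        show "AE y in M. (\<lambda>k. ?s k y) \<longlonglongrightarrow> 0"
        proof (rule AE_I2)
          fix y
          have "((\<lambda>x. f x y) has_derivative (\<lambda>h. \<Sum>j\<in>UNIV. (h $ j) *\<^sub>R ?d j y)) (at x0)"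
            by (rule has_derivative_partial_derivs[OF diff])
          then have "((\<lambda>h. norm (f (x0 + h) y - f x0 y - (\<Sum>j\<in>UNIV. (h $ j) *\<^sub>R ?d j y)) / norm h) \<longlongrightarrow> 0) (at 0)"
            by (simp add: has_derivative_at)
          moreover have "filterlim X (at 0) sequentially"
            using X lim by (auto simp: filterlim_at)
          ultimately show "(\<lambda>k. ?s k y) \<longlonglongrightarrow> 0" by (rule filterlim_compose)
        qed
        fix k
        have Xk: "norm (X k) \<le> 1" "norm (X k) > 0" using X by auto
        have "?s k y \<le> 2 * real CARD('n) * Bd y" for y
        proof -
          have "norm (f (x0 + X k) y - f x0 y) \<le> real CARD('n) * Bd y * norm (X k)"
          proof (rule norm_increment_le[OF diff])
            fix s :: real and j assume "0 \<le> s" "s \<le> 1"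
            then have "norm (s *\<^sub>R X k) \<le> 1" using Xk by (simp add: mult_le_one)
            then show "norm (partial_deriv j (\<lambda>x. f x y) (x0 + s *\<^sub>R X k)) \<le> Bd y" by (intro bd) simp
          qed
          moreover have "norm (\<Sum>j\<in>UNIV. (X k $ j) *\<^sub>R ?d j y) \<le> (\<Sum>j\<in>(UNIV::'n set). norm (X k) * Bd y)"
            using bd[of x0] by (intro order_trans[OF norm_sum] sum_mono)
              (auto intro!: mult_mono component_le_norm_cart)
          ultimately have "norm (f (x0 + X k) y - f x0 y - (\<Sum>j\<in>UNIV. (X k $ j) *\<^sub>R ?d j y))
             \<le> (2 * real CARD('n) * Bd y) * norm (X k)"
            using norm_triangle_ineq4[of "f (x0 + X k) y - f x0 y" "\<Sum>j\<in>UNIV. (X k $ j) *\<^sub>R ?d j y"]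
            by (simp add: mult_ac)
          then show ?thesis using Xk by (subst pos_divide_le_eq) auto
        qed
        then show "AE y in M. norm (?s k y) \<le> 2 * real CARD('n) * Bd y" by simp
      qed simp_all
      have le: "norm (norm (?F (x0 + X k) - ?F x0 - ?D (X k)) / norm (X k)) \<le> (\<integral>y. ?s k y \<partial>M)" for k
      proof -
        have i: "integrable M (\<lambda>y. f (x0 + X k) y - f x0 y - (\<Sum>j\<in>UNIV. (X k $ j) *\<^sub>R ?d j y))"
          using int int_d by (intro Bochner_Integration.integrable_diff Bochner_Integration.integrable_sum) auto
        have eq: "?F (x0 + X k) - ?F x0 - ?D (X k) = (\<integral>y. f (x0 + X k) y - f x0 y - (\<Sum>j\<in>UNIV. (X k $ j) *\<^sub>R ?d j y) \<partial>M)"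
          using int int_d by simp
        have "norm (?F (x0 + X k) - ?F x0 - ?D (X k))
            \<le> (\<integral>y. norm (f (x0 + X k) y - f x0 y - (\<Sum>j\<in>UNIV. (X k $ j) *\<^sub>R ?d j y)) \<partial>M)"
          unfolding eq by (rule integral_norm_bound)
        then show ?thesis by (simp add: divide_right_mono)
      qed
      show "((\<lambda>h. norm (?F (x0 + h) - ?F x0 - ?D h) / norm h) \<circ> X) \<longlonglongrightarrow> 0"
        unfolding comp_def
        by (rule Lim_null_comparison[OF always_eventually[OF allI[OF le]] lim0[unfolded integral_zero]])
    qed
    then show "(\<lambda>h. norm (?F (x0 + h) - ?F x0 - ?D h) / norm h) \<midarrow>0\<rightarrow> 0"
      by (subst (asm) at_within_interior) auto
  qed
  then show "?F differentiable (at x0)" using differentiable_def by blast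
  show "partial_deriv j ?F x0 = (\<integral>y. ?d j y \<partial>M)"
  proof -
    have "(\<Sum>i\<in>UNIV. (axis j 1 $ i) *\<^sub>R c i) = c j" for c :: "'n \<Rightarrow> complex"
      by (subst sum.remove[of UNIV j]) (auto simp: axis_def intro!: sum.neutral)
    then show ?thesis
      using partial_deriv_eqI[OF \<open>(?F has_derivative ?D) (at x0)\<close>, of j] by (simp only:)
  qed
qed

section \<open>Fourier inversion\<close>

definition character :: "real^'n \<Rightarrow> real^'n \<Rightarrow> complex" where
  "character t \<xi> = exp (2 * of_real pi * \<i> * of_real (t \<bullet> \<xi>))"

lemma character_commute: "character t \<xi> = character \<xi> t"
  by (simp add: character_def inner_commute)

lemma norm_character [simp]: "norm (character t \<xi>) = 1"
proof -
  have "character t \<xi> = exp (\<i> * of_real (2 * pi * (t \<bullet> \<xi>)))" by (simp add: character_def mult_ac)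
  then show ?thesis by (simp only: norm_exp_i_times)
qed

lemma character_borel [measurable (raw)]:
  assumes "f \<in> borel_measurable M" "g \<in> borel_measurable M"
  shows "(\<lambda>x. character (f x) (g x)) \<in> borel_measurable M"
  using assms unfolding character_def by measurable

lemma character_deriv:
  "partial_deriv j (\<lambda>t. character (a + c *\<^sub>R t) \<xi>) t
     = 2 * of_real pi * \<i> * of_real (c * \<xi> $ j) * character (a + c *\<^sub>R t) \<xi>"
  "(\<lambda>t. character (a + c *\<^sub>R t) \<xi>) differentiable (at t)"
proof -
  have "((\<lambda>t. 2 * of_real pi * \<i> * of_real ((a + c *\<^sub>R t) \<bullet> \<xi>)) has_derivative
      (\<lambda>h. 2 * of_real pi * \<i> * of_real (c * (h \<bullet> \<xi>)))) (at t)"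
    by (auto intro!: derivative_eq_intros)
  moreover have "(exp has_derivative (\<lambda>w. exp z * w)) (at z)" for z :: complex
    using DERIV_exp[of z] by (simp add: has_field_derivative_def)
  ultimately have d: "((\<lambda>t. character (a + c *\<^sub>R t) \<xi>) has_derivative
      (\<lambda>h. character (a + c *\<^sub>R t) \<xi> * (2 * of_real pi * \<i> * of_real (c * (h \<bullet> \<xi>))))) (at t)"
    unfolding character_def by (rule has_derivative_compose)
  show "partial_deriv j (\<lambda>t. character (a + c *\<^sub>R t) \<xi>) t
     = 2 * of_real pi * \<i> * of_real (c * \<xi> $ j) * character (a + c *\<^sub>R t) \<xi>"
    using partial_deriv_eqI[OF d, of j] by (simp add: inner_axis' mult_ac)
  show "(\<lambda>t. character (a + c *\<^sub>R t) \<xi>) differentiable (at t)" using d differentiable_def by blast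
qed

lemma character_poly_C1: "poly_C1 (\<lambda>t. character (a + c *\<^sub>R t) \<xi>)"
proof -
  have "partial_deriv j (\<lambda>t. character (a + c *\<^sub>R t) \<xi>)
      = (\<lambda>t. 2 * of_real pi * \<i> * of_real (c * \<xi> $ j) * character (a + c *\<^sub>R t) \<xi>)" for j
    by (rule ext) (rule character_deriv(1))
  moreover have "poly_bounded (\<lambda>t. k * character (a + c *\<^sub>R t) \<xi>)" for k
    by (rule poly_bounded_bounded[of _ "norm k"]) (simp add: norm_mult)
  moreover from this[of 1] have "poly_bounded (\<lambda>t. character (a + c *\<^sub>R t) \<xi>)" by simp
  ultimately show ?thesis
    unfolding poly_C1_def by (simp add: character_deriv(2) del: of_real_mult)
qed

text \<open>The usual transform at \<open>\<xi>\<close> multiplied by the phase at \<open>x\<close>.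
  In this form it is the inner integral of the Weyl quantization, and inversion is plain integration
  over \<open>\<xi>\<close>.\<close>

definition fourier :: "(real^'n \<Rightarrow> complex) \<Rightarrow> real^'n \<Rightarrow> real^'n \<Rightarrow> complex" where
  "fourier w x \<xi> = (\<integral>y. character (x - y) \<xi> * w y \<partial>lborel)"

lemma fourier_integrable:
  "integrable lborel w \<Longrightarrow> integrable lborel (\<lambda>y. character (x - y) \<xi> * w y)"
  by (rule Bochner_Integration.integrable_bound[of _ w]) (auto simp: norm_mult)

lemma fourier_partial_deriv:
  assumes "w \<in> schwartz"
  shows "fourier (partial_deriv j w) x \<xi> = 2 * of_real pi * \<i> * of_real (\<xi> $ j) * fourier w x \<xi>"
proof -
  have 1: "poly_C1 (\<lambda>y. character (x - y) \<xi>)"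
    using character_poly_C1[of x "-1" \<xi>] by simp
  have 2: "partial_deriv j (\<lambda>y. character (x - y) \<xi>) y
      = - (2 * of_real pi * \<i> * of_real (\<xi> $ j) * character (x - y) \<xi>)" for y
    using character_deriv(1)[of j x "-1" \<xi> y] by simp
  have "fourier (partial_deriv j w) x \<xi> = (\<integral>y. partial_deriv j w y * character (x - y) \<xi> \<partial>lborel)"
    by (simp add: fourier_def mult.commute)
  also have "\<dots> = - (\<integral>y. w y * partial_deriv j (\<lambda>y. character (x - y) \<xi>) y \<partial>lborel)"
    by (rule integral_by_parts(1)[OF schwartz_rapid_C1[OF assms] 1])
  also have "\<dots> = (\<integral>y. 2 * of_real pi * \<i> * of_real (\<xi> $ j) * (character (x - y) \<xi> * w y) \<partial>lborel)"
    unfolding 2 by (simp add: mult_ac)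
  also have "\<dots> = 2 * of_real pi * \<i> * of_real (\<xi> $ j) * fourier w x \<xi>"
    unfolding fourier_def by (rule integral_mult_right_zero)
  finally show ?thesis .
qed

lemma fourier_add:
  "integrable lborel v \<Longrightarrow> integrable lborel w \<Longrightarrow> fourier (\<lambda>y. v y + w y) x \<xi> = fourier v x \<xi> + fourier w x \<xi>"
  unfolding fourier_def distrib_left by (intro Bochner_Integration.integral_add fourier_integrable)

lemma fourier_cmult: "fourier (\<lambda>y. c * w y) x \<xi> = c * fourier w x \<xi>"
  unfolding fourier_def integral_mult_right_zero[symmetric] by (simp add: mult_ac)

lemma fourier_sum:
  assumes "finite I" "\<And>i. i \<in> I \<Longrightarrow> integrable lborel (w i)"
  shows "fourier (\<lambda>y. \<Sum>i\<in>I. w i y) x \<xi> = (\<Sum>i\<in>I. fourier (w i) x \<xi>)"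
  unfolding fourier_def sum_distrib_left by (intro Bochner_Integration.integral_sum fourier_integrable assms)

lemma norm_power2_sum: "(norm (\<xi>::real^'n))\<^sup>2 = (\<Sum>j\<in>UNIV. (\<xi> $ j)\<^sup>2)"
  unfolding norm_vec_def L2_set_def by (simp add: sum_nonneg)

lemma fourier_laplacian:
  assumes "w \<in> schwartz"
  shows "fourier (laplacian w) x \<xi> = - (4 * of_real (pi\<^sup>2) * of_real ((norm \<xi>)\<^sup>2)) * fourier w x \<xi>"
proof -
  have "fourier (laplacian w) x \<xi> = (\<Sum>j\<in>UNIV. fourier (partial_deriv j (partial_deriv j w)) x \<xi>)"
    unfolding laplacian_def[abs_def]
    by (intro fourier_sum schwartz_integrable schwartz_partial_deriv assms) simp
  also have "\<dots> = (\<Sum>j\<in>UNIV. - (4 * of_real (pi\<^sup>2) * of_real ((\<xi> $ j)\<^sup>2)) * fourier w x \<xi>)"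
    by (simp add: fourier_partial_deriv schwartz_partial_deriv assms power2_eq_square)
       (simp add: mult_ac)
  also have "\<dots> = - (4 * of_real (pi\<^sup>2) * of_real ((norm \<xi>)\<^sup>2)) * fourier w x \<xi>"
    by (simp add: norm_power2_sum sum_distrib_left sum_distrib_right sum_negf)
  finally show ?thesis .
qed

lemma norm_fourier_le:
  assumes "integrable lborel w"
  shows "norm (fourier w x \<xi>) \<le> (\<integral>y. norm (w y) \<partial>lborel)"
  unfolding fourier_def
  using integral_norm_bound[of lborel "\<lambda>y. character (x - y) \<xi> * w y"] by (simp add: norm_mult)

lemma fourier_borel [measurable]:
  assumes [measurable]: "w \<in> borel_measurable borel"
  shows "fourier w x \<in> borel_measurable borel"
proof -
  have "(\<lambda>\<xi>. \<integral>y. character (x - y) \<xi> * w y \<partial>lborel) \<in> borel_measurable borel"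
    by (rule lborel.borel_measurable_lebesgue_integral) measurable
  then show ?thesis by (simp add: fourier_def[abs_def])
qed

text \<open>Multiplying the transform by \<open>1 + |\<xi>|^2\<close> gives the transform of
  \<open>w - laplacian w / (4 \<pi>^2)\<close>, again a Schwartz function; hence the induction with
  \<open>w\<close> arbitrary.\<close>

lemma fourier_decay:
  assumes "w \<in> schwartz"
  shows "\<exists>C. \<forall>\<xi>. (1 + (norm \<xi>)\<^sup>2) ^ k * norm (fourier w x \<xi>) \<le> C"
  using assms
proof (induction k arbitrary: w)
  case 0
  show ?case using norm_fourier_le[OF schwartz_integrable[OF 0]] by auto
next
  case (Suc k)
  define v where "v y = w y + (- of_real (1 / (4 * pi\<^sup>2))) * laplacian w y" for y
  have v: "v \<in> schwartz"
    unfolding v_def[abs_def] by (intro schwartz_add schwartz_cmult laplacian_schwartz Suc.prems)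
  have "fourier v x \<xi> = of_real (1 + (norm \<xi>)\<^sup>2) * fourier w x \<xi>" for \<xi>
  proof -
    have "fourier v x \<xi> = fourier w x \<xi> + (- of_real (1 / (4 * pi\<^sup>2))) * fourier (laplacian w) x \<xi>"
      unfolding v_def[abs_def] fourier_cmult[symmetric]
      by (intro fourier_add schwartz_integrable schwartz_cmult laplacian_schwartz Suc.prems)
    then show ?thesis
      unfolding fourier_laplacian[OF Suc.prems] by (simp add: algebra_simps)
  qed
  then have eq: "(1 + (norm \<xi>)\<^sup>2) ^ Suc k * norm (fourier w x \<xi>) = (1 + (norm \<xi>)\<^sup>2) ^ k * norm (fourier v x \<xi>)" for \<xi>
    by (simp add: norm_mult del: of_real_add of_real_power)
  show ?case unfolding eq by (rule Suc.IH[OF v])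
qed

lemma fourier_integrable_frequency:
  assumes "w \<in> schwartz" shows "integrable lborel (fourier w x)"
proof -
  let ?N = "DIM(real^'a) + 2"
  obtain C where C: "\<And>\<xi>. (1 + (norm \<xi>)\<^sup>2) ^ ?N * norm (fourier w x \<xi>) \<le> C"
    using fourier_decay[OF assms] by blast
  show ?thesis
  proof (rule integrable_decay)
    show "fourier w x \<in> borel_measurable borel" by (intro fourier_borel schwartz_borel assms)
    fix \<xi> :: "real^'a"
    have "norm \<xi> \<le> 1 + (norm \<xi>)\<^sup>2"
      using sum_squares_bound[of 1 "norm \<xi>"] norm_ge_zero[of \<xi>] unfolding mult_1_right power_one by linarith
    moreover have "1 + t \<le> 2 * (1 + q)" if "t \<le> 1 + q" "0 \<le> q" for t q :: real using that by simp
    ultimately have "1 + norm \<xi> \<le> 2 * (1 + (norm \<xi>)\<^sup>2)" using zero_le_power2 by blast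
    then have "(1 + norm \<xi>) ^ ?N \<le> 2 ^ ?N * (1 + (norm \<xi>)\<^sup>2) ^ ?N"
      unfolding power_mult_distrib[symmetric] by (intro power_mono) auto
    then have "(1 + norm \<xi>) ^ ?N * norm (fourier w x \<xi>) \<le> 2 ^ ?N * ((1 + (norm \<xi>)\<^sup>2) ^ ?N * norm (fourier w x \<xi>))"
      unfolding mult.assoc[symmetric] by (intro mult_right_mono) auto
    also have "\<dots> \<le> 2 ^ ?N * C" by (intro mult_left_mono C) auto
    finally show "(1 + norm \<xi>) ^ ?N * norm (fourier w x \<xi>) \<le> 2 ^ ?N * C" .
  qed
qed

section \<open>Gaussian approximate identities and Fourier inversion\<close>

lemma gaussian_integrable: "a > 0 \<Longrightarrow> integrable lborel (gaussian a c)"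
  by (rule rapidly_decreasing_integrable[OF gaussian_rapidly_decreasing]) auto

text \<open>In each coordinate the factor is the centred normal density of variance
  \<open>1 / (2 \<pi>)\<close>.\<close>

lemma integral_gaussian_pi: "(\<integral>x. gaussian pi (0::real^'n) x \<partial>lborel) = 1"
proof -
  have 1: "exp (- pi * t\<^sup>2) = normal_density 0 (sqrt (1 / (2 * pi))) t" for t
    by (simp add: normal_density_def real_sqrt_divide field_simps)
  have 2: "(\<integral>\<^sup>+t. ennreal (exp (- pi * t\<^sup>2)) \<partial>lborel) = 1"
    unfolding 1 by (subst nn_integral_eq_integral) auto
  have "gaussian pi 0 x = (\<Prod>b\<in>Basis. exp (- pi * (x \<bullet> b)\<^sup>2))" for x :: "real^'n"
  proof -
    have "(norm x)\<^sup>2 = (\<Sum>b\<in>Basis. (x \<bullet> b)\<^sup>2)"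
      unfolding power2_norm_eq_inner by (subst euclidean_inner) (simp add: power2_eq_square)
    then show ?thesis by (simp add: gaussian_def exp_sum[symmetric] sum_distrib_left sum_negf)
  qed
  then have "(\<integral>\<^sup>+x. ennreal (gaussian pi (0::real^'n) x) \<partial>lborel)
      = (\<integral>\<^sup>+x. (\<Prod>b\<in>Basis. ennreal (exp (- pi * ((x::real^'n) \<bullet> b)\<^sup>2))) \<partial>lborel)"
    by (simp add: prod_ennreal)
  also have "\<dots> = (\<Prod>b\<in>(Basis::(real^'n) set). (\<integral>\<^sup>+t. ennreal (exp (- pi * t\<^sup>2)) \<partial>lborel))"
    by (rule nn_integral_lborel_prod) auto
  also have "\<dots> = 1" unfolding 2 by simp
  finally show ?thesis
    using nn_integral_eq_integral[OF gaussian_integrable[OF pi_gt_zero, of "0::real^'n"]]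
    by (simp add: less_imp_le)
qed

lemma integral_gaussian_scaled:
  assumes "\<epsilon> > 0"
  shows "(\<integral>x. gaussian (pi * \<epsilon>\<^sup>2) (0::real^'n) x \<partial>lborel) = 1 / \<epsilon> ^ CARD('n)"
proof -
  have "gaussian pi 0 (0 + \<epsilon> *\<^sub>R x) = gaussian (pi * \<epsilon>\<^sup>2) 0 x" for x :: "real^'n"
    by (simp add: gaussian_def power_mult_distrib)
  then show ?thesis
    using integral_affine[of "gaussian pi (0::real^'n)" \<epsilon> 0] assms
    by (simp add: integral_gaussian_pi field_simps)
qed

text \<open>The approximate identity at scale \<open>\<epsilon>\<close>. A Gaussian is chosen
  because it is a Schwartz function and at the same time an explicit Fourier transform, so one
  kernel serves both inversion and the regularization of weak solutions.\<close>

definition mollifier :: "real \<Rightarrow> real^'n \<Rightarrow> real" where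
  "mollifier \<epsilon> t = gaussian (pi / \<epsilon>\<^sup>2) 0 t / \<epsilon> ^ CARD('n)"

text \<open>The Fourier transform \<open>F\<close> of a Gaussian satisfies \<open>\<partial>\<^sub>j F(t) = - 2 \<pi> t\<^sub>j F(t) / \<epsilon>\<^sup>2\<close>.\<close>

lemma gaussian_character:
  fixes t :: "real^'n"
  assumes \<epsilon>: "\<epsilon> > 0"
  shows "(\<integral>\<xi>. character t \<xi> * of_real (gaussian (pi * \<epsilon>\<^sup>2) 0 \<xi>) \<partial>lborel) = of_real (mollifier \<epsilon> t)"
proof -
  define g where "g = (\<lambda>\<xi>::real^'n. complex_of_real (gaussian (pi * \<epsilon>\<^sup>2) 0 \<xi>))"
  define F where "F = (\<lambda>t. \<integral>\<xi>. character t \<xi> * g \<xi> \<partial>lborel)"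
  have a: "pi * \<epsilon>\<^sup>2 > 0" using \<epsilon> by simp
  have g: "g \<in> schwartz" unfolding g_def by (rule gaussian_schwartz[OF a])
  have [measurable]: "g \<in> borel_measurable borel" by (rule schwartz_borel[OF g])
  have g': "partial_deriv j g \<xi> = - of_real (2 * pi * \<epsilon>\<^sup>2 * \<xi> $ j) * g \<xi>" for j \<xi>
    unfolding g_def by (simp add: partial_deriv_of_real(1)[OF gaussian_deriv(2)] gaussian_deriv(1))
  have int: "integrable lborel (\<lambda>\<xi>. character t \<xi> * g \<xi>)" for t
    by (rule Bochner_Integration.integrable_bound[OF schwartz_integrable[OF g]]) (auto simp: norm_mult)
  have diff: "(\<lambda>t. character t \<xi> * g \<xi>) differentiable (at t)" for t \<xi>
    using character_deriv(2)[of 0 1 \<xi> t] by (intro differentiable_mult) auto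
  have d: "partial_deriv j (\<lambda>t. character t \<xi> * g \<xi>) t
      = 2 * of_real pi * \<i> * of_real (\<xi> $ j) * character t \<xi> * g \<xi>" for j t \<xi>
    using partial_deriv_cmult(1)[OF character_deriv(2)[of 0 1 \<xi> t], of j "g \<xi>"] character_deriv(1)[of j 0 1 \<xi> t]
    by (simp add: mult_ac)
  define Bd where "Bd = (\<lambda>\<xi>::real^'n. 2 * pi * (norm \<xi> * norm (g \<xi>)))"
  have "rapidly_decreasing (\<lambda>\<xi>. norm \<xi> * norm (g \<xi>))"
    by (rule rapidly_decreasing_dominated[OF schwartz_rapidly_decreasing[OF g] poly_bounded_norm]) (simp add: mult.commute)
  then have intB: "integrable lborel Bd"
    unfolding Bd_def by (intro integrable_mult_right rapidly_decreasing_integrable) auto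
  have bd: "norm (partial_deriv j (\<lambda>t. character t \<xi> * g \<xi>) t) \<le> Bd \<xi>" for j t \<xi>
    unfolding d Bd_def
    by (auto simp: norm_mult mult.assoc intro!: mult_right_mono component_le_norm_cart)
  note F_diff = partial_deriv_integral(1)[OF diff int bd intB, folded F_def]
  have F': "partial_deriv j F t = - of_real (2 * pi / \<epsilon>\<^sup>2 * t $ j) * F t" for j t
  proof -
    have "partial_deriv j F t = (\<integral>\<xi>. 2 * of_real pi * \<i> * of_real (\<xi> $ j) * character t \<xi> * g \<xi> \<partial>lborel)"
      using partial_deriv_integral(2)[OF diff int bd intB, folded F_def] unfolding d .
    \<comment> \<open>The factor \<open>\<xi>_j\<close> brought down by the character is reabsorbed
      into a derivative of the Gaussian; integrating by parts then brings down \<open>t_j\<close>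
      instead.\<close>
    also have "\<dots> = (\<integral>\<xi>. (- \<i> / of_real (\<epsilon>\<^sup>2)) * (partial_deriv j g \<xi> * character t \<xi>) \<partial>lborel)"
      unfolding g' using \<epsilon> by (intro Bochner_Integration.integral_cong) (auto simp: field_simps)
    also have "\<dots> = (- \<i> / of_real (\<epsilon>\<^sup>2)) * (\<integral>\<xi>. partial_deriv j g \<xi> * character t \<xi> \<partial>lborel)"
      by (rule integral_mult_right_zero)
    also have "(\<integral>\<xi>. partial_deriv j g \<xi> * character t \<xi> \<partial>lborel)
        = - (\<integral>\<xi>. g \<xi> * partial_deriv j (character t) \<xi> \<partial>lborel)"
    proof -
      have "character (0 + 1 *\<^sub>R \<xi>) t = character t \<xi>" for \<xi>
        by (simp add: character_commute[of t])
      then show ?thesis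
        using integral_by_parts(1)[OF schwartz_rapid_C1[OF g] character_poly_C1[of 0 1 t], of j]
        by (simp only:)
    qed
    also have "(\<integral>\<xi>. g \<xi> * partial_deriv j (character t) \<xi> \<partial>lborel)
        = (\<integral>\<xi>. (2 * of_real pi * \<i> * of_real (t $ j)) * (character t \<xi> * g \<xi>) \<partial>lborel)"
    proof -
      have "partial_deriv j (character t) \<xi> = 2 * of_real pi * \<i> * of_real (t $ j) * character t \<xi>" for \<xi>
      proof -
        have "(\<lambda>\<xi>. character (0 + 1 *\<^sub>R \<xi>) t) = character t"
          by (rule ext) (simp add: character_commute[of t])
        then show ?thesis
          using character_deriv(1)[of j 0 1 t \<xi>] by (simp add: character_commute[of t])
      qed
      then show ?thesis by (simp add: mult_ac)
    qed
    also have "\<dots> = (2 * of_real pi * \<i> * of_real (t $ j)) * F t"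
      unfolding F_def by (rule integral_mult_right_zero)
    finally show ?thesis using \<epsilon> by (simp add: field_simps)
  qed
  \<comment> \<open>The reciprocal of the expected solution. The product of \<open>F\<close> with it
    has vanishing gradient, so it keeps its value at 0.\<close>
  define E where "E = (\<lambda>t::real^'n. complex_of_real (gaussian (- pi / \<epsilon>\<^sup>2) 0 t))"
  have E_diff: "E differentiable (at t)" for t
    unfolding E_def by (rule partial_deriv_of_real(2)[OF gaussian_deriv(2)])
  have E': "partial_deriv j E t = of_real (2 * pi / \<epsilon>\<^sup>2 * t $ j) * E t" for j t
    unfolding E_def by (simp add: partial_deriv_of_real(1)[OF gaussian_deriv(2)] gaussian_deriv(1))
  have "norm ((\<lambda>t. F t * E t) (0 + t) - (\<lambda>t. F t * E t) 0) \<le> real CARD('n) * 0 * norm t"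
  proof (rule norm_increment_le)
    show "(\<lambda>t. F t * E t) differentiable (at t)" for t by (intro differentiable_mult F_diff E_diff)
    show "norm (partial_deriv j (\<lambda>t. F t * E t) (0 + s *\<^sub>R t)) \<le> 0" for s j
      by (subst partial_deriv_mult[OF F_diff E_diff]) (simp add: F' E')
  qed
  then have "F t * E t = F 0 * E 0" by simp
  moreover have "E t * of_real (gaussian (pi / \<epsilon>\<^sup>2) 0 t) = 1"
    unfolding E_def of_real_mult[symmetric] by (simp add: gaussian_def exp_add[symmetric])
  moreover have "E 0 = 1" by (simp add: E_def gaussian_def)
  moreover have "F 0 = of_real (1 / \<epsilon> ^ CARD('n))"
  proof -
    have "F 0 = (\<integral>\<xi>. of_real (gaussian (pi * \<epsilon>\<^sup>2) (0::real^'n) \<xi>) \<partial>lborel)"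
      by (simp add: F_def g_def character_def)
    also have "\<dots> = of_real (1 / \<epsilon> ^ CARD('n))"
      unfolding integral_complex_of_real integral_gaussian_scaled[OF \<epsilon>] ..
    finally show ?thesis .
  qed
  ultimately have "F t = of_real (1 / \<epsilon> ^ CARD('n)) * of_real (gaussian (pi / \<epsilon>\<^sup>2) 0 t)"
    by (metis mult.assoc mult.right_neutral)
  then show ?thesis by (simp add: F_def g_def mollifier_def)
qed

lemma mollifier_borel [measurable]: "mollifier \<epsilon> \<in> borel_measurable borel"
  unfolding mollifier_def[abs_def] by measurable

text \<open>The substitution \<open>y = x - \<epsilon> t\<close> moves \<open>\<epsilon>\<close>
  from the kernel into the argument of \<open>f\<close>, so that limits in \<open>\<epsilon>\<close>
  can be dominated by a function of \<open>t\<close> alone.\<close>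

lemma mollifier_subst:
  fixes f :: "real^'n \<Rightarrow> 'b::{second_countable_topology,banach}"
  assumes [measurable]: "f \<in> borel_measurable borel" and \<epsilon>: "\<epsilon> > 0"
  shows "(\<integral>y. mollifier \<epsilon> (x - y) *\<^sub>R f y \<partial>lborel) = (\<integral>t. gaussian pi 0 t *\<^sub>R f (x - \<epsilon> *\<^sub>R t) \<partial>lborel)"
proof -
  have "mollifier \<epsilon> (\<epsilon> *\<^sub>R t) = gaussian pi 0 t / \<epsilon> ^ CARD('n)" for t :: "real^'n"
    using \<epsilon> by (simp add: mollifier_def gaussian_def power_mult_distrib)
  then show ?thesis
    using integral_affine[of "\<lambda>y. mollifier \<epsilon> (x - y) *\<^sub>R f y" "- \<epsilon>" x] \<epsilon>
    by (simp flip: integral_scaleR_right)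
qed

lemma mollifier_tendsto:
  fixes f :: "real^'n \<Rightarrow> 'b::{second_countable_topology,banach}"
  assumes [measurable]: "f \<in> borel_measurable borel" and bd: "\<And>y. norm (f y) \<le> C" and cont: "isCont f x"
  shows "(\<lambda>k. \<integral>y. mollifier (1 / real (Suc k)) (x - y) *\<^sub>R f y \<partial>lborel) \<longlonglongrightarrow> f x"
proof -
  have "(\<lambda>k. \<integral>t. gaussian pi 0 t *\<^sub>R f (x - (1 / real (Suc k)) *\<^sub>R t) \<partial>lborel)
      \<longlonglongrightarrow> (\<integral>t. gaussian pi (0::real^'n) t *\<^sub>R f x \<partial>lborel)"
  proof (rule integral_dominated_convergence)
    show "integrable lborel (\<lambda>t::real^'n. gaussian pi 0 t * C)"
      by (intro integrable_mult_left gaussian_integrable) simp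
    show "AE t in lborel. (\<lambda>k. gaussian pi 0 t *\<^sub>R f (x - (1 / real (Suc k)) *\<^sub>R t)) \<longlonglongrightarrow> gaussian pi 0 t *\<^sub>R f x"
    proof (intro AE_I2 tendsto_scaleR tendsto_const)
      fix t :: "real^'n"
      have "(\<lambda>k. 1 / real (Suc k)) \<longlonglongrightarrow> 0"
        using LIMSEQ_inverse_real_of_nat unfolding inverse_eq_divide .
      then have "(\<lambda>k. x - (1 / real (Suc k)) *\<^sub>R t) \<longlonglongrightarrow> x - 0 *\<^sub>R t"
        by (intro tendsto_diff tendsto_scaleR tendsto_const)
      then show "(\<lambda>k. f (x - (1 / real (Suc k)) *\<^sub>R t)) \<longlonglongrightarrow> f x"
        using isCont_tendsto_compose[OF cont] by simp
    qed
    show "AE t in lborel. norm (gaussian pi 0 t *\<^sub>R f (x - (1 / real (Suc k)) *\<^sub>R t)) \<le> gaussian pi 0 t * C" for k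
      using bd by (auto simp: less_imp_le)
  qed measurable
  also have "(\<integral>t. gaussian pi (0::real^'n) t *\<^sub>R f x \<partial>lborel) = f x"
    using gaussian_integrable[of pi "0::real^'n"] by (simp add: integral_gaussian_pi)
  finally show ?thesis by (simp add: mollifier_subst)
qed

text \<open>A Gaussian factor in \<open>\<xi>\<close> makes the double integral absolutely
  convergent, and after exchanging the integrals the inner one is a mollifier. As the factor tends
  to 1, one side converges because the transform is integrable, the other because \<open>w\<close>
  is bounded and continuous.\<close>

lemma fourier_inversion:
  fixes w :: "real^'n \<Rightarrow> complex"
  assumes w: "w \<in> schwartz"
  shows "(\<integral>\<xi>. fourier w x \<xi> \<partial>lborel) = w x"
proof -
  have [measurable]: "w \<in> borel_measurable borel" by (rule schwartz_borel[OF w])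
  let ?e = "\<lambda>k. 1 / real (Suc k)"
  let ?g = "\<lambda>k \<xi>. complex_of_real (gaussian (pi * (?e k)\<^sup>2) (0::real^'n) \<xi>)"
  have int: "integrable lborel (fourier w x)" by (rule fourier_integrable_frequency[OF w])
  have "(\<lambda>k. \<integral>\<xi>. fourier w x \<xi> * ?g k \<xi> \<partial>lborel) \<longlonglongrightarrow> (\<integral>\<xi>. fourier w x \<xi> \<partial>lborel)"
  proof (rule integral_dominated_convergence)
    show "integrable lborel (\<lambda>\<xi>. norm (fourier w x \<xi>))" using int by simp
    show "AE \<xi> in lborel. (\<lambda>k. fourier w x \<xi> * ?g k \<xi>) \<longlonglongrightarrow> fourier w x \<xi>"
    proof (rule AE_I2)
      fix \<xi> :: "real^'n"
      have "?e \<longlonglongrightarrow> 0" using LIMSEQ_inverse_real_of_nat unfolding inverse_eq_divide .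
      then have "(\<lambda>k. fourier w x \<xi> * complex_of_real (exp (- (pi * (?e k)\<^sup>2) * (norm (\<xi> - 0))\<^sup>2)))
         \<longlonglongrightarrow> fourier w x \<xi> * complex_of_real (exp (- (pi * 0\<^sup>2) * (norm (\<xi> - 0))\<^sup>2))"
        by (intro tendsto_mult tendsto_const tendsto_of_real tendsto_exp tendsto_minus tendsto_power)
      then show "(\<lambda>k. fourier w x \<xi> * ?g k \<xi>) \<longlonglongrightarrow> fourier w x \<xi>" by (simp add: gaussian_def)
    qed
    show "AE \<xi> in lborel. norm (fourier w x \<xi> * ?g k \<xi>) \<le> norm (fourier w x \<xi>)" for k
    proof (rule AE_I2)
      fix \<xi> :: "real^'n"
      have "gaussian (pi * (?e k)\<^sup>2) 0 \<xi> \<le> 1" by (rule gaussian_le_1) simp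
      then show "norm (fourier w x \<xi> * ?g k \<xi>) \<le> norm (fourier w x \<xi>)"
        by (simp add: norm_mult mult_left_le less_imp_le del: of_nat_Suc)
    qed
  qed measurable
  moreover have "(\<integral>\<xi>. fourier w x \<xi> * ?g k \<xi> \<partial>lborel) = (\<integral>y. mollifier (?e k) (x - y) *\<^sub>R w y \<partial>lborel)" for k
  proof -
    have pos: "pi * (?e k)\<^sup>2 > 0" by simp
    have ig: "integrable lborel (?g k)" by (rule schwartz_integrable[OF gaussian_schwartz[OF pos]])
    have "integrable (lborel \<Otimes>\<^sub>M lborel) (case_prod (\<lambda>y \<xi>. character (x - y) \<xi> * w y * ?g k \<xi>))"
    proof (rule lborel_pair.Fubini_integrable)
      show "(\<lambda>(y, \<xi>). character (x - y) \<xi> * w y * ?g k \<xi>) \<in> borel_measurable (lborel \<Otimes>\<^sub>M lborel)" by measurable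
      have "integrable lborel (\<lambda>y. norm (w y) * (\<integral>\<xi>. norm (?g k \<xi>) \<partial>lborel))"
        using schwartz_integrable[OF w] by simp
      then show "integrable lborel (\<lambda>y. \<integral>\<xi>. norm (case (y, \<xi>) of (y, \<xi>) \<Rightarrow> character (x - y) \<xi> * w y * ?g k \<xi>) \<partial>lborel)"
        by (simp add: norm_mult)
      show "AE y in lborel. integrable lborel (\<lambda>\<xi>. case (y, \<xi>) of (y, \<xi>) \<Rightarrow> character (x - y) \<xi> * w y * ?g k \<xi>)"
      proof (rule AE_I2)
        fix y
        have "integrable lborel (\<lambda>\<xi>. w y * ?g k \<xi>)" using ig by (rule integrable_mult_right)
        then show "integrable lborel (\<lambda>\<xi>. case (y, \<xi>) of (y, \<xi>) \<Rightarrow> character (x - y) \<xi> * w y * ?g k \<xi>)"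
          by (rule Bochner_Integration.integrable_bound) (auto simp: norm_mult)
      qed
    qed
    from lborel_pair.Fubini_integral[OF this]
    have "(\<integral>\<xi>. \<integral>y. character (x - y) \<xi> * w y * ?g k \<xi> \<partial>lborel \<partial>lborel)
        = (\<integral>y. \<integral>\<xi>. character (x - y) \<xi> * w y * ?g k \<xi> \<partial>lborel \<partial>lborel)" .
    moreover have "(\<integral>y. character (x - y) \<xi> * w y * ?g k \<xi> \<partial>lborel) = fourier w x \<xi> * ?g k \<xi>" for \<xi>
      unfolding fourier_def by (rule integral_mult_left_zero)
    moreover have "(\<integral>\<xi>. character (x - y) \<xi> * w y * ?g k \<xi> \<partial>lborel) = mollifier (?e k) (x - y) *\<^sub>R w y" for y
    proof -
      have "(\<integral>\<xi>. character (x - y) \<xi> * w y * ?g k \<xi> \<partial>lborel) = (\<integral>\<xi>. (character (x - y) \<xi> * ?g k \<xi>) * w y \<partial>lborel)"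
        by (simp add: mult_ac)
      also have "\<dots> = (\<integral>\<xi>. character (x - y) \<xi> * ?g k \<xi> \<partial>lborel) * w y" by (rule integral_mult_left_zero)
      also have "(\<integral>\<xi>. character (x - y) \<xi> * ?g k \<xi> \<partial>lborel) = of_real (mollifier (?e k) (x - y))"
        by (rule gaussian_character) simp
      finally show ?thesis by (simp add: scaleR_conv_of_real)
    qed
    ultimately show ?thesis by (simp only:)
  qed
  moreover have "(\<lambda>k. \<integral>y. mollifier (?e k) (x - y) *\<^sub>R w y \<partial>lborel) \<longlonglongrightarrow> w x"
  proof -
    obtain C where "\<And>y. norm (w y) \<le> C"
      using rapidly_decreasingE[OF schwartz_rapidly_decreasing[OF w], of 0] by auto
    then show ?thesis
      by (intro mollifier_tendsto differentiable_imp_continuous_within schwartz_differentiable w) auto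
  qed
  ultimately show ?thesis using LIMSEQ_unique by simp
qed

text \<open>For fixed \<open>x\<close> the inner integral is the transform of a single Schwartz
  function \<open>w\<close>, which depends on \<open>x\<close> through the midpoint in
  \<open>V\<close>. Inversion evaluates \<open>w\<close> at \<open>y = x\<close>, where the midpoint
  is \<open>x\<close> itself.\<close>

lemma weyl_eq_schroedinger:
  fixes u V :: "real^'n \<Rightarrow> complex"
  assumes u: "u \<in> schwartz" and V: "moderate V"
  shows "weyl (schroedinger_symbol V) h u x = schroedinger ((h / (2 * pi))\<^sup>2) V u x"
proof -
  define v where "v y = V ((1/2) *\<^sub>R x + (1/2) *\<^sub>R y) * u y" for y
  define w where "w y = - of_real ((h / (2 * pi))\<^sup>2) * laplacian u y + v y" for y
  have v: "v \<in> schwartz" unfolding v_def[abs_def] by (intro schwartz_mult moderate_affine V u)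
  have lu: "(\<lambda>y. - of_real ((h / (2 * pi))\<^sup>2) * laplacian u y) \<in> schwartz"
    by (intro schwartz_cmult laplacian_schwartz u)
  have w: "w \<in> schwartz" unfolding w_def[abs_def] by (intro schwartz_add lu v)
  have "fourier w x \<xi> = (\<integral>y. exp (2 * complex_of_real pi * \<i> * complex_of_real ((x - y) \<bullet> \<xi>))
                 * schroedinger_symbol V ((1/2) *\<^sub>R (x + y)) (h *\<^sub>R \<xi>) * u y \<partial>lborel)" for \<xi>
  proof -
    have "fourier w x \<xi> = (- of_real ((h / (2 * pi))\<^sup>2)) * fourier (laplacian u) x \<xi> + fourier v x \<xi>"
      unfolding w_def[abs_def] fourier_cmult[symmetric] by (intro fourier_add schwartz_integrable lu v)
    also have "\<dots> = of_real ((norm (h *\<^sub>R \<xi>))\<^sup>2) * fourier u x \<xi> + fourier v x \<xi>"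
      unfolding fourier_laplacian[OF u] by (simp add: power_mult_distrib power_divide)
    also have "\<dots> = fourier (\<lambda>y. of_real ((norm (h *\<^sub>R \<xi>))\<^sup>2) * u y + v y) x \<xi>"
      unfolding fourier_cmult[symmetric] by (intro fourier_add[symmetric] schwartz_integrable schwartz_cmult u v)
    also have "\<dots> = (\<integral>y. exp (2 * complex_of_real pi * \<i> * complex_of_real ((x - y) \<bullet> \<xi>))
                 * schroedinger_symbol V ((1/2) *\<^sub>R (x + y)) (h *\<^sub>R \<xi>) * u y \<partial>lborel)"
      unfolding fourier_def character_def v_def schroedinger_symbol_def
      by (simp add: algebra_simps)
    finally show ?thesis .
  qed
  then have "weyl (schroedinger_symbol V) h u x = (\<integral>\<xi>. fourier w x \<xi> \<partial>lborel)"
    unfolding weyl_def by simp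
  also have "\<dots> = w x" by (rule fourier_inversion[OF w])
  also have "\<dots> = schroedinger ((h / (2 * pi))\<^sup>2) V u x"
    by (simp add: w_def v_def schroedinger_def scaleR_add_left[symmetric])
  finally show ?thesis .
qed

section \<open>Mollification of square integrable functions\<close>

text \<open>Boxes are stable under intersection and generate the Borel sets. The step to complements
  needs an integrable function on the whole space, so \<open>g\<close> is first cut to a large box;
  countably many of these exhaust the space.\<close>

lemma AE_zero_of_boxes:
  fixes g :: "'a::euclidean_space \<Rightarrow> 'b::{second_countable_topology,banach}"
  assumes int: "\<And>a b. integrable lborel (\<lambda>x. indicator (box a b) x *\<^sub>R g x)"
    and zero: "\<And>a b. (\<integral>x. indicator (box a b) x *\<^sub>R g x \<partial>lborel) = 0"
  shows "AE x in lborel. g x = 0"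
proof -
  have "AE x in lborel. indicator (box (- (real N *\<^sub>R One)) (real N *\<^sub>R One)) x *\<^sub>R g x = 0" for N
  proof -
    define f where "f x = indicator (box (- (real N *\<^sub>R One)) (real N *\<^sub>R One)) x *\<^sub>R g x" for x
    have f: "integrable lborel f" unfolding f_def[abs_def] by (rule int)
    have fbox: "set_lebesgue_integral lborel (box a b) f = 0" for a b
    proof -
      obtain c d where "box a b \<inter> box (- (real N *\<^sub>R One)) (real N *\<^sub>R One) = box c d"
        by (simp add: box_Int_box)
      then have "indicator (box a b) x *\<^sub>R f x = indicator (box c d) x *\<^sub>R g x" for x
        unfolding f_def by (metis indicator_inter_arith scaleR_scaleR)
      then show ?thesis using zero[of c d] by (simp add: set_lebesgue_integral_def)
    qed
    have fUNIV: "(\<integral>x. f x \<partial>lborel) = 0" unfolding f_def by (rule zero)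
    have "AE x in lborel. f x = 0"
    proof (rule sigma_finite_measure.density_zero[OF sigma_finite_lborel f])
      fix A :: "'a set" assume "A \<in> sets lborel"
      then have A: "A \<in> sigma_sets UNIV (range (\<lambda>(a, b). box a b))"
        by (simp add: borel_eq_box)
      have st: "Int_stable (range (\<lambda>(a, b). box a b :: 'a set))"
        by (auto simp: Int_stable_def box_Int_box)
      have pw: "range (\<lambda>(a, b). box a b :: 'a set) \<subseteq> Pow UNIV" by simp
      show "set_lebesgue_integral lborel A f = 0"
        using st pw A
      proof (induction rule: sigma_sets_induct_disjoint)
        case (basic A) then show ?case using fbox by auto
      next
        case empty show ?case by (simp add: set_lebesgue_integral_def)
      next
        case (compl A)
        then have "A \<in> sets lborel" by (simp add: borel_eq_box)
        then have "integrable lborel (\<lambda>x. indicator A x *\<^sub>R f x)" using f by (intro integrable_mult_indicator)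
        moreover have "indicator (UNIV - A) x *\<^sub>R f x = f x - indicator A x *\<^sub>R f x" for x
          by (auto simp: indicator_def)
        ultimately show ?case
          using compl f fUNIV unfolding set_lebesgue_integral_def by simp
      next
        case (union A)
        have m: "A i \<in> sets lborel" for i using union(2) by (auto simp: borel_eq_box)
        have "set_integrable lborel (\<Union>i. A i) f"
          unfolding set_integrable_def using f m by (intro integrable_mult_indicator) auto
        then have "set_lebesgue_integral lborel (\<Union>i. A i) f = (\<Sum>i. set_lebesgue_integral lborel (A i) f)"
          using union(1) m by (intro lebesgue_integral_countable_add) (auto simp: disjoint_family_on_def)
        then show ?case using union(3) by simp
      qed
    qed
    then show ?thesis by (simp add: f_def)
  qed
  then have "AE x in lborel. \<forall>N. indicator (box (- (real N *\<^sub>R One)) (real N *\<^sub>R One)) x *\<^sub>R g x = 0"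
    by (rule AE_all_countable[THEN iffD2, OF allI])
  then show ?thesis
  proof eventually_elim
    case (elim x)
    obtain N where N: "norm x < real N" using reals_Archimedean2 by blast
    have "x \<in> box (- (real N *\<^sub>R One)) (real N *\<^sub>R One)"
      unfolding mem_box
    proof
      fix i :: 'a assume i: "i \<in> Basis"
      have "\<bar>x \<bullet> i\<bar> < real N" using Basis_le_norm[OF i, of x] N by linarith
      then show "- (real N *\<^sub>R One) \<bullet> i < x \<bullet> i \<and> x \<bullet> i < (real N *\<^sub>R One) \<bullet> i"
        using i by (auto simp: inner_sum_left_Basis)
    qed
    then show ?case using elim[rule_format, of N] by simp
  qed
qed

text \<open>Young's inequality for an integrable kernel and a square integrable function, by
  Cauchy-Schwarz after splitting the kernel into two square roots. It is stated for any
  \<open>h\<close> dominated by such a convolution, since it is applied also to the commutator of a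
  potential with a mollifier.\<close>

lemma Young_convolution:
  fixes g :: "real^'n \<Rightarrow> 'b::euclidean_space" and h :: "real^'n \<Rightarrow> 'c::euclidean_space"
    and \<psi> :: "real^'n \<Rightarrow> real"
  assumes g: "square_integrable g" and \<psi>: "integrable lborel \<psi>" "\<And>t. 0 \<le> \<psi> t"
    and [measurable]: "h \<in> borel_measurable borel"
    and h: "\<And>x. ennreal (norm (h x)) \<le> (\<integral>\<^sup>+y. ennreal (\<psi> (x - y) * norm (g y)) \<partial>lborel)"
  shows "square_integrable h" "l2norm h \<le> (\<integral>t. \<psi> t \<partial>lborel) * l2norm g"
proof -
  let ?I = "\<integral>t. \<psi> t \<partial>lborel"
  have [measurable]: "g \<in> borel_measurable borel" "\<psi> \<in> borel_measurable borel"
    using square_integrableD(1)[OF g] \<psi>(1) by auto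
  have I: "?I \<ge> 0" using \<psi>(2) by simp
  have nI: "(\<integral>\<^sup>+t. ennreal (\<psi> t) \<partial>lborel) = ennreal ?I"
    by (rule nn_integral_eq_integral[OF \<psi>(1)]) (simp add: \<psi>(2))
  have shift: "(\<integral>\<^sup>+y. f (x - y) \<partial>lborel) = (\<integral>\<^sup>+y. f y \<partial>lborel)" "(\<integral>\<^sup>+y. f (y - x) \<partial>lborel) = (\<integral>\<^sup>+y. f y \<partial>lborel)"
    if "f \<in> borel_measurable borel" for f :: "real^'n \<Rightarrow> ennreal" and x
    using nn_integral_affine[OF that, of "-1" x] nn_integral_affine[OF that, of 1 "- x"] by simp_all
  have pw: "ennreal ((norm (h x))\<^sup>2) \<le> ennreal ?I * (\<integral>\<^sup>+y. ennreal (\<psi> (x - y) * (norm (g y))\<^sup>2) \<partial>lborel)" for x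
  proof -
    have "ennreal ((norm (h x))\<^sup>2) = (ennreal (norm (h x)))\<^sup>2" by (simp add: ennreal_power)
    also have "\<dots> \<le> (\<integral>\<^sup>+y. ennreal (\<psi> (x - y) * norm (g y)) \<partial>lborel)\<^sup>2" by (intro power_mono h) simp
    also have "(\<integral>\<^sup>+y. ennreal (\<psi> (x - y) * norm (g y)) \<partial>lborel)
        = (\<integral>\<^sup>+y. ennreal (sqrt (\<psi> (x - y))) * ennreal (sqrt (\<psi> (x - y)) * norm (g y)) \<partial>lborel)"
      using \<psi>(2) by (intro nn_integral_cong) (simp add: ennreal_mult'[symmetric] mult.assoc[symmetric])
    also have "\<dots>\<^sup>2 \<le> (\<integral>\<^sup>+y. (ennreal (sqrt (\<psi> (x - y))))\<^sup>2 \<partial>lborel) * (\<integral>\<^sup>+y. (ennreal (sqrt (\<psi> (x - y)) * norm (g y)))\<^sup>2 \<partial>lborel)"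
      by (rule Cauchy_Schwarz_nn_integral) measurable
    also have "\<dots> = (\<integral>\<^sup>+y. ennreal (\<psi> (x - y)) \<partial>lborel) * (\<integral>\<^sup>+y. ennreal (\<psi> (x - y) * (norm (g y))\<^sup>2) \<partial>lborel)"
      using \<psi>(2) by (simp add: ennreal_power power_mult_distrib)
    also have "(\<integral>\<^sup>+y. ennreal (\<psi> (x - y)) \<partial>lborel) = ennreal ?I"
      using shift(1)[of "\<lambda>t. ennreal (\<psi> t)" x] nI by simp
    finally show ?thesis .
  qed
  have "(\<integral>\<^sup>+x. ennreal ((norm (h x))\<^sup>2) \<partial>lborel)
      \<le> (\<integral>\<^sup>+x. ennreal ?I * (\<integral>\<^sup>+y. ennreal (\<psi> (x - y) * (norm (g y))\<^sup>2) \<partial>lborel) \<partial>lborel)"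
    by (intro nn_integral_mono pw)
  also have "\<dots> = ennreal ?I * (\<integral>\<^sup>+x. (\<integral>\<^sup>+y. ennreal (\<psi> (x - y) * (norm (g y))\<^sup>2) \<partial>lborel) \<partial>lborel)"
    by (rule nn_integral_cmult) measurable
  also have "(\<integral>\<^sup>+x. (\<integral>\<^sup>+y. ennreal (\<psi> (x - y) * (norm (g y))\<^sup>2) \<partial>lborel) \<partial>lborel)
      = (\<integral>\<^sup>+y. (\<integral>\<^sup>+x. ennreal (\<psi> (x - y) * (norm (g y))\<^sup>2) \<partial>lborel) \<partial>lborel)"
    by (rule lborel_pair.Fubini') measurable
  also have "\<dots> = (\<integral>\<^sup>+y. ennreal ?I * ennreal ((norm (g y))\<^sup>2) \<partial>lborel)"
  proof (rule nn_integral_cong)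
    fix y
    have "(\<integral>\<^sup>+x. ennreal (\<psi> (x - y) * (norm (g y))\<^sup>2) \<partial>lborel)
        = (\<integral>\<^sup>+x. ennreal (\<psi> (x - y)) * ennreal ((norm (g y))\<^sup>2) \<partial>lborel)"
      using \<psi>(2) by (simp add: ennreal_mult')
    also have "\<dots> = (\<integral>\<^sup>+x. ennreal (\<psi> (x - y)) \<partial>lborel) * ennreal ((norm (g y))\<^sup>2)"
      by (rule nn_integral_multc) measurable
    also have "(\<integral>\<^sup>+x. ennreal (\<psi> (x - y)) \<partial>lborel) = ennreal ?I"
      using shift(2)[of "\<lambda>t. ennreal (\<psi> t)" y] nI by simp
    finally show "(\<integral>\<^sup>+x. ennreal (\<psi> (x - y) * (norm (g y))\<^sup>2) \<partial>lborel) = ennreal ?I * ennreal ((norm (g y))\<^sup>2)" .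
  qed
  also have "\<dots> = ennreal ?I * ennreal ((l2norm g)\<^sup>2)"
    unfolding nn_integral_square[OF g, symmetric] by (rule nn_integral_cmult) measurable
  also have "ennreal ?I * (ennreal ?I * ennreal ((l2norm g)\<^sup>2)) = ennreal ((?I * l2norm g)\<^sup>2)"
    using I by (simp add: ennreal_mult'[symmetric] power2_eq_square mult_ac)
  finally have "(\<integral>\<^sup>+x. ennreal ((norm (h x))\<^sup>2) \<partial>lborel) \<le> ennreal ((?I * l2norm g)\<^sup>2)" .
  from square_integrable_nnI[OF _ this] I
  show "square_integrable h" "l2norm h \<le> ?I * l2norm g" by auto
qed

lemma square_integrable_inverse_power_norm:
  "square_integrable (\<lambda>t::'a::euclidean_space. 1 / (1 + norm t) ^ (DIM('a) + 2))"
  unfolding square_integrable_def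
proof
  let ?p = "\<lambda>t::'a. 1 / (1 + norm t) ^ (DIM('a) + 2)"
  show "integrable lborel (\<lambda>x. (norm (?p x))\<^sup>2)"
  proof (rule Bochner_Integration.integrable_bound[OF integrable_inverse_power_norm])
    have "?p t \<le> 1" for t
    proof -
      have "1 \<le> (1 + norm t) ^ (DIM('a) + 2)" by (rule one_le_power) simp
      then show ?thesis by (subst divide_le_eq_1_pos) linarith+
    qed
    moreover have "(norm a)\<^sup>2 \<le> norm a" if "0 \<le> a" "a \<le> 1" for a :: real
      using that by (simp add: power2_eq_square mult_left_le)
    ultimately show "AE x in lborel. norm ((norm (?p x))\<^sup>2) \<le> norm (?p x)" by simp
  qed measurable
qed measurable

section \<open>Convolutions with Schwartz functions and mollification\<close>

definition convolution :: "(real^'n \<Rightarrow> complex) \<Rightarrow> (real^'n \<Rightarrow> complex) \<Rightarrow> real^'n \<Rightarrow> complex" where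
  "convolution \<phi> g x = (\<integral>y. \<phi> (x - y) * g y \<partial>lborel)"

lemma square_integrable_reflect:
  fixes f :: "real^'n \<Rightarrow> 'b::euclidean_space"
  assumes "square_integrable f"
  shows "square_integrable (\<lambda>y. f (x - y))" "l2norm (\<lambda>y. f (x - y)) = l2norm f"
proof -
  note [measurable] = square_integrableD(1)[OF assms]
  have "integrable lborel (\<lambda>y. (norm (f (x - y)))\<^sup>2)"
    using integrable_affine[OF square_integrableD(2)[OF assms], of "-1" x] by simp
  then show "square_integrable (\<lambda>y. f (x - y))" by (simp add: square_integrable_def)
  show "l2norm (\<lambda>y. f (x - y)) = l2norm f"
    unfolding l2norm_def using integral_reflect[of "\<lambda>y. (norm (f y))\<^sup>2" x] by simp
qed

lemma convolution_integrable:
  fixes \<phi> :: "real^'n \<Rightarrow> complex"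
  assumes "square_integrable \<phi>" "square_integrable g"
  shows "integrable lborel (\<lambda>y. \<phi> (x - y) * g y)" "norm (convolution \<phi> g x) \<le> l2norm \<phi> * l2norm g"
proof -
  note s = square_integrable_reflect[OF assms(1), of x]
  have m: "(\<lambda>y. \<phi> (x - y) * g y) \<in> borel_measurable borel"
    using square_integrableD(1)[OF s(1)] square_integrableD(1)[OF assms(2)] by measurable
  show "integrable lborel (\<lambda>y. \<phi> (x - y) * g y)"
    by (rule Cauchy_Schwarz_integral(1)[OF s(1) assms(2) m]) (simp add: norm_mult)
  show "norm (convolution \<phi> g x) \<le> l2norm \<phi> * l2norm g"
    unfolding convolution_def s(2)[symmetric]
    by (rule Cauchy_Schwarz_integral(2)[OF s(1) assms(2) m]) (simp add: norm_mult)
qed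

text \<open>As \<open>g\<close> is only square integrable, the dominating function must be
  \<open>norm (g y)\<close> times a square integrable function of \<open>y\<close>. The decay of the
  derivative of the kernel supplies it, compared between \<open>x\<close> and the fixed
  \<open>x0\<close> at distance at most 1.\<close>

lemma convolution_deriv:
  fixes \<phi> g :: "real^'n \<Rightarrow> complex"
  assumes \<phi>: "\<phi> \<in> schwartz" and g: "square_integrable g"
  shows "convolution \<phi> g differentiable (at x0)"
    and "partial_deriv j (convolution \<phi> g) x0 = convolution (partial_deriv j \<phi>) g x0"
proof -
  let ?N = "DIM(real^'n) + 2"
  let ?S = "\<lambda>t. \<Sum>j\<in>UNIV. norm (partial_deriv j \<phi> t)"
  have "rapidly_decreasing ?S"
    by (intro rapidly_decreasing_sum rapidly_decreasing_mono[OF schwartz_rapidly_decreasing[OF schwartz_partial_deriv[OF \<phi>]]])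
       auto
  then obtain C where C: "C > 0" "\<And>t. (1 + norm t) ^ ?N * norm (?S t) \<le> C"
    using rapidly_decreasingE by blast
  define p where "p = (\<lambda>t::real^'n. 1 / (1 + norm t) ^ ?N)"
  have p: "0 \<le> p t" for t by (simp add: p_def)
  have "square_integrable p" unfolding p_def by (rule square_integrable_inverse_power_norm)
  note ps = square_integrable_reflect(1)[OF this, of x0]
  have [measurable]: "g \<in> borel_measurable borel" by (rule square_integrableD(1)[OF g])
  define Bd where "Bd = (\<lambda>y. 2 ^ ?N * C * (norm (p (x0 - y)) * norm (g y)))"
  have intB: "integrable lborel Bd"
    unfolding Bd_def by (intro integrable_mult_right integrable_norm_mult ps g)
  have aff: "partial_deriv j (\<lambda>x. \<phi> (x - y)) x = partial_deriv j \<phi> (x - y)"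
    "(\<lambda>x. \<phi> (x - y)) differentiable (at x)" for j x y
    using partial_deriv_affine[where f=\<phi> and a="- y" and c=1 and x=x]
      schwartz_differentiable[OF \<phi>] by auto
  have d: "partial_deriv j (\<lambda>x. \<phi> (x - y) * g y) x = partial_deriv j \<phi> (x - y) * g y" for j x y
    using partial_deriv_cmult(1)[OF aff(2)[where x=x and y=y], where j=j] by (simp add: aff(1) mult.commute)
  have diff: "(\<lambda>x. \<phi> (x - y) * g y) differentiable (at x)" for x y
    by (intro differentiable_mult aff(2)) simp
  have int: "integrable lborel (\<lambda>y. \<phi> (x - y) * g y)" for x
    by (rule convolution_integrable(1)[OF schwartz_square_integrable[OF \<phi>] g])
  have bd: "norm (partial_deriv j (\<lambda>x. \<phi> (x - y) * g y) x) \<le> Bd y" if "norm (x - x0) \<le> 1" for j x y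
  proof -
    have "1 + norm (x0 - y) \<le> (1 + norm (x - y)) * (1 + norm (x0 - x))"
      using one_plus_norm_add_le[of "x - y" "x0 - x"] by (simp add: algebra_simps)
    also have "\<dots> \<le> (1 + norm (x - y)) * 2"
      using that by (intro mult_left_mono) (auto simp: norm_minus_commute)
    finally have "(1 + norm (x0 - y)) ^ ?N \<le> ((1 + norm (x - y)) * 2) ^ ?N" by (intro power_mono) auto
    then have "(1 + norm (x0 - y)) ^ ?N * norm (partial_deriv j \<phi> (x - y))
        \<le> ((1 + norm (x - y)) * 2) ^ ?N * norm (?S (x - y))"
      using member_le_sum[of j UNIV "\<lambda>j. norm (partial_deriv j \<phi> (x - y))"]
      by (intro mult_mono) (auto simp: sum_nonneg)
    also have "\<dots> = 2 ^ ?N * ((1 + norm (x - y)) ^ ?N * norm (?S (x - y)))"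
      unfolding power_mult_distrib by (simp only: mult_ac)
    also have "\<dots> \<le> 2 ^ ?N * C" by (intro mult_left_mono C) auto
    finally have "(1 + norm (x0 - y)) ^ ?N * norm (partial_deriv j \<phi> (x - y)) \<le> 2 ^ ?N * C" .
    moreover have "0 < (1 + norm (x0 - y)) ^ ?N" by (intro zero_less_power) (simp add: add_pos_nonneg)
    ultimately have "norm (partial_deriv j \<phi> (x - y)) \<le> 2 ^ ?N * C * p (x0 - y)"
      unfolding p_def by (simp add: field_simps)
    then have "norm (partial_deriv j \<phi> (x - y)) * norm (g y) \<le> 2 ^ ?N * C * p (x0 - y) * norm (g y)"
      by (rule mult_right_mono) simp
    then show ?thesis unfolding d Bd_def using p[of "x0 - y"] by (simp add: norm_mult mult.assoc)
  qed
  note * = partial_deriv_integral[OF diff int bd intB]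
  show "convolution \<phi> g differentiable (at x0)"
    using *(1) unfolding convolution_def[abs_def] .
  show "partial_deriv j (convolution \<phi> g) x0 = convolution (partial_deriv j \<phi>) g x0"
    using *(2)[where j=j] unfolding d convolution_def[abs_def] .
qed

text \<open>Derivatives fall on the Schwartz factor, so the convolutions with a fixed
  \<open>g\<close> form a family closed under differentiation, and Cauchy-Schwarz bounds each of
  them.\<close>

lemma convolution_moderate:
  fixes \<phi> g :: "real^'n \<Rightarrow> complex"
  assumes \<phi>: "\<phi> \<in> schwartz" and g: "square_integrable g"
  shows "moderate (convolution \<phi> g)"
proof (rule moderate_coinduct[of _ "{convolution \<phi> g | \<phi>. \<phi> \<in> schwartz}"])
  fix f :: "real^'n \<Rightarrow> complex" assume "f \<in> {convolution \<phi> g | \<phi>. \<phi> \<in> schwartz}"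
  then obtain \<phi> where f: "f = convolution \<phi> g" and \<phi>: "\<phi> \<in> schwartz" by blast
  show "f differentiable (at x)" for x unfolding f by (rule convolution_deriv(1)[OF \<phi> g])
  show "poly_bounded f"
    unfolding f by (rule poly_bounded_bounded[OF convolution_integrable(2)[OF schwartz_square_integrable[OF \<phi>] g]])
  have "partial_deriv j f = convolution (partial_deriv j \<phi>) g" for j
    unfolding f by (rule ext) (rule convolution_deriv(2)[OF \<phi> g])
  then show "partial_deriv j f \<in> {convolution \<phi> g | \<phi>. \<phi> \<in> schwartz}" for j
    using schwartz_partial_deriv[OF \<phi>] by blast
qed (use \<phi> in blast)

lemma laplacian_convolution:
  assumes \<phi>: "\<phi> \<in> schwartz" and g: "square_integrable g"
  shows "laplacian (convolution \<phi> g) x = convolution (laplacian \<phi>) g x"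
proof -
  have "partial_deriv j (convolution \<psi> g) = convolution (partial_deriv j \<psi>) g" if "\<psi> \<in> schwartz" for j \<psi>
    by (rule ext) (rule convolution_deriv(2)[OF that g])
  then have "laplacian (convolution \<phi> g) x = (\<Sum>j\<in>UNIV. convolution (partial_deriv j (partial_deriv j \<phi>)) g x)"
    by (simp add: laplacian_def \<phi> schwartz_partial_deriv)
  also have "\<dots> = convolution (laplacian \<phi>) g x"
    unfolding convolution_def laplacian_def sum_distrib_right
    by (intro Bochner_Integration.integral_sum[symmetric] convolution_integrable schwartz_square_integrable
        schwartz_partial_deriv \<phi> g)
  finally show ?thesis .
qed

lemma mollifier_schwartz:
  "\<epsilon> > 0 \<Longrightarrow> (\<lambda>t. complex_of_real (mollifier \<epsilon> t)) \<in> schwartz"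
  using schwartz_cmult[OF gaussian_schwartz[of "pi / \<epsilon>\<^sup>2" 0], of "1 / of_real (\<epsilon> ^ CARD('a))"]
  by (simp add: mollifier_def)

lemma mollifier_nonneg: "\<epsilon> > 0 \<Longrightarrow> 0 \<le> mollifier \<epsilon> t"
  by (simp add: mollifier_def less_imp_le)

lemma mollifier_integral:
  assumes "\<epsilon> > 0"
  shows "integrable lborel (mollifier \<epsilon> :: real^'n \<Rightarrow> real)" "(\<integral>t. mollifier \<epsilon> (t::real^'n) \<partial>lborel) = 1"
proof -
  show "integrable lborel (mollifier \<epsilon> :: real^'n \<Rightarrow> real)"
    using assms unfolding mollifier_def[abs_def] by (intro integrable_divide gaussian_integrable) simp
  have "(\<integral>t. mollifier \<epsilon> (0 - (t::real^'n)) *\<^sub>R (1::real) \<partial>lborel) = (\<integral>t. gaussian pi (0::real^'n) t *\<^sub>R 1 \<partial>lborel)"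
    using mollifier_subst[of "\<lambda>_::real^'n. 1::real" \<epsilon> 0] assms by simp
  then show "(\<integral>t. mollifier \<epsilon> (t::real^'n) \<partial>lborel) = 1"
    using integral_reflect[of "mollifier \<epsilon>" "0::real^'n"] by (simp add: integral_gaussian_pi)
qed

text \<open>A first moment is of order \<open>\<epsilon>\<close>. The extra polynomial weight will
  come from the growth of the increments of a potential, and it is harmless because
  \<open>1 + \<epsilon> |t| \<le> 1 + |t|\<close>.\<close>

lemma mollifier_moment:
  fixes p :: nat
  assumes \<epsilon>: "0 < \<epsilon>" "\<epsilon> \<le> 1"
  defines "M \<equiv> \<integral>t. gaussian pi (0::real^'n) t * (norm t * (1 + norm t) ^ p) \<partial>lborel"
  shows "integrable lborel (\<lambda>t::real^'n. mollifier \<epsilon> t * (norm t * (1 + norm t) ^ p))"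
    and "(\<integral>t. mollifier \<epsilon> (t::real^'n) * (norm t * (1 + norm t) ^ p) \<partial>lborel) \<le> \<epsilon> * M"
proof -
  have pb: "poly_bounded (\<lambda>t::real^'n. norm t * (1 + norm t) ^ p)"
    by (rule poly_boundedI[of _ 1 "Suc p"]) (simp add: abs_mult mult_right_mono)
  have int: "integrable lborel (\<lambda>t::real^'n. gaussian a 0 t * (norm t * (1 + norm t) ^ p))" if "a > 0" for a
    by (intro rapidly_decreasing_integrable rapidly_decreasing_mult(1) gaussian_rapidly_decreasing that pb) measurable
  have "integrable lborel (\<lambda>t::real^'n. gaussian (pi / \<epsilon>\<^sup>2) 0 t * (norm t * (1 + norm t) ^ p) / \<epsilon> ^ CARD('n))"
    using \<epsilon> by (intro integrable_divide int) simp
  then show "integrable lborel (\<lambda>t::real^'n. mollifier \<epsilon> t * (norm t * (1 + norm t) ^ p))"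
    by (simp add: mollifier_def)
  let ?f = "\<lambda>t::real^'n. norm t * (1 + norm t) ^ p"
  have "(\<integral>t. mollifier \<epsilon> (t::real^'n) * ?f t \<partial>lborel) = (\<integral>t. mollifier \<epsilon> (0 - t) *\<^sub>R ?f t \<partial>lborel)"
    using integral_reflect[of "\<lambda>t. mollifier \<epsilon> t * ?f t" "0::real^'n"] by simp
  also have "\<dots> = (\<integral>t. gaussian pi 0 t *\<^sub>R ?f (0 - \<epsilon> *\<^sub>R t) \<partial>lborel)"
    by (rule mollifier_subst) (use \<epsilon> in auto)
  also have "\<dots> \<le> (\<integral>t. \<epsilon> * (gaussian pi 0 t * ?f t) \<partial>lborel)"
  proof (rule integral_mono_AE')
    show "integrable lborel (\<lambda>t. \<epsilon> * (gaussian pi 0 t * ?f t))" by (intro integrable_mult_right int) simp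
    have "gaussian pi 0 t *\<^sub>R ?f (0 - \<epsilon> *\<^sub>R t) \<le> \<epsilon> * (gaussian pi 0 t * ?f t)" for t :: "real^'n"
    proof -
      have "?f (0 - \<epsilon> *\<^sub>R t) = \<epsilon> * (norm t * (1 + \<epsilon> * norm t) ^ p)" using \<epsilon> by simp
      also have "\<dots> \<le> \<epsilon> * (norm t * (1 + norm t) ^ p)"
        using \<epsilon> by (intro mult_left_mono power_mono add_left_mono) (auto simp: mult_left_le_one_le)
      finally have "gaussian pi 0 t * ?f (0 - \<epsilon> *\<^sub>R t) \<le> gaussian pi 0 t * (\<epsilon> * (norm t * (1 + norm t) ^ p))"
        by (intro mult_left_mono) (auto simp: less_imp_le)
      then show ?thesis by (simp add: mult_ac)
    qed
    then show "AE t in lborel. gaussian pi 0 t *\<^sub>R ?f (0 - \<epsilon> *\<^sub>R t) \<le> \<epsilon> * (gaussian pi 0 t * ?f t)" by simp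
    show "AE t in lborel. 0 \<le> \<epsilon> * (gaussian pi 0 t * ?f t)" using \<epsilon> by (simp add: less_imp_le)
  qed
  also have "\<dots> = \<epsilon> * M" unfolding M_def by simp
  finally show "(\<integral>t. mollifier \<epsilon> (t::real^'n) * (norm t * (1 + norm t) ^ p) \<partial>lborel) \<le> \<epsilon> * M" .
qed

definition mollify :: "real \<Rightarrow> (real^'n \<Rightarrow> complex) \<Rightarrow> real^'n \<Rightarrow> complex" where
  "mollify \<epsilon> g = convolution (\<lambda>t. of_real (mollifier \<epsilon> t)) g"

lemma mollify_moderate: "\<epsilon> > 0 \<Longrightarrow> square_integrable g \<Longrightarrow> moderate (mollify \<epsilon> g)"
  unfolding mollify_def by (intro convolution_moderate mollifier_schwartz)

lemma mollify_l2norm: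
  fixes g :: "real^'n \<Rightarrow> complex"
  assumes \<epsilon>: "\<epsilon> > 0" and g: "square_integrable g"
  shows "square_integrable (mollify \<epsilon> g)" "l2norm (mollify \<epsilon> g) \<le> l2norm g"
proof -
  have h: "ennreal (norm (mollify \<epsilon> g x)) \<le> (\<integral>\<^sup>+y. ennreal (mollifier \<epsilon> (x - y) * norm (g y)) \<partial>lborel)" for x
    using integral_norm_bound_ennreal[OF convolution_integrable(1)[OF schwartz_square_integrable[OF mollifier_schwartz[OF \<epsilon>]] g], of x]
    by (simp add: mollify_def convolution_def norm_mult mollifier_nonneg[OF \<epsilon>])
  note Y = Young_convolution[OF g mollifier_integral(1)[OF \<epsilon>] mollifier_nonneg[OF \<epsilon>]
      moderate_borel[OF mollify_moderate[OF \<epsilon> g]] h]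
  show "square_integrable (mollify \<epsilon> g)" by (rule Y(1))
  show "l2norm (mollify \<epsilon> g) \<le> l2norm g" using Y(2) by (simp add: mollifier_integral(2)[OF \<epsilon>])
qed

text \<open>The kernel is even, so Fubini moves the mollification from \<open>g\<close> to the test
  function. Its mollifications converge wherever \<open>f\<close> is continuous and keep a uniform
  decay. Almost everywhere continuity admits indicator functions of boxes.\<close>

lemma mollify_weak_limit:
  fixes g :: "real^'n \<Rightarrow> complex" and f :: "real^'n \<Rightarrow> real"
  assumes g: "square_integrable g" and f: "rapidly_decreasing f" and [measurable]: "f \<in> borel_measurable borel"
    and cont: "AE x in lborel. isCont f x"
  shows "(\<lambda>k. \<integral>x. f x *\<^sub>R mollify (1 / real (Suc k)) g x \<partial>lborel) \<longlonglongrightarrow> (\<integral>x. f x *\<^sub>R g x \<partial>lborel)"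
proof -
  let ?e = "\<lambda>k. 1 / real (Suc k)"
  let ?N = "DIM(real^'n) + 2"
  have [measurable]: "g \<in> borel_measurable borel" by (rule square_integrableD(1)[OF g])
  have sf: "square_integrable f" by (rule square_integrable_rapid[OF f]) simp
  obtain C where C: "C > 0" "\<And>x. (1 + norm x) ^ ?N * norm (f x) \<le> C"
    using rapidly_decreasingE[OF f] by blast
  obtain C0 where C0: "\<And>x. norm (f x) \<le> C0" using rapidly_decreasingE[OF f, of 0] by auto
  define F where "F k y = (\<integral>x. mollifier (?e k) (y - x) *\<^sub>R f x \<partial>lborel)" for k y
  have [measurable]: "F k \<in> borel_measurable borel" for k
  proof -
    have "(\<lambda>y. \<integral>x. mollifier (?e k) (y - x) *\<^sub>R f x \<partial>lborel) \<in> borel_measurable borel"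
      by (rule lborel.borel_measurable_lebesgue_integral) measurable
    then show ?thesis by (simp add: F_def[abs_def])
  qed
  have sym: "mollifier (?e k) (x - y) = mollifier (?e k) (y - x)" for k and x y :: "real^'n"
    by (simp add: mollifier_def gaussian_def norm_minus_commute)
  have swap: "(\<integral>x. f x *\<^sub>R mollify (?e k) g x \<partial>lborel) = (\<integral>y. F k y *\<^sub>R g y \<partial>lborel)" for k
  proof -
    have pos: "?e k > 0" by simp
    \<comment> \<open>Absolute convergence of the double integral is the pairing of
      \<open>|f|\<close> with the mollification of \<open>|g|\<close>, both square
      integrable.\<close>
    have ng: "square_integrable (\<lambda>y. complex_of_real (norm (g y)))"
      by (rule square_integrable_dominated[OF g, of _ 1]) auto
    let ?c = "\<lambda>x y. f x *\<^sub>R (of_real (mollifier (?e k) (x - y)) * g y)"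
    have ms: "square_integrable (\<lambda>t::real^'n. complex_of_real (mollifier (?e k) t))"
      by (intro schwartz_square_integrable mollifier_schwartz pos)
    have "integrable (lborel \<Otimes>\<^sub>M lborel) (case_prod ?c)"
    proof (rule lborel_pair.Fubini_integrable)
      show "case_prod ?c \<in> borel_measurable (lborel \<Otimes>\<^sub>M lborel)" by measurable
      have "integrable lborel (\<lambda>x. norm (f x) * norm (mollify (?e k) (\<lambda>y. complex_of_real (norm (g y))) x))"
        by (intro integrable_norm_mult sf mollify_l2norm pos ng)
      moreover have "(\<integral>y. norm (?c x y) \<partial>lborel)
          = norm (f x) * norm (mollify (?e k) (\<lambda>y. complex_of_real (norm (g y))) x)" for x
      proof -
        have "mollify (?e k) (\<lambda>y. complex_of_real (norm (g y))) x
            = of_real (\<integral>y. mollifier (?e k) (x - y) * norm (g y) \<partial>lborel)"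
          unfolding mollify_def convolution_def of_real_mult[symmetric] by (rule integral_complex_of_real)
        moreover have "0 \<le> (\<integral>y. mollifier (?e k) (x - y) * norm (g y) \<partial>lborel)"
          by (intro Bochner_Integration.integral_nonneg mult_nonneg_nonneg mollifier_nonneg pos norm_ge_zero)
        ultimately show ?thesis
          by (simp add: norm_mult mollifier_nonneg[OF pos, THEN abs_of_nonneg] del: of_nat_Suc)
      qed
      ultimately show "integrable lborel (\<lambda>x. \<integral>y. norm (case (x, y) of (x, y) \<Rightarrow> ?c x y) \<partial>lborel)"
        unfolding case_prod_conv by (simp only:)
      show "AE x in lborel. integrable lborel (\<lambda>y. case (x, y) of (x, y) \<Rightarrow> ?c x y)"
        using convolution_integrable(1)[OF ms g] by (auto intro!: integrable_scaleR_right)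
    qed
    from lborel_pair.Fubini_integral[OF this]
    have "(\<integral>y. \<integral>x. ?c x y \<partial>lborel \<partial>lborel) = (\<integral>x. \<integral>y. ?c x y \<partial>lborel \<partial>lborel)" .
    moreover have "(\<integral>y. ?c x y \<partial>lborel) = f x *\<^sub>R mollify (?e k) g x" for x
      unfolding mollify_def convolution_def by (rule integral_scaleR_right)
    moreover have "(\<integral>x. ?c x y \<partial>lborel) = F k y *\<^sub>R g y" for y
    proof -
      have "(\<integral>x. ?c x y \<partial>lborel) = (\<integral>x. (mollifier (?e k) (y - x) *\<^sub>R f x) *\<^sub>R g y \<partial>lborel)"
        unfolding sym[of k _ y] by (simp add: scaleR_conv_of_real mult_ac)
      also have "\<dots> = F k y *\<^sub>R g y"
        unfolding F_def
      proof (rule integral_scaleR_left)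
        have i: "integrable lborel (\<lambda>x. C0 * mollifier (?e k) (y - x))"
          using integrable_affine[OF mollifier_integral(1)[OF pos], of "-1" y] by simp
        have le: "norm (mollifier (?e k) (y - x) *\<^sub>R f x) \<le> norm (C0 * mollifier (?e k) (y - x))" for x
        proof -
          have "\<bar>mollifier (?e k) (y - x)\<bar> * norm (f x) \<le> \<bar>mollifier (?e k) (y - x)\<bar> * \<bar>C0\<bar>"
            using C0[of x] by (intro mult_left_mono) auto
          then show ?thesis by (simp add: abs_mult mult.commute del: of_nat_Suc)
        qed
        show "integrable lborel (\<lambda>x. mollifier (?e k) (y - x) *\<^sub>R f x)"
          by (rule Bochner_Integration.integrable_bound[OF i _ AE_I2[OF le]]) measurable
      qed
      finally show ?thesis .
    qed
    ultimately show ?thesis by (simp only:)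
  qed
  define M where "M = (\<integral>t. gaussian pi (0::real^'n) t * (1 + norm t) ^ ?N \<partial>lborel)"
  have pbN: "poly_bounded (\<lambda>t::real^'n. (1 + norm t) ^ ?N)"
    by (rule poly_boundedI[of _ 1 ?N]) simp
  have intM: "integrable lborel (\<lambda>t::real^'n. gaussian pi 0 t * (1 + norm t) ^ ?N)"
    by (intro rapidly_decreasing_integrable rapidly_decreasing_mult(1)[OF gaussian_rapidly_decreasing pbN]) auto
  define p where "p = (\<lambda>t::real^'n. 1 / (1 + norm t) ^ ?N)"
  \<comment> \<open>The bound is uniform in \<open>k\<close> since the argument is displaced by at
    most \<open>norm t\<close>; the weight lost in this way is a moment of the Gaussian.\<close>
  have Fbd: "norm (F k y) \<le> C * M * p y" for k y
  proof -
    have "F k y = (\<integral>t. gaussian pi 0 t *\<^sub>R f (y - ?e k *\<^sub>R t) \<partial>lborel)"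
      unfolding F_def by (rule mollifier_subst) auto
    also have "norm \<dots> \<le> (\<integral>t. (C * p y) * (gaussian pi 0 (t::real^'n) * (1 + norm t) ^ ?N) \<partial>lborel)"
    proof -
      have iM: "integrable lborel (\<lambda>t::real^'n. (C * p y) * (gaussian pi 0 t * (1 + norm t) ^ ?N))"
        by (intro integrable_mult_right intM)
      have le: "norm (gaussian pi 0 t *\<^sub>R f (y - ?e k *\<^sub>R t)) \<le> (C * p y) * (gaussian pi 0 t * (1 + norm t) ^ ?N)" for t :: "real^'n"
      proof -
      let ?x = "y - ?e k *\<^sub>R t"
      have "norm (?e k *\<^sub>R t) = ?e k * norm t" by simp
      also have "\<dots> \<le> 1 * norm t" by (intro mult_right_mono) auto
      finally have "norm (?e k *\<^sub>R t) \<le> norm t" by simp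
      then have "1 + norm y \<le> (1 + norm ?x) * (1 + norm t)"
        using one_plus_norm_add_le[of ?x "?e k *\<^sub>R t"]
          mult_left_mono[of "1 + norm (?e k *\<^sub>R t)" "1 + norm t" "1 + norm ?x"] by simp
      then have "(1 + norm y) ^ ?N \<le> (1 + norm ?x) ^ ?N * (1 + norm t) ^ ?N"
        unfolding power_mult_distrib[symmetric] by (intro power_mono) auto
      then have "(1 + norm y) ^ ?N * norm (f ?x) \<le> ((1 + norm ?x) ^ ?N * (1 + norm t) ^ ?N) * norm (f ?x)"
        by (rule mult_right_mono) simp
      also have "\<dots> = ((1 + norm ?x) ^ ?N * norm (f ?x)) * (1 + norm t) ^ ?N" by (simp only: mult_ac)
      also have "\<dots> \<le> C * (1 + norm t) ^ ?N" by (intro mult_right_mono C) auto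
      finally have "(1 + norm y) ^ ?N * norm (f ?x) \<le> C * (1 + norm t) ^ ?N" .
      moreover have "0 < (1 + norm y) ^ ?N" by (intro zero_less_power) (simp add: add_pos_nonneg)
      ultimately have "norm (f ?x) \<le> C * p y * (1 + norm t) ^ ?N"
        unfolding p_def by (simp add: field_simps)
      then have "gaussian pi 0 t * norm (f ?x) \<le> gaussian pi 0 t * (C * p y * (1 + norm t) ^ ?N)"
        by (intro mult_left_mono) (auto simp: less_imp_le)
      moreover have "norm (gaussian pi 0 t *\<^sub>R f ?x) = gaussian pi 0 t * norm (f ?x)"
        by (simp only: norm_scaleR abs_of_pos[OF gaussian_pos])
      ultimately show ?thesis by (simp only: mult_ac)
      qed
      have ig: "integrable lborel (\<lambda>t. gaussian pi 0 t *\<^sub>R f (y - ?e k *\<^sub>R t))"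
        by (rule Bochner_Integration.integrable_bound[OF iM], measurable)
           (rule AE_I2, rule order_trans[OF le], simp)
      show ?thesis
        by (rule order_trans[OF integral_norm_bound integral_mono[OF integrable_norm[OF ig] iM le]])
    qed
    also have "\<dots> = C * M * p y" unfolding M_def by simp
    finally show ?thesis .
  qed
  have p: "0 \<le> p y" "norm (p y) = p y" for y by (simp_all add: p_def)
  have M: "M \<ge> 0"
    unfolding M_def by (rule Bochner_Integration.integral_nonneg) (simp add: less_imp_le)
  have sp: "square_integrable p" unfolding p_def by (rule square_integrable_inverse_power_norm)
  have "(\<lambda>k. \<integral>y. F k y *\<^sub>R g y \<partial>lborel) \<longlonglongrightarrow> (\<integral>y. f y *\<^sub>R g y \<partial>lborel)"
  proof (rule integral_dominated_convergence)
    show "integrable lborel (\<lambda>y. (C * M) * (norm (p y) * norm (g y)))"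
      by (intro integrable_mult_right integrable_norm_mult sp g)
    show "AE y in lborel. (\<lambda>k. F k y *\<^sub>R g y) \<longlonglongrightarrow> f y *\<^sub>R g y"
      using cont
    proof eventually_elim
      case (elim y)
      have "(\<lambda>k. F k y) \<longlonglongrightarrow> f y"
        unfolding F_def by (rule mollifier_tendsto[OF _ C0 elim]) simp
      then show ?case by (intro tendsto_scaleR tendsto_const)
    qed
    show "AE y in lborel. norm (F k y *\<^sub>R g y) \<le> (C * M) * (norm (p y) * norm (g y))" for k
    proof (rule AE_I2)
      fix y
      have "norm (F k y) * norm (g y) \<le> (C * M * p y) * norm (g y)"
        by (intro mult_right_mono Fbd) simp
      then show "norm (F k y *\<^sub>R g y) \<le> (C * M) * (norm (p y) * norm (g y))"
        by (simp add: p mult.assoc)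
    qed
  qed measurable
  then show ?thesis by (simp only: swap)
qed

section \<open>A Schwartz cutoff with relatively bounded derivatives\<close>

text \<open>The Japanese bracket, comparable to \<open>norm x\<close> at infinity but smooth at the
  origin, so that its exponential can be a Schwartz function.\<close>

definition japanese :: "real^'n \<Rightarrow> real" where
  "japanese x = sqrt (1 + (norm x)\<^sup>2)"

text \<open>Unlike for a Gaussian, the derivatives of this cutoff are bounded by \<open>\<sigma>\<close> times the cutoff.\<close>

definition cutoff :: "real \<Rightarrow> real^'n \<Rightarrow> real" where
  "cutoff \<sigma> x = exp (- \<sigma> * japanese x)"

lemma japanese_ge: "1 \<le> japanese x" "norm x \<le> japanese x" "japanese x > 0"
proof -
  show "1 \<le> japanese x" by (simp add: japanese_def)
  then show "japanese x > 0" by linarith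
  show "norm x \<le> japanese x" unfolding japanese_def by (rule real_le_rsqrt) simp
qed

lemma japanese_deriv:
  "partial_deriv j japanese x = x $ j / japanese x" "japanese differentiable (at x)"
proof -
  have d: "((\<lambda>x. 1 + x \<bullet> x) has_derivative (\<lambda>h. 2 * (x \<bullet> h))) (at x)"
    by (auto intro!: derivative_eq_intros simp: inner_commute)
  have pos: "1 + x \<bullet> x > 0" by (simp add: add_pos_nonneg)
  have p: "(sqrt has_field_derivative (inverse (sqrt (1 + x \<bullet> x)) / 2)) (at (1 + x \<bullet> x))"
    by (rule DERIV_real_sqrt[OF pos])
  have eq: "japanese = (\<lambda>x. sqrt (1 + x \<bullet> x))"
    by (rule ext) (simp add: japanese_def power2_norm_eq_inner)
  have diff: "(\<lambda>x. 1 + x \<bullet> x) differentiable (at x)" using d differentiable_def by blast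
  have 2: "partial_deriv j (\<lambda>x. 1 + x \<bullet> x) x = 2 * x $ j"
    using partial_deriv_eqI[OF d, of j] by (simp add: inner_axis)
  have "inverse s / 2 * (2 * t) = t / s" for s t :: real by (simp add: inverse_eq_divide)
  then show "partial_deriv j japanese x = x $ j / japanese x"
    unfolding eq partial_deriv_comp_real(1)[OF diff p, of j] 2 .
  show "japanese differentiable (at x)"
    unfolding eq by (rule partial_deriv_comp_real(2)[OF diff p])
qed

lemma cutoff_deriv:
  "partial_deriv j (cutoff \<sigma>) x = - \<sigma> * (x $ j / japanese x) * cutoff \<sigma> x"
  "cutoff \<sigma> differentiable (at x)"
proof -
  have p: "((\<lambda>t. exp (- \<sigma> * t)) has_field_derivative (- \<sigma> * exp (- \<sigma> * japanese x))) (at (japanese x))"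
    by (auto intro!: derivative_eq_intros)
  have eq: "cutoff \<sigma> = (\<lambda>x. exp (- \<sigma> * japanese x))" by (rule ext) (simp add: cutoff_def)
  show "partial_deriv j (cutoff \<sigma>) x = - \<sigma> * (x $ j / japanese x) * cutoff \<sigma> x"
    unfolding eq using partial_deriv_comp_real(1)[OF japanese_deriv(2) p, of j] by (simp add: japanese_deriv(1))
  show "cutoff \<sigma> differentiable (at x)"
    unfolding eq by (rule partial_deriv_comp_real(2)[OF japanese_deriv(2) p])
qed

lemma inverse_japanese_deriv:
  "partial_deriv j (\<lambda>x. inverse (japanese x)) x = - (x $ j) * inverse (japanese x) ^ 3"
  "(\<lambda>x. inverse (japanese x)) differentiable (at x)"
proof -
  have "japanese x \<noteq> 0" using japanese_ge(3)[of x] by simp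
  from DERIV_inverse[OF this]
  have p: "(inverse has_field_derivative (- (inverse (japanese x) ^ Suc (Suc 0)))) (at (japanese x))" .
  show "partial_deriv j (\<lambda>x. inverse (japanese x)) x = - (x $ j) * inverse (japanese x) ^ 3"
    using partial_deriv_comp_real(1)[OF japanese_deriv(2) p, of j]
    by (simp add: japanese_deriv(1) divide_inverse power3_eq_cube)
  show "(\<lambda>x. inverse (japanese x)) differentiable (at x)"
    by (rule partial_deriv_comp_real(2)[OF japanese_deriv(2) p])
qed

lemma cutoff_pos [simp]: "0 < cutoff \<sigma> x"
  by (simp add: cutoff_def)

lemma cutoff_le_1: "0 \<le> \<sigma> \<Longrightarrow> cutoff \<sigma> x \<le> 1"
  using japanese_ge(3)[of x] by (simp add: cutoff_def)

lemma cutoff_first_deriv_le: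
  assumes "0 \<le> \<sigma>" shows "\<bar>partial_deriv j (cutoff \<sigma>) x\<bar> \<le> \<sigma> * cutoff \<sigma> x"
proof -
  have "\<bar>x $ j\<bar> \<le> japanese x" using component_le_norm_cart[of x j] japanese_ge(2)[of x] by linarith
  then have "\<bar>x $ j / japanese x\<bar> \<le> 1" using japanese_ge(3)[of x] by simp
  then have "\<sigma> * \<bar>x $ j / japanese x\<bar> * cutoff \<sigma> x \<le> \<sigma> * 1 * cutoff \<sigma> x"
    using assms by (intro mult_right_mono mult_left_mono) (auto simp: less_imp_le)
  then show ?thesis using assms by (simp add: cutoff_deriv(1) abs_mult less_imp_le)
qed

text \<open>Write the first derivative as \<open>- \<sigma> l\<close> times the cutoff. The second
  then consists of a part with another first derivative, bounded by the cutoff itself since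
  \<open>\<sigma> \<le> 1\<close>, and a part with the derivative of \<open>l\<close>, which is at
  most 2; together 1 + 2.\<close>

lemma cutoff_second_deriv_le:
  assumes "0 \<le> \<sigma>" "\<sigma> \<le> 1"
  shows "\<bar>partial_deriv j (partial_deriv j (cutoff \<sigma>)) x\<bar> \<le> 3 * \<sigma> * cutoff \<sigma> x"
proof -
  let ?i = "inverse (japanese x)"
  define l where "l = (\<lambda>x. (x::real^'a) $ j * inverse (japanese x))"
  have ld: "l differentiable (at x)" for x
    unfolding l_def by (intro differentiable_mult component_differentiable inverse_japanese_deriv(2))
  have l': "partial_deriv j l x = x $ j * (- (x $ j) * ?i ^ 3) + ?i"
    unfolding l_def
    by (subst partial_deriv_mult[OF component_differentiable inverse_japanese_deriv(2)])
       (simp add: inverse_japanese_deriv(1) partial_deriv_component)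
  have eq: "partial_deriv j (cutoff \<sigma>) = (\<lambda>x. - \<sigma> * (l x * cutoff \<sigma> x))"
    by (rule ext) (simp add: cutoff_deriv(1) l_def divide_inverse)
  have "partial_deriv j (partial_deriv j (cutoff \<sigma>)) x
      = - \<sigma> * (l x * partial_deriv j (cutoff \<sigma>) x + partial_deriv j l x * cutoff \<sigma> x)"
    unfolding eq
    by (subst partial_deriv_cmult(1), intro differentiable_mult ld cutoff_deriv(2),
        subst partial_deriv_mult[OF ld cutoff_deriv(2)]) (simp add: eq)
  then have "\<bar>partial_deriv j (partial_deriv j (cutoff \<sigma>)) x\<bar>
      \<le> \<sigma> * (\<bar>l x\<bar> * \<bar>partial_deriv j (cutoff \<sigma>) x\<bar> + \<bar>partial_deriv j l x\<bar> * cutoff \<sigma> x)"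
    using assms by (auto simp: abs_mult less_imp_le intro!: mult_left_mono order_trans[OF abs_triangle_ineq])
  also have "\<dots> \<le> \<sigma> * (1 * (1 * cutoff \<sigma> x) + 2 * cutoff \<sigma> x)"
  proof (intro mult_left_mono add_mono mult_mono mult_right_mono assms)
    have ji: "0 \<le> ?i" "?i \<le> 1" using japanese_ge(1,3)[of x] by (auto simp: inverse_le_1_iff)
    have xi: "\<bar>x $ j\<bar> * ?i \<le> 1"
    proof -
      have "\<bar>x $ j\<bar> \<le> japanese x" using component_le_norm_cart[of x j] japanese_ge(2)[of x] by linarith
      then show ?thesis using japanese_ge(3)[of x] by (simp add: field_simps)
    qed
    then show "\<bar>l x\<bar> \<le> 1" using ji by (simp add: l_def abs_mult)
    have "\<sigma> * cutoff \<sigma> x \<le> 1 * cutoff \<sigma> x" using assms by (intro mult_right_mono) (auto simp: less_imp_le)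
    then show "\<bar>partial_deriv j (cutoff \<sigma>) x\<bar> \<le> 1 * cutoff \<sigma> x"
      using cutoff_first_deriv_le[OF assms(1), of j x] by linarith
    have "(\<bar>x $ j\<bar> * ?i) * (\<bar>x $ j\<bar> * ?i) * ?i \<le> 1 * 1 * 1"
      using xi ji by (intro mult_mono) auto
    then have "\<bar>x $ j * (- (x $ j) * ?i ^ 3)\<bar> \<le> 1"
      using ji by (simp add: abs_mult power3_eq_cube mult_ac)
    then show "\<bar>partial_deriv j l x\<bar> \<le> 2" unfolding l' using ji by linarith
  qed (auto simp: less_imp_le)
  also have "\<dots> = 3 * \<sigma> * cutoff \<sigma> x" by simp
  finally show ?thesis .
qed

lemma cutoff_rapidly_decreasing:
  assumes "\<sigma> > 0" shows "rapidly_decreasing (cutoff \<sigma> :: real^'n \<Rightarrow> real)"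
  unfolding rapidly_decreasing_def
proof
  fix k
  define K where "K = real k + 1"
  have K: "K > 0" "real k \<le> K" by (simp_all add: K_def)
  define b where "b = 1 + K / \<sigma>"
  have b: "b \<ge> 1" using assms K by (simp add: b_def)
  have "(1 + norm x) ^ k * norm (cutoff \<sigma> x) \<le> b ^ k" for x :: "real^'n"
  proof -
    define s where "s = \<sigma> * norm x / K"
    have s: "s \<ge> 0" "norm x = (K / \<sigma>) * s" using assms K by (simp_all add: s_def)
    have "real k * s \<le> K * s" using s(1) K by (intro mult_right_mono) auto
    also have "\<dots> = \<sigma> * norm x" using K by (simp add: s_def)
    also have "\<dots> \<le> \<sigma> * japanese x" using assms by (intro mult_left_mono japanese_ge) auto
    finally have s3: "real k * s \<le> \<sigma> * japanese x" .
    have "1 + norm x \<le> b * (1 + s)"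
      using s assms K unfolding b_def distrib_left distrib_right by simp
    also have "\<dots> \<le> b * exp s"
      using b exp_ge_add_one_self[of s] by (intro mult_left_mono) auto
    finally have "(1 + norm x) ^ k \<le> (b * exp s) ^ k" by (intro power_mono) auto
    also have "\<dots> = b ^ k * exp (real k * s)" by (simp add: power_mult_distrib exp_of_nat_mult)
    also have "\<dots> \<le> b ^ k * exp (\<sigma> * japanese x)"
      using s3 b by (intro mult_left_mono) auto
    finally have "(1 + norm x) ^ k * exp (- (\<sigma> * japanese x)) \<le> b ^ k * exp (\<sigma> * japanese x) * exp (- (\<sigma> * japanese x))"
      by (rule mult_right_mono) simp
    then show ?thesis by (simp add: cutoff_def mult.assoc exp_add[symmetric])
  qed
  then show "\<exists>C. \<forall>x::real^'n. (1 + norm x) ^ k * norm (cutoff \<sigma> x) \<le> C" by blast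
qed

text \<open>Differentiation produces coordinates and inverse powers of \<open>japanese\<close>, so
  multiplication by both is built in.\<close>

inductive_set cutoff_span :: "real \<Rightarrow> (real^'n \<Rightarrow> complex) set" for \<sigma>
  where
    cutoff: "(\<lambda>x. complex_of_real (cutoff \<sigma> x)) \<in> cutoff_span \<sigma>"
  | component: "f \<in> cutoff_span \<sigma> \<Longrightarrow> (\<lambda>x. complex_of_real (x $ i) * f x) \<in> cutoff_span \<sigma>"
  | inverse: "f \<in> cutoff_span \<sigma> \<Longrightarrow> (\<lambda>x. complex_of_real (inverse (japanese x)) * f x) \<in> cutoff_span \<sigma>"
  | cmult: "f \<in> cutoff_span \<sigma> \<Longrightarrow> (\<lambda>x. k * f x) \<in> cutoff_span \<sigma>"
  | add: "f \<in> cutoff_span \<sigma> \<Longrightarrow> g \<in> cutoff_span \<sigma> \<Longrightarrow> (\<lambda>x. f x + g x) \<in> cutoff_span \<sigma>"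

lemma cutoff_span_partial_deriv:
  fixes f :: "real^'n \<Rightarrow> complex"
  assumes "f \<in> cutoff_span \<sigma>"
  shows "(\<forall>x. f differentiable (at x)) \<and> partial_deriv j f \<in> cutoff_span \<sigma>"
  using assms
proof induction
  case cutoff
  have "partial_deriv j (\<lambda>x. complex_of_real (cutoff \<sigma> x)) =
     (\<lambda>x. (- of_real \<sigma>) * (complex_of_real (x $ j) * (complex_of_real (inverse (japanese x)) * complex_of_real (cutoff \<sigma> x))))"
    by (rule ext) (simp add: partial_deriv_of_real(1)[OF cutoff_deriv(2)] cutoff_deriv(1) divide_inverse)
  also have "\<dots> \<in> cutoff_span \<sigma>" by (intro cutoff_span.intros)
  finally show ?case
    using partial_deriv_of_real(2)[OF cutoff_deriv(2)[of \<sigma>]] by blast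
next
  case (component f i)
  have "partial_deriv j (\<lambda>x. of_real (x $ i) * f x) =
     (\<lambda>x. of_real (x $ i) * partial_deriv j f x + (if i = j then 1 else 0) * f x)"
    by (rule ext, subst partial_deriv_mult)
       (use component.IH in \<open>auto intro!: partial_deriv_of_real(2) component_differentiable
          simp: partial_deriv_of_real(1)[OF component_differentiable] partial_deriv_component\<close>)
  then show ?case using component
    by (auto intro!: cutoff_span.add cutoff_span.component cutoff_span.cmult differentiable_mult
         partial_deriv_of_real(2) component_differentiable)
next
  case (inverse f)
  have "partial_deriv j (\<lambda>x. complex_of_real (inverse (japanese x)) * f x) =
     (\<lambda>x. complex_of_real (inverse (japanese x)) * partial_deriv j f x
       + (-1) * (complex_of_real (x $ j) * (complex_of_real (inverse (japanese x)) *
           (complex_of_real (inverse (japanese x)) * (complex_of_real (inverse (japanese x)) * f x)))))"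
    by (rule ext, subst partial_deriv_mult)
       (use inverse.IH in \<open>auto intro!: partial_deriv_of_real(2) inverse_japanese_deriv(2)
          simp: partial_deriv_of_real(1)[OF inverse_japanese_deriv(2)] inverse_japanese_deriv(1) power3_eq_cube
          simp del: of_real_inverse\<close>)
  also have "\<dots> \<in> cutoff_span \<sigma>"
    using inverse by (intro cutoff_span.intros) auto
  finally have "partial_deriv j (\<lambda>x. complex_of_real (inverse (japanese x)) * f x) \<in> cutoff_span \<sigma>" .
  moreover have "(\<lambda>x. complex_of_real (inverse (japanese x)) * f x) differentiable (at x)" for x
    using inverse.IH by (intro differentiable_mult partial_deriv_of_real(2) inverse_japanese_deriv(2)) auto
  ultimately show ?case by blast
next
  case (cmult f k)
  have "partial_deriv j (\<lambda>x. k * f x) = (\<lambda>x. k * partial_deriv j f x)"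
    using cmult.IH by (intro ext partial_deriv_cmult) auto
  then show ?case using cmult by (auto intro!: cutoff_span.cmult differentiable_mult)
next
  case (add f g)
  have "partial_deriv j (\<lambda>x. f x + g x) = (\<lambda>x. partial_deriv j f x + partial_deriv j g x)"
    using add.IH by (intro ext partial_deriv_add) auto
  then show ?case using add by (auto intro!: cutoff_span.add)
qed

lemma cutoff_schwartz:
  assumes "\<sigma> > 0" shows "(\<lambda>x::real^'n. complex_of_real (cutoff \<sigma> x)) \<in> schwartz"
proof (rule schwartz_coinduct[OF cutoff_span.cutoff])
  fix f :: "real^'n \<Rightarrow> complex" assume f: "f \<in> cutoff_span \<sigma>"
  show "f differentiable (at x)" for x using cutoff_span_partial_deriv[OF f] by blast
  show "partial_deriv j f \<in> cutoff_span \<sigma>" for j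
    using cutoff_span_partial_deriv[OF f] by blast
  show "rapidly_decreasing f"
    using f
  proof induction
    case cutoff
    show ?case by (rule rapidly_decreasing_mono[OF cutoff_rapidly_decreasing[OF assms]]) simp
  next
    case (component f i)
    show ?case by (rule rapidly_decreasing_mult(2)[OF component.IH poly_bounded_component])
  next
    case (inverse f)
    have "poly_bounded (\<lambda>x::real^'n. complex_of_real (inverse (japanese x)))"
    proof (rule poly_bounded_bounded)
      show "norm (complex_of_real (inverse (japanese x))) \<le> 1" for x :: "real^'n"
        using japanese_ge(1,3)[of x] by (simp add: norm_inverse inverse_le_1_iff)
    qed
    from rapidly_decreasing_mult(2)[OF inverse.IH this] show ?case .
  next
    case (cmult f k)
    show ?case by (rule rapidly_decreasing_mult(2)[OF cmult.IH poly_bounded_const])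
  qed (rule rapidly_decreasing_add)
qed

section \<open>Weak solutions\<close>

lemma schroedinger_mult:
  assumes \<zeta>: "moderate \<zeta>" and G: "moderate G"
  shows "schroedinger \<tau> W (\<lambda>x. \<zeta> x * G x) x = \<zeta> x * schroedinger \<tau> W G x
     - 2 * of_real \<tau> * (\<Sum>j\<in>UNIV. partial_deriv j \<zeta> x * partial_deriv j G x)
     - of_real \<tau> * laplacian \<zeta> x * G x"
proof -
  note d = moderate_differentiable
  have 1: "partial_deriv j (\<lambda>x. f x * g x) = (\<lambda>x. f x * partial_deriv j g x + partial_deriv j f x * g x)"
    if "moderate f" "moderate g" for j and f g :: "real^'a \<Rightarrow> complex"
    by (rule ext) (intro partial_deriv_mult d that)
  have "laplacian (\<lambda>x. \<zeta> x * G x) x = (\<Sum>j\<in>UNIV. \<zeta> x * partial_deriv j (partial_deriv j G) x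
      + 2 * (partial_deriv j \<zeta> x * partial_deriv j G x) + partial_deriv j (partial_deriv j \<zeta>) x * G x)"
    unfolding laplacian_def
  proof (rule sum.cong)
    fix j
    have "partial_deriv j (partial_deriv j (\<lambda>x. \<zeta> x * G x)) x
       = partial_deriv j (\<lambda>x. \<zeta> x * partial_deriv j G x) x + partial_deriv j (\<lambda>x. partial_deriv j \<zeta> x * G x) x"
      unfolding 1[OF \<zeta> G]
      by (intro partial_deriv_add differentiable_mult d \<zeta> G moderate_partial_deriv)
    then show "partial_deriv j (partial_deriv j (\<lambda>x. \<zeta> x * G x)) x = \<zeta> x * partial_deriv j (partial_deriv j G) x
      + 2 * (partial_deriv j \<zeta> x * partial_deriv j G x) + partial_deriv j (partial_deriv j \<zeta>) x * G x"
      by (simp add: 1 \<zeta> G moderate_partial_deriv)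
  qed simp
  also have "\<dots> = \<zeta> x * laplacian G x + 2 * (\<Sum>j\<in>UNIV. partial_deriv j \<zeta> x * partial_deriv j G x) + laplacian \<zeta> x * G x"
    unfolding laplacian_def by (simp add: sum.distrib sum_distrib_left sum_distrib_right)
  finally show ?thesis by (simp add: schroedinger_def algebra_simps)
qed

text \<open>The bound separates \<open>x\<close> from \<open>v\<close>: the factor in
  \<open>x\<close> will be absorbed by the cutoff, the one in \<open>v\<close> by a moment of the
  mollifier.\<close>

lemma moderate_increment:
  fixes W :: "real^'n \<Rightarrow> complex"
  assumes W: "moderate W"
  obtains C p where "C > 0" "\<And>x v. norm (W (x + v) - W x) \<le> C * (1 + norm x) ^ p * (norm v * (1 + norm v) ^ p)"
proof -
  have "poly_bounded (\<lambda>x. \<Sum>j\<in>UNIV. norm (partial_deriv j W x))"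
    by (intro poly_bounded_sum poly_bounded_mono[OF moderate_poly_bounded[OF moderate_partial_deriv[OF W]]]) auto
  from poly_boundedE[OF this] obtain C p where C: "C > 0"
    and bd: "\<And>x. norm (\<Sum>j\<in>UNIV. norm (partial_deriv j W x)) \<le> C * (1 + norm x) ^ p"
    by blast
  have pb: "norm (partial_deriv j W x) \<le> C * (1 + norm x) ^ p" for j x
    using bd[of x] member_le_sum[of j UNIV "\<lambda>j. norm (partial_deriv j W x)"] by simp
  have "norm (W (x + v) - W x) \<le> real CARD('n) * C * (1 + norm x) ^ p * (norm v * (1 + norm v) ^ p)" for x v
  proof -
    have "norm (W (x + v) - W x) \<le> real CARD('n) * (C * ((1 + norm x) ^ p * (1 + norm v) ^ p)) * norm v"
    proof (rule norm_increment_le[OF moderate_differentiable[OF W]])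
      fix s :: real and j assume s: "0 \<le> s" "s \<le> 1"
      have "norm (s *\<^sub>R v) \<le> norm v" using s by (simp add: mult_left_le_one_le)
      then have "1 + norm (x + s *\<^sub>R v) \<le> (1 + norm x) * (1 + norm v)"
        using one_plus_norm_add_le[of x "s *\<^sub>R v"]
          mult_left_mono[of "1 + norm (s *\<^sub>R v)" "1 + norm v" "1 + norm x"] by simp
      then have "(1 + norm (x + s *\<^sub>R v)) ^ p \<le> (1 + norm x) ^ p * (1 + norm v) ^ p"
        unfolding power_mult_distrib[symmetric] by (intro power_mono) auto
      then show "norm (partial_deriv j W (x + s *\<^sub>R v)) \<le> C * ((1 + norm x) ^ p * (1 + norm v) ^ p)"
        using C by (intro order_trans[OF pb] mult_left_mono) auto
    qed
    then show ?thesis by (simp add: mult_ac)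
  qed
  then show ?thesis using C by (intro that[of "real CARD('n) * C" p]) auto
qed

lemma mollifier_reflect_schwartz:
  fixes x :: "real^'n"
  assumes "\<epsilon> > 0" shows "(\<lambda>y. complex_of_real (mollifier \<epsilon> (x - y))) \<in> schwartz"
proof -
  have "mollifier \<epsilon> (x - y) = gaussian (pi / \<epsilon>\<^sup>2) x y / \<epsilon> ^ CARD('n)" for y
    by (simp add: mollifier_def gaussian_def norm_minus_commute)
  then show ?thesis
    using schwartz_cmult[OF gaussian_schwartz[of "pi / \<epsilon>\<^sup>2" x], of "1 / of_real (\<epsilon> ^ CARD('n))"] assms
    by simp
qed

lemma laplacian_reflect:
  assumes "\<phi> \<in> schwartz"
  shows "laplacian (\<lambda>y. \<phi> (x - y)) y = laplacian \<phi> (x - y)"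
proof -
  have 1: "partial_deriv j (\<lambda>y. \<psi> (x - y)) y = - partial_deriv j \<psi> (x - y)"
    "(\<lambda>y. \<psi> (x - y)) differentiable (at y)" if "\<psi> \<in> schwartz" for j \<psi> y
    using partial_deriv_affine[where f=\<psi> and a=x and c="-1" and x=y] schwartz_differentiable[OF that] by auto
  have "partial_deriv j (\<lambda>y. \<phi> (x - y)) = (\<lambda>y. (-1) * partial_deriv j \<phi> (x - y))" for j
    by (rule ext) (simp add: 1(1)[OF assms])
  then show ?thesis
    unfolding laplacian_def
    by (simp only: partial_deriv_cmult(1)[OF 1(2)[OF schwartz_partial_deriv[OF assms]]]
        1(1)[OF schwartz_partial_deriv[OF assms]]) simp
qed

text \<open>Testing the weak equation with the reflected and translated mollifier trades the
  Laplacian of the mollified function for the potential. What remains is the commutator of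
  mollification with multiplication by \<open>W\<close>.\<close>

lemma weak_mollified:
  fixes g W :: "real^'n \<Rightarrow> complex"
  assumes g: "square_integrable g" and W: "moderate W" and \<epsilon>: "\<epsilon> > 0"
    and weak: "\<And>\<phi>. \<phi> \<in> schwartz \<Longrightarrow> (\<integral>y. g y * schroedinger \<tau> W \<phi> y \<partial>lborel) = 0"
  shows "schroedinger \<tau> W (mollify \<epsilon> g) x = (\<integral>y. (W x - W y) * (of_real (mollifier \<epsilon> (x - y)) * g y) \<partial>lborel)"
    and "integrable lborel (\<lambda>y. (W x - W y) * (of_real (mollifier \<epsilon> (x - y)) * g y))"
proof -
  define m where "m = (\<lambda>t::real^'n. complex_of_real (mollifier \<epsilon> t))"
  have m: "m \<in> schwartz" unfolding m_def by (rule mollifier_schwartz[OF \<epsilon>])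
  have mx: "(\<lambda>y. m (x - y)) \<in> schwartz" unfolding m_def by (rule mollifier_reflect_schwartz[OF \<epsilon>])
  have [measurable]: "g \<in> borel_measurable borel" by (rule square_integrableD(1)[OF g])
  have prod: "integrable lborel (\<lambda>y. \<phi> y * g y)" if "\<phi> \<in> schwartz" for \<phi> :: "real^'n \<Rightarrow> complex"
  proof -
    have [measurable]: "\<phi> \<in> borel_measurable borel" by (rule schwartz_borel[OF that])
    show ?thesis
      by (rule Cauchy_Schwarz_integral(1)[OF schwartz_square_integrable[OF that] g]) (auto simp: norm_mult)
  qed
  have i1: "integrable lborel (\<lambda>y. m (x - y) * g y)" by (rule prod[OF mx])
  have i2: "integrable lborel (\<lambda>y. W y * m (x - y) * g y)"
    using prod[OF schwartz_mult[OF W mx]] .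
  have i3: "integrable lborel (\<lambda>y. laplacian m (x - y) * g y)"
    by (rule convolution_integrable(1)[OF schwartz_square_integrable[OF laplacian_schwartz[OF m]] g])
  have "0 = (\<integral>y. g y * schroedinger \<tau> W (\<lambda>y. m (x - y)) y \<partial>lborel)" by (rule weak[OF mx, symmetric])
  also have "\<dots> = (\<integral>y. - of_real \<tau> * (laplacian m (x - y) * g y) + W y * m (x - y) * g y \<partial>lborel)"
    by (intro Bochner_Integration.integral_cong) (simp_all add: schroedinger_def laplacian_reflect[OF m] algebra_simps)
  also have "\<dots> = - of_real \<tau> * convolution (laplacian m) g x + (\<integral>y. W y * m (x - y) * g y \<partial>lborel)"
    using i2 i3 unfolding convolution_def by simp
  finally have w: "- of_real \<tau> * convolution (laplacian m) g x = - (\<integral>y. W y * m (x - y) * g y \<partial>lborel)"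
    by (simp add: eq_neg_iff_add_eq_0)
  have eq: "(W x - W y) * (m (x - y) * g y) = W x * (m (x - y) * g y) - W y * m (x - y) * g y" for y
    by (simp add: algebra_simps)
  show "integrable lborel (\<lambda>y. (W x - W y) * (of_real (mollifier \<epsilon> (x - y)) * g y))"
  proof -
    have "integrable lborel (\<lambda>y. (W x - W y) * (m (x - y) * g y))"
      unfolding eq by (intro Bochner_Integration.integrable_diff integrable_mult_right i1 i2)
    then show ?thesis unfolding m_def .
  qed
  have "schroedinger \<tau> W (mollify \<epsilon> g) x = - of_real \<tau> * laplacian (convolution m g) x + W x * convolution m g x"
    by (simp add: schroedinger_def mollify_def m_def)
  also have "\<dots> = (\<integral>y. W x * (m (x - y) * g y) \<partial>lborel) - (\<integral>y. W y * m (x - y) * g y \<partial>lborel)"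
    unfolding laplacian_convolution[OF m g] w by (simp add: convolution_def)
  also have "\<dots> = (\<integral>y. (W x - W y) * (m (x - y) * g y) \<partial>lborel)"
    unfolding eq using i1 i2 by simp
  finally show "schroedinger \<tau> W (mollify \<epsilon> g) x = (\<integral>y. (W x - W y) * (of_real (mollifier \<epsilon> (x - y)) * g y) \<partial>lborel)"
    by (simp add: m_def)
qed

lemma l2norm_sum:
  assumes "finite I" "\<And>i. i \<in> I \<Longrightarrow> square_integrable (f i)"
  shows "square_integrable (\<lambda>x. \<Sum>i\<in>I. f i x)" "l2norm (\<lambda>x. \<Sum>i\<in>I. f i x) \<le> (\<Sum>i\<in>I. l2norm (f i))"
proof -
  have "square_integrable (\<lambda>x. \<Sum>i\<in>I. f i x) \<and> l2norm (\<lambda>x. \<Sum>i\<in>I. f i x) \<le> (\<Sum>i\<in>I. l2norm (f i))"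
    using assms
  proof (induction I rule: finite_induct)
    case empty
    then show ?case by (simp add: square_integrable_def l2norm_def)
  next
    case (insert i I)
    then have IH: "square_integrable (\<lambda>x. \<Sum>i\<in>I. f i x)"
        "l2norm (\<lambda>x. \<Sum>i\<in>I. f i x) \<le> (\<Sum>i\<in>I. l2norm (f i))" by auto
    have "square_integrable (f i)" using insert.prems by simp
    from square_integrable_add[OF this IH(1)] l2norm_triangle[OF this IH(1)] IH(2)
    show ?case using insert.hyps by simp
  qed
  then show "square_integrable (\<lambda>x. \<Sum>i\<in>I. f i x)" "l2norm (\<lambda>x. \<Sum>i\<in>I. f i x) \<le> (\<Sum>i\<in>I. l2norm (f i))"
    by auto
qed

lemma square_integrable_scaleR:
  assumes "square_integrable f" shows "square_integrable (\<lambda>x. c *\<^sub>R f x)"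
  by (rule square_integrable_dominated[OF assms, of _ "\<bar>c\<bar>"]) (use square_integrableD(1)[OF assms] in auto)

lemma square_integrable_norm:
  assumes "square_integrable f"
  shows "square_integrable (\<lambda>x. norm (f x))" "l2norm (\<lambda>x. norm (f x)) = l2norm f"
proof -
  show "square_integrable (\<lambda>x. norm (f x))"
    by (rule square_integrable_dominated[OF assms, of _ 1]) (use square_integrableD(1)[OF assms] in auto)
  show "l2norm (\<lambda>x. norm (f x)) = l2norm f" by (simp add: l2norm_def)
qed

lemma rapidly_decreasing_indicator_box:
  fixes h :: "real^'n \<Rightarrow> real"
  assumes "continuous_on UNIV h"
  shows "rapidly_decreasing (\<lambda>x. indicator (box a b) x * h x)"
  unfolding rapidly_decreasing_def
proof
  fix k
  have "compact ((\<lambda>x. (1 + norm x) ^ k * norm (h x)) ` cbox a b)"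
    by (intro compact_continuous_image compact_cbox continuous_intros continuous_on_subset[OF assms]) auto
  then obtain C where C: "\<And>x. x \<in> cbox a b \<Longrightarrow> (1 + norm x) ^ k * norm (h x) \<le> C"
    using compact_imp_bounded[THEN bounded_imp_bdd_above] unfolding bdd_above_def by fastforce
  have "(1 + norm x) ^ k * norm (indicator (box a b) x * h x) \<le> max C 0" for x
    using C[of x] box_subset_cbox[of a b] by (auto simp: indicator_def le_max_iff_disj)
  then show "\<exists>C. \<forall>x. (1 + norm x) ^ k * norm (indicator (box a b) x * h x) \<le> C" by blast
qed

lemma AE_isCont_indicator_box:
  "AE x in lborel. isCont (indicator (box a b) :: real^'n \<Rightarrow> real) x"
proof -
  have "AE x in lborel. x \<notin> cbox a b - box a b"
  proof (rule AE_not_in)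
    have "emeasure lborel (cbox a b - box a b) = emeasure lborel (cbox a b) - emeasure lborel (box a b)"
      by (rule emeasure_Diff) (auto simp: box_subset_cbox emeasure_lborel_box_eq)
    also have "\<dots> = 0" by (simp add: emeasure_lborel_box_eq emeasure_lborel_cbox_eq)
    finally show "cbox a b - box a b \<in> null_sets lborel" by (auto simp: null_sets_def)
  qed
  then show ?thesis
    by eventually_elim (auto simp: isCont_indicator frontier_box split: if_splits)
qed

text \<open>Box integrals of the mollifications converge to those of \<open>g\<close>, and box
  integrals determine a function almost everywhere.\<close>

lemma AE_zero_of_mollified:
  fixes g :: "real^'n \<Rightarrow> complex"
  assumes g: "square_integrable g"
    and lim: "\<And>a b. (\<lambda>k. \<integral>x. indicator (box a b) x *\<^sub>R mollify (1 / real (Suc k)) g x \<partial>lborel) \<longlonglongrightarrow> 0"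
  shows "AE x in lborel. g x = 0"
proof (rule AE_zero_of_boxes)
  fix a b :: "real^'n"
  let ?f = "indicator (box a b) :: real^'n \<Rightarrow> real"
  have f: "rapidly_decreasing ?f"
    using rapidly_decreasing_indicator_box[of "\<lambda>x. 1" a b] by simp
  have sf: "square_integrable ?f" by (rule square_integrable_rapid[OF f]) simp
  show "integrable lborel (\<lambda>x. ?f x *\<^sub>R g x)"
    by (rule Cauchy_Schwarz_integral(1)[OF sf g]) (use square_integrableD(1)[OF g] in auto)
  have "(\<lambda>k. \<integral>x. ?f x *\<^sub>R mollify (1 / real (Suc k)) g x \<partial>lborel) \<longlonglongrightarrow> (\<integral>x. ?f x *\<^sub>R g x \<partial>lborel)"
    by (rule mollify_weak_limit[OF g f _ AE_isCont_indicator_box]) simp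
  then show "(\<integral>x. ?f x *\<^sub>R g x \<partial>lborel) = 0"
    by (rule LIMSEQ_unique[OF _ lim])
qed

text \<open>Translated mollifiers are admissible test functions, so every mollification of
  \<open>g\<close> vanishes identically.\<close>

lemma AE_zero_of_orthogonal:
  fixes g :: "real^'n \<Rightarrow> complex"
  assumes g: "square_integrable g"
    and orth: "\<And>\<phi>. \<phi> \<in> schwartz \<Longrightarrow> (\<integral>y. g y * \<phi> y \<partial>lborel) = 0"
  shows "AE x in lborel. g x = 0"
proof (rule AE_zero_of_mollified[OF g])
  fix a b :: "real^'n"
  have "mollify (1 / real (Suc k)) g x = 0" for k x
    using orth[OF mollifier_reflect_schwartz[of "1 / real (Suc k)" x]]
    by (simp add: mollify_def convolution_def mult.commute del: of_nat_Suc)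
  then show "(\<lambda>k. \<integral>x. indicator (box a b) x *\<^sub>R mollify (1 / real (Suc k)) g x \<partial>lborel) \<longlonglongrightarrow> 0"
    by simp
qed

text \<open>The constant may depend on \<open>\<sigma>\<close> but not on \<open>\<epsilon>\<close>.
  The cutoff absorbs the polynomial growth in \<open>x\<close> of the commutator kernel, at the
  price \<open>D\<close>; what is left is a convolution kernel whose integral is of order
  \<open>\<epsilon>\<close>, so Young's inequality concludes.\<close>

lemma cutoff_error_bound:
  fixes g W :: "real^'n \<Rightarrow> complex"
  assumes g: "square_integrable g" and W: "moderate W" and \<sigma>: "\<sigma> > 0"
    and weak: "\<And>\<phi>. \<phi> \<in> schwartz \<Longrightarrow> (\<integral>y. g y * schroedinger \<tau> W \<phi> y \<partial>lborel) = 0"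
  shows "\<exists>C\<ge>0. \<forall>\<epsilon>. 0 < \<epsilon> \<and> \<epsilon> \<le> 1 \<longrightarrow>
     l2norm (\<lambda>x. cutoff \<sigma> x *\<^sub>R schroedinger \<tau> W (mollify \<epsilon> g) x) \<le> C * \<epsilon>"
proof -
  obtain C p where C: "C > 0"
    and inc: "\<And>x v. norm (W (x + v) - W x) \<le> C * (1 + norm x) ^ p * (norm v * (1 + norm v) ^ p)"
    using moderate_increment[OF W] by metis
  obtain D where D: "D > 0" "\<And>x::real^'n. (1 + norm x) ^ p * norm (cutoff \<sigma> x) \<le> D"
    using rapidly_decreasingE[OF cutoff_rapidly_decreasing[OF \<sigma>]] by blast
  define M where "M = (\<integral>t. gaussian pi (0::real^'n) t * (norm t * (1 + norm t) ^ p) \<partial>lborel)"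
  have M: "M \<ge> 0" unfolding M_def by (rule Bochner_Integration.integral_nonneg) (simp add: less_imp_le)
  have [measurable]: "g \<in> borel_measurable borel" "W \<in> borel_measurable borel"
    by (rule square_integrableD(1)[OF g]) (rule moderate_borel[OF W])
  have "l2norm (\<lambda>x. cutoff \<sigma> x *\<^sub>R schroedinger \<tau> W (mollify \<epsilon> g) x) \<le> (C * D * M * l2norm g) * \<epsilon>"
    if \<epsilon>: "0 < \<epsilon>" "\<epsilon> \<le> 1" for \<epsilon>
  proof -
    define \<psi> where "\<psi> t = (C * D) * (mollifier \<epsilon> t * (norm t * (1 + norm t) ^ p))" for t :: "real^'n"
    let ?h = "\<lambda>x. cutoff \<sigma> x *\<^sub>R schroedinger \<tau> W (mollify \<epsilon> g) x"
    note mom = mollifier_moment[OF \<epsilon>, of p, where 'n='n, folded M_def]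
    have \<psi>: "integrable lborel \<psi>" "\<psi> t \<ge> 0" for t
      unfolding \<psi>_def using C D mollifier_nonneg[OF \<epsilon>(1)]
      by (intro integrable_mult_right mom(1), intro mult_nonneg_nonneg, auto)
    have [measurable]: "\<psi> \<in> borel_measurable borel" using \<psi>(1) by auto
    have lap: "moderate (laplacian (mollify \<epsilon> g))"
      unfolding mollify_def laplacian_convolution[OF mollifier_schwartz[OF \<epsilon>(1)] g, abs_def]
      by (intro convolution_moderate laplacian_schwartz mollifier_schwartz \<epsilon> g)
    have hm: "?h \<in> borel_measurable borel"
      using moderate_borel[OF lap] moderate_borel[OF W] moderate_borel[OF mollify_moderate[OF \<epsilon>(1) g]]
        borel_measurable_differentiable[OF cutoff_deriv(2)[of \<sigma>]]
      unfolding schroedinger_def by measurable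
    have h: "ennreal (norm (?h x)) \<le> (\<integral>\<^sup>+y. ennreal (\<psi> (x - y) * norm (g y)) \<partial>lborel)" for x
    proof -
      note wm = weak_mollified[OF g W \<epsilon>(1) weak, where x=x]
      have "ennreal (norm (?h x)) = ennreal (cutoff \<sigma> x) * ennreal (norm (schroedinger \<tau> W (mollify \<epsilon> g) x))"
        by (simp add: ennreal_mult' less_imp_le)
      also have "\<dots> \<le> ennreal (cutoff \<sigma> x) * (\<integral>\<^sup>+y. ennreal (norm ((W x - W y) * (of_real (mollifier \<epsilon> (x - y)) * g y))) \<partial>lborel)"
      proof (rule mult_left_mono)
        show "ennreal (norm (schroedinger \<tau> W (mollify \<epsilon> g) x))
            \<le> (\<integral>\<^sup>+y. ennreal (norm ((W x - W y) * (of_real (mollifier \<epsilon> (x - y)) * g y))) \<partial>lborel)"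
          using integral_norm_bound_ennreal[OF wm(2)] wm(1) by simp
      qed simp
      also have "\<dots> = (\<integral>\<^sup>+y. ennreal (cutoff \<sigma> x) * ennreal (norm ((W x - W y) * (of_real (mollifier \<epsilon> (x - y)) * g y))) \<partial>lborel)"
        by (rule nn_integral_cmult[symmetric]) measurable
      also have "\<dots> \<le> (\<integral>\<^sup>+y. ennreal (\<psi> (x - y) * norm (g y)) \<partial>lborel)"
      proof (rule nn_integral_mono)
        fix y
        let ?q = "norm (x - y) * (1 + norm (x - y)) ^ p"
        have "norm (W x - W y) \<le> C * (1 + norm x) ^ p * ?q"
          using inc[of x "y - x"] by (simp add: norm_minus_commute)
        then have "cutoff \<sigma> x * norm (W x - W y) \<le> cutoff \<sigma> x * (C * (1 + norm x) ^ p * ?q)"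
          by (intro mult_left_mono) (auto simp: less_imp_le)
        also have "\<dots> = ((1 + norm x) ^ p * norm (cutoff \<sigma> x)) * (C * ?q)"
          by (simp add: less_imp_le mult_ac)
        also have "\<dots> \<le> D * (C * ?q)" using C by (intro mult_right_mono D) auto
        finally have "cutoff \<sigma> x * norm (W x - W y) * (mollifier \<epsilon> (x - y) * norm (g y))
            \<le> D * (C * ?q) * (mollifier \<epsilon> (x - y) * norm (g y))"
          by (intro mult_right_mono mult_nonneg_nonneg mollifier_nonneg \<epsilon>) auto
        then have "cutoff \<sigma> x * norm ((W x - W y) * (of_real (mollifier \<epsilon> (x - y)) * g y)) \<le> \<psi> (x - y) * norm (g y)"
          by (simp add: \<psi>_def norm_mult mult_ac abs_of_nonneg[OF mollifier_nonneg[OF \<epsilon>(1)]])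
        then show "ennreal (cutoff \<sigma> x) * ennreal (norm ((W x - W y) * (of_real (mollifier \<epsilon> (x - y)) * g y)))
            \<le> ennreal (\<psi> (x - y) * norm (g y))"
          by (simp add: ennreal_mult'[symmetric] less_imp_le ennreal_leI)
      qed
      finally show ?thesis .
    qed
    have "l2norm ?h \<le> (\<integral>t. \<psi> t \<partial>lborel) * l2norm g"
      by (rule Young_convolution(2)[OF g \<psi> hm h])
    also have "\<dots> \<le> ((C * D) * (\<epsilon> * M)) * l2norm g"
      unfolding \<psi>_def using C D mom(2) by (intro mult_right_mono) (auto intro!: mult_left_mono)
    finally show ?thesis by (simp add: mult_ac)
  qed
  moreover have "0 \<le> C * D * M * l2norm g" using C D M by simp
  ultimately show ?thesis by blast
qed

text \<open>A weak solution in \<open>L\<^sup>2\<close> is approximated by the Schwartz functions \<open>cutoff \<cdot> mollify g\<close>; the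
  commutator terms are of size \<open>\<sigma>\<close>, since accretivity bounds the cut off gradient uniformly.\<close>

lemma cutoff_mollify_bound:
  fixes g W :: "real^'n \<Rightarrow> complex"
  assumes g: "square_integrable g" and W: "moderate W" and \<tau>: "\<tau> > 0"
    and \<mu>: "\<mu> \<ge> 0" "\<And>x. - \<mu> \<le> Re (W x)"
  shows "\<exists>E\<ge>0. \<forall>\<sigma> \<epsilon> k. 0 < \<sigma> \<and> \<sigma> \<le> 1 \<and> 0 < \<epsilon> \<and> k \<le> 1 \<and>
     l2norm (\<lambda>x. cutoff \<sigma> x *\<^sub>R schroedinger \<tau> W (mollify \<epsilon> g) x) \<le> k \<longrightarrow>
     l2norm (schroedinger \<tau> W (\<lambda>x. of_real (cutoff \<sigma> x) * mollify \<epsilon> g x)) \<le> k + \<sigma> * E"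
proof -
  define \<beta> where "\<beta> = l2norm g"
  define n where "n = real CARD('n)"
  have \<beta>: "\<beta> \<ge> 0" and n: "n \<ge> 1" by (simp_all add: \<beta>_def n_def Suc_leI)
  \<comment> \<open>An a priori bound for the gradient of the cut off function. If this gradient has
    norm at least 1, \<open>grad_bound\<close> becomes
    \<open>\<tau> D^2 \<le> \<tau> (D0 - 1) D\<close>; the added 1 ensures that a gradient larger
    than \<open>D0\<close> is in that range. The coefficient \<open>5 * n\<close> is
    \<open>2 * n\<close> from the mixed first derivatives plus \<open>3 * n\<close> from the
    Laplacian of the cutoff.\<close>
  define D0 where "D0 = (n * (1 + 5 * n * \<tau> * \<beta>) * \<beta> + n * \<mu> * \<beta>\<^sup>2 + 2 * n * \<tau> * \<beta>) / \<tau> + 1"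
  define E where "E = 2 * \<tau> * D0 + 5 * n * \<tau> * \<beta>"
  have D0: "D0 \<ge> 1" using \<beta> n \<tau> \<mu> by (simp add: D0_def)
  have E: "E \<ge> 0" using D0 \<beta> n \<tau> by (simp add: E_def)
  show ?thesis
  proof (intro exI[of _ E] conjI E allI impI; elim conjE)
    fix \<sigma> \<epsilon> k :: real
    assume \<sigma>: "0 < \<sigma>" "\<sigma> \<le> 1" and \<epsilon>: "0 < \<epsilon>" and k: "k \<le> 1"
      and K: "l2norm (\<lambda>x. cutoff \<sigma> x *\<^sub>R schroedinger \<tau> W (mollify \<epsilon> g) x) \<le> k"
    define G where "G = mollify \<epsilon> g"
    define c where "c = (\<lambda>x::real^'n. complex_of_real (cutoff \<sigma> x))"
    define v where "v = (\<lambda>x. c x * G x)"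
    have k0: "k \<ge> 0" using K l2norm_nonneg order_trans by blast
    have G: "moderate G" unfolding G_def by (rule mollify_moderate[OF \<epsilon> g])
    have c: "c \<in> schwartz" unfolding c_def by (rule cutoff_schwartz[OF \<sigma>(1)])
    note cm = schwartz_imp_moderate[OF c]
    have v: "v \<in> schwartz"
      unfolding v_def using schwartz_mult[OF G c] by (simp add: mult.commute)
    note sv = schwartz_square_integrable[OF v]
    note sdv = schwartz_square_integrable[OF schwartz_partial_deriv[OF v]]
    have H: "schroedinger \<tau> W v \<in> schwartz" by (rule schroedinger_schwartz[OF v W])
    have nv: "norm (v x) = cutoff \<sigma> x * norm (G x)" for x
      by (simp add: v_def c_def norm_mult less_imp_le)
    have v\<beta>: "l2norm v \<le> \<beta>"
    proof -
      have "l2norm v \<le> l2norm G"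
      proof (rule l2norm_mono)
        show "square_integrable G" unfolding G_def by (rule mollify_l2norm(1)[OF \<epsilon> g])
        show "norm (v x) \<le> norm (G x)" for x
          unfolding nv using cutoff_le_1[of \<sigma> x] \<sigma> by (intro mult_left_le_one_le) (auto simp: less_imp_le)
      qed (rule schwartz_borel[OF v])
      also have "\<dots> \<le> \<beta>" unfolding G_def \<beta>_def by (rule mollify_l2norm(2)[OF \<epsilon> g])
      finally show ?thesis .
    qed
    have c': "norm (partial_deriv j c x) \<le> \<sigma> * cutoff \<sigma> x"
      and c'': "norm (partial_deriv j (partial_deriv j c) x) \<le> 3 * \<sigma> * cutoff \<sigma> x" for j x
    proof -
      have 1: "partial_deriv j c = (\<lambda>x. of_real (partial_deriv j (cutoff \<sigma>) x))"
        unfolding c_def by (rule ext) (rule partial_deriv_of_real(1)[OF cutoff_deriv(2)])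
      show "norm (partial_deriv j c x) \<le> \<sigma> * cutoff \<sigma> x"
        using cutoff_first_deriv_le[of \<sigma> j x] \<sigma> by (simp add: 1)
      have "partial_deriv j (cutoff \<sigma>) = (\<lambda>x. Re (partial_deriv j c x))" by (simp add: 1)
      then have "partial_deriv j (cutoff \<sigma>) differentiable (at x)"
        using partial_deriv_Re(2)[OF schwartz_differentiable[OF schwartz_partial_deriv[OF c]]] by simp
      then have "partial_deriv j (partial_deriv j c) x = of_real (partial_deriv j (partial_deriv j (cutoff \<sigma>)) x)"
        unfolding 1 by (rule partial_deriv_of_real(1))
      then show "norm (partial_deriv j (partial_deriv j c) x) \<le> 3 * \<sigma> * cutoff \<sigma> x"
        using cutoff_second_deriv_le[of \<sigma> j x] \<sigma> by simp
    qed
    \<comment> \<open>The derivatives of the cutoff are bounded by the cutoff itself, so the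
      gradient of \<open>G\<close> multiplied by the cutoff is controlled by \<open>v\<close> and
      its gradient, for which an energy estimate is available.\<close>
    have dG: "cutoff \<sigma> x * norm (partial_deriv j G x) \<le> norm (partial_deriv j v x) + norm (v x)" for j x
    proof -
      have "partial_deriv j v x = c x * partial_deriv j G x + partial_deriv j c x * G x"
        unfolding v_def by (intro partial_deriv_mult moderate_differentiable cm G)
      then have "c x * partial_deriv j G x = partial_deriv j v x - partial_deriv j c x * G x" by simp
      then have "norm (c x * partial_deriv j G x) \<le> norm (partial_deriv j v x) + norm (partial_deriv j c x * G x)"
        by (simp add: norm_triangle_ineq4)
      moreover have "norm (partial_deriv j c x * G x) \<le> norm (v x)"
      proof -
        have "norm (partial_deriv j c x) \<le> 1 * cutoff \<sigma> x"
          using \<sigma> by (intro order_trans[OF c'] mult_right_mono) (auto simp: less_imp_le)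
        then show ?thesis unfolding nv norm_mult by (intro mult_right_mono) auto
      qed
      moreover have "norm (c x * partial_deriv j G x) = cutoff \<sigma> x * norm (partial_deriv j G x)"
        by (simp add: c_def norm_mult less_imp_le)
      ultimately show ?thesis by linarith
    qed
    let ?K = "\<lambda>x. cutoff \<sigma> x *\<^sub>R schroedinger \<tau> W G x"
    let ?r = "\<lambda>x. norm (?K x) + ((2 * \<tau> * \<sigma>) *\<^sub>R (\<Sum>j\<in>UNIV. norm (partial_deriv j v x)) + (5 * n * \<tau> * \<sigma>) *\<^sub>R norm (v x))"
    have pw: "norm (schroedinger \<tau> W v x) \<le> ?r x" for x
    proof -
      let ?S1 = "\<Sum>j\<in>UNIV. partial_deriv j c x * partial_deriv j G x"
      have 0: "norm (schroedinger \<tau> W v x) \<le> norm (?K x) + (2 * \<tau>) * norm ?S1 + \<tau> * norm (laplacian c x * G x)"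
      proof -
        have "schroedinger \<tau> W v x = ?K x - of_real (2 * \<tau>) * ?S1 - of_real \<tau> * (laplacian c x * G x)"
          unfolding v_def schroedinger_mult[OF cm G] by (simp add: c_def scaleR_conv_of_real mult.assoc)
        also have "norm \<dots> \<le> norm (?K x) + norm (of_real (2 * \<tau>) * ?S1) + norm (of_real \<tau> * (laplacian c x * G x))"
          by (intro order_trans[OF norm_triangle_ineq4] add_right_mono norm_triangle_ineq4)
        finally show ?thesis using \<tau> by (simp only: norm_mult norm_of_real abs_mult abs_numeral abs_of_pos)
      qed
      have 1: "norm ?S1 \<le> \<sigma> * (\<Sum>j\<in>UNIV. norm (partial_deriv j v x)) + n * \<sigma> * norm (v x)"
      proof -
        have "norm ?S1 \<le> (\<Sum>j\<in>(UNIV::'n set). \<sigma> * (norm (partial_deriv j v x) + norm (v x)))"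
        proof (intro order_trans[OF norm_sum] sum_mono)
          fix j
          have "norm (partial_deriv j c x * partial_deriv j G x) \<le> \<sigma> * cutoff \<sigma> x * norm (partial_deriv j G x)"
            unfolding norm_mult by (intro mult_right_mono c') simp
          also have "\<dots> = \<sigma> * (cutoff \<sigma> x * norm (partial_deriv j G x))" by simp
          also have "\<dots> \<le> \<sigma> * (norm (partial_deriv j v x) + norm (v x))"
            using \<sigma> by (intro mult_left_mono dG) auto
          finally show "norm (partial_deriv j c x * partial_deriv j G x) \<le> \<sigma> * (norm (partial_deriv j v x) + norm (v x))" .
        qed
        then show ?thesis by (simp add: sum.distrib sum_distrib_left[symmetric] n_def distrib_left)
      qed
      have 2: "norm (laplacian c x * G x) \<le> 3 * n * \<sigma> * norm (v x)"
      proof -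
        have "norm (laplacian c x) \<le> (\<Sum>j\<in>(UNIV::'n set). 3 * \<sigma> * cutoff \<sigma> x)"
          unfolding laplacian_def by (intro order_trans[OF norm_sum] sum_mono c'')
        then have "norm (laplacian c x) * norm (G x) \<le> (3 * n * \<sigma> * cutoff \<sigma> x) * norm (G x)"
          by (intro mult_right_mono) (auto simp: n_def)
        then show ?thesis by (simp add: norm_mult nv)
      qed
      have "(2 * \<tau>) * norm ?S1 \<le> (2 * \<tau>) * (\<sigma> * (\<Sum>j\<in>UNIV. norm (partial_deriv j v x)) + n * \<sigma> * norm (v x))"
        using \<tau> by (intro mult_left_mono 1) auto
      moreover have "\<tau> * norm (laplacian c x * G x) \<le> \<tau> * (3 * n * \<sigma> * norm (v x))"
        using \<tau> by (intro mult_left_mono 2) auto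
      ultimately show ?thesis using 0 by (simp add: algebra_simps)
    qed
    \<comment> \<open>Solving the product formula for this term exhibits it as a sum of Schwartz
      functions.\<close>
    have sK: "square_integrable ?K"
    proof -
      have "(\<lambda>x. schroedinger \<tau> W v x + of_real (2 * \<tau>) * (\<Sum>j\<in>UNIV. partial_deriv j G x * partial_deriv j c x)
          + of_real \<tau> * (G x * laplacian c x)) \<in> schwartz"
        by (intro schwartz_add schwartz_cmult schwartz_sum schwartz_mult H moderate_partial_deriv
            schwartz_partial_deriv laplacian_schwartz G c) simp
      moreover have "schroedinger \<tau> W v x + of_real (2 * \<tau>) * (\<Sum>j\<in>UNIV. partial_deriv j G x * partial_deriv j c x)
          + of_real \<tau> * (G x * laplacian c x) = ?K x" for x
        unfolding v_def schroedinger_mult[OF cm G] by (simp add: c_def scaleR_conv_of_real mult_ac)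
      ultimately have "?K \<in> schwartz" by (simp only:)
      then show ?thesis by (rule schwartz_square_integrable)
    qed
    have sS: "square_integrable (\<lambda>x. \<Sum>j\<in>UNIV. norm (partial_deriv j v x))"
      and lS: "l2norm (\<lambda>x. \<Sum>j\<in>UNIV. norm (partial_deriv j v x)) \<le> grad_norm v"
      using l2norm_sum[of UNIV "\<lambda>j x. norm (partial_deriv j v x)"] square_integrable_norm[OF sdv]
      by (auto simp: grad_norm_def)
    have Hle: "l2norm (schroedinger \<tau> W v) \<le> k + 2 * \<tau> * \<sigma> * grad_norm v + 5 * n * \<tau> * \<sigma> * l2norm v"
    proof -
      note s1 = square_integrable_norm(1)[OF sK] and s2 = square_integrable_scaleR[OF sS, of "2 * \<tau> * \<sigma>"]
        and s3 = square_integrable_scaleR[OF square_integrable_norm(1)[OF sv], of "5 * n * \<tau> * \<sigma>"]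
      have "l2norm (schroedinger \<tau> W v) \<le> l2norm ?r"
        using schwartz_borel[OF H] pw
        by (intro l2norm_mono square_integrable_add s1 s2 s3) (auto intro: order_trans[OF _ abs_ge_self])
      also have "\<dots> \<le> l2norm (\<lambda>x. norm (?K x)) + (l2norm (\<lambda>x. (2 * \<tau> * \<sigma>) *\<^sub>R (\<Sum>j\<in>UNIV. norm (partial_deriv j v x)))
           + l2norm (\<lambda>x. (5 * n * \<tau> * \<sigma>) *\<^sub>R norm (v x)))"
        by (intro order_trans[OF l2norm_triangle[OF s1 square_integrable_add[OF s2 s3]]] add_left_mono l2norm_triangle s2 s3)
      also have "\<dots> \<le> k + (2 * \<tau> * \<sigma> * grad_norm v + 5 * n * \<tau> * \<sigma> * l2norm v)"
        unfolding l2norm_scaleR square_integrable_norm(2)[OF sK] square_integrable_norm(2)[OF sv]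
        using K \<tau> \<sigma> n lS by (intro add_mono) (auto simp: G_def intro!: mult_left_mono)
      finally show ?thesis by simp
    qed
    have D: "grad_norm v \<le> D0"
    proof (rule ccontr)
      assume "\<not> grad_norm v \<le> D0"
      then have big: "grad_norm v > D0" by simp
      then have D1: "grad_norm v \<ge> 1" using D0 by linarith
      let ?D = "grad_norm v"
      have "l2norm (schroedinger \<tau> W v) \<le> 1 + 2 * \<tau> * ?D + 5 * n * \<tau> * \<beta>"
      proof -
        have "2 * \<tau> * \<sigma> * ?D \<le> 2 * \<tau> * 1 * ?D" using \<sigma> \<tau> D1 by (intro mult_right_mono mult_left_mono) auto
        moreover have "5 * n * \<tau> * \<sigma> * l2norm v \<le> 5 * n * \<tau> * 1 * \<beta>"
          using \<sigma> \<tau> n v\<beta> by (intro mult_mono mult_left_mono) auto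
        ultimately show ?thesis using Hle k by linarith
      qed
      then have "l2norm (schroedinger \<tau> W v) * l2norm v \<le> (1 + 2 * \<tau> * ?D + 5 * n * \<tau> * \<beta>) * \<beta>"
        using v\<beta> \<beta> n \<tau> D1 by (intro mult_mono) auto
      moreover have "\<mu> * (l2norm v)\<^sup>2 \<le> \<mu> * \<beta>\<^sup>2" using v\<beta> \<mu>(1) by (intro mult_left_mono power_mono) auto
      ultimately have "l2norm (schroedinger \<tau> W v) * l2norm v + \<mu> * (l2norm v)\<^sup>2
          \<le> (1 + 2 * \<tau> * ?D + 5 * n * \<tau> * \<beta>) * \<beta> + \<mu> * \<beta>\<^sup>2" by (rule add_mono)
      then have "n * (l2norm (schroedinger \<tau> W v) * l2norm v + \<mu> * (l2norm v)\<^sup>2)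
          \<le> n * ((1 + 2 * \<tau> * ?D + 5 * n * \<tau> * \<beta>) * \<beta> + \<mu> * \<beta>\<^sup>2)"
        using n by (intro mult_left_mono) auto
      then have "\<tau> * ?D\<^sup>2 \<le> n * ((1 + 2 * \<tau> * ?D + 5 * n * \<tau> * \<beta>) * \<beta> + \<mu> * \<beta>\<^sup>2)"
        by (rule order_trans[OF grad_bound[OF v W less_imp_le[OF \<tau>] \<mu>(2), folded n_def]])
      also have "\<dots> = (n * (1 + 5 * n * \<tau> * \<beta>) * \<beta> + n * \<mu> * \<beta>\<^sup>2) + 2 * n * \<tau> * \<beta> * ?D"
        by (simp add: algebra_simps)
      also have "\<dots> \<le> (n * (1 + 5 * n * \<tau> * \<beta>) * \<beta> + n * \<mu> * \<beta>\<^sup>2) * ?D + 2 * n * \<tau> * \<beta> * ?D"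
      proof -
        have "0 \<le> n * (1 + 5 * n * \<tau> * \<beta>) * \<beta> + n * \<mu> * \<beta>\<^sup>2" using n \<tau> \<beta> \<mu> by simp
        from mult_left_mono[OF D1 this] show ?thesis by simp
      qed
      also have "\<dots> = \<tau> * (D0 - 1) * ?D"
      proof -
        have "\<tau> * (D0 - 1) = n * (1 + 5 * n * \<tau> * \<beta>) * \<beta> + n * \<mu> * \<beta>\<^sup>2 + 2 * n * \<tau> * \<beta>"
          using \<tau> by (simp add: D0_def)
        then show ?thesis by (simp only: distrib_right)
      qed
      finally have "\<tau> * ?D * ?D \<le> \<tau> * ?D * (D0 - 1)" by (simp add: power2_eq_square mult_ac)
      then have "?D \<le> D0 - 1" using \<tau> D1 by (subst (asm) mult_le_cancel_left_pos) auto
      then show False using big by linarith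
    qed
    have "2 * \<tau> * \<sigma> * grad_norm v \<le> 2 * \<tau> * \<sigma> * D0" using \<tau> \<sigma> D by (intro mult_left_mono) auto
    moreover have "5 * n * \<tau> * \<sigma> * l2norm v \<le> 5 * n * \<tau> * \<sigma> * \<beta>" using \<tau> \<sigma> n v\<beta> by (intro mult_left_mono) auto
    ultimately have "l2norm (schroedinger \<tau> W v) \<le> k + (2 * \<tau> * \<sigma> * D0 + 5 * n * \<tau> * \<sigma> * \<beta>)" using Hle by linarith
    also have "2 * \<tau> * \<sigma> * D0 + 5 * n * \<tau> * \<sigma> * \<beta> = \<sigma> * E" by (simp add: E_def algebra_simps)
    finally show "l2norm (schroedinger \<tau> W (\<lambda>x. of_real (cutoff \<sigma> x) * mollify \<epsilon> g x)) \<le> k + \<sigma> * E"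
      unfolding v_def c_def G_def .
  qed
qed

text \<open>First \<open>\<sigma>\<close> is chosen to make the commutator terms small, then the
  mollification scale, whose error constant depends on \<open>\<sigma>\<close>. The lower bound
  makes the cut off mollification small in norm; on a fixed box the cutoffs with
  \<open>\<sigma> \<le> 1\<close> have a common positive lower bound, so the box integrals of the
  mollifications tend to 0.\<close>

lemma weak_solution_AE_zero:
  fixes g W :: "real^'n \<Rightarrow> complex"
  assumes g: "square_integrable g" and W: "moderate W" and \<tau>: "\<tau> > 0"
    and \<mu>: "\<mu> \<ge> 0" "\<And>x. - \<mu> \<le> Re (W x)"
    and \<delta>: "\<delta> > 0" "\<And>v. v \<in> schwartz \<Longrightarrow> \<delta> * l2norm v \<le> l2norm (schroedinger \<tau> W v)"
    and weak: "\<And>\<phi>. \<phi> \<in> schwartz \<Longrightarrow> (\<integral>y. g y * schroedinger \<tau> W \<phi> y \<partial>lborel) = 0"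
  shows "AE x in lborel. g x = 0"
proof (rule AE_zero_of_mollified[OF g])
  fix a b :: "real^'n"
  obtain E where E: "E \<ge> 0" and bd: "\<And>\<sigma> \<epsilon> k. 0 < \<sigma> \<Longrightarrow> \<sigma> \<le> 1 \<Longrightarrow> 0 < \<epsilon> \<Longrightarrow> k \<le> 1 \<Longrightarrow>
     l2norm (\<lambda>x. cutoff \<sigma> x *\<^sub>R schroedinger \<tau> W (mollify \<epsilon> g) x) \<le> k \<Longrightarrow>
     l2norm (schroedinger \<tau> W (\<lambda>x. of_real (cutoff \<sigma> x) * mollify \<epsilon> g x)) \<le> k + \<sigma> * E"
    using cutoff_mollify_bound[OF g W \<tau> \<mu>] by blast
  \<comment> \<open>The exponential compensates the cutoff on the box, uniformly in
    \<open>\<sigma> \<le> 1\<close>.\<close>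
  define q where "q = (\<lambda>x::real^'n. indicator (box a b) x * exp (japanese x) :: real)"
  have jc: "continuous_on UNIV (\<lambda>x::real^'n. exp (japanese x))"
    by (intro continuous_intros continuous_on_differentiable japanese_deriv(2))
  have "q \<in> borel_measurable borel"
    unfolding q_def using borel_measurable_continuous_onI[OF jc] by measurable
  then have sq: "square_integrable q"
    by (intro square_integrable_rapid) (auto simp: q_def intro: rapidly_decreasing_indicator_box[OF jc])
  let ?e = "\<lambda>k. 1 / real (Suc k)"
  let ?I = "\<lambda>k. \<integral>x. indicator (box a b) x *\<^sub>R mollify (?e k) g x \<partial>lborel"
  show "?I \<longlonglongrightarrow> 0"
  proof (rule LIMSEQ_I)
    fix e :: real assume e: "e > 0"
    \<comment> \<open>The box integral is at most \<open>l2norm q * l2norm v\<close>, with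
      \<open>l2norm q \<le> A \<delta>\<close>. Making each of the two errors at most
      \<open>e / (4 A)\<close> bounds it by \<open>e / 2\<close>. The 1 keeps \<open>A\<close>
      positive.\<close>
    define A where "A = l2norm q / \<delta> + 1"
    have A: "A > 0" using \<delta>(1) by (simp add: A_def add_nonneg_pos)
    define \<sigma> where "\<sigma> = min 1 (e / (4 * A * (E + 1)))"
    have \<sigma>: "0 < \<sigma>" "\<sigma> \<le> 1" using e A E by (auto simp: \<sigma>_def)
    have "\<sigma> * E \<le> (e / (4 * A * (E + 1))) * (E + 1)"
      using E \<sigma>(1) by (intro mult_mono) (auto simp: \<sigma>_def)
    moreover have "e / (4 * A * q) * q = e / (4 * A)" if "q > 0" for q using that by simp
    ultimately have \<sigma>E: "\<sigma> * E \<le> e / (4 * A)" using E by simp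
    obtain C where C: "C \<ge> 0" and err: "\<And>\<epsilon>. 0 < \<epsilon> \<Longrightarrow> \<epsilon> \<le> 1 \<Longrightarrow>
       l2norm (\<lambda>x. cutoff \<sigma> x *\<^sub>R schroedinger \<tau> W (mollify \<epsilon> g) x) \<le> C * \<epsilon>"
      using cutoff_error_bound[OF g W \<sigma>(1) weak] by blast
    have "(\<lambda>k. C * ?e k) \<longlonglongrightarrow> C * 0"
      using LIMSEQ_inverse_real_of_nat unfolding inverse_eq_divide by (intro tendsto_mult tendsto_const)
    then have "\<forall>\<^sub>F k in sequentially. C * ?e k < min 1 (e / (4 * A))"
      using e A by (intro order_tendstoD(2)) auto
    then obtain N where N: "\<And>k. k \<ge> N \<Longrightarrow> C * ?e k < min 1 (e / (4 * A))"
      by (auto simp: eventually_sequentially)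
    have "norm (?I k - 0) < e" if "k \<ge> N" for k
    proof -
      define v where "v = (\<lambda>x. complex_of_real (cutoff \<sigma> x) * mollify (?e k) g x)"
      have pos: "?e k > 0" by simp
      have v: "v \<in> schwartz"
        unfolding v_def using schwartz_mult[OF mollify_moderate[OF pos g] cutoff_schwartz[OF \<sigma>(1)]]
        by (simp only: mult.commute)
      have "l2norm (schroedinger \<tau> W v) \<le> C * ?e k + \<sigma> * E"
        unfolding v_def using N[OF that] by (intro bd \<sigma> pos err) auto
      then have "\<delta> * l2norm v \<le> C * ?e k + \<sigma> * E" using \<delta>(2)[OF v] by linarith
      also have "\<dots> \<le> e / (4 * A) + e / (4 * A)" using N[OF that] \<sigma>E by (intro add_mono) auto
      also have "\<dots> = e / (2 * A)" using A by (simp add: field_simps)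
      finally have lv: "l2norm v \<le> e / (2 * A) / \<delta>" using \<delta>(1) by (subst pos_le_divide_eq) (simp_all only: mult.commute)
      have "norm (?I k) \<le> l2norm q * l2norm v"
      proof (rule Cauchy_Schwarz_integral(2)[OF sq schwartz_square_integrable[OF v]])
        show "(\<lambda>x. indicator (box a b) x *\<^sub>R mollify (?e k) g x) \<in> borel_measurable borel"
          using moderate_borel[OF mollify_moderate[OF pos g]] by measurable
        fix x :: "real^'n"
        have "1 \<le> exp (japanese x) * cutoff \<sigma> x"
        proof -
          have "\<sigma> * japanese x \<le> 1 * japanese x" using \<sigma> japanese_ge(3)[of x] by (intro mult_right_mono) auto
          then show ?thesis by (simp add: cutoff_def exp_add[symmetric])
        qed
        then have "indicator (box a b) x * norm (mollify (?e k) g x) * 1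
            \<le> indicator (box a b) x * norm (mollify (?e k) g x) * (exp (japanese x) * cutoff \<sigma> x)"
          by (intro mult_left_mono) auto
        then show "norm (indicator (box a b) x *\<^sub>R mollify (?e k) g x) \<le> norm (q x) * norm (v x)"
          by (simp add: q_def v_def norm_mult abs_mult less_imp_le mult_ac)
      qed
      also have "\<dots> \<le> (A * \<delta>) * (e / (2 * A) / \<delta>)"
        using lv \<delta>(1) A e by (intro mult_mono) (auto simp: A_def field_simps)
      also have "\<dots> = e / 2" using A \<delta>(1) by simp
      finally show ?thesis using e by simp
    qed
    then show "\<exists>N. \<forall>k\<ge>N. norm (?I k - 0) < e" by blast
  qed
qed

section \<open>Closures in \<open>L\<^sup>2\<close>\<close>

lemma integral_add_sub_square:
  assumes "square_integrable f" "square_integrable g"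
  shows "(l2norm (\<lambda>x. f x + g x))\<^sup>2 + (l2norm (\<lambda>x. f x - g x))\<^sup>2 = 2 * (l2norm f)\<^sup>2 + 2 * (l2norm g)\<^sup>2"
proof -
  note i = assms[THEN square_integrableD(2)] square_integrableD(2)[OF square_integrable_add[OF assms]]
    square_integrableD(2)[OF square_integrable_diff[OF assms]]
  have pl: "(norm (x + y))\<^sup>2 + (norm (x - y))\<^sup>2 = 2 * (norm x)\<^sup>2 + 2 * (norm y)\<^sup>2" for x y :: 'b
    by (simp add: power2_norm_eq_inner inner_simps inner_commute)
  have "(l2norm (\<lambda>x. f x + g x))\<^sup>2 + (l2norm (\<lambda>x. f x - g x))\<^sup>2
      = (\<integral>x. (norm (f x + g x))\<^sup>2 + (norm (f x - g x))\<^sup>2 \<partial>lborel)"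
    using i by (simp add: l2norm_power2)
  also have "\<dots> = (\<integral>x. 2 * (norm (f x))\<^sup>2 + 2 * (norm (g x))\<^sup>2 \<partial>lborel)" by (simp only: pl)
  also have "\<dots> = 2 * (l2norm f)\<^sup>2 + 2 * (l2norm g)\<^sup>2" using i by (simp add: l2norm_power2)
  finally show ?thesis .
qed

text \<open>The distance from \<open>f\<close> to a subspace \<open>S\<close> of \<open>L\<^sup>2\<close> with trivial orthogonal complement is \<open>0\<close>:
  minimizing sequences are Cauchy by the parallelogram law, and the difference between \<open>f\<close> and their
  limit is orthogonal to \<open>S\<close>.\<close>

lemma dense_of_trivial_complement:
  fixes S :: "('a::euclidean_space \<Rightarrow> complex) set"
  assumes sq: "\<And>s. s \<in> S \<Longrightarrow> square_integrable s" and ne: "S \<noteq> {}"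
    and add: "\<And>s t. s \<in> S \<Longrightarrow> t \<in> S \<Longrightarrow> (\<lambda>x. s x + t x) \<in> S"
    and cmult: "\<And>c s. s \<in> S \<Longrightarrow> (\<lambda>x. c * s x) \<in> S"
    and triv: "\<And>g. square_integrable g \<Longrightarrow> (\<And>s. s \<in> S \<Longrightarrow> (\<integral>x. cnj (g x) * s x \<partial>lborel) = 0) \<Longrightarrow>
       AE x in lborel. g x = 0"
    and f: "square_integrable f" and e: "e > 0"
  shows "\<exists>s\<in>S. l2norm (\<lambda>x. f x - s x) < e"
proof -
  define d where "d = (INF s\<in>S. (l2norm (\<lambda>x. f x - s x))\<^sup>2)"
  have bdd: "bdd_below ((\<lambda>s. (l2norm (\<lambda>x. f x - s x))\<^sup>2) ` S)" by (rule bdd_belowI[of _ 0]) auto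
  have d_le: "d \<le> (l2norm (\<lambda>x. f x - s x))\<^sup>2" if "s \<in> S" for s
    unfolding d_def by (rule cINF_lower[OF bdd that])
  have d0: "d \<ge> 0" unfolding d_def by (rule cINF_greatest[OF ne]) simp
  have "\<exists>s\<in>S. (l2norm (\<lambda>x. f x - s x))\<^sup>2 < d + 1 / real (Suc k)" for k
    using cINF_less_iff[OF ne bdd, of "d + 1 / real (Suc k)"] unfolding d_def by simp
  then obtain s where s: "\<And>k. s k \<in> S" and sd: "\<And>k. (l2norm (\<lambda>x. f x - s k x))\<^sup>2 < d + 1 / real (Suc k)"
    by metis
  have fs: "square_integrable (\<lambda>x. f x - t x)" if "t \<in> S" for t by (intro square_integrable_diff f sq that)
  define u where "u k x = f x - s k x" for k x
  have u: "square_integrable (u k)" for k unfolding u_def[abs_def] by (rule fs[OF s])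
  have gap: "(l2norm (\<lambda>x. u m x - u n x))\<^sup>2 \<le> 2 / real (Suc m) + 2 / real (Suc n)" for m n
  proof -
    \<comment> \<open>The midpoint of two approximants lies in \<open>S\<close>, so the sum of the
      two residuals has norm squared at least \<open>4 d\<close>. The parallelogram law then bounds
      their difference.\<close>
    have "(\<lambda>x. (1/2) * (s m x + s n x)) \<in> S" by (intro cmult add s)
    from d_le[OF this] have "4 * d \<le> 4 * (l2norm (\<lambda>x. f x - (1/2) * (s m x + s n x)))\<^sup>2" by simp
    also have "\<dots> = (l2norm (\<lambda>x. 2 * (f x - (1/2) * (s m x + s n x))))\<^sup>2"
      by (simp only: l2norm_cmult power_mult_distrib) simp
    also have "(\<lambda>x. 2 * (f x - (1/2) * (s m x + s n x))) = (\<lambda>x. u m x + u n x)"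
      by (rule ext) (simp add: u_def algebra_simps)
    finally have "4 * d \<le> (l2norm (\<lambda>x. u m x + u n x))\<^sup>2" .
    moreover have "(l2norm (u m))\<^sup>2 < d + 1 / real (Suc m)" "(l2norm (u n))\<^sup>2 < d + 1 / real (Suc n)"
      unfolding u_def[abs_def] by (rule sd)+
    ultimately show ?thesis using integral_add_sub_square[OF u[of m] u[of n]] by simp
  qed
  have "\<exists>N. \<forall>m\<ge>N. \<forall>n\<ge>N. l2norm (\<lambda>x. u m x - u n x) < \<epsilon>" if "\<epsilon> > 0" for \<epsilon>
  proof -
    obtain N where N: "4 / \<epsilon>\<^sup>2 < real N" using reals_Archimedean2 by blast
    have "l2norm (\<lambda>x. u m x - u n x) < \<epsilon>" if mn: "m \<ge> N" "n \<ge> N" for m n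
    proof (rule power2_less_imp_less)
      have "2 / real (Suc k) < \<epsilon>\<^sup>2 / 2" if "k \<ge> N" for k
      proof -
        have "4 / \<epsilon>\<^sup>2 < real (Suc k)" using N that by simp
        then show ?thesis using \<open>\<epsilon> > 0\<close> by (simp add: field_simps)
      qed
      from this[OF mn(1)] this[OF mn(2)] show "(l2norm (\<lambda>x. u m x - u n x))\<^sup>2 < \<epsilon>\<^sup>2"
        using gap[of m n] by linarith
    qed (use \<open>\<epsilon> > 0\<close> in simp)
    then show ?thesis by blast
  qed
  from square_integrable_complete[OF u this]
  obtain w where w: "square_integrable w" and lim: "(\<lambda>k. l2norm (\<lambda>x. u k x - w x)) \<longlonglongrightarrow> 0" by blast
  have w_le: "(l2norm w)\<^sup>2 \<le> d"
  proof (rule LIMSEQ_le_const)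
    have "(\<lambda>k. (sqrt (d + 1 / real (Suc k)) + l2norm (\<lambda>x. u k x - w x))\<^sup>2) \<longlonglongrightarrow> (sqrt (d + 0) + 0)\<^sup>2"
      using LIMSEQ_inverse_real_of_nat unfolding inverse_eq_divide by (intro tendsto_intros lim)
    then show "(\<lambda>k. (sqrt (d + 1 / real (Suc k)) + l2norm (\<lambda>x. u k x - w x))\<^sup>2) \<longlonglongrightarrow> d" using d0 by simp
    have "l2norm w \<le> sqrt (d + 1 / real (Suc k)) + l2norm (\<lambda>x. u k x - w x)" for k
    proof -
      have "l2norm (\<lambda>x. u k x + (w x - u k x)) \<le> l2norm (u k) + l2norm (\<lambda>x. w x - u k x)"
        by (intro l2norm_triangle u square_integrable_diff w)
      moreover have "l2norm (u k) \<le> sqrt (d + 1 / real (Suc k))"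
        using sd[of k] unfolding u_def[abs_def] by (intro real_le_rsqrt) simp
      ultimately show ?thesis by (simp add: l2norm_minus_commute[of w])
    qed
    then show "\<exists>N. \<forall>k\<ge>N. (l2norm w)\<^sup>2 \<le> (sqrt (d + 1 / real (Suc k)) + l2norm (\<lambda>x. u k x - w x))\<^sup>2"
      by (intro exI allI impI power_mono) auto
  qed
  \<comment> \<open>Minimality passes to the limit, since \<open>f - s k - t\<close> tends to
    \<open>w - t\<close>. With \<open>w_le\<close> this says that subtracting an element of
    \<open>S\<close> never makes \<open>w\<close> shorter.\<close>
  have near: "d \<le> (l2norm (\<lambda>x. w x - t x))\<^sup>2" if t: "t \<in> S" for t
  proof (rule LIMSEQ_le_const)
    have "(\<lambda>k. (l2norm (\<lambda>x. w x - t x) + l2norm (\<lambda>x. u k x - w x))\<^sup>2) \<longlonglongrightarrow> (l2norm (\<lambda>x. w x - t x) + 0)\<^sup>2"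
      by (intro tendsto_intros lim)
    then show "(\<lambda>k. (l2norm (\<lambda>x. w x - t x) + l2norm (\<lambda>x. u k x - w x))\<^sup>2) \<longlonglongrightarrow> (l2norm (\<lambda>x. w x - t x))\<^sup>2" by simp
    have "d \<le> (l2norm (\<lambda>x. w x - t x) + l2norm (\<lambda>x. u k x - w x))\<^sup>2" for k
    proof -
      have "d \<le> (l2norm (\<lambda>x. f x - (s k x + t x)))\<^sup>2" by (intro d_le add s t)
      also have "(\<lambda>x. f x - (s k x + t x)) = (\<lambda>x. (w x - t x) + (u k x - w x))"
        by (rule ext) (simp add: u_def)
      also have "(l2norm \<dots>)\<^sup>2 \<le> (l2norm (\<lambda>x. w x - t x) + l2norm (\<lambda>x. u k x - w x))\<^sup>2"
        by (intro power_mono l2norm_triangle square_integrable_diff w u sq t) simp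
      finally show ?thesis .
    qed
    then show "\<exists>N. \<forall>k\<ge>N. d \<le> (l2norm (\<lambda>x. w x - t x) + l2norm (\<lambda>x. u k x - w x))\<^sup>2" by blast
  qed
  have orth: "(\<integral>x. cnj (w x) * t x \<partial>lborel) = 0" if t: "t \<in> S" for t
  proof -
    note st = sq[OF t]
    have [measurable]: "w \<in> borel_measurable borel" "t \<in> borel_measurable borel"
      using square_integrableD(1)[OF w] square_integrableD(1)[OF st] by auto
    have i: "integrable lborel (\<lambda>x. cnj (w x) * t x)"
      by (rule Cauchy_Schwarz_integral(1)[OF w st]) (auto simp: norm_mult)
    define a where "a = (\<integral>x. cnj (w x) * t x \<partial>lborel)"
    \<comment> \<open>Compare \<open>w\<close> with \<open>w\<close> minus \<open>r * cnj a\<close>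
      times \<open>t\<close>. The phase \<open>cnj a\<close> makes the linear term real, and a
      quadratic inequality without constant term for all real \<open>r\<close> forces
      \<open>a = 0\<close>.\<close>
    have "2 * r * (norm a)\<^sup>2 \<le> r\<^sup>2 * ((norm a)\<^sup>2 * (l2norm t)\<^sup>2) + 0" for r :: real
    proof -
      let ?c = "of_real r * cnj a"
      have "(\<lambda>x. ?c * t x) \<in> S" by (intro cmult t)
      from near[OF this] w_le have "(l2norm w)\<^sup>2 \<le> (l2norm (\<lambda>x. w x - ?c * t x))\<^sup>2" by linarith
      also have "\<dots> = (\<integral>x. (norm (w x))\<^sup>2 - 2 * Re (?c * (cnj (w x) * t x)) + (norm ?c)\<^sup>2 * (norm (t x))\<^sup>2 \<partial>lborel)"
        unfolding l2norm_power2
      proof (rule Bochner_Integration.integral_cong)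
        fix x
        have "(norm (p - q))\<^sup>2 = (norm p)\<^sup>2 - 2 * Re (cnj p * q) + (norm q)\<^sup>2" for p q :: complex
          unfolding cmod_power2 by (simp add: power2_eq_square algebra_simps)
        from this[of "w x" "?c * t x"]
        show "(norm (w x - ?c * t x))\<^sup>2 = (norm (w x))\<^sup>2 - 2 * Re (?c * (cnj (w x) * t x)) + (norm ?c)\<^sup>2 * (norm (t x))\<^sup>2"
          by (simp only: norm_mult power_mult_distrib mult_ac)
      qed simp
      also have "\<dots> = (l2norm w)\<^sup>2 - 2 * Re (?c * a) + (norm ?c)\<^sup>2 * (l2norm t)\<^sup>2"
      proof -
        have i': "integrable lborel (\<lambda>x. ?c * (cnj (w x) * t x))" using i by (rule integrable_mult_right)
        have "(\<integral>x. Re (?c * (cnj (w x) * t x)) \<partial>lborel) = Re (\<integral>x. ?c * (cnj (w x) * t x) \<partial>lborel)"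
          by (rule integral_Re[OF i'])
        also have "(\<integral>x. ?c * (cnj (w x) * t x) \<partial>lborel) = ?c * (\<integral>x. cnj (w x) * t x \<partial>lborel)"
          by (rule integral_mult_right_zero)
        also have "(\<integral>x. cnj (w x) * t x \<partial>lborel) = a" by (rule a_def[symmetric])
        finally have "(\<integral>x. Re (?c * (cnj (w x) * t x)) \<partial>lborel) = Re (?c * a)" .
        moreover have "(\<integral>x. f x - 2 * R x + k * h x \<partial>lborel)
            = (\<integral>x. f x \<partial>lborel) - 2 * (\<integral>x. R x \<partial>lborel) + k * (\<integral>x. h x \<partial>lborel)"
          if "integrable lborel f" "integrable lborel R" "integrable lborel h" for f R h :: "'a \<Rightarrow> real" and k
          using that by simp
        note this[OF square_integrableD(2)[OF w] integrable_Re[OF i'] square_integrableD(2)[OF st]]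
        ultimately show ?thesis unfolding l2norm_power2 by (simp only:)
      qed
      also have "Re (?c * a) = r * (norm a)\<^sup>2"
        using mult_cnj_norm[of a] by (simp add: mult.assoc mult.commute[of "cnj a"])
      finally show ?thesis by (simp add: norm_mult power_mult_distrib mult_ac)
    qed
    from discriminant_bound[OF this] have "((norm a)\<^sup>2)\<^sup>2 \<le> 0" by simp
    then show ?thesis by (simp add: a_def)
  qed
  have "AE x in lborel. w x = 0" by (rule triv[OF w orth])
  then have "l2norm w = l2norm (\<lambda>x::'a. 0 :: complex)"
    using square_integrableD(1)[OF w] by (intro l2norm_cong_AE) auto
  then have w0: "l2norm w = 0" by (simp add: l2norm_def)
  obtain k where "l2norm (\<lambda>x. u k x - w x) < e"
    using order_tendstoD(2)[OF lim e] by (auto simp: eventually_sequentially)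
  moreover have "l2norm (\<lambda>x. (u k x - w x) + w x) \<le> l2norm (\<lambda>x. u k x - w x) + l2norm w"
    by (intro l2norm_triangle square_integrable_diff u w)
  ultimately have "l2norm (u k) < e" using w0 by simp
  then show ?thesis using s[of k] unfolding u_def[abs_def] by blast
qed

section \<open>Symmetry of the operator and properties of its graph closure\<close>

lemma integral_laplacian_symmetric:
  fixes u v :: "real^'n \<Rightarrow> complex"
  assumes u: "u \<in> schwartz" and v: "v \<in> schwartz"
  shows "(\<integral>x. laplacian u x * v x \<partial>lborel) = (\<integral>x. u x * laplacian v x \<partial>lborel)"
proof -
  note du = schwartz_partial_deriv[OF u] and dv = schwartz_partial_deriv[OF v]
  note a = integral_by_parts[OF schwartz_rapid_C1[OF du] rapid_C1_imp_poly_C1[OF schwartz_rapid_C1[OF v]]]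
  note b = integral_by_parts[OF schwartz_rapid_C1[OF u] rapid_C1_imp_poly_C1[OF schwartz_rapid_C1[OF dv]]]
  have "(\<integral>x. laplacian u x * v x \<partial>lborel) = (\<Sum>j\<in>UNIV. \<integral>x. partial_deriv j (partial_deriv j u) x * v x \<partial>lborel)"
    unfolding laplacian_def sum_distrib_right by (intro Bochner_Integration.integral_sum a(2))
  also have "\<dots> = (\<Sum>j\<in>UNIV. \<integral>x. u x * partial_deriv j (partial_deriv j v) x \<partial>lborel)"
    by (intro sum.cong refl) (simp add: a(1) b(1))
  also have "\<dots> = (\<integral>x. u x * laplacian v x \<partial>lborel)"
    unfolding laplacian_def sum_distrib_left by (intro Bochner_Integration.integral_sum[symmetric] b(3))
  finally show ?thesis .
qed

lemma schwartz_mult_integrable: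
  assumes "u \<in> schwartz" "v \<in> schwartz" shows "integrable lborel (\<lambda>x. u x * v x)"
  by (rule schwartz_integrable[OF schwartz_mult[OF schwartz_imp_moderate[OF assms(1)] assms(2)]])

lemma schroedinger_symmetric:
  fixes u v W :: "real^'n \<Rightarrow> complex"
  assumes u: "u \<in> schwartz" and v: "v \<in> schwartz" and W: "moderate W"
  shows "(\<integral>x. schroedinger \<tau> W u x * v x \<partial>lborel) = (\<integral>x. u x * schroedinger \<tau> W v x \<partial>lborel)"
proof -
  have i: "integrable lborel (\<lambda>x. laplacian u x * v x)" "integrable lborel (\<lambda>x. u x * laplacian v x)"
    by (intro schwartz_mult_integrable laplacian_schwartz u v)+
  have iW: "integrable lborel (\<lambda>x. W x * u x * v x)"
    by (intro schwartz_mult_integrable schwartz_mult W u v)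
  have "(\<integral>x. schroedinger \<tau> W u x * v x \<partial>lborel)
      = (\<integral>x. - of_real \<tau> * (laplacian u x * v x) + W x * u x * v x \<partial>lborel)"
    by (simp add: schroedinger_def algebra_simps)
  also have "\<dots> = - of_real \<tau> * (\<integral>x. laplacian u x * v x \<partial>lborel) + (\<integral>x. W x * u x * v x \<partial>lborel)"
    using i iW by simp
  also have "\<dots> = - of_real \<tau> * (\<integral>x. u x * laplacian v x \<partial>lborel) + (\<integral>x. W x * u x * v x \<partial>lborel)"
    by (simp only: integral_laplacian_symmetric[OF u v])
  also have "\<dots> = (\<integral>x. - of_real \<tau> * (u x * laplacian v x) + W x * u x * v x \<partial>lborel)"
    using i iW by simp
  also have "\<dots> = (\<integral>x. u x * schroedinger \<tau> W v x \<partial>lborel)"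
    by (simp add: schroedinger_def algebra_simps)
  finally show ?thesis .
qed

lemma laplacian_add_cmult:
  assumes "u \<in> schwartz" "v \<in> schwartz"
  shows "laplacian (\<lambda>x. u x + c * v x) x = laplacian u x + c * laplacian v x"
proof -
  have 1: "partial_deriv j (\<lambda>x. u x + c * v x) = (\<lambda>x. partial_deriv j u x + c * partial_deriv j v x)"
    if "u \<in> schwartz" "v \<in> schwartz" for j and u v :: "real^'a \<Rightarrow> complex"
  proof
    fix x
    have "(\<lambda>x. c * v x) differentiable (at x)" 
      by (rule differentiable_mult[OF differentiable_const schwartz_differentiable[OF that(2)]])
    from partial_deriv_add[OF schwartz_differentiable[OF that(1)] this]
    show "partial_deriv j (\<lambda>x. u x + c * v x) x = partial_deriv j u x + c * partial_deriv j v x"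
      by (simp add: partial_deriv_cmult(1)[OF schwartz_differentiable[OF that(2)]])
  qed
  show ?thesis
    unfolding laplacian_def
    by (simp add: 1 assms schwartz_partial_deriv sum.distrib sum_distrib_left)
qed

lemma schroedinger_add_cmult:
  assumes "u \<in> schwartz" "v \<in> schwartz"
  shows "schroedinger \<tau> W (\<lambda>x. u x + c * v x) x = schroedinger \<tau> W u x + c * schroedinger \<tau> W v x"
  unfolding schroedinger_def laplacian_add_cmult[OF assms] by (simp add: algebra_simps)

lemma schroedinger_cmult:
  assumes "v \<in> schwartz"
  shows "schroedinger \<tau> W (\<lambda>x. c * v x) x = c * schroedinger \<tau> W v x"
proof -
  have "laplacian (\<lambda>x. 0) x = 0" for x :: "real^'a"
  proof -
    have "partial_deriv j (\<lambda>x::real^'a. 0::complex) = (\<lambda>x. 0)" for j by (rule ext) simp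
    then show ?thesis by (simp add: laplacian_def)
  qed
  then show ?thesis
    using schroedinger_add_cmult[OF schwartz_zero assms, of \<tau> W c x] by (simp add: schroedinger_def)
qed

text \<open>The Schwartz space is invariant under the operator, so the approximating pairs are
  square integrable from the start and can be indexed by Schwartz functions alone.\<close>

definition closure_graph :: "real \<Rightarrow> (real^'n \<Rightarrow> complex) \<Rightarrow> 'n::finite L2_graph" where
  "closure_graph \<tau> W = {(u, F). square_integrable u \<and> square_integrable F \<and>
     (\<forall>\<epsilon>>0. \<exists>v\<in>schwartz. l2norm (\<lambda>x. u x - v x) < \<epsilon> \<and> l2norm (\<lambda>x. F x - schroedinger \<tau> W v x) < \<epsilon>)}"

text \<open>The same approximants serve both closures, because adding \<open>c\<close> perturbs the
  operator by a bounded one. Applied with \<open>- z\<close> and \<open>z\<close>, it shows that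
  taking the closure commutes with subtracting the scalar.\<close>

lemma closure_graph_add_cmult:
  assumes W: "moderate W" and uF: "(u, F) \<in> closure_graph \<tau> W"
  shows "(u, \<lambda>x. F x + c * u x) \<in> closure_graph \<tau> (\<lambda>x. W x + c)"
proof -
  have u: "square_integrable u" and F: "square_integrable F" using uF by (auto simp: closure_graph_def)
  show ?thesis
    unfolding closure_graph_def
  proof (intro CollectI case_prodI conjI allI impI u square_integrable_add F square_integrable_cmult)
    fix \<epsilon> :: real assume \<epsilon>: "\<epsilon> > 0"
    define d where "d = \<epsilon> / (1 + norm c)"
    have d: "d > 0" using \<epsilon> by (simp add: d_def add_pos_nonneg)
    have dc: "d + norm c * d = \<epsilon>"
      unfolding d_def by (simp add: field_simps add_pos_nonneg less_imp_neq[symmetric] add_nonneg_eq_0_iff)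
    have "d \<le> \<epsilon>" using dc d by (metis add_increasing2 mult_nonneg_nonneg norm_ge_zero less_imp_le order_refl)
    obtain v where v: "v \<in> schwartz" and uv: "l2norm (\<lambda>x. u x - v x) < d"
      and Fv: "l2norm (\<lambda>x. F x - schroedinger \<tau> W v x) < d"
      using uF d unfolding closure_graph_def by blast
    have "(\<lambda>x. F x + c * u x - schroedinger \<tau> (\<lambda>x. W x + c) v x)
       = (\<lambda>x. (F x - schroedinger \<tau> W v x) + c * (u x - v x))"
      by (rule ext) (simp add: schroedinger_def algebra_simps)
    moreover have "l2norm (\<lambda>x. (F x - schroedinger \<tau> W v x) + c * (u x - v x))
       \<le> l2norm (\<lambda>x. F x - schroedinger \<tau> W v x) + norm c * l2norm (\<lambda>x. u x - v x)"
      unfolding l2norm_cmult[symmetric]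
      by (intro l2norm_triangle square_integrable_diff square_integrable_cmult F u
          schwartz_square_integrable schroedinger_schwartz v W)
    moreover have "norm c * l2norm (\<lambda>x. u x - v x) \<le> norm c * d" using uv by (intro mult_left_mono) auto
    ultimately have "l2norm (\<lambda>x. F x + c * u x - schroedinger \<tau> (\<lambda>x. W x + c) v x) < \<epsilon>"
      using Fv dc by simp
    then show "\<exists>v\<in>schwartz. l2norm (\<lambda>x. u x - v x) < \<epsilon> \<and>
        l2norm (\<lambda>x. F x + c * u x - schroedinger \<tau> (\<lambda>x. W x + c) v x) < \<epsilon>"
      using v uv \<open>d \<le> \<epsilon>\<close> by (intro bexI[of _ v]) auto
  qed
qed

lemma weyl_closure_eq:
  fixes V :: "real^'n \<Rightarrow> complex"
  assumes V: "moderate V"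
  shows "weyl_closure (schroedinger_symbol V) h = closure_graph ((h / (2 * pi))\<^sup>2) V"
proof -
  have w: "weyl (schroedinger_symbol V) h u = schroedinger ((h / (2 * pi))\<^sup>2) V u" if "u \<in> schwartz" for u
    by (rule ext) (rule weyl_eq_schroedinger[OF that V])
  have "{(u, weyl (schroedinger_symbol V) h u) | u. u \<in> schwartz} \<inter> (L2 \<times> L2)
      = {(u, schroedinger ((h / (2 * pi))\<^sup>2) V u) | u. u \<in> schwartz}"
    using w by (auto simp: L2_iff intro!: schwartz_square_integrable schroedinger_schwartz V)
  then show ?thesis
    unfolding weyl_closure_def L2_graph_closure_def closure_graph_def L2_iff L2norm_eq by fastforce
qed

lemma graph_minus_scalar_eq:
  assumes V: "moderate V"
  shows "graph_minus_scalar (closure_graph \<tau> V) z = closure_graph \<tau> (\<lambda>x. V x - z)"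
proof (intro set_eqI iffI; clarify)
  fix u F assume "(u, F) \<in> graph_minus_scalar (closure_graph \<tau> V) z"
  then obtain f where f: "(u, f) \<in> closure_graph \<tau> V" and F: "F = (\<lambda>x. f x - z * u x)"
    by (auto simp: graph_minus_scalar_def)
  from closure_graph_add_cmult[OF V f, of "- z"] show "(u, F) \<in> closure_graph \<tau> (\<lambda>x. V x - z)"
    by (simp add: F)
next
  fix u F assume "(u, F) \<in> closure_graph \<tau> (\<lambda>x. V x - z)"
  from closure_graph_add_cmult[OF moderate_diff_const[OF V] this, of z]
  have "(u, \<lambda>x. F x + z * u x) \<in> closure_graph \<tau> V" by simp
  then show "(u, F) \<in> graph_minus_scalar (closure_graph \<tau> V) z"
    unfolding graph_minus_scalar_def by (intro CollectI exI[of _ u] exI[of _ "\<lambda>x. F x + z * u x"]) simp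
qed

lemma closure_graph_diff:
  fixes W :: "real^'n \<Rightarrow> complex"
  assumes W: "moderate W" and uF: "(u, F) \<in> closure_graph \<tau> W" and vG: "(v, G) \<in> closure_graph \<tau> W"
  shows "(\<lambda>x. u x - v x, \<lambda>x. F x - G x) \<in> closure_graph \<tau> W"
proof -
  have s: "square_integrable u" "square_integrable F" "square_integrable v" "square_integrable G"
    using uF vG by (auto simp: closure_graph_def)
  show ?thesis
    unfolding closure_graph_def
  proof (intro CollectI case_prodI conjI allI impI square_integrable_diff s)
    fix \<epsilon> :: real assume "\<epsilon> > 0"
    then have e: "\<epsilon> / 2 > 0" by simp
    obtain a where a: "a \<in> schwartz" "l2norm (\<lambda>x. u x - a x) < \<epsilon> / 2" "l2norm (\<lambda>x. F x - schroedinger \<tau> W a x) < \<epsilon> / 2"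
      using uF e unfolding closure_graph_def by blast
    obtain b where b: "b \<in> schwartz" "l2norm (\<lambda>x. v x - b x) < \<epsilon> / 2" "l2norm (\<lambda>x. G x - schroedinger \<tau> W b x) < \<epsilon> / 2"
      using vG e unfolding closure_graph_def by blast
    note sa = schwartz_square_integrable[OF a(1)] schwartz_square_integrable[OF schroedinger_schwartz[OF a(1) W]]
    note sb = schwartz_square_integrable[OF b(1)] schwartz_square_integrable[OF schroedinger_schwartz[OF b(1) W]]
    have tri: "l2norm (\<lambda>x. (p x - q x) - (p' x - q' x)) < \<epsilon>"
      if "square_integrable p" "square_integrable p'" "square_integrable q" "square_integrable q'"
        "l2norm (\<lambda>x. p x - p' x) < \<epsilon> / 2" "l2norm (\<lambda>x. q x - q' x) < \<epsilon> / 2" for p q p' q' :: "real^'n \<Rightarrow> complex"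
    proof -
      have "l2norm (\<lambda>x. (p x - p' x) + (q' x - q x)) \<le> l2norm (\<lambda>x. p x - p' x) + l2norm (\<lambda>x. q' x - q x)"
        by (intro l2norm_triangle square_integrable_diff that)
      moreover have "(\<lambda>x. (p x - p' x) + (q' x - q x)) = (\<lambda>x. (p x - q x) - (p' x - q' x))"
        by (rule ext) simp
      ultimately show ?thesis using that(5,6) l2norm_minus_commute[of q q'] by simp
    qed
    have eq: "schroedinger \<tau> W (\<lambda>x. a x - b x) x = schroedinger \<tau> W a x - schroedinger \<tau> W b x" for x
      using schroedinger_add_cmult[OF a(1) b(1), of \<tau> W "-1" x] by simp
    show "\<exists>w\<in>schwartz. l2norm (\<lambda>x. u x - v x - w x) < \<epsilon> \<and> l2norm (\<lambda>x. F x - G x - schroedinger \<tau> W w x) < \<epsilon>"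
      using tri[OF s(1) sa(1) s(3) sb(1) a(2) b(2)] tri[OF s(2) sa(2) s(4) sb(2) a(3) b(3)] schwartz_diff[OF a(1) b(1)]
      by (intro bexI[of _ "\<lambda>x. a x - b x"]) (auto simp: eq)
  qed
qed

lemma closure_graph_lower_bound:
  assumes W: "moderate W" and uF: "(u, F) \<in> closure_graph \<tau> W" and \<delta>: "\<delta> > 0"
    and lower: "\<And>v. v \<in> schwartz \<Longrightarrow> \<delta> * l2norm v \<le> l2norm (schroedinger \<tau> W v)"
  shows "\<delta> * l2norm u \<le> l2norm F"
proof (rule field_le_epsilon)
  fix e :: real assume "e > 0"
  define d where "d = e / (1 + \<delta>)"
  have d: "d > 0" using \<open>e > 0\<close> \<delta> by (simp add: d_def)
  have de: "d + \<delta> * d = e" using \<delta> by (simp add: d_def field_simps add_pos_pos less_imp_neq[symmetric])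
  have s: "square_integrable u" "square_integrable F" using uF by (auto simp: closure_graph_def)
  obtain v where v: "v \<in> schwartz" "l2norm (\<lambda>x. u x - v x) < d" "l2norm (\<lambda>x. F x - schroedinger \<tau> W v x) < d"
    using uF d unfolding closure_graph_def by blast
  note sv = schwartz_square_integrable[OF v(1)] schwartz_square_integrable[OF schroedinger_schwartz[OF v(1) W]]
  have "l2norm (\<lambda>x. (u x - v x) + v x) \<le> l2norm (\<lambda>x. u x - v x) + l2norm v"
    by (intro l2norm_triangle square_integrable_diff s sv)
  then have 1: "l2norm u \<le> d + l2norm v" using v(2) by simp
  have "l2norm (\<lambda>x. (schroedinger \<tau> W v x - F x) + F x) \<le> l2norm (\<lambda>x. schroedinger \<tau> W v x - F x) + l2norm F"
    by (intro l2norm_triangle square_integrable_diff s sv)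
  then have 2: "l2norm (schroedinger \<tau> W v) \<le> d + l2norm F"
    using v(3) l2norm_minus_commute[of F "schroedinger \<tau> W v"] by simp
  have "\<delta> * l2norm u \<le> \<delta> * (d + l2norm v)" using 1 \<delta> by (intro mult_left_mono) auto
  also have "\<dots> = \<delta> * d + \<delta> * l2norm v" by (rule distrib_left)
  also have "\<dots> \<le> \<delta> * d + (d + l2norm F)" using lower[OF v(1)] 2 by linarith
  finally show "\<delta> * l2norm u \<le> l2norm F + e" using de by simp
qed

text \<open>Closability by symmetry: if \<open>v\<close> is close to 0 and its image close to
  \<open>F\<close>, the pairing of \<open>F\<close> with a Schwartz function is close to the pairing
  of \<open>v\<close> with the image of that function, hence to 0.\<close>

lemma closure_graph_single_valued:
  fixes W :: "real^'n \<Rightarrow> complex"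
  assumes W: "moderate W" and uF: "(u, F) \<in> closure_graph \<tau> W" and u0: "l2norm u = 0"
  shows "AE x in lborel. F x = 0"
proof (rule AE_zero_of_orthogonal)
  have s: "square_integrable u" "square_integrable F" using uF by (auto simp: closure_graph_def)
  show "square_integrable F" by (rule s(2))
  fix \<phi> :: "real^'n \<Rightarrow> complex" assume \<phi>: "\<phi> \<in> schwartz"
  let ?H = "schroedinger \<tau> W"
  note s\<phi> = schwartz_square_integrable[OF \<phi>] schwartz_square_integrable[OF schroedinger_schwartz[OF \<phi> W]]
  define A where "A = l2norm \<phi> + l2norm (?H \<phi>) + 1"
  have A: "A > 0" by (simp add: A_def add_nonneg_pos)
  have "norm (\<integral>x. F x * \<phi> x \<partial>lborel) \<le> 0 + e" if e: "e > 0" for e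
  proof -
    have d: "e / A > 0" using e A by simp
    obtain v where v: "v \<in> schwartz" "l2norm (\<lambda>x. u x - v x) < e / A" "l2norm (\<lambda>x. F x - ?H v x) < e / A"
      using uF d unfolding closure_graph_def by blast
    note sv = schwartz_square_integrable[OF v(1)] schwartz_square_integrable[OF schroedinger_schwartz[OF v(1) W]]
    have "l2norm (\<lambda>x. (v x - u x) + u x) \<le> l2norm (\<lambda>x. v x - u x) + l2norm u"
      by (intro l2norm_triangle square_integrable_diff s sv)
    then have lv: "l2norm v \<le> e / A" using v(2) u0 l2norm_minus_commute[of u v] by simp
    note [measurable] = square_integrableD(1)[OF s(2)] schwartz_borel[OF \<phi>] schwartz_borel[OF v(1)]
      square_integrableD(1)[OF sv(2)] square_integrableD(1)[OF s\<phi>(2)]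
    have sd: "square_integrable (\<lambda>x. F x - ?H v x)" by (intro square_integrable_diff s sv)
    have 1: "integrable lborel (\<lambda>x. (F x - ?H v x) * \<phi> x)"
      "norm (\<integral>x. (F x - ?H v x) * \<phi> x \<partial>lborel) \<le> l2norm (\<lambda>x. F x - ?H v x) * l2norm \<phi>"
      by (rule Cauchy_Schwarz_integral[OF sd s\<phi>(1)]; simp add: norm_mult)+
    have 2: "norm (\<integral>x. v x * ?H \<phi> x \<partial>lborel) \<le> l2norm v * l2norm (?H \<phi>)"
      by (rule Cauchy_Schwarz_integral(2)[OF sv(1) s\<phi>(2)]; simp add: norm_mult)
    have i: "integrable lborel (\<lambda>x. ?H v x * \<phi> x)"
      by (intro schwartz_mult_integrable schroedinger_schwartz v \<phi> W)
    have "(\<integral>x. F x * \<phi> x \<partial>lborel) = (\<integral>x. (F x - ?H v x) * \<phi> x + ?H v x * \<phi> x \<partial>lborel)"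
      by (simp add: algebra_simps)
    also have "\<dots> = (\<integral>x. (F x - ?H v x) * \<phi> x \<partial>lborel) + (\<integral>x. v x * ?H \<phi> x \<partial>lborel)"
      unfolding schroedinger_symmetric[OF v(1) \<phi> W, symmetric] by (rule Bochner_Integration.integral_add[OF 1(1) i])
    finally have "norm (\<integral>x. F x * \<phi> x \<partial>lborel)
        \<le> l2norm (\<lambda>x. F x - ?H v x) * l2norm \<phi> + l2norm v * l2norm (?H \<phi>)"
      using norm_triangle_ineq[of "\<integral>x. (F x - ?H v x) * \<phi> x \<partial>lborel" "\<integral>x. v x * ?H \<phi> x \<partial>lborel"] 1(2) 2 by simp
    also have "\<dots> \<le> (e / A) * l2norm \<phi> + (e / A) * l2norm (?H \<phi>)"
      using v(3) lv by (intro add_mono mult_right_mono) auto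
    also have "\<dots> \<le> (e / A) * A" using d unfolding distrib_left[symmetric] by (intro mult_left_mono) (auto simp: A_def)
    also have "\<dots> = e" using A by simp
    finally show ?thesis by simp
  qed
  then have "norm (\<integral>x. F x * \<phi> x \<partial>lborel) \<le> 0" by (rule field_le_epsilon)
  then show "(\<integral>x. F x * \<phi> x \<partial>lborel) = 0" by simp
qed

text \<open>Images of Schwartz functions approximate \<open>F\<close>, and the lower bound makes the
  chosen preimages a Cauchy sequence; completeness provides the solution.\<close>

lemma closure_graph_surjective:
  fixes W :: "real^'n \<Rightarrow> complex"
  assumes W: "moderate W" and \<tau>: "\<tau> > 0" and \<mu>: "\<mu> \<ge> 0" "\<And>x. - \<mu> \<le> Re (W x)" and \<delta>: "\<delta> > 0"
    and lower: "\<And>v. v \<in> schwartz \<Longrightarrow> \<delta> * l2norm v \<le> l2norm (schroedinger \<tau> W v)"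
    and F: "square_integrable F"
  shows "\<exists>u. (u, F) \<in> closure_graph \<tau> W"
proof -
  let ?H = "schroedinger \<tau> W"
  let ?S = "?H ` schwartz"
  have dense: "\<exists>s\<in>?S. l2norm (\<lambda>x. F x - s x) < e" if "e > 0" for e
  proof (rule dense_of_trivial_complement[OF _ _ _ _ _ F that])
    show "square_integrable s" if "s \<in> ?S" for s
      using that by (auto intro!: schwartz_square_integrable schroedinger_schwartz W)
    show "?S \<noteq> {}" using schwartz_zero by blast
    show "(\<lambda>x. s x + t x) \<in> ?S" if st: "s \<in> ?S" "t \<in> ?S" for s t
    proof -
      obtain a b where ab: "a \<in> schwartz" "b \<in> schwartz" "s = ?H a" "t = ?H b" using st by blast
      have "(\<lambda>x. s x + t x) = ?H (\<lambda>x. a x + b x)"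
        using schroedinger_add_cmult[OF ab(1,2), of \<tau> W 1] by (intro ext) (simp add: ab)
      then show ?thesis using schwartz_add[OF ab(1,2)] by blast
    qed
    show "(\<lambda>x. c * s x) \<in> ?S" if st: "s \<in> ?S" for c s
    proof -
      obtain a where a: "a \<in> schwartz" "s = ?H a" using st by blast
      have "(\<lambda>x. c * s x) = ?H (\<lambda>x. c * a x)"
        using schroedinger_cmult[OF a(1)] by (intro ext) (simp add: a)
      then show ?thesis using schwartz_cmult[OF a(1)] by blast
    qed
    fix g :: "real^'n \<Rightarrow> complex"
    assume g: "square_integrable g" and orth: "\<And>s. s \<in> ?S \<Longrightarrow> (\<integral>x. cnj (g x) * s x \<partial>lborel) = 0"
    \<comment> \<open>Orthogonality is sesquilinear while the weak equation is bilinear, so the weak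
      solution is the conjugate of \<open>g\<close>.\<close>
    have "square_integrable (\<lambda>x. cnj (g x))"
      by (rule square_integrable_dominated[OF g, of _ 1]) (use square_integrableD(1)[OF g] in auto)
    from weak_solution_AE_zero[OF this W \<tau> \<mu> \<delta> lower] orth
    show "AE x in lborel. g x = 0" by auto
  qed
  have "\<exists>v\<in>schwartz. l2norm (\<lambda>x. F x - ?H v x) < 1 / real (Suc k)" for k
    using dense[of "1 / real (Suc k)"] by auto
  then obtain v where v: "\<And>k. v k \<in> schwartz" and lim: "\<And>k. l2norm (\<lambda>x. F x - ?H (v k) x) < 1 / real (Suc k)"
    by metis
  note sv = schwartz_square_integrable[OF v] and sH = schwartz_square_integrable[OF schroedinger_schwartz[OF v W]]
  have gap: "\<delta> * l2norm (\<lambda>x. v m x - v n x) \<le> 1 / real (Suc m) + 1 / real (Suc n)" for m n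
  proof -
    have "\<delta> * l2norm (\<lambda>x. v m x - v n x) \<le> l2norm (?H (\<lambda>x. v m x - v n x))"
      by (intro lower schwartz_diff v)
    also have "?H (\<lambda>x. v m x - v n x) = (\<lambda>x. ?H (v m) x - ?H (v n) x)"
      using schroedinger_add_cmult[OF v v, of \<tau> W m "-1" n] by (intro ext) simp
    also have "l2norm (\<lambda>x. ?H (v m) x - ?H (v n) x) \<le> l2norm (\<lambda>x. ?H (v m) x - F x) + l2norm (\<lambda>x. F x - ?H (v n) x)"
      by (rule l2norm_triangle_diff[OF sH F sH])
    also have "\<dots> \<le> 1 / real (Suc m) + 1 / real (Suc n)"
      using lim[of m] lim[of n] l2norm_minus_commute[of F "?H (v m)"] by simp
    finally show ?thesis .
  qed
  have "\<exists>N. \<forall>m\<ge>N. \<forall>n\<ge>N. l2norm (\<lambda>x. v m x - v n x) < \<epsilon>" if "\<epsilon> > 0" for \<epsilon>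
  proof -
    have de: "\<delta> * \<epsilon> > 0" using that \<delta> by simp
    obtain N where N: "2 / (\<delta> * \<epsilon>) < real N" using reals_Archimedean2 by blast
    have "l2norm (\<lambda>x. v m x - v n x) < \<epsilon>" if mn: "m \<ge> N" "n \<ge> N" for m n
    proof -
      have "1 / real (Suc k) < \<delta> * \<epsilon> / 2" if "k \<ge> N" for k
      proof -
        have "2 / (\<delta> * \<epsilon>) < real (Suc k)" using N that by simp
        then show ?thesis using de by (simp add: field_simps)
      qed
      from this[OF mn(1)] this[OF mn(2)] have "\<delta> * l2norm (\<lambda>x. v m x - v n x) < \<delta> * \<epsilon>"
        using gap[of m n] by linarith
      then show ?thesis using \<delta> by simp
    qed
    then show ?thesis by blast
  qed
  from square_integrable_complete[OF sv this]
  obtain u where u: "square_integrable u" and ulim: "(\<lambda>k. l2norm (\<lambda>x. v k x - u x)) \<longlonglongrightarrow> 0" by blast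
  have "(u, F) \<in> closure_graph \<tau> W"
    unfolding closure_graph_def
  proof (intro CollectI case_prodI conjI allI impI u F)
    fix \<epsilon> :: real assume \<epsilon>: "\<epsilon> > 0"
    obtain N1 where N1: "\<And>k. k \<ge> N1 \<Longrightarrow> l2norm (\<lambda>x. v k x - u x) < \<epsilon>"
      using order_tendstoD(2)[OF ulim \<epsilon>] by (auto simp: eventually_sequentially)
    obtain N2 where N2: "1 / \<epsilon> < real N2" using reals_Archimedean2 by blast
    define k where "k = max N1 N2"
    have "1 / \<epsilon> < real (Suc k)" using N2 by (simp add: k_def)
    then have "1 / real (Suc k) < \<epsilon>" using \<epsilon> by (simp add: field_simps)
    then show "\<exists>v\<in>schwartz. l2norm (\<lambda>x. u x - v x) < \<epsilon> \<and> l2norm (\<lambda>x. F x - ?H v x) < \<epsilon>"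
      using N1[of k] lim[of k] v[of k] l2norm_minus_commute[of u "v k"]
      by (intro bexI[of _ "v k"]) (auto simp: k_def)
  qed
  then show ?thesis by blast
qed

text \<open>The inverse is a chosen representative; its norm bound holds for every representative
  because the lower bound is valid on the whole graph.\<close>

lemma closure_graph_invertible:
  fixes W :: "real^'n \<Rightarrow> complex"
  assumes W: "moderate W" and \<tau>: "\<tau> > 0" and \<mu>: "\<mu> \<ge> 0" "\<And>x. - \<mu> \<le> Re (W x)" and \<delta>: "\<delta> > 0"
    and lower: "\<And>v. v \<in> schwartz \<Longrightarrow> \<delta> * l2norm v \<le> l2norm (schroedinger \<tau> W v)"
  shows "L2_invertible (closure_graph \<tau> W)"
    and "\<And>F. F \<in> L2 \<Longrightarrow> \<delta> * L2norm (L2_inverse (closure_graph \<tau> W) F) \<le> L2norm F"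
proof -
  note surj = closure_graph_surjective[OF W \<tau> \<mu> \<delta> lower]
  have zero: "l2norm (\<lambda>x. p x - q x) = 0"
    if "ae_eq p q" "square_integrable p" "square_integrable q" for p q :: "real^'n \<Rightarrow> complex"
  proof -
    have "l2norm (\<lambda>x. p x - q x) = l2norm (\<lambda>x::real^'n. 0 :: complex)"
      using that(1) square_integrableD(1)[OF that(2)] square_integrableD(1)[OF that(3)]
      by (intro l2norm_cong_AE) (auto simp: ae_eq_def)
    then show ?thesis by (simp add: l2norm_def)
  qed
  show "L2_invertible (closure_graph \<tau> W)"
    unfolding L2_invertible_def
  proof (intro conjI ballI; clarsimp?)
    fix u F v G assume uF: "(u, F) \<in> closure_graph \<tau> W" and vG: "(v, G) \<in> closure_graph \<tau> W"
    note d = closure_graph_diff[OF W uF vG]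
    have s: "square_integrable u" "square_integrable F" "square_integrable v" "square_integrable G"
      using uF vG by (auto simp: closure_graph_def)
    {
      assume "ae_eq u v"
      then have "l2norm (\<lambda>x. u x - v x) = 0" by (rule zero[OF _ s(1,3)])
      from closure_graph_single_valued[OF W d this] show "ae_eq F G"
        by (simp add: ae_eq_def)
    }
    {
      assume "ae_eq F G"
      then have "l2norm (\<lambda>x. F x - G x) = 0" by (rule zero[OF _ s(2,4)])
      then have "\<delta> * l2norm (\<lambda>x. u x - v x) \<le> 0"
        using closure_graph_lower_bound[OF W d \<delta> lower] by simp
      then have "l2norm (\<lambda>x. u x - v x) = 0" using \<delta> l2norm_nonneg[of "\<lambda>x. u x - v x"]
        by (simp add: mult_le_0_iff)
      from l2norm_eq_0D[OF square_integrable_diff[OF s(1,3)] this] show "ae_eq u v"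
        by (simp add: ae_eq_def)
    }
  next
    fix F :: "real^'n \<Rightarrow> complex" assume "F \<in> L2"
    then show "\<exists>u. (u, F) \<in> closure_graph \<tau> W" by (intro surj) (simp_all add: L2_iff)
  qed
  fix F :: "real^'n \<Rightarrow> complex" assume "F \<in> L2"
  then have "\<exists>u. (u, F) \<in> closure_graph \<tau> W" by (intro surj) (simp_all add: L2_iff)
  then have "(L2_inverse (closure_graph \<tau> W) F, F) \<in> closure_graph \<tau> W"
    unfolding L2_inverse_def by (rule someI_ex)
  from closure_graph_lower_bound[OF W this \<delta> lower]
  show "\<delta> * L2norm (L2_inverse (closure_graph \<tau> W) F) \<le> L2norm F" by (simp add: L2norm_eq)
qed

theorem theorem3:
  fixes V :: "real^'n \<Rightarrow> complex" and V1 V2 :: "real^'n \<Rightarrow> real" and L T R K :: real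
  assumes V_eq: "\<And>x. V x = complex_of_real (V1 x) + \<i> * complex_of_real (V2 x)"
    and V_smooth: "smooth V"
    and V1_nonneg: "\<And>x. V1 x \<ge> 0"
    and V_S1: "second_derivs_in_S1 V"
    and L_pos: "L > 0" and T_nonneg: "T \<ge> 0"
    and V2_bound: "\<exists>c0>0. \<forall>x. norm (gradient V2 x) \<le> L \<longrightarrow>
                     \<bar>V2 x\<bar> - T \<le> c0 * (norm (gradient V2 x))\<^sup>2"
    and R_pos: "R > 0" and K_gt: "K > 1"
  shows "\<exists>A M h0 c C. A > 0 \<and> M > 0 \<and> h0 > 0 \<and> c > 0 \<and> C > 0 \<and>
    (\<forall>h z. 0 < h \<and> h \<le> h0 \<and> M * h \<le> cmod z - K * T \<and> cmod z - K * T \<le> R \<and>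
        Re z \<le> A * h powr (2/3) * (cmod z - T) powr (1/3) \<longrightarrow>
      (\<forall>u \<in> schwartz.
         L2norm (\<lambda>x. weyl (schroedinger_symbol V) h u x - z * u x)
           \<ge> c * h powr (2/3) * (cmod z - T) powr (1/3) * L2norm u) \<and>
      L2_invertible (graph_minus_scalar (weyl_closure (schroedinger_symbol V) h) z) \<and>
      (\<forall>u \<in> L2.
         L2norm (L2_inverse (graph_minus_scalar (weyl_closure (schroedinger_symbol V) h) z) u)
           \<le> C * h powr (-2/3) * (cmod z - T) powr (-1/3) * L2norm u))"
proof -
  have V: "moderate V" by (rule moderate_of_second_derivs[OF V_smooth V_S1])
  have V2_eq: "V2 = (\<lambda>x. Im (V x))" and V1_eq: "V1 = (\<lambda>x. Re (V x))" by (auto simp: V_eq)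
  have "\<exists>C\<ge>0. \<forall>i j x. \<bar>partial_deriv i (partial_deriv j V2) x\<bar> \<le> C"
  proof -
    have d1: "partial_deriv j V2 = (\<lambda>x. Im (partial_deriv j V x))" for j
      unfolding V2_eq by (rule ext) (rule partial_deriv_Im(1)[OF moderate_differentiable[OF V]])
    have d2: "partial_deriv i (partial_deriv j V2) x = Im (partial_deriv i (partial_deriv j V) x)" for i j x
      unfolding d1 by (rule partial_deriv_Im(1)[OF moderate_differentiable[OF moderate_partial_deriv[OF V]]])
    have "\<exists>b. \<forall>x. norm (partial_deriv i (partial_deriv j V) x) \<le> b" for i j
    proof -
      have "bounded (range (partial_derivs [i, j] V))"
        using V_S1 unfolding second_derivs_in_S1_def by (metis length_Cons list.size(3) numeral_2_eq_2 order_refl)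
      then show ?thesis by (auto simp: bounded_iff)
    qed
    then obtain b where b: "\<And>i j x. norm (partial_deriv i (partial_deriv j V) x) \<le> b i j" by metis
    have b0: "0 \<le> b i j" for i j using order_trans[OF norm_ge_zero b] .
    \<comment> \<open>The bounds depend on the pair of indices; as there are finitely many pairs,
      their sum is a common bound.\<close>
    have "\<bar>partial_deriv i (partial_deriv j V2) x\<bar> \<le> (\<Sum>i\<in>UNIV. \<Sum>j\<in>UNIV. b i j)" for i j x
    proof -
      have "\<bar>partial_deriv i (partial_deriv j V2) x\<bar> \<le> b i j"
        unfolding d2 by (rule order_trans[OF abs_Im_le_cmod b])
      also have "\<dots> \<le> (\<Sum>j\<in>UNIV. b i j)" by (rule member_le_sum) (auto simp: b0)
      also have "\<dots> \<le> (\<Sum>i\<in>UNIV. \<Sum>j\<in>UNIV. b i j)"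
        by (rule member_le_sum[of i UNIV "\<lambda>i. \<Sum>j\<in>UNIV. b i j"]) (auto intro: sum_nonneg b0)
      finally show ?thesis .
    qed
    then show ?thesis by (intro exI[of _ "\<Sum>i\<in>UNIV. \<Sum>j\<in>UNIV. b i j"]) (auto intro: sum_nonneg b0)
  qed
  then obtain B where B: "B \<ge> 0" "\<And>i j x. \<bar>partial_deriv i (partial_deriv j V2) x\<bar> \<le> B" by blast
  obtain c0 where c0: "c0 > 0" and hyp: "\<And>x. norm (gradient V2 x) \<le> L \<Longrightarrow>
      \<bar>V2 x\<bar> - T \<le> c0 * (norm (gradient V2 x))\<^sup>2" using V2_bound by blast
  then have hyp': "\<bar>Im (V x)\<bar> - T \<le> c0 * (norm (gradient V2 x))\<^sup>2" if "norm (gradient V2 x) \<le> L" for x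
    using that by (simp add: V_eq)
  \<comment> \<open>The estimate is phrased with \<open>r = |z| - T\<close>, and
    \<open>|z| - K T \<le> R\<close> means \<open>r \<le> R + (K - 1) T\<close>.\<close>
  define R' where "R' = R + (K - 1) * T"
  have R': "R' > 0" using R_pos K_gt T_nonneg by (simp add: R'_def add_pos_nonneg)
  have Re_nonneg: "0 \<le> Re (V x)" for x using V1_nonneg[of x] by (simp add: V_eq)
  obtain \<eta> where \<eta>: "\<eta> > 0" and est: "\<And>k r z u. 0 < k \<Longrightarrow> k ^ 3 \<le> r \<Longrightarrow> r \<le> R' \<Longrightarrow> cmod z = r + T \<Longrightarrow>
      Re z \<le> \<eta> * (k\<^sup>2 * r powr (1/3)) \<Longrightarrow> u \<in> schwartz \<Longrightarrow>
      \<eta> * (k\<^sup>2 * r powr (1/3)) * l2norm u \<le> l2norm (schroedinger (k ^ 6) (\<lambda>x. V x - z) u)"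
    using schroedinger_lower_bound[OF V Re_nonneg, folded V2_eq, OF B L_pos T_nonneg c0 hyp' R'] by blast
  \<comment> \<open>With \<open>k^3 = h / (2 \<pi>)\<close>, \<open>k^2\<close> is
    \<open>h^(2/3)\<close> times this power of \<open>2 \<pi>\<close>, which is moved into the
    constant.\<close>
  define c where "c = \<eta> * (2 * pi) powr (- 2 / 3)"
  have c: "c > 0" using \<eta> by (simp add: c_def)
  show ?thesis
  \<comment> \<open>The constant \<open>c\<close> both limits \<open>Re z\<close> and bounds the
    operator from below, so \<open>1 / c\<close> bounds the inverse. The choice 1 for
    \<open>M\<close> and for the largest \<open>h\<close> works: since \<open>T \<le> K T\<close>,
    the assumption gives \<open>h \<le> r\<close>, and thus
    \<open>k^3 = h / (2 \<pi>) \<le> r\<close>.\<close>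
  proof (rule exI[of _ c], rule exI[of _ 1], rule exI[of _ 1], rule exI[of _ c], rule exI[of _ "1 / c"],
      intro conjI allI impI; (elim conjE)?)
    fix h :: real and z :: complex
    assume h: "0 < h" "h \<le> 1" "1 * h \<le> cmod z - K * T" "cmod z - K * T \<le> R"
      and Rez: "Re z \<le> c * h powr (2 / 3) * (cmod z - T) powr (1 / 3)"
    define r where "r = cmod z - T"
    define k where "k = (h / (2 * pi)) powr (1/3)"
    define \<delta> where "\<delta> = c * h powr (2 / 3) * r powr (1 / 3)"
    have "1 * T \<le> K * T" using K_gt T_nonneg by (intro mult_right_mono) auto
    then have hr: "h \<le> r" using h by (simp add: r_def)
    have r: "r > 0" "r \<le> R'" "cmod z = r + T" using hr h by (auto simp: r_def R'_def algebra_simps)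
    have pos: "h / (2 * pi) > 0" using h by simp
    have k: "k > 0" using h(1) by (simp add: k_def)
    have pw: "(q powr (1/3)) ^ 3 = q" "(q powr (1/3))\<^sup>2 = q powr (2/3)" if "q > 0" for q :: real
      using that by (auto simp: powr_power)
    have neg: "x powr (- 2 / 3) = inverse (x powr (2 / 3))" "x powr (- 1 / 3) = inverse (x powr (1 / 3))" for x :: real
      using powr_minus[of x "2/3"] powr_minus[of x "1/3"] by simp_all
    have k3: "k ^ 3 = h / (2 * pi)" unfolding k_def by (rule pw(1)[OF pos])
    have k6: "k ^ 6 = (h / (2 * pi))\<^sup>2" unfolding k3[symmetric] by (simp add: power_mult[symmetric])
    have "h \<le> h * (2 * pi)" using h(1) pi_gt3 by simp
    then have "h / (2 * pi) \<le> h" by (subst pos_divide_le_eq) (auto simp: pi_gt_zero)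
    then have k3_le: "k ^ 3 \<le> r" using k3 hr by simp
    have "k\<^sup>2 = (h / (2 * pi)) powr (2/3)" unfolding k_def by (rule pw(2)[OF pos])
    also have "\<dots> = h powr (2/3) * (2 * pi) powr (- 2 / 3)"
    proof -
      have "(h / (2 * pi)) powr (2/3) = h powr (2/3) / (2 * pi) powr (2/3)"
        by (rule powr_divide)
      then show ?thesis unfolding neg(1) by (simp only: divide_inverse[of "h powr _"])
    qed
    finally have \<delta>_eq: "\<eta> * (k\<^sup>2 * r powr (1/3)) = \<delta>"
      by (simp add: \<delta>_def c_def mult_ac)
    have \<delta>: "\<delta> > 0" unfolding \<delta>_def using c h r by simp
    let ?\<tau> = "(h / (2 * pi))\<^sup>2" and ?W = "\<lambda>x. V x - z"
    have lower: "\<delta> * l2norm v \<le> l2norm (schroedinger ?\<tau> ?W v)" if "v \<in> schwartz" for v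
      using est[OF k k3_le r(2,3) _ that] Rez unfolding \<delta>_eq k6 by (simp add: \<delta>_def r_def)
    have \<tau>: "?\<tau> > 0" by (rule zero_less_power[OF pos])
    have W: "moderate ?W" by (rule moderate_diff_const[OF V])
    have \<mu>: "- \<bar>Re z\<bar> \<le> Re (?W x)" for x using Re_nonneg[of x] by simp
    have graph: "graph_minus_scalar (weyl_closure (schroedinger_symbol V) h) z = closure_graph ?\<tau> ?W"
      unfolding weyl_closure_eq[OF V] by (rule graph_minus_scalar_eq[OF V])
    note inv = closure_graph_invertible[OF W \<tau> abs_ge_zero \<mu> \<delta> lower]
    show "\<forall>u\<in>schwartz. c * h powr (2 / 3) * (cmod z - T) powr (1 / 3) * L2norm u
        \<le> L2norm (\<lambda>x. weyl (schroedinger_symbol V) h u x - z * u x)"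
    proof
      fix u :: "real^'n \<Rightarrow> complex" assume u: "u \<in> schwartz"
      have "(\<lambda>x. weyl (schroedinger_symbol V) h u x - z * u x) = schroedinger ?\<tau> ?W u"
        by (rule ext) (simp add: weyl_eq_schroedinger[OF u V] schroedinger_def algebra_simps)
      then show "c * h powr (2 / 3) * (cmod z - T) powr (1 / 3) * L2norm u
        \<le> L2norm (\<lambda>x. weyl (schroedinger_symbol V) h u x - z * u x)"
        using lower[OF u] by (simp add: L2norm_eq \<delta>_def r_def)
    qed
    show "L2_invertible (graph_minus_scalar (weyl_closure (schroedinger_symbol V) h) z)"
      unfolding graph by (rule inv(1))
    show "\<forall>u\<in>L2. L2norm (L2_inverse (graph_minus_scalar (weyl_closure (schroedinger_symbol V) h) z) u)
        \<le> 1 / c * h powr (- 2 / 3) * (cmod z - T) powr (- 1 / 3) * L2norm u"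
    proof
      fix u :: "real^'n \<Rightarrow> complex" assume "u \<in> L2"
      have "1 / c * h powr (- 2 / 3) * r powr (- 1 / 3) = inverse \<delta>"
        unfolding \<delta>_def neg by (simp only: inverse_mult_distrib inverse_eq_divide[symmetric])
      moreover have "L2norm (L2_inverse (closure_graph ?\<tau> ?W) u) \<le> inverse \<delta> * L2norm u"
        using inv(2)[OF _ \<open>u \<in> L2\<close>] \<delta> by (simp add: field_simps)
      ultimately show "L2norm (L2_inverse (graph_minus_scalar (weyl_closure (schroedinger_symbol V) h) z) u)
        \<le> 1 / c * h powr (- 2 / 3) * (cmod z - T) powr (- 1 / 3) * L2norm u"
        unfolding graph r_def by simp
    qed
  qed (use c in auto)
qed

end
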